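(* Let $\mathcal{C}\in\{\mathcal{C}^\infty,\mathcal{C}^\omega\}$, let $M$ be a connected manifold of class $\mathcal{C}$ and dimension $n\ge3$, and let $\Delta$ be a totally nonholonomic distribution of class $\mathcal{C}$ and corank $1$ (that is, of rank $m=n-1$) on $M$. Assume that: (H1) the distribution $\vec{\mathcal{F}}$ restricted to $\mathcal{S}_0$ has constant rank equal to $0$ or $1$; (H2) the singular set $\Sigma=\Delta^\perp\setminus\mathcal{S}_0$ has Lebesgue measure zero in $\Delta^\perp$. Then $\Delta$ satisfies the Sard Conjecture: for every $x\in M$, the set $\mathrm{Abn}_\Delta(x)$ of end-points of singular horizontal paths starting from $x$ has Lebesgue measure zero in $M$.
   Context: A distribution of rank $m$ on $M$ is a subbundle $\Delta\subset TM$ of rank $m$; it is totally nonholonomic (bracket generating) if iterated Lie brackets of its local sections span $T_xM$ at every $x$. $\omega$ is the canonical symplectic form on $T^*M$, $\pi:T^*M\to M$ the projection, $\Delta^\perp=\{(x,p)\in T^*M: p\ne0,\ p\cdot v=0\ \forall v\in\Delta(x)\}$, and $\omega^\perp$ is the restriction (pullback) of $\omega$ to the submanifold $\Delta^\perp$, with kernel $\ker(\omega^\perp_{\mathfrak{a}})\subset T_{\mathfrak{a}}\Delta^\perp$. $\mathcal{S}_0\subset\Delta^\perp$ is the open and dense set of points in a neighborhood of which $\mathfrak{a}\mapsto\dim\ker(\omega^\perp_{\mathfrak{a}})$ is constant. $\Sigma:=\Delta^\perp\setminus\mathcal{S}_0$. The singular distribution $\vec{\mathcal{F}}$ assigns to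 $\mathfrak{a}\in\Delta^\perp$ the subspace $\vec{\mathcal{F}}(\mathfrak{a})=\ker(\omega^\perp_{\mathfrak{a}})$ if $\mathfrak{a}\in\mathcal{S}_0$ and $\vec{\mathcal{F}}(\mathfrak{a})=\{0\}$ if $\mathfrak{a}\in\Sigma$; its rank at $\mathfrak{a}$ is $\dim\vec{\mathcal{F}}(\mathfrak{a})$. A path $\gamma:[0,1]\to M$ is horizontal if it is absolutely continuous with derivative in $L^2$ and $\dot\gamma(t)\in\Delta(\gamma(t))$ for a.e. $t$. It is singular if it is a critical point of the end-point map on horizontal paths starting at $\gamma(0)$; equivalently, if there is an absolutely continuous $\psi:[0,1]\to\Delta^\perp$ with $\pi\circ\psi=\gamma$ and $\dot\psi(t)\in\ker(\omega^\perp_{\psi(t)})$ for a.e. $t$. *)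

theory Defs
  imports "HOL-Analysis.Analysis"
begin

section \<open>Regularity classes of maps between Euclidean spaces\<close>

text \<open>All notions of this section are meant for open sets \<open>S\<close>.\<close>

primrec Ck_on :: "nat \<Rightarrow> 'a::euclidean_space set \<Rightarrow> ('a \<Rightarrow> 'b::euclidean_space) \<Rightarrow> bool" where
  "Ck_on 0 S f \<longleftrightarrow> continuous_on S f"
| "Ck_on (Suc k) S f \<longleftrightarrow>
     (\<forall>x\<in>S. f differentiable (at x)) \<and> (\<forall>v. Ck_on k S (\<lambda>x. frechet_derivative f (at x) v))"

definition C_infinity_on :: "'a::euclidean_space set \<Rightarrow> ('a \<Rightarrow> 'b::euclidean_space) \<Rightarrow> bool" where
  "C_infinity_on S f \<longleftrightarrow> (\<forall>k. Ck_on k S f)"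

text \<open>Real analyticity: near every point \<open>f\<close> is the sum of an (absolutely) convergent power
  series. Multi-indices are functions from \<open>Basis\<close> to \<open>nat\<close>; extensionality makes each of them
  occur once.\<close>

definition real_analytic_on :: "'a::euclidean_space set \<Rightarrow> ('a \<Rightarrow> 'b::euclidean_space) \<Rightarrow> bool" where
  "real_analytic_on S f \<longleftrightarrow>
     (\<forall>x0\<in>S. \<exists>r>0. \<exists>coef :: ('a \<Rightarrow> nat) \<Rightarrow> 'b. \<forall>x\<in>ball x0 r.
        ((\<lambda>\<alpha>. (\<Prod>b\<in>Basis. ((x - x0) \<bullet> b) ^ \<alpha> b) *\<^sub>R coef \<alpha>) has_sum f x)
          (Basis \<rightarrow>\<^sub>E (UNIV :: nat set)))"

datatype regularity = Smooth | Analytic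

fun class_on ::
  "regularity \<Rightarrow> 'a::euclidean_space set \<Rightarrow> ('a \<Rightarrow> 'b::euclidean_space) \<Rightarrow> bool" where
  "class_on Smooth S f \<longleftrightarrow> C_infinity_on S f"
| "class_on Analytic S f \<longleftrightarrow> real_analytic_on S f"

section \<open>Manifolds\<close>

text \<open>A chart is a pair of a domain and a coordinate map; the values of the coordinate map outside
  the domain are irrelevant. An atlas determines its underlying set and its topology, so that a
  manifold modelled on \<open>'e\<close> (hence of dimension \<open>DIM('e)\<close>) is given by an atlas alone.\<close>

type_synonym ('m, 'e) chart = "'m set \<times> ('m \<Rightarrow> 'e)"
type_synonym ('m, 'e) atlas = "('m, 'e) chart set"

definition carrier :: "('m, 'e) atlas \<Rightarrow> 'm set" where
  "carrier A = (\<Union>c\<in>A. fst c)"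

definition manifold_topology :: "('m, 'e::euclidean_space) atlas \<Rightarrow> 'm topology" where
  "manifold_topology A =
     topology (\<lambda>W. W \<subseteq> carrier A \<and> (\<forall>c\<in>A. open (snd c ` (W \<inter> fst c))))"

definition transition :: "('m, 'e) chart \<Rightarrow> ('m, 'e) chart \<Rightarrow> 'e \<Rightarrow> 'e" where
  "transition c d = snd d \<circ> inv_into (fst c) (snd c)"

definition manifold :: "regularity \<Rightarrow> ('m, 'e::euclidean_space) atlas \<Rightarrow> bool" where
  "manifold C A \<longleftrightarrow>
     (\<forall>c\<in>A. inj_on (snd c) (fst c) \<and> open (snd c ` fst c)) \<and>
     (\<forall>c\<in>A. \<forall>d\<in>A. open (snd c ` (fst c \<inter> fst d)) \<and>
                  class_on C (snd c ` (fst c \<inter> fst d)) (transition c d)) \<and>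
     Hausdorff_space (manifold_topology A) \<and> second_countable (manifold_topology A)"

lemma openin_manifold_topology:
  assumes "\<And>c. c \<in> A \<Longrightarrow> inj_on (snd c) (fst c)"
  shows "openin (manifold_topology A) W \<longleftrightarrow>
           W \<subseteq> carrier A \<and> (\<forall>c\<in>A. open (snd c ` (W \<inter> fst c)))"
proof -
  have "istopology (\<lambda>W. W \<subseteq> carrier A \<and> (\<forall>c\<in>A. open (snd c ` (W \<inter> fst c))))"
    unfolding istopology_def
  proof (intro conjI allI impI ballI)
    fix S T c
    assume S: "S \<subseteq> carrier A \<and> (\<forall>c\<in>A. open (snd c ` (S \<inter> fst c)))"
      and T: "T \<subseteq> carrier A \<and> (\<forall>c\<in>A. open (snd c ` (T \<inter> fst c)))" and c: "c \<in> A"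
    have "snd c ` (S \<inter> T \<inter> fst c) = snd c ` ((S \<inter> fst c) \<inter> (T \<inter> fst c))"
      by (rule arg_cong[where f = "image (snd c)"]) auto
    also have "\<dots> = snd c ` (S \<inter> fst c) \<inter> snd c ` (T \<inter> fst c)"
      by (rule inj_on_image_Int[OF assms[OF c]]) auto
    finally show "open (snd c ` (S \<inter> T \<inter> fst c))"
      using S T c by auto
  next
    fix K c
    assume K: "\<forall>S\<in>K. S \<subseteq> carrier A \<and> (\<forall>c\<in>A. open (snd c ` (S \<inter> fst c)))" and c: "c \<in> A"
    have "snd c ` (\<Union>K \<inter> fst c) = (\<Union>S\<in>K. snd c ` (S \<inter> fst c))" by auto
    then show "open (snd c ` (\<Union>K \<inter> fst c))"
      using K c by auto
  qed auto
  then show ?thesis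
    unfolding manifold_topology_def by (simp only: topology_inverse')
qed

section \<open>Tangent and cotangent vectors\<close>

text \<open>A tangent vector at \<open>x\<close> is the family of its coordinate expressions in the charts around \<open>x\<close>,
  transforming by the derivatives of the transition maps. Components at other charts are
  set to zero, so that equality and linear combinations of tangent vectors are those of functions.\<close>

definition tangent_space ::
  "('m, 'e::euclidean_space) atlas \<Rightarrow> 'm \<Rightarrow> (('m, 'e) chart \<Rightarrow> 'e) set" where
  "tangent_space A x = {v.
     (\<forall>c\<in>A. \<forall>d\<in>A. x \<in> fst c \<and> x \<in> fst d \<longrightarrow>
        v d = frechet_derivative (transition c d) (at (snd c x)) (v c)) \<and>
     (\<forall>c. \<not> (c \<in> A \<and> x \<in> fst c) \<longrightarrow> v c = 0)}"

text \<open>A covector \<open>p\<close> at \<open>x\<close> is likewise a family of components; in every chart \<open>c\<close> around \<open>x\<close> its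
  value on \<open>v\<close> is \<open>p c \<bullet> v c\<close>.\<close>

definition cotangent_space ::
  "('m, 'e::euclidean_space) atlas \<Rightarrow> 'm \<Rightarrow> (('m, 'e) chart \<Rightarrow> 'e) set" where
  "cotangent_space A x = {p.
     (\<forall>c\<in>A. \<forall>d\<in>A. x \<in> fst c \<and> x \<in> fst d \<longrightarrow>
        (\<forall>w. p c \<bullet> w = p d \<bullet> frechet_derivative (transition c d) (at (snd c x)) w)) \<and>
     (\<forall>c. \<not> (c \<in> A \<and> x \<in> fst c) \<longrightarrow> p c = 0)}"

text \<open>An arbitrary chart around \<open>x\<close>; the notions defined with its help do not depend on the choice.\<close>

definition chart_at :: "('m, 'e) atlas \<Rightarrow> 'm \<Rightarrow> ('m, 'e) chart" where
  "chart_at A x = (SOME c. c \<in> A \<and> x \<in> fst c)"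

definition pairing ::
  "('m, 'e::euclidean_space) atlas \<Rightarrow> 'm \<Rightarrow> (('m, 'e) chart \<Rightarrow> 'e) \<Rightarrow> (('m, 'e) chart \<Rightarrow> 'e) \<Rightarrow> real"
  where
  "pairing A x p v = p (chart_at A x) \<bullet> v (chart_at A x)"

lemma pairing_eq:
  assumes "p \<in> cotangent_space A x" "v \<in> tangent_space A x" "c \<in> A" "x \<in> fst c"
  shows "pairing A x p v = p c \<bullet> v c"
proof -
  define d where "d = chart_at A x"
  have d: "d \<in> A" "x \<in> fst d"
    using someI[of "\<lambda>c. c \<in> A \<and> x \<in> fst c" c] assms(3,4)
    unfolding d_def chart_at_def by blast+
  have v: "v c = frechet_derivative (transition d c) (at (snd d x)) (v d)"
    using assms(2-4) d unfolding tangent_space_def by blast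
  have "p d \<bullet> v d = p c \<bullet> frechet_derivative (transition d c) (at (snd d x)) (v d)"
    using assms(1,3,4) d unfolding cotangent_space_def by blast
  then have "p d \<bullet> v d = p c \<bullet> v c"
    by (simp only: v)
  then show ?thesis
    by (simp only: pairing_def d_def)
qed

text \<open>Dimension of a linear subspace of a tangent space.\<close>

definition subspace_dim ::
  "('m, 'e::euclidean_space) atlas \<Rightarrow> 'm \<Rightarrow> (('m, 'e) chart \<Rightarrow> 'e) set \<Rightarrow> nat" where
  "subspace_dim A x W = dim ((\<lambda>v. v (chart_at A x)) ` W)"

section \<open>Vector fields and distributions\<close>

type_synonym ('m, 'e) vfield = "'m \<Rightarrow> ('m, 'e) chart \<Rightarrow> 'e"

definition coord_expr :: "('m, 'e) chart \<Rightarrow> ('m, 'e) vfield \<Rightarrow> 'e \<Rightarrow> 'e" where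
  "coord_expr c X y = X (inv_into (fst c) (snd c) y) c"

definition vector_field_on ::
  "regularity \<Rightarrow> ('m, 'e::euclidean_space) atlas \<Rightarrow> 'm set \<Rightarrow> ('m, 'e) vfield \<Rightarrow> bool" where
  "vector_field_on C A U X \<longleftrightarrow>
     (\<forall>x\<in>U. X x \<in> tangent_space A x) \<and>
     (\<forall>c\<in>A. class_on C (snd c ` (U \<inter> fst c)) (coord_expr c X))"

definition lie_bracket ::
  "('m, 'e::euclidean_space) atlas \<Rightarrow> ('m, 'e) vfield \<Rightarrow> ('m, 'e) vfield \<Rightarrow> ('m, 'e) vfield" where
  "lie_bracket A X Y = (\<lambda>x c.
     if c \<in> A \<and> x \<in> fst c
     then frechet_derivative (coord_expr c Y) (at (snd c x)) (X x c)
        - frechet_derivative (coord_expr c X) (at (snd c x)) (Y x c)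
     else 0)"

text \<open>A distribution assigns to each point a set of tangent vectors which, locally, is the fibrewise
  span of \<open>m\<close> pointwise linearly independent vector fields.\<close>

definition distribution ::
  "regularity \<Rightarrow> ('m, 'e::euclidean_space) atlas \<Rightarrow> nat \<Rightarrow>
   ('m \<Rightarrow> (('m, 'e) chart \<Rightarrow> 'e) set) \<Rightarrow> bool" where
  "distribution C A m \<Delta> \<longleftrightarrow>
     (\<forall>x\<in>carrier A. \<exists>U X. openin (manifold_topology A) U \<and> x \<in> U \<and>
        (\<forall>i<m. vector_field_on C A U (X i)) \<and>
        (\<forall>y\<in>U. \<Delta> y = {\<lambda>c. \<Sum>i<m. a i *\<^sub>R X i y c | a :: nat \<Rightarrow> real. True} \<and>
               (\<forall>a :: nat \<Rightarrow> real. (\<lambda>c. \<Sum>i<m. a i *\<^sub>R X i y c) = (\<lambda>c. 0) \<longrightarrow> (\<forall>i<m. a i = 0))))"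

definition section_on ::
  "regularity \<Rightarrow> ('m, 'e::euclidean_space) atlas \<Rightarrow> ('m \<Rightarrow> (('m, 'e) chart \<Rightarrow> 'e) set) \<Rightarrow>
   'm set \<Rightarrow> ('m, 'e) vfield \<Rightarrow> bool" where
  "section_on C A \<Delta> U X \<longleftrightarrow> vector_field_on C A U X \<and> (\<forall>x\<in>U. X x \<in> \<Delta> x)"

inductive iterated_bracket ::
  "regularity \<Rightarrow> ('m, 'e::euclidean_space) atlas \<Rightarrow> ('m \<Rightarrow> (('m, 'e) chart \<Rightarrow> 'e) set) \<Rightarrow>
   'm set \<Rightarrow> ('m, 'e) vfield \<Rightarrow> bool"
  for C A \<Delta> U where
  "section_on C A \<Delta> U X \<Longrightarrow> iterated_bracket C A \<Delta> U X"
| "iterated_bracket C A \<Delta> U X \<Longrightarrow> iterated_bracket C A \<Delta> U Y \<Longrightarrow>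
     iterated_bracket C A \<Delta> U (lie_bracket A X Y)"

definition totally_nonholonomic ::
  "regularity \<Rightarrow> ('m, 'e::euclidean_space) atlas \<Rightarrow> ('m \<Rightarrow> (('m, 'e) chart \<Rightarrow> 'e) set) \<Rightarrow> bool"
  where
  "totally_nonholonomic C A \<Delta> \<longleftrightarrow>
     (\<forall>x\<in>carrier A. \<forall>c\<in>A. x \<in> fst c \<longrightarrow>
        span {X x c | X U. openin (manifold_topology A) U \<and> x \<in> U \<and> iterated_bracket C A \<Delta> U X}
          = UNIV)"

section \<open>Maps into manifolds and submanifolds\<close>

definition smooth_map_on ::
  "('p, 'f::euclidean_space) atlas \<Rightarrow> 'k::euclidean_space set \<Rightarrow> ('k \<Rightarrow> 'p) \<Rightarrow> bool" where
  "smooth_map_on B V \<sigma> \<longleftrightarrow>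
     open V \<and> \<sigma> ` V \<subseteq> carrier B \<and>
     (\<forall>c\<in>B. open {y\<in>V. \<sigma> y \<in> fst c} \<and> class_on Smooth {y\<in>V. \<sigma> y \<in> fst c} (snd c \<circ> \<sigma>))"

definition has_velocity ::
  "('p, 'f::euclidean_space) atlas \<Rightarrow> (real \<Rightarrow> 'p) \<Rightarrow> (('p, 'f) chart \<Rightarrow> 'f) \<Rightarrow> real \<Rightarrow> real set \<Rightarrow> bool"
  where
  "has_velocity B \<gamma> v t S \<longleftrightarrow>
     v \<in> tangent_space B (\<gamma> t) \<and>
     (\<forall>c\<in>B. \<gamma> t \<in> fst c \<longrightarrow> ((snd c \<circ> \<gamma>) has_vector_derivative v c) (at t within S))"

text \<open>Tangent space at \<open>a\<close> of an embedded submanifold \<open>N\<close>: velocities of smooth curves in \<open>N\<close>.\<close>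

definition tangent_space_sub ::
  "('p, 'f::euclidean_space) atlas \<Rightarrow> 'p set \<Rightarrow> 'p \<Rightarrow> (('p, 'f) chart \<Rightarrow> 'f) set" where
  "tangent_space_sub B N a = {v. \<exists>\<gamma> e. e > 0 \<and> smooth_map_on B {-e<..<e} \<gamma> \<and>
     \<gamma> ` {-e<..<e} \<subseteq> N \<and> \<gamma> 0 = a \<and> has_velocity B \<gamma> v 0 UNIV}"

definition local_parametrization ::
  "('p, 'f::euclidean_space) atlas \<Rightarrow> 'p set \<Rightarrow> 'k::euclidean_space set \<Rightarrow> ('k \<Rightarrow> 'p) \<Rightarrow> bool" where
  "local_parametrization B N V \<sigma> \<longleftrightarrow>
     smooth_map_on B V \<sigma> \<and> \<sigma> ` V \<subseteq> N \<and>
     openin (subtopology (manifold_topology B) N) (\<sigma> ` V) \<and>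
     homeomorphic_map (top_of_set V) (subtopology (manifold_topology B) (\<sigma> ` V)) \<sigma> \<and>
     (\<forall>c\<in>B. \<forall>y\<in>V. \<sigma> y \<in> fst c \<longrightarrow> inj (frechet_derivative (snd c \<circ> \<sigma>) (at y)))"

section \<open>Lebesgue measure zero\<close>

definition measure_zero :: "('m, 'e::euclidean_space) atlas \<Rightarrow> 'm set \<Rightarrow> bool" where
  "measure_zero A E \<longleftrightarrow> (\<forall>c\<in>A. snd c ` (E \<inter> fst c) \<in> null_sets lebesgue)"

text \<open>Measure zero in an embedded submanifold \<open>N\<close>, tested in local parametrizations. The model
  space \<open>'k\<close> must be chosen with \<open>DIM('k)\<close> equal to the dimension of \<open>N\<close>.\<close>

definition measure_zero_sub ::
  "'k::euclidean_space itself \<Rightarrow> ('p, 'f::euclidean_space) atlas \<Rightarrow> 'p set \<Rightarrow> 'p set \<Rightarrow> bool" where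
  "measure_zero_sub K B N E \<longleftrightarrow>
     (\<forall>(V :: 'k set) \<sigma>. local_parametrization B N V \<sigma> \<longrightarrow> {y\<in>V. \<sigma> y \<in> E} \<in> null_sets lebesgue)"

section \<open>The cotangent bundle and the annihilator of a distribution\<close>

type_synonym ('m, 'e) cotangent = "'m \<times> (('m, 'e) chart \<Rightarrow> 'e)"

text \<open>Canonical coordinates \<open>(x, p)\<close> on the cotangent bundle induced by a chart.\<close>

definition cotangent_chart ::
  "('m, 'e::euclidean_space) atlas \<Rightarrow> ('m, 'e) chart \<Rightarrow> (('m, 'e) cotangent, 'e \<times> 'e) chart" where
  "cotangent_chart A c =
     ({(x, p). x \<in> fst c \<and> p \<in> cotangent_space A x}, \<lambda>(x, p). (snd c x, p c))"

definition cotangent_atlas ::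
  "('m, 'e::euclidean_space) atlas \<Rightarrow> (('m, 'e) cotangent, 'e \<times> 'e) atlas" where
  "cotangent_atlas A = cotangent_chart A ` A"

text \<open>The canonical symplectic form \<open>dp \<and> dx\<close>, evaluated in canonical coordinates.\<close>

definition canonical_form ::
  "('m, 'e::euclidean_space) atlas \<Rightarrow> ('m, 'e) cotangent \<Rightarrow>
   ((('m, 'e) cotangent, 'e \<times> 'e) chart \<Rightarrow> 'e \<times> 'e) \<Rightarrow>
   ((('m, 'e) cotangent, 'e \<times> 'e) chart \<Rightarrow> 'e \<times> 'e) \<Rightarrow> real" where
  "canonical_form A a \<xi> \<eta> =
     (let c = cotangent_chart A (chart_at A (fst a))
      in snd (\<xi> c) \<bullet> fst (\<eta> c) - snd (\<eta> c) \<bullet> fst (\<xi> c))"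

definition annihilator ::
  "('m, 'e::euclidean_space) atlas \<Rightarrow> ('m \<Rightarrow> (('m, 'e) chart \<Rightarrow> 'e) set) \<Rightarrow> ('m, 'e) cotangent set"
  where
  "annihilator A \<Delta> = {(x, p). x \<in> carrier A \<and> p \<in> cotangent_space A x \<and> p \<noteq> (\<lambda>c. 0) \<and>
     (\<forall>v\<in>\<Delta> x. pairing A x p v = 0)}"

definition ker_omega ::
  "('m, 'e::euclidean_space) atlas \<Rightarrow> ('m \<Rightarrow> (('m, 'e) chart \<Rightarrow> 'e) set) \<Rightarrow> ('m, 'e) cotangent \<Rightarrow>
   ((('m, 'e) cotangent, 'e \<times> 'e) chart \<Rightarrow> 'e \<times> 'e) set" where
  "ker_omega A \<Delta> a =
     {\<xi> \<in> tangent_space_sub (cotangent_atlas A) (annihilator A \<Delta>) a.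
        \<forall>\<eta> \<in> tangent_space_sub (cotangent_atlas A) (annihilator A \<Delta>) a. canonical_form A a \<xi> \<eta> = 0}"

definition regular_set ::
  "('m, 'e::euclidean_space) atlas \<Rightarrow> ('m \<Rightarrow> (('m, 'e) chart \<Rightarrow> 'e) set) \<Rightarrow> ('m, 'e) cotangent set"
  where
  "regular_set A \<Delta> = {a \<in> annihilator A \<Delta>.
     \<exists>W k. openin (subtopology (manifold_topology (cotangent_atlas A)) (annihilator A \<Delta>)) W \<and>
       a \<in> W \<and> (\<forall>b\<in>W. subspace_dim (cotangent_atlas A) b (ker_omega A \<Delta> b) = k)}"

definition singular_set ::
  "('m, 'e::euclidean_space) atlas \<Rightarrow> ('m \<Rightarrow> (('m, 'e) chart \<Rightarrow> 'e) set) \<Rightarrow> ('m, 'e) cotangent set"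
  where
  "singular_set A \<Delta> = annihilator A \<Delta> - regular_set A \<Delta>"

definition char_distribution ::
  "('m, 'e::euclidean_space) atlas \<Rightarrow> ('m \<Rightarrow> (('m, 'e) chart \<Rightarrow> 'e) set) \<Rightarrow> ('m, 'e) cotangent \<Rightarrow>
   ((('m, 'e) cotangent, 'e \<times> 'e) chart \<Rightarrow> 'e \<times> 'e) set" where
  "char_distribution A \<Delta> a = (if a \<in> regular_set A \<Delta> then ker_omega A \<Delta> a else {\<lambda>c. 0})"

definition char_rank ::
  "('m, 'e::euclidean_space) atlas \<Rightarrow> ('m \<Rightarrow> (('m, 'e) chart \<Rightarrow> 'e) set) \<Rightarrow> ('m, 'e) cotangent \<Rightarrow> nat"
  where
  "char_rank A \<Delta> a = subspace_dim (cotangent_atlas A) a (char_distribution A \<Delta> a)"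

section \<open>Horizontal and singular paths\<close>

definition abs_continuous_on :: "real \<Rightarrow> real \<Rightarrow> (real \<Rightarrow> 'b::metric_space) \<Rightarrow> bool" where
  "abs_continuous_on a b f \<longleftrightarrow>
     (\<forall>\<epsilon>>0. \<exists>\<delta>>0. \<forall>P :: (real \<times> real) set.
        finite P \<and> (\<forall>(u, v)\<in>P. a \<le> u \<and> u \<le> v \<and> v \<le> b) \<and>
        (\<forall>I\<in>P. \<forall>J\<in>P. I \<noteq> J \<longrightarrow> {fst I<..<snd I} \<inter> {fst J<..<snd J} = {}) \<and>
        (\<Sum>(u, v)\<in>P. v - u) < \<delta>
        \<longrightarrow> (\<Sum>(u, v)\<in>P. dist (f u) (f v)) < \<epsilon>)"

text \<open>On a manifold, absolute continuity and square integrability of the derivative are required on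
  every compact interval which the path maps into a single chart domain.\<close>

definition ac_path :: "('p, 'f::euclidean_space) atlas \<Rightarrow> (real \<Rightarrow> 'p) \<Rightarrow> bool" where
  "ac_path B \<gamma> \<longleftrightarrow>
     continuous_map (top_of_set {0..1}) (manifold_topology B) \<gamma> \<and>
     (\<forall>c\<in>B. \<forall>s t. 0 \<le> s \<and> s \<le> t \<and> t \<le> 1 \<and> \<gamma> ` {s..t} \<subseteq> fst c \<longrightarrow> abs_continuous_on s t (snd c \<circ> \<gamma>))"

definition L2_derivative :: "('p, 'f::euclidean_space) atlas \<Rightarrow> (real \<Rightarrow> 'p) \<Rightarrow> bool" where
  "L2_derivative B \<gamma> \<longleftrightarrow>
     (\<forall>c\<in>B. \<forall>s t. 0 \<le> s \<and> s \<le> t \<and> t \<le> 1 \<and> \<gamma> ` {s..t} \<subseteq> fst c \<longrightarrow>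
        set_integrable lebesgue {s..t}
          (\<lambda>\<tau>. (norm (vector_derivative (snd c \<circ> \<gamma>) (at \<tau> within {s..t})))\<^sup>2))"

definition horizontal_path ::
  "('m, 'e::euclidean_space) atlas \<Rightarrow> ('m \<Rightarrow> (('m, 'e) chart \<Rightarrow> 'e) set) \<Rightarrow> (real \<Rightarrow> 'm) \<Rightarrow> bool" where
  "horizontal_path A \<Delta> \<gamma> \<longleftrightarrow>
     ac_path A \<gamma> \<and> L2_derivative A \<gamma> \<and>
     (AE t in lebesgue_on {0..1}. \<exists>v\<in>\<Delta> (\<gamma> t). has_velocity A \<gamma> v t {0..1})"

text \<open>Singular paths are defined by the existence of an abnormal lift, that is, of an absolutely
  continuous lift to the annihilator which is almost everywhere tangent to the kernel of the
  restricted symplectic form; equivalently, they are the critical points of the end-point map on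
  horizontal paths with fixed starting point.\<close>

definition singular_path ::
  "('m, 'e::euclidean_space) atlas \<Rightarrow> ('m \<Rightarrow> (('m, 'e) chart \<Rightarrow> 'e) set) \<Rightarrow> (real \<Rightarrow> 'm) \<Rightarrow> bool" where
  "singular_path A \<Delta> \<gamma> \<longleftrightarrow>
     horizontal_path A \<Delta> \<gamma> \<and>
     (\<exists>\<psi>. ac_path (cotangent_atlas A) \<psi> \<and>
          (\<forall>t\<in>{0..1}. \<psi> t \<in> annihilator A \<Delta> \<and> fst (\<psi> t) = \<gamma> t) \<and>
          (AE t in lebesgue_on {0..1}.
             \<exists>\<xi>\<in>ker_omega A \<Delta> (\<psi> t). has_velocity (cotangent_atlas A) \<psi> \<xi> t {0..1}))"

definition Abn ::
  "('m, 'e::euclidean_space) atlas \<Rightarrow> ('m \<Rightarrow> (('m, 'e) chart \<Rightarrow> 'e) set) \<Rightarrow> 'm \<Rightarrow> 'm set" where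
  "Abn A \<Delta> x = {\<gamma> 1 | \<gamma>. singular_path A \<Delta> \<gamma> \<and> \<gamma> 0 = x}"

definition sard_conjecture ::
  "('m, 'e::euclidean_space) atlas \<Rightarrow> ('m \<Rightarrow> (('m, 'e) chart \<Rightarrow> 'e) set) \<Rightarrow> bool" where
  "sard_conjecture A \<Delta> \<longleftrightarrow> (\<forall>x\<in>carrier A. measure_zero A (Abn A \<Delta> x))"

end

theory Submission
  imports Defs
begin

text \<open>Locally \<open>\<Delta> = ker \<nu>\<close>, and in the coordinates \<open>(y, \<kappa>)\<close> of the annihilator, \<open>p = \<kappa> \<nu>(y)\<close>, the
  restricted form is \<open>\<theta> = d(\<kappa> \<nu>)\<close>. If its kernel has rank one, it is spanned by the vector field \<open>Z\<close>
  whose coefficients are sub-Pfaffians of \<open>\<theta>\<close>; \<open>d\<theta> = 0\<close> makes \<open>Z\<close> divergence free, and \<open>Z\<close> vanishes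
  exactly where the rank of the kernel is not one. A leaf of \<open>Z\<close> which tends to a zero of \<open>Z\<close> does so in
  infinite time, so the points of such leaves form a set which the volume preserving flow pushes into
  every neighbourhood of the null set of zeros; hence they form a null set, and by invariance under
  scaling of the fibres so does their projection to \<open>M\<close>. A singular path moves along leaves: after its
  last visit to the projection of \<open>\<Sigma>\<close> it starts in this null set, and inside flow boxes it stays in the
  closure of this null set under countably many (rational) motions along leaves, which is null again.
  If there is no such visit, it runs on the leaf of \<open>x\<close>; in rank zero it is constant.\<close>

section \<open>Flows, curves and volume\<close>

text \<open>Volume has to be controlled on the annihilator and not on M: the projected kernel field
  has no reason to be divergence free there, whereas Z is, because \<theta> is closed. The flow is
  never differentiated in its initial point. It is approximated by Euler steps x + h Z(x), whose
  Jacobian is 1 + O(h^2) because DZ has trace zero, so that m/h steps lose only O(h) of the volume.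
  A singular path brings no usable time with it. Its lift is merely absolutely continuous; it may
  rest, turn back, and start from a zero of Z, near which the time of Z diverges. Inside flow boxes
  the path is therefore measured by a linear coordinate, and the time of Z is recovered only on
  intervals away from the zeros. The motions along leaves form an uncountable family, so a null set
  cannot simply be saturated by them; this is why the propagation must get by with countably many.
  The kernel has the same dimension along each fibre. Hence regularity, the last singular time and
  the exceptional null sets can all be discussed on M, where the end-points live.\<close>

abbreviation fderiv :: "('a::real_normed_vector => 'b::real_normed_vector) => 'a => 'a => 'b" where
  "fderiv f x \<equiv> frechet_derivative f (at x)"

subsection \<open>Global flows of bounded Lipschitz fields\<close>

lemma has_vector_derivative_affine:
  assumes "(x has_vector_derivative D) (at (c * s + d))"
  shows "((\<lambda>s. x (c * s + d)) has_vector_derivative c *\<^sub>R D) (at (s::real))"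
proof -
  have "((\<lambda>s. c * s + d) has_real_derivative c) (at s)" by (auto intro!: derivative_eq_intros)
  then have "((\<lambda>s. c * s + d) has_vector_derivative c) (at s)" by (simp only: has_real_derivative_iff_has_vector_derivative)
  from vector_diff_chain_at[OF this assms] show ?thesis by (simp add: o_def)
qed

text \<open>The mean value inequality against the primitive (C / c) * exp (c * t) of the bound. With
  c = 2 * L it is the contraction estimate for the Picard operator in
  \<open>integral_curve_exists\<close>.\<close>

lemma exp_bound_of_derivative:
  fixes K :: "real => 'a::euclidean_space"
  assumes c: "c > 0" and K0: "K 0 = 0"
    and K: "\<And>t. (K has_vector_derivative k t) (at t)"
    and k: "\<And>t. norm (k t) \<le> C * exp (c * \<bar>t\<bar>)"
  shows "norm (K t) \<le> C / c * exp (c * \<bar>t\<bar>)"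
proof -
  have C: "C \<ge> 0" using order_trans[OF norm_ge_zero k[of 0]] by simp
  \<comment> \<open>One-sided and for arbitrary J, because negative times are treated by applying it
    to the reflected curve.\<close>
  have *: "norm (J t) \<le> C / c * exp (c * t)"
    if "t \<ge> 0" "J 0 = 0" and J: "\<And>t. (J has_vector_derivative j t) (at t)"
      and j: "\<And>t. norm (j t) \<le> C * exp (c * \<bar>t\<bar>)" for J j :: "real => 'a" and t
  proof (cases "t = 0")
    case True then show ?thesis using that C c by simp
  next
    case False
    have "norm (J t - J 0) \<le> C / c * exp (c * t) - C / c * exp (c * 0)"
    proof (rule differentiable_bound_general[where f' = j and \<phi>' = "\<lambda>t. C * exp (c * t)"])
      show "0 < t" using that False by simp
      show "continuous_on {0..t} J" by (intro continuous_at_imp_continuous_on ballI has_vector_derivative_continuous[OF J])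
      show "continuous_on {0..t} (\<lambda>a. C / c * exp (c * a))" by (intro continuous_intros)
      show "(J has_vector_derivative j x) (at x)" for x by (rule J)
      show "((\<lambda>a. C / c * exp (c * a)) has_vector_derivative C * exp (c * x)) (at x)" for x
        using c by (auto intro!: derivative_eq_intros simp: has_real_derivative_iff_has_vector_derivative[symmetric])
      show "norm (j x) \<le> C * exp (c * x)" if "0 < x" for x using j[of x] that by simp
    qed
    also have "\<dots> \<le> C / c * exp (c * t)" using C c by simp
    finally show ?thesis using that by simp
  qed
  show ?thesis
  proof (cases "t \<ge> 0")
    case True then show ?thesis using *[OF _ K0 K k, of t] by simp
  next
    case False
    have "norm ((\<lambda>s. K (- s)) (- t)) \<le> C / c * exp (c * (- t))"
    proof (rule *[where j = "\<lambda>s. - k (- s)"])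
      show "((\<lambda>s. K (- s)) has_vector_derivative - k (- s)) (at s)" for s
        using has_vector_derivative_affine[of K "k (- s)" "-1" s 0] K[of "- s"] by simp
    qed (use False K0 k[of "- _"] in auto)
    then show ?thesis using False by simp
  qed
qed

lemma antiderivative_real_line:
  fixes h :: "real => 'a::banach"
  assumes "continuous_on UNIV h"
  shows "\<exists>H. H 0 = 0 \<and> (\<forall>t. (H has_vector_derivative h t) (at t))"
proof -
  let ?H = "\<lambda>t. if t \<ge> 0 then integral {0..t} h else - integral {t..0} h"
  have "(?H has_vector_derivative h t) (at t)" for t proof -
  \<comment> \<open>On {-R<..<R} both cases of \<open>?H\<close> are the integral from -R minus one
    constant, so the fundamental theorem on {-R..R} covers t = 0 as well.\<close>
  define R where "R = \<bar>t\<bar> + 1"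
  have int: "h integrable_on {a..b}" for a b by (rule integrable_continuous_real) (rule continuous_on_subset[OF assms], simp)
  have eq: "?H s = integral {-R..s} h - integral {-R..0} h" if "s \<in> {-R<..<R}" for s
  proof (cases "s \<ge> 0")
    case True
    have "integral {-R..0} h + integral {0..s} h = integral {-R..s} h"
      by (rule Henstock_Kurzweil_Integration.integral_combine) (use True int R_def in auto)
    then show ?thesis using True by (simp add: algebra_simps)
  next
    case False
    have "integral {-R..s} h + integral {s..0} h = integral {-R..0} h"
      by (rule Henstock_Kurzweil_Integration.integral_combine) (use that False int in auto)
    then show ?thesis using False by (simp add: algebra_simps)
  qed
  have "((\<lambda>s. integral {-R..s} h) has_vector_derivative h t) (at t within {-R..R})"
    by (rule integral_has_vector_derivative) (auto intro: continuous_on_subset[OF assms] simp: R_def)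
  then have "((\<lambda>s. integral {-R..s} h) has_vector_derivative h t) (at t)" by (subst (asm) at_within_interior) (auto simp: R_def)
  then have "((\<lambda>s. integral {-R..s} h - integral {-R..0} h) has_vector_derivative h t) (at t)"
    by (auto intro!: derivative_eq_intros)
  then show ?thesis by (rule has_vector_derivative_transform_within_open[of _ _ _ "{-R<..<R}"])
      (auto simp: R_def eq)
  qed
  then show ?thesis by (intro exI[of _ ?H]) simp
qed

text \<open>Gronwall by a monotone quantity: the squared distance times exp (-2 * L * t) has
  nonpositive derivative, since the inner product of x - y with the difference of velocities is at
  most L times the squared distance.\<close>

lemma integral_curve_unique:
  fixes Y :: "'a::euclidean_space => 'a"
  assumes lip: "\<And>x y. norm (Y x - Y y) \<le> L * norm (x - y)" and t: "t \<ge> 0"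
    and x: "\<And>t. (x has_vector_derivative Y (x t)) (at t)"
    and y: "\<And>t. (y has_vector_derivative Y (y t)) (at t)"
  shows "norm (x t - y t) \<le> exp (L * t) * norm (x 0 - y 0)"
proof -
  define g where "g t = ((x t - y t) \<bullet> (x t - y t)) * exp (- 2 * L * t)" for t
  have "g 0 \<ge> g t"
  proof (rule DERIV_nonpos_imp_nonincreasing[OF t])
    fix s
    have xy: "((\<lambda>s. x s - y s) has_vector_derivative Y (x s) - Y (y s)) (at s)" using x y by (auto intro!: derivative_eq_intros)
    have in': "((\<lambda>s. (x s - y s) \<bullet> (x s - y s)) has_real_derivative
        2 * ((x s - y s) \<bullet> (Y (x s) - Y (y s)))) (at s)"
      using has_derivative_inner[OF xy[unfolded has_vector_derivative_def] xy[unfolded has_vector_derivative_def]]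
      unfolding has_field_derivative_def by (rule has_derivative_eq_rhs) (auto simp: fun_eq_iff inner_commute algebra_simps)
    have "(g has_real_derivative (2 * ((x s - y s) \<bullet> (Y (x s) - Y (y s)))) * exp (- 2 * L * s)
        + ((x s - y s) \<bullet> (x s - y s)) * (exp (- 2 * L * s) * (- 2 * L))) (at s)"
      unfolding g_def by (auto intro!: derivative_eq_intros in')
    moreover have "(x s - y s) \<bullet> (Y (x s) - Y (y s)) \<le> norm (x s - y s) * (L * norm (x s - y s))"
      by (rule order_trans[OF norm_cauchy_schwarz]) (intro mult_left_mono lip, simp)
    then have "2 * ((x s - y s) \<bullet> (Y (x s) - Y (y s))) - 2 * L * ((x s - y s) \<bullet> (x s - y s)) \<le> 0"
      by (simp add: dot_square_norm power2_eq_square algebra_simps)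
    then have "(2 * ((x s - y s) \<bullet> (Y (x s) - Y (y s))) - 2 * L * ((x s - y s) \<bullet> (x s - y s)))
        * exp (- 2 * L * s) \<le> 0" by (intro mult_nonpos_nonneg) auto
    ultimately show "\<exists>y. (g has_real_derivative y) (at s) \<and> y \<le> 0" by (intro exI conjI) (auto simp: algebra_simps)
  qed
  then have "(norm (x t - y t))\<^sup>2 \<le> (norm (x 0 - y 0))\<^sup>2 * exp (2 * L * t)"
    by (simp add: g_def dot_square_norm exp_minus field_simps)
  also have "\<dots> = (exp (L * t) * norm (x 0 - y 0))\<^sup>2"
    by (simp add: power_mult_distrib exp_double[symmetric] mult.commute mult.left_commute)
  finally show ?thesis by (rule power2_le_imp_le) simp
qed

lemma exp_minus_mult_le: "n \<le> B * exp x ==> exp (- x) * n \<le> (B :: real)"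
  by (simp add: exp_minus divide_simps mult.commute)

text \<open>Picard iteration on the whole line at once. The unknown is written as a + exp (2 * L *
  |t|) g(t) with g bounded and continuous; in this weighted norm the integral operator contracts by
  L / (2 * L) = 1/2, so no local solution has to be continued.\<close>

lemma integral_curve_exists:
  fixes Y :: "'a::euclidean_space => 'a"
  assumes lip: "\<And>x y. norm (Y x - Y y) \<le> L * norm (x - y)" and L: "L > 0"
    and bdd: "\<And>x. norm (Y x) \<le> M"
  shows "\<exists>x. x 0 = a \<and> (\<forall>t. (x has_vector_derivative Y (x t)) (at t))"
proof -
  have M: "M \<ge> 0" using bdd[of 0] norm_ge_zero[of "Y 0"] by linarith
  have contY: "continuous_on UNIV Y"
    by (rule lipschitz_on_continuous_on[of L]) (use lip L in \<open>auto simp: lipschitz_on_def dist_norm\<close>)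
  define h where "h g t = Y (a + exp (2 * L * \<bar>t\<bar>) *\<^sub>R apply_bcontfun g t)" for g t
  have conth: "continuous_on UNIV (h g)" for g
    unfolding h_def by (rule continuous_on_compose2[OF contY]) (auto intro!: continuous_intros)
  define H where "H g = (SOME H. H 0 = 0 \<and> (\<forall>t. (H has_vector_derivative h g t) (at t)))" for g
  have H: "H g 0 = 0" "(H g has_vector_derivative h g t) (at t)" for g t
    using someI_ex[OF antiderivative_real_line[OF conth[of g]]] by (auto simp: H_def)
  have contH: "continuous_on UNIV (H g)" for g by (intro continuous_at_imp_continuous_on ballI has_vector_derivative_continuous[OF H(2)])
  define p where "p g t = exp (- (2 * L * \<bar>t\<bar>)) *\<^sub>R H g t" for g t
  have bp: "norm (H g t) \<le> M / (2 * L) * exp (2 * L * \<bar>t\<bar>)" for g t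
  proof (rule exp_bound_of_derivative[where k = "h g"])
    fix t
    have "M * 1 \<le> M * exp (2 * L * \<bar>t\<bar>)" by (rule mult_left_mono) (use M L in auto)
    with bdd[of "a + exp (2 * L * \<bar>t\<bar>) *\<^sub>R apply_bcontfun g t"]
    show "norm (h g t) \<le> M * exp (2 * L * \<bar>t\<bar>)"
      unfolding h_def by linarith
  qed (use L H in auto)
  have inB: "p g \<in> bcontfun" for g
  proof (rule bcontfun_normI[of _ "M / (2 * L)"])
    show "continuous_on UNIV (p g)" unfolding p_def by (intro continuous_intros contH)
    show "norm (p g t) \<le> M / (2 * L)" for t using exp_minus_mult_le[OF bp[of g t]] by (simp add: p_def)
  qed
  define P where "P g = Bcontfun (p g)" for g
  have P: "apply_bcontfun (P g) = p g" for g
    unfolding P_def by (rule Bcontfun_inverse[OF inB])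
  have "\<exists>!g. P g = g"
  proof (rule banach_fix_type[of "1/2"], simp, simp, intro allI dist_bound)
    fix f g :: "real \<Rightarrow>\<^sub>C 'a" and t
    have "norm (H f t - H g t) \<le> (L * dist f g) / (2 * L) * exp (2 * L * \<bar>t\<bar>)"
    proof (rule exp_bound_of_derivative[where k = "\<lambda>t. h f t - h g t"])
      fix t
      show "((\<lambda>t. H f t - H g t) has_vector_derivative h f t - h g t) (at t)" using H by (auto intro!: derivative_eq_intros)
      have "norm (h f t - h g t) \<le> L * (exp (2 * L * \<bar>t\<bar>) * dist (apply_bcontfun f t) (apply_bcontfun g t))"
        unfolding h_def by (rule order_trans[OF lip]) (simp add: scaleR_diff_right[symmetric] dist_norm)
      also have "\<dots> \<le> L * (exp (2 * L * \<bar>t\<bar>) * dist f g)" using L by (intro mult_left_mono dist_bounded) auto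
      finally show "norm (h f t - h g t) \<le> L * dist f g * exp (2 * L * \<bar>t\<bar>)" by (simp add: algebra_simps)
    qed (use L H in auto)
    then show "dist (apply_bcontfun (P f) t) (apply_bcontfun (P g) t) \<le> 1 / 2 * dist f g"
      using exp_minus_mult_le L by (fastforce simp: P p_def dist_norm scaleR_diff_right[symmetric])
  qed
  then obtain g where g: "P g = g" by blast
  have "a + exp (2 * L * \<bar>t\<bar>) *\<^sub>R apply_bcontfun g t = a + H g t" for t proof -
    have "apply_bcontfun g t = p g t" using P[of g] g by simp
    then show ?thesis by (simp add: p_def exp_minus)
  qed
  then have "h g t = Y (a + H g t)" for t by (simp add: h_def)
  then have "((\<lambda>t. a + H g t) has_vector_derivative Y (a + H g t)) (at t)" for t
    using H(2)[of g t] by (auto intro!: derivative_eq_intros)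
  then show ?thesis using H(1) by (intro exI[of _ "\<lambda>t. a + H g t"]) auto
qed

text \<open>The concrete fields are only controlled on a ball. Composed with the nearest-point
  projection (\<open>lipschitz_field_closest_point\<close>) they become bounded and globally
  Lipschitz, so flows exist for all times and cause no domain questions.\<close>

locale lipschitz_field =
  fixes Y :: "'a::euclidean_space => 'a" and L M :: real
  assumes lip: "norm (Y x - Y y) \<le> L * norm (x - y)" and L_pos: "L > 0"
    and bdd: "norm (Y x) \<le> M"
begin

definition flow :: "real => 'a => 'a" where
  "flow s a = (SOME x. x 0 = a \<and> (\<forall>t. (x has_vector_derivative Y (x t)) (at t))) s"

lemma flow_0 [simp]: "flow 0 a = a"
  and flow_deriv: "((\<lambda>s. flow s a) has_vector_derivative Y (flow s a)) (at s)"
  using someI_ex[OF integral_curve_exists[of Y L M a, OF lip L_pos bdd]] by (auto simp: flow_def)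

lemma M_nonneg: "M \<ge> 0" using bdd[of 0] norm_ge_zero[of "Y 0"] by linarith

lemma integral_curve_dist:
  assumes x: "\<And>t. (x has_vector_derivative Y (x t)) (at t)"
    and y: "\<And>t. (y has_vector_derivative Y (y t)) (at t)"
  shows "norm (x t - y t) \<le> exp (L * \<bar>t\<bar>) * norm (x 0 - y 0)"
proof (cases "t \<ge> 0")
  case True then show ?thesis using integral_curve_unique[OF lip True x y] by simp
next
  case False
  have rev: "((\<lambda>s. z (- s)) has_vector_derivative - Y (z (- s))) (at s)"
    if "\<And>t. (z has_vector_derivative Y (z t)) (at t)" for z s
    using has_vector_derivative_affine[of z "Y (z (- s))" "-1" s 0] that[of "- s"] by simp
  have "norm (x (- (- t)) - y (- (- t))) \<le> exp (L * (- t)) * norm (x (- 0) - y (- 0))"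
    using integral_curve_unique[of "\<lambda>z. - Y z" L "- t" "\<lambda>s. x (- s)" "\<lambda>s. y (- s)", OF _ _ rev[OF x] rev[OF y]] lip False
    by (simp add: norm_minus_commute)
  then show ?thesis using False by simp
qed

lemma flow_unique:
  assumes x: "\<And>t. (x has_vector_derivative Y (x t)) (at t)"
  shows "x t = flow t (x 0)" using integral_curve_dist[OF x flow_deriv, of t "x 0"] by simp

lemma flow_add: "flow (s + t) a = flow s (flow t a)"
proof -
  have "((\<lambda>s. flow (s + t) a) has_vector_derivative Y (flow (s + t) a)) (at s)" for s
    using has_vector_derivative_affine[of "\<lambda>s. flow s a" "Y (flow (s + t) a)" 1 s t] flow_deriv[of a "s + t"] by simp
  from flow_unique[of "\<lambda>s. flow (s + t) a" s, OF this] show ?thesis by simp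
qed

lemma flow_lipschitz: "norm (flow s a - flow s b) \<le> exp (L * \<bar>s\<bar>) * norm (a - b)"
  using integral_curve_dist[OF flow_deriv flow_deriv, of s a b] by simp

lemma flow_time_lipschitz: "norm (flow s a - flow t a) \<le> M * \<bar>s - t\<bar>"
proof -
  have "norm (flow s a - flow t a) \<le> M * norm (s - t)"
  proof (rule differentiable_bound[of UNIV "\<lambda>s. flow s a" "\<lambda>s h. h *\<^sub>R Y (flow s a)"])
    show "((\<lambda>s. flow s a) has_derivative (\<lambda>h. h *\<^sub>R Y (flow x a))) (at x within UNIV)" for x
      using flow_deriv[of a x] by (simp add: has_vector_derivative_def)
    show "onorm (\<lambda>h. h *\<^sub>R Y (flow x a)) \<le> M" for x
      by (rule onorm_le) (metis bdd mult_right_mono norm_ge_zero norm_scaleR mult.commute real_norm_def)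
  qed auto
  then show ?thesis by simp
qed

text \<open>The local error of one Euler step: flow s a - s Y(a) has derivative Y(flow s a) - Y(a),
  of norm at most L * M * |h| between 0 and h.\<close>

lemma flow_step: "norm (flow h a - a - h *\<^sub>R Y a) \<le> L * M * h\<^sup>2"
proof -
  have "norm ((flow h a - h *\<^sub>R Y a) - (flow 0 a - 0 *\<^sub>R Y a)) \<le> (L * (M * \<bar>h\<bar>)) * norm (h - 0)"
  proof (rule differentiable_bound[of "closed_segment 0 h" "\<lambda>s. flow s a - s *\<^sub>R Y a" "\<lambda>s h. h *\<^sub>R (Y (flow s a) - Y a)"])
    show "((\<lambda>s. flow s a - s *\<^sub>R Y a) has_derivative (\<lambda>h. h *\<^sub>R (Y (flow x a) - Y a))) (at x within closed_segment 0 h)" for x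
    proof -
      have "((\<lambda>s. flow s a - s *\<^sub>R Y a) has_vector_derivative (Y (flow x a) - Y a)) (at x)"
        by (auto intro!: derivative_eq_intros flow_deriv)
      then show ?thesis by (simp add: has_vector_derivative_def has_derivative_at_withinI)
    qed
    show "onorm (\<lambda>h. h *\<^sub>R (Y (flow x a) - Y a)) \<le> L * (M * \<bar>h\<bar>)" if "x \<in> closed_segment 0 h" for x
    proof (rule onorm_le)
      have "norm (Y (flow x a) - Y a) \<le> L * norm (flow x a - flow 0 a)" using lip by simp
      also have "\<dots> \<le> L * (M * \<bar>x - 0\<bar>)" using L_pos by (intro mult_left_mono flow_time_lipschitz) auto
      also have "\<dots> \<le> L * (M * \<bar>h\<bar>)" using that L_pos M_nonneg
        by (intro mult_left_mono) (auto simp: closed_segment_eq_real_ivl split: if_splits)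
      finally show "norm (y *\<^sub>R (Y (flow x a) - Y a)) \<le> L * (M * \<bar>h\<bar>) * norm y" for y
        using mult_left_mono[of _ _ "norm y"] by (simp add: mult.commute[of _ "\<bar>y\<bar>"])
    qed
  qed auto
  then show ?thesis by (simp add: power2_eq_square algebra_simps)
qed

lemma flow_minus [simp]: "flow (- s) (flow s a) = a" using flow_add[of "- s" s a] by simp

lemma continuous_on_flow: "continuous_on S (flow s)" by (rule lipschitz_on_continuous_on[of "exp (L * \<bar>s\<bar>)"])
    (auto simp: lipschitz_on_def dist_norm flow_lipschitz)

lemma negligible_flow_image:
  assumes "negligible N" shows "negligible (flow s ` N)"
proof (rule negligible_locally_Lipschitz_image[OF _ assms])
  fix x assume "x \<in> N"
  show "\<exists>T B. open T \<and> x \<in> T \<and> (\<forall>y\<in>N \<inter> T. norm (flow s y - flow s x) \<le> B * norm (y - x))"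
    by (rule exI[of _ UNIV], rule exI[of _ "exp (L * \<bar>s\<bar>)"]) (auto simp: flow_lipschitz)
qed simp

lemma flow_fixed: "Y a = 0 ==> flow s a = a" using flow_unique[of "\<lambda>_. a" s] by simp

lemma negligible_orbit:
  assumes "DIM('a) \<ge> 2" shows "negligible (range (\<lambda>s. flow s a))"
proof -
  have "negligible ((\<lambda>s. flow s a) ` UNIV)"
  proof (rule negligible_differentiable_image_lowdim)
    show "DIM(real) < DIM('a)" using assms by simp
    show "(\<lambda>s. flow s a) differentiable_on UNIV"
      using flow_deriv[of a] by (auto simp: differentiable_on_def has_vector_derivative_def intro!: differentiableI)
  qed
  then show ?thesis .
qed

end

abbreviation nonoverlapping :: "(real \<times> real) set => bool" where
  "nonoverlapping P \<equiv> \<forall>I\<in>P. \<forall>J\<in>P. I \<noteq> J \<longrightarrow> {fst I<..<snd I} \<inter> {fst J<..<snd J} = {}"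

subsection \<open>Absolutely continuous curves\<close>

lemma abs_continuous_onE:
  assumes "abs_continuous_on a b f" "e > 0"
  obtains d where "d > 0" "\<And>P. finite P \<and> (\<forall>(u, v)\<in>P. a \<le> u \<and> u \<le> v \<and> v \<le> b) \<and>
        nonoverlapping P \<and>
        (\<Sum>(u, v)\<in>P. v - u) < d ==> (\<Sum>(u, v)\<in>P. dist (f u) (f v)) < e"
proof -
  from spec[OF assms(1)[unfolded abs_continuous_on_def], of e] assms(2)
  have "\<exists>d>0. \<forall>P. finite P \<and> (\<forall>(u, v)\<in>P. a \<le> u \<and> u \<le> v \<and> v \<le> b) \<and>
        nonoverlapping P \<and>
        (\<Sum>(u, v)\<in>P. v - u) < d \<longrightarrow> (\<Sum>(u, v)\<in>P. dist (f u) (f v)) < e" by (rule mp)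
  then show thesis by (elim exE conjE) (rule that, assumption, drule spec, erule mp, assumption)
qed

text \<open>Two controlling functions are allowed because flow (- s t) (c t) depends on the curve c
  and on its time s. A Lipschitz image of a single curve is the case f = g.\<close>

lemma abs_continuous_on_dominated:
  assumes f: "abs_continuous_on a b f" and g: "abs_continuous_on a b g"
    and h: "\<And>u v. [|u \<in> {a..b}; v \<in> {a..b}|] ==> dist (h u) (h v) \<le> L * (dist (f u) (f v) + dist (g u) (g v))"
  shows "abs_continuous_on a b h"
  unfolding abs_continuous_on_def
proof (intro allI impI)
  fix e :: real assume "e > 0"
  define e' where "e' = e / (\<bar>L\<bar> + 1) / 2"
  have e': "e' > 0" "\<bar>L\<bar> * (e' + e') < e" proof -
    have "e' + e' = e / (\<bar>L\<bar> + 1)" unfolding e'_def by (rule field_sum_of_halves)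
    then have "\<bar>L\<bar> * (e' + e') = e * (\<bar>L\<bar> / (\<bar>L\<bar> + 1))" by simp
    also have "\<dots> < e * 1" using \<open>e > 0\<close> by (intro mult_strict_left_mono) (auto simp: divide_less_eq)
    finally show "\<bar>L\<bar> * (e' + e') < e" by simp
    show "e' > 0" using \<open>e > 0\<close> by (auto simp: e'_def intro!: divide_pos_pos mult_pos_pos)
  qed
  obtain d1 where d1: "d1 > 0" "\<And>P. finite P \<and> (\<forall>(u, v)\<in>P. a \<le> u \<and> u \<le> v \<and> v \<le> b) \<and>
        nonoverlapping P \<and>
        (\<Sum>(u, v)\<in>P. v - u) < d1 ==> (\<Sum>(u, v)\<in>P. dist (f u) (f v)) < e'"
    by (rule abs_continuous_onE[OF f e'(1)]) (rule that)
  obtain d2 where d2: "d2 > 0" "\<And>P. finite P \<and> (\<forall>(u, v)\<in>P. a \<le> u \<and> u \<le> v \<and> v \<le> b) \<and>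
        nonoverlapping P \<and>
        (\<Sum>(u, v)\<in>P. v - u) < d2 ==> (\<Sum>(u, v)\<in>P. dist (g u) (g v)) < e'"
    by (rule abs_continuous_onE[OF g e'(1)]) (rule that)
  show "\<exists>\<delta>>0. \<forall>P :: (real \<times> real) set. finite P \<and> (\<forall>(u, v)\<in>P. a \<le> u \<and> u \<le> v \<and> v \<le> b) \<and>
        nonoverlapping P \<and>
        (\<Sum>(u, v)\<in>P. v - u) < \<delta> \<longrightarrow> (\<Sum>(u, v)\<in>P. dist (h u) (h v)) < e"
  proof (intro exI[of _ "min d1 d2"] conjI allI impI)
    fix P :: "(real \<times> real) set"
    assume P: "finite P \<and> (\<forall>(u, v)\<in>P. a \<le> u \<and> u \<le> v \<and> v \<le> b) \<and>
        nonoverlapping P \<and>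
        (\<Sum>(u, v)\<in>P. v - u) < min d1 d2"
    have "(\<Sum>(u, v)\<in>P. dist (h u) (h v)) \<le> (\<Sum>(u, v)\<in>P. \<bar>L\<bar> * (dist (f u) (f v) + dist (g u) (g v)))"
    proof (rule sum_mono, clarify)
      fix u v assume "(u, v) \<in> P"
      then have "u \<in> {a..b}" "v \<in> {a..b}" using P by fastforce+
      from h[OF this] show "dist (h u) (h v) \<le> \<bar>L\<bar> * (dist (f u) (f v) + dist (g u) (g v))"
        by (rule order_trans) (intro mult_right_mono, auto)
    qed
    also have "\<dots> = \<bar>L\<bar> * ((\<Sum>(u, v)\<in>P. dist (f u) (f v)) + (\<Sum>(u, v)\<in>P. dist (g u) (g v)))"
      by (simp add: case_prod_unfold sum_distrib_left sum.distrib distrib_left)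
    also have "\<dots> \<le> \<bar>L\<bar> * (e' + e')"
      using d1(2)[of P] d2(2)[of P] P by (intro mult_left_mono add_mono) (auto intro: less_imp_le)
    also have "\<dots> < e" by (rule e')
    finally show "(\<Sum>(u, v)\<in>P. dist (h u) (h v)) < e" .
  qed (use d1 d2 in auto)
qed

lemma abs_continuous_on_subinterval:
  assumes "abs_continuous_on a b f" "a \<le> c" "d \<le> b"
  shows "abs_continuous_on c d f"
  unfolding abs_continuous_on_def
proof (intro allI impI)
  fix e :: real assume "e > 0"
  obtain d1 where d1: "d1 > 0" "\<And>P. finite P \<and> (\<forall>(u, v)\<in>P. a \<le> u \<and> u \<le> v \<and> v \<le> b) \<and>
        nonoverlapping P \<and>
        (\<Sum>(u, v)\<in>P. v - u) < d1 ==> (\<Sum>(u, v)\<in>P. dist (f u) (f v)) < e"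
    by (rule abs_continuous_onE[OF assms(1) \<open>e > 0\<close>]) (rule that)
  show "\<exists>\<delta>>0. \<forall>P :: (real \<times> real) set. finite P \<and> (\<forall>(u, v)\<in>P. c \<le> u \<and> u \<le> v \<and> v \<le> d) \<and>
        nonoverlapping P \<and>
        (\<Sum>(u, v)\<in>P. v - u) < \<delta> \<longrightarrow> (\<Sum>(u, v)\<in>P. dist (f u) (f v)) < e"
  proof (intro exI[of _ d1] conjI allI impI)
    fix P :: "(real \<times> real) set"
    assume P: "finite P \<and> (\<forall>(u, v)\<in>P. c \<le> u \<and> u \<le> v \<and> v \<le> d) \<and>
        nonoverlapping P \<and>
        (\<Sum>(u, v)\<in>P. v - u) < d1"
    then have "\<forall>(u, v)\<in>P. a \<le> u \<and> u \<le> v \<and> v \<le> b" using assms(2,3) by auto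
    with P show "(\<Sum>(u, v)\<in>P. dist (f u) (f v)) < e" by (intro d1(2)) blast
  qed (rule d1)
qed

lemma abs_continuous_on_imp_continuous_on:
  assumes "abs_continuous_on a b f" shows "continuous_on {a..b} f"
  unfolding continuous_on_iff
proof (intro ballI allI impI)
  fix x e :: real assume x: "x \<in> {a..b}" and "e > 0"
  obtain d where d: "d > 0" "\<And>P. finite P \<and> (\<forall>(u, v)\<in>P. a \<le> u \<and> u \<le> v \<and> v \<le> b) \<and>
        nonoverlapping P \<and>
        (\<Sum>(u, v)\<in>P. v - u) < d ==> (\<Sum>(u, v)\<in>P. dist (f u) (f v)) < e"
    by (rule abs_continuous_onE[OF assms(1) \<open>e > 0\<close>]) (rule that)
  show "\<exists>d>0. \<forall>x'\<in>{a..b}. dist x' x < d \<longrightarrow> dist (f x') (f x) < e"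
  proof (intro exI[of _ d] conjI ballI impI d)
    fix y assume "y \<in> {a..b}" "dist y x < d"
    then show "dist (f y) (f x) < e" using d(2)[of "{(min x y, max x y)}"] x
      by (cases "x \<le> y") (auto simp: min_def max_def dist_commute dist_real_def)
  qed
qed

text \<open>The fundamental theorem for absolutely continuous curves, with the gauge integral.
  Outside N the gauge makes the difference quotients accurate; intervals tagged in N lie in an open
  set G of measure below \<delta>, where absolute continuity bounds the total increment.\<close>

lemma abs_continuous_on_has_integral:
  fixes F :: "real => 'b::euclidean_space"
  assumes ab: "a \<le> b" and ac: "abs_continuous_on a b F" and N: "negligible N"
    and f: "\<And>t. t \<in> {a..b} - N ==> (F has_vector_derivative f t) (at t within {a..b})"
  shows "((\<lambda>t. if t \<in> N then 0 else f t) has_integral F b - F a) {a..b}"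
  unfolding has_integral_real
proof (intro allI impI)
  fix e :: real assume "e > 0"
  define e1 where "e1 = e / (2 * (b - a + 1))"
  have e1: "e1 > 0" "e1 * (b - a) < e / 2" using \<open>e > 0\<close> ab by (auto simp: e1_def field_simps)
  have e2: "e / 2 > 0" using \<open>e > 0\<close> by simp
  obtain \<delta> where \<delta>: "\<delta> > 0" "\<And>P. finite P \<and> (\<forall>(u, v)\<in>P. a \<le> u \<and> u \<le> v \<and> v \<le> b) \<and>
        nonoverlapping P \<and>
        (\<Sum>(u, v)\<in>P. v - u) < \<delta> ==> (\<Sum>(u, v)\<in>P. dist (F u) (F v)) < e / 2"
    by (rule abs_continuous_onE[OF ac e2]) (rule that)
  obtain G where G: "open G" "N \<subseteq> G" "G \<in> lmeasurable" "measure lebesgue G < \<delta>" proof -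
    obtain T where T: "open T" "N \<subseteq> T" "T - N \<in> lmeasurable" "emeasure lebesgue (T - N) < ennreal \<delta>"
      using sets_lebesgue_outer_open[OF negligible_imp_sets[OF N] \<delta>(1)] by auto
    have neg: "negligible (T \<inter> N)" using N by (simp add: negligible_Int)
    have eq: "T = (T - N) \<union> (T \<inter> N)" by auto
    have meas: "T \<in> lmeasurable" using fmeasurable.Un[OF T(3) negligible_imp_measurable[OF neg]] eq by simp
    have "measure lebesgue T = measure lebesgue (T - N)"
      by (rule measure_negligible_symdiff[OF T(3)]) (use N in \<open>auto intro: negligible_subset\<close>)
    moreover have "measure lebesgue (T - N) < \<delta>" using T(4) T(3) \<delta>(1) by (simp add: emeasure_eq_measure2 ennreal_less_iff)
    ultimately show ?thesis using that T meas by auto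
  qed
  have "\<exists>d>0. \<forall>y\<in>{a..b}. norm (y - t) < d \<longrightarrow> norm (F y - F t - (y - t) *\<^sub>R f t) \<le> e1 * norm (y - t)"
    if "t \<in> {a..b} - N" for t

    using f[OF that, unfolded has_vector_derivative_def has_derivative_within_alt] e1(1) by blast
  then obtain d where d: "\<And>t. t \<in> {a..b} - N ==> d t > 0"
    "\<And>t y. [|t \<in> {a..b} - N; y \<in> {a..b}; norm (y - t) < d t|] ==> norm (F y - F t - (y - t) *\<^sub>R f t) \<le> e1 * norm (y - t)"
    by metis
  \<comment> \<open>Points of N get all of G as their neighbourhood: no derivative is available
    there, and only the total length of the intervals matters.\<close>
  define g where "g t = (if t \<in> N then G else if t \<in> {a..b} then ball t (d t) else ball t 1)" for t
  have gauge: "gauge g" using G d(1) by (auto simp: gauge_def g_def)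
  show "\<exists>\<gamma>. gauge \<gamma> \<and> (\<forall>D. D tagged_division_of {a..b} \<and> \<gamma> fine D \<longrightarrow>
     norm ((\<Sum>(x, k)\<in>D. measure lborel k *\<^sub>R (if x \<in> N then 0 else f x)) - (F b - F a)) < e)"
  proof (intro exI[of _ g] conjI gauge allI impI, elim conjE)
    fix D assume D: "D tagged_division_of {a..b}" and fine: "g fine D"
    note Dp = tagged_division_ofD[OF D]
    have K: "\<exists>u v. k = {u..v} \<and> u \<le> v \<and> a \<le> u \<and> v \<le> b \<and> x \<in> {u..v}" if xk: "(x, k) \<in> D" for x k
    proof -
      obtain u v where "k = {u..v}" using Dp(4)[OF xk] by auto
      then show ?thesis using Dp(2,3)[OF xk] by (intro exI[of _ u] exI[of _ v]) auto
    qed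
    \<comment> \<open>The error of one tagged interval. These add up to the total error because the
      increments of F telescope.\<close>
    define w where "w = (\<lambda>(x, k). measure lborel k *\<^sub>R (if x \<in> N then 0 else f x) - (F (Sup k) - F (Inf k)))"
    have "(\<Sum>(x, k)\<in>D. measure lborel k *\<^sub>R (if x \<in> N then 0 else f x)) - (F b - F a) = sum w D"
      by (simp add: additive_tagged_division_1[OF ab D, of F, symmetric] w_def sum_subtractf case_prod_unfold)
    also have "\<dots> = sum w {z\<in>D. fst z \<in> N} + sum w {z\<in>D. fst z \<notin> N}"
      by (subst sum.union_disjoint[symmetric]) (use Dp(1) in \<open>auto intro!: sum.cong\<close>)
    also have "norm \<dots> < e" proof -
      have "norm (sum w {z\<in>D. fst z \<notin> N}) \<le> (\<Sum>z\<in>{z\<in>D. fst z \<notin> N}. e1 * (Sup (snd z) - Inf (snd z)))"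
      proof (rule sum_norm_le)
        fix z assume z: "z \<in> {z\<in>D. fst z \<notin> N}"
        obtain x k where xk: "z = (x, k)" by (cases z)
        with z have zD: "(x, k) \<in> D" "x \<notin> N" by auto
        obtain u v where uv: "k = {u..v}" "u \<le> v" "a \<le> u" "v \<le> b" "x \<in> {u..v}" using K[OF zD(1)] by blast
        have sub: "k \<subseteq> ball x (d x)"  proof -
          have "k \<subseteq> g x" using fine zD(1) by (auto simp: fine_def)
          moreover have "x \<in> {a..b}" using uv by auto
          ultimately show ?thesis using zD(2) by (simp add: g_def)
        qed
        have "u \<in> k" "v \<in> k" using uv(1,2) by auto
        then have "u \<in> ball x (d x)" "v \<in> ball x (d x)" using sub by blast+
        then have near: "norm (u - x) < d x" "norm (v - x) < d x" by (auto simp: dist_norm norm_minus_commute)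
        have nn: "norm (u - x) = x - u" "norm (v - x) = v - x" and mem: "x \<in> {a..b} - N" "u \<in> {a..b}" "v \<in> {a..b}"
          using uv zD(2) by auto
        have "norm (F u - F x - (u - x) *\<^sub>R f x) \<le> e1 * (x - u)"
          "norm (F v - F x - (v - x) *\<^sub>R f x) \<le> e1 * (v - x)"
          using d(2)[OF mem(1,2) near(1)] d(2)[OF mem(1,3) near(2)] by (simp_all only: nn)
        moreover have "w z = (F u - F x - (u - x) *\<^sub>R f x) - (F v - F x - (v - x) *\<^sub>R f x)"
          using uv zD by (simp add: w_def xk algebra_simps)
        then have "norm (w z) \<le> norm (F u - F x - (u - x) *\<^sub>R f x) + norm (F v - F x - (v - x) *\<^sub>R f x)"
          by (simp only: norm_triangle_ineq4)
        ultimately have "norm (w z) \<le> e1 * (x - u) + e1 * (v - x)" by linarith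
        then show "norm (w z) \<le> e1 * (Sup (snd z) - Inf (snd z))" using uv by (simp add: xk algebra_simps)
      qed
      also have "\<dots> \<le> (\<Sum>z\<in>D. e1 * (Sup (snd z) - Inf (snd z)))"
      proof (rule sum_mono2[OF Dp(1)])
        fix z assume "z \<in> D - {z \<in> D. fst z \<notin> N}"
        then obtain x k where "z = (x, k)" "(x, k) \<in> D" by (cases z) auto
        with K[OF this(2)] e1(1) show "0 \<le> e1 * (Sup (snd z) - Inf (snd z))" by auto
      qed auto
      also have "\<dots> = e1 * (b - a)"
        using additive_tagged_division_1[OF ab D, of "\<lambda>x. x"] by (simp add: sum_distrib_left[symmetric] case_prod_unfold)
      finally have 1: "norm (sum w {z\<in>D. fst z \<notin> N}) < e / 2" using e1(2) by simp
      let ?D1 = "{z\<in>D. fst z \<in> N}"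
      have fin: "finite ?D1" using Dp(1) by auto
      define q where "q = (\<lambda>z::real \<times> real set. (Inf (snd z), Sup (snd z)))"
      have disj: "{fst (q z)<..<snd (q z)} \<inter> {fst (q z')<..<snd (q z')} = {}" if "z \<in> D" "z' \<in> D" "z \<noteq> z'" for z z'
      proof -
        obtain x k x' k' where zz: "z = (x, k)" "z' = (x', k')" by (cases z, cases z')
        have *: "interior k \<inter> interior k' = {}" using Dp(5)[of x k x' k'] that zz by auto
        have zD: "(x, k) \<in> D" "(x', k') \<in> D" using that zz by auto
        obtain u v where uv: "k = {u..v}" "u \<le> v" using K[OF zD(1)] by blast
        obtain u' v' where "k' = {u'..v'}" "u' \<le> v'" using K[OF zD(2)] by blast
        with uv * show ?thesis by (simp add: q_def zz)
      qed
      \<comment> \<open>Equal endpoints and disjoint interiors force a degenerate interval, and then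
        the tags coincide as well.\<close>
      have inj: "inj_on q ?D1"
      proof (rule inj_onI, rule ccontr)
        fix z z' assume z: "z \<in> ?D1" "z' \<in> ?D1" "q z = q z'" "z \<noteq> z'"
        obtain x k x' k' where zz: "z = (x, k)" "z' = (x', k')" by (cases z, cases z')
        have zD: "(x, k) \<in> D" "(x', k') \<in> D" using z zz by auto
        obtain u v where uv1: "k = {u..v}" "u \<le> v" "x \<in> {u..v}" using K[OF zD(1)] by blast
        obtain u' v' where uv2: "k' = {u'..v'}" "u' \<le> v'" "x' \<in> {u'..v'}" using K[OF zD(2)] by blast
        note uv = uv1 uv2
        have eq: "u = u'" "v = v'" using z(3) uv zz by (auto simp: q_def)
        have "{u<..<v} = {}" using disj[of z z'] z zz uv eq by (auto simp: q_def)
        then have "u = v" using uv(2) by auto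
        then show False using z(4) zz uv eq by auto
      qed
      have "(\<Sum>(u, v)\<in>q ` ?D1. dist (F u) (F v)) < e / 2"
      proof (rule \<delta>(2), intro conjI)
        show "finite (q ` ?D1)" using fin by simp
        show "\<forall>(u, v)\<in>q ` ?D1. a \<le> u \<and> u \<le> v \<and> v \<le> b" using K by (force simp: q_def)
        show "\<forall>I\<in>q ` ?D1. \<forall>J\<in>q ` ?D1. I \<noteq> J \<longrightarrow> {fst I<..<snd I} \<inter> {fst J<..<snd J} = {}"
          using disj by auto
        have "(\<Sum>(u, v)\<in>q ` ?D1. v - u) = (\<Sum>z\<in>?D1. measure lebesgue {fst (q z)<..<snd (q z)})"
          unfolding sum.reindex[OF inj] o_def case_prod_unfold
        proof (rule sum.cong[OF refl])
          fix z assume "z \<in> ?D1"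
          then obtain x k where "z = (x, k)" "(x, k) \<in> D" by (cases z) auto
          with K[OF this(2)] show "snd (q z) - fst (q z) = measure lebesgue {fst (q z)<..<snd (q z)}" by (auto simp: q_def)
        qed
        also have "\<dots> = measure lebesgue (\<Union>z\<in>?D1. {fst (q z)<..<snd (q z)})"
          by (rule measure_negligible_finite_Union_image[symmetric, OF fin]) (use disj in \<open>auto simp: pairwise_def\<close>)
        also have "\<dots> \<le> measure lebesgue G"
        proof (rule measure_mono_fmeasurable[OF _ _ G(3)])
          show "(\<Union>z\<in>?D1. {fst (q z)<..<snd (q z)}) \<subseteq> G"
          proof clarify
            fix y x k assume y: "y \<in> {fst (q (x, k))<..<snd (q (x, k))}" and xk: "(x, k) \<in> D" "fst (x, k) \<in> N"
            have "k \<subseteq> g x" using fine xk(1) by (auto simp: fine_def)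
            then have "k \<subseteq> G" using xk(2) by (simp add: g_def)
            with K[OF xk(1)] y show "y \<in> G" by (auto simp: q_def)
          qed
        qed (use fin in auto)
        also have "\<dots> < \<delta>" by (rule G)
        finally show "(\<Sum>(u, v)\<in>q ` ?D1. v - u) < \<delta>" .
      qed
      moreover have "norm (sum w ?D1) \<le> (\<Sum>(u, v)\<in>q ` ?D1. dist (F u) (F v))"
        unfolding sum.reindex[OF inj]
        by (rule order_trans[OF norm_sum], rule sum_mono) (auto simp: w_def q_def dist_norm norm_minus_commute)
      ultimately show ?thesis using 1 norm_triangle_ineq[of "sum w ?D1" "sum w {z\<in>D. fst z \<notin> N}"] by linarith
    qed
    finally show "norm ((\<Sum>(x, k)\<in>D. measure lborel k *\<^sub>R (if x \<in> N then 0 else f x)) - (F b - F a)) < e" .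
  qed
qed

corollary abs_continuous_on_deriv_zero:
  fixes F :: "real => 'b::euclidean_space"
  assumes "a \<le> b" "abs_continuous_on a b F" "negligible N"
    and "\<And>t. t \<in> {a..b} - N ==> (F has_vector_derivative 0) (at t within {a..b})"
  shows "F b = F a" using abs_continuous_on_has_integral[OF assms] by simp

context lipschitz_field
begin

text \<open>The curve w, which undoes the flow by the accumulated time, is absolutely continuous
  with derivative 0 outside N, hence constant. As the flow is known to be only Lipschitz in the
  point, that derivative is estimated by hand from \<open>flow_step\<close>.\<close>

lemma flow_reparametrize:
  assumes ab: "a \<le> b" and c: "abs_continuous_on a b c" and s: "abs_continuous_on a b s" and N: "negligible N"
    and deriv: "\<And>t. t \<in> {a..b} - N ==> \<exists>u. (c has_vector_derivative u *\<^sub>R Y (c t)) (at t within {a..b}) \<and>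
      (s has_vector_derivative u) (at t within {a..b})"
  shows "c b = flow (s b - s a) (c a)"
proof -
  define w where "w t = flow (- s t) (c t)" for t
  have conts: "continuous_on {a..b} s" and contc: "continuous_on {a..b} c" using s c by (auto intro: abs_continuous_on_imp_continuous_on)
  obtain R where R: "\<And>t. t \<in> {a..b} ==> \<bar>s t\<bar> \<le> R"
    using compact_imp_bounded[OF compact_continuous_image[OF conts compact_Icc]]
    unfolding bounded_iff by (metis imageI real_norm_def)
  have acw: "abs_continuous_on a b w"
  proof (rule abs_continuous_on_dominated[OF c s, where L = "exp (L * R) + M"])
    fix u v assume uv: "u \<in> {a..b}" "v \<in> {a..b}"
    have "dist (w u) (w v) \<le> dist (w u) (flow (- s u) (c v)) + dist (flow (- s u) (c v)) (w v)" by (rule dist_triangle)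
    also have "dist (w u) (flow (- s u) (c v)) \<le> exp (L * \<bar>- s u\<bar>) * norm (c u - c v)"
      unfolding w_def dist_norm by (rule flow_lipschitz)
    also have "exp (L * \<bar>- s u\<bar>) * norm (c u - c v) \<le> exp (L * R) * dist (c u) (c v)"
      unfolding dist_norm using R[OF uv(1)] L_pos by (intro mult_right_mono) auto
    also have "dist (flow (- s u) (c v)) (w v) \<le> M * \<bar>- s u - - s v\<bar>"
      unfolding w_def dist_norm by (rule flow_time_lipschitz)
    also have "M * \<bar>- s u - - s v\<bar> = M * dist (s u) (s v)" by (simp add: dist_real_def abs_minus_commute)
    also have "exp (L * R) * dist (c u) (c v) + M * dist (s u) (s v)
      \<le> (exp (L * R) + M) * (dist (c u) (c v) + dist (s u) (s v))" using M_nonneg by (simp add: algebra_simps)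
    finally show "dist (w u) (w v) \<le> (exp (L * R) + M) * (dist (c u) (c v) + dist (s u) (s v))" by simp
  qed
  have "w b = w a"
  proof (rule abs_continuous_on_deriv_zero[OF ab acw N])
    fix t assume t: "t \<in> {a..b} - N"
    obtain u where u: "(c has_vector_derivative u *\<^sub>R Y (c t)) (at t within {a..b})"
      "(s has_vector_derivative u) (at t within {a..b})" using deriv[OF t] by blast
    define K where "K = exp (L * \<bar>- s t\<bar>)"
    have K: "K > 0" by (simp add: K_def)
    let ?F = "at t within {a..b}"
    \<comment> \<open>The displacement of c minus that of the vector frozen at c t: its derivative
      at t vanishes. By \<open>bound\<close>, whatever else contributes to w is a product of two
      small factors.\<close>
    define A where "A t' = c t' - s t' *\<^sub>R Y (c t)" for t'
    have "(A has_vector_derivative u *\<^sub>R Y (c t) - u *\<^sub>R Y (c t)) ?F"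
      unfolding A_def by (intro derivative_intros u has_vector_derivative_diff
        bounded_linear.has_vector_derivative[OF bounded_linear_scaleR_left])
    then have A: "(A has_derivative (\<lambda>h. h *\<^sub>R 0)) ?F" by (simp add: has_vector_derivative_def)
    have bound: "norm (w y - w t) \<le> K * (norm (A y - A t) + \<bar>s y - s t\<bar> * (L * norm (c y - c t) + L * M * \<bar>s y - s t\<bar>))" for y
    proof -
      define D where "D = s y - s t"
      have "- s y = - s t + - D" by (simp add: D_def)
      then have "w y = flow (- s t) (flow (- D) (c y))" by (simp only: w_def flow_add)
      then have "norm (w y - w t) \<le> K * norm (flow (- D) (c y) - c t)"
        unfolding w_def[of t] K_def by (simp only: flow_lipschitz)
      also have "flow (- D) (c y) - c t = (flow (- D) (c y) - c y - (- D) *\<^sub>R Y (c y)) + (A y - A t)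
          + D *\<^sub>R (Y (c t) - Y (c y))" by (simp add: A_def D_def algebra_simps)
      also have "norm \<dots> \<le> L * M * (- D)\<^sup>2 + norm (A y - A t) + \<bar>D\<bar> * (L * norm (c y - c t))"
      proof (intro norm_triangle_le add_mono flow_step order_refl)
        show "norm (D *\<^sub>R (Y (c t) - Y (c y))) \<le> \<bar>D\<bar> * (L * norm (c y - c t))"
          using lip[of "c t" "c y"] by (simp add: mult_left_mono norm_minus_commute)
      qed
      also have "L * M * (- D)\<^sup>2 + norm (A y - A t) + \<bar>D\<bar> * (L * norm (c y - c t))
        = norm (A y - A t) + \<bar>D\<bar> * (L * norm (c y - c t) + L * M * \<bar>D\<bar>)" by (simp add: power2_eq_square distrib_left)
      finally show ?thesis using K by (simp add: D_def[symmetric])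
    qed
    have "(w has_derivative (\<lambda>h. h *\<^sub>R 0)) ?F"
      unfolding has_derivative_within_alt2
    proof (intro conjI allI impI)
      show "bounded_linear (\<lambda>h::real. h *\<^sub>R (0::'a))" by (rule bounded_linear_scaleR_left)
      fix e :: real assume e: "e > 0"
      have ev1: "eventually (\<lambda>y. norm (A y - A t) \<le> (e / (2 * K)) * norm (y - t)) ?F"
        using conjunct2[OF A[unfolded has_derivative_within_alt2], rule_format, of "e / (2 * K)"] e K by simp
      have "eventually (\<lambda>y. norm (s y - s t - (y - t) * u) \<le> 1 * norm (y - t)) ?F"
        using conjunct2[OF u(2)[unfolded has_vector_derivative_def has_derivative_within_alt2], rule_format, of 1] by simp
      then have ev2: "eventually (\<lambda>y. \<bar>s y - s t\<bar> \<le> (\<bar>u\<bar> + 1) * norm (y - t)) ?F"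
      proof eventually_elim
        case (elim y)
        have "\<bar>s y - s t\<bar> \<le> \<bar>s y - s t - (y - t) * u\<bar> + \<bar>(y - t) * u\<bar>" by linarith
        also have "\<bar>(y - t) * u\<bar> = \<bar>u\<bar> * norm (y - t)" by (simp add: abs_mult mult.commute)
        finally show ?case using elim unfolding real_norm_def distrib_right by linarith
      qed
      \<comment> \<open>This factor tends to 0 while the other one, |s y - s t|, is O(|y - t|) by
        \<open>ev2\<close>; the threshold is what turns their product into e / (2 * K) times |y -
        t|.\<close>
      have "((\<lambda>y. L * norm (c y - c t) + L * M * \<bar>s y - s t\<bar>) \<longlongrightarrow> L * norm (c t - c t) + L * M * \<bar>s t - s t\<bar>) ?F"
        using contc conts t by (intro tendsto_intros) (auto simp: continuous_on_def)
      then have ev3: "eventually (\<lambda>y. L * norm (c y - c t) + L * M * \<bar>s y - s t\<bar> < e / (2 * K * (\<bar>u\<bar> + 1))) ?F"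
        by (rule order_tendstoD(2)) (use e K in \<open>auto intro!: divide_pos_pos mult_pos_pos\<close>)
      show "eventually (\<lambda>y. norm (w y - w t - (y - t) *\<^sub>R 0) \<le> e * norm (y - t)) ?F" using ev1 ev2 ev3
      proof eventually_elim
        case (elim y)
        have "\<bar>s y - s t\<bar> * (L * norm (c y - c t) + L * M * \<bar>s y - s t\<bar>)
          \<le> ((\<bar>u\<bar> + 1) * norm (y - t)) * (e / (2 * K * (\<bar>u\<bar> + 1)))"
          using elim M_nonneg L_pos by (intro mult_mono) auto
        also have "\<dots> = e / (2 * K) * norm (y - t)" using K abs_ge_zero[of u] by (simp add: divide_simps) linarith
        finally have "K * (norm (A y - A t) + \<bar>s y - s t\<bar> * (L * norm (c y - c t) + L * M * \<bar>s y - s t\<bar>))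
           \<le> K * (e / (2 * K) * norm (y - t) + e / (2 * K) * norm (y - t))" using elim K by (intro mult_left_mono add_mono) auto
        also have "\<dots> = e * norm (y - t)" using K by (simp add: field_simps)
        finally show ?case using bound[of y] by simp
      qed
    qed
    then show "(w has_vector_derivative 0) ?F" by (simp add: has_vector_derivative_def)
  qed
  then have "flow (s b) (w b) = flow (s b) (w a)" by simp
  then show ?thesis using flow_add[of "s b" "- s b" "c b"] flow_add[of "s b" "- s a" "c a"] by (simp add: w_def)
qed

end

subsection \<open>Volume distortion of maps close to the identity\<close>

text \<open>The change of variables theorem of the library is stated for \<^typ>\<open>real^'n\<close>; a type of indices
  of the right cardinality transfers it to an arbitrary Euclidean space.\<close>

typedef (overloaded) 'a basis_index = "Basis :: 'a::euclidean_space set" using nonempty_Basis by blast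

text \<open>The order carries no meaning: the change of variables theorem asks for a well-ordered
  index type, and any injection into the naturals supplies one.\<close>

instantiation basis_index :: (euclidean_space) "{finite, wellorder}"
begin

definition index_code :: "'a basis_index => nat" where
  "index_code = (SOME f. inj f)"

definition less_eq_basis_index :: "'a basis_index => 'a basis_index => bool" where
  "x \<le> y \<longleftrightarrow> index_code x \<le> index_code y"

definition less_basis_index :: "'a basis_index => 'a basis_index => bool" where
  "x < y \<longleftrightarrow> index_code x < index_code y"

instance
proof
  have fin: "finite (UNIV :: 'a basis_index set)" by (rule finite_imageD[of Rep_basis_index])
      (auto intro: finite_subset[OF _ finite_Basis] inj_onI simp: Rep_basis_index Rep_basis_index_inject)
  then show "finite (UNIV :: 'a basis_index set)" .
  have "\<exists>f :: 'a basis_index => nat. inj f" using finite_imp_inj_to_nat_seg[OF fin] by blast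
  then have inj: "inj (index_code :: 'a basis_index => nat)"
    unfolding index_code_def by (rule someI_ex)
  fix x y z :: "'a basis_index"
  show "(x < y) = (x \<le> y \<and> \<not> y \<le> x)" "x \<le> x" "x \<le> y ==> y \<le> z ==> x \<le> z" "x \<le> y \<or> y \<le> x"
    by (auto simp: less_eq_basis_index_def less_basis_index_def)
  show "x \<le> y ==> y \<le> x ==> x = y" using inj by (auto simp: less_eq_basis_index_def inj_eq)
  fix P :: "'a basis_index => bool" and a
  assume hyp: "\<And>x. (\<And>y. y < x ==> P y) ==> P x"
  show "P a"
  proof (induction a rule: measure_induct_rule[of index_code])
    case (less x)
    show ?case by (rule hyp) (rule less, simp only: less_basis_index_def)
  qed
qed

end

definition to_cart :: "'a::euclidean_space => real ^ 'a basis_index" where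
  "to_cart x = (\<chi> i. x \<bullet> Rep_basis_index i)"

definition of_cart :: "real ^ 'a basis_index => 'a::euclidean_space" where
  "of_cart v = (\<Sum>b\<in>Basis. (v $ Abs_basis_index b) *\<^sub>R b)"

lemma of_cart_inner: "b \<in> Basis ==> of_cart v \<bullet> b = v $ Abs_basis_index b"
  by (simp add: of_cart_def inner_sum_left inner_Basis if_distrib cong: if_cong)

lemma of_cart_to_cart [simp]: "of_cart (to_cart x) = x"
  by (rule euclidean_eqI) (simp add: of_cart_inner to_cart_def Abs_basis_index_inverse)

lemma to_cart_of_cart [simp]: "to_cart (of_cart v) = v"
  by (simp add: to_cart_def vec_eq_iff of_cart_inner Rep_basis_index Rep_basis_index_inverse)

lemma linear_to_cart: "linear to_cart" by (rule linearI) (simp_all add: to_cart_def vec_eq_iff inner_add_left)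

lemma linear_of_cart: "linear of_cart" by (rule linearI) (simp_all add: of_cart_def scaleR_add_left sum.distrib scaleR_sum_right)

lemma ball_Basis_iff: "(\<forall>b\<in>Basis. Q b) \<longleftrightarrow> (\<forall>i. Q (Rep_basis_index i))"
  by (metis Abs_basis_index_inverse Rep_basis_index)

lemma of_cart_axis: "of_cart (axis i 1) = Rep_basis_index i" by (rule euclidean_eqI)
    (auto simp: of_cart_inner axis_def inner_Basis Rep_basis_index Abs_basis_index_inverse Rep_basis_index_inverse)

lemma sum_basis_index: "(\<Sum>i\<in>UNIV. f (Rep_basis_index i)) = (\<Sum>b\<in>Basis. f b)" by (rule sum.reindex_bij_betw)
    (auto simp: bij_betw_def inj_on_def Rep_basis_index_inject Rep_basis_index image_def intro: Abs_basis_index_inverse[symmetric])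

text \<open>Lebesgue measure is determined by its values on boxes, and \<open>of_cart\<close> pulls
  a box back to a box with the same edge lengths.\<close>

lemma measure_to_cart_image:
  fixes S :: "'a::euclidean_space set"
  assumes "compact S"
  shows "measure lebesgue (to_cart ` S) = measure lebesgue S"
proof -
  note cont = linear_continuous_on[OF linear_conv_bounded_linear[THEN iffD1]]
  have meas: "of_cart \<in> borel_measurable borel" by (rule borel_measurable_continuous_onI) (rule cont[OF linear_of_cart])
  have eq: "lborel = distr lborel borel (of_cart :: real ^ 'a basis_index => 'a)"
  proof (rule lborel_eqI)
    fix l u :: 'a assume lu: "\<And>b. b \<in> Basis ==> l \<bullet> b \<le> u \<bullet> b"
    have "of_cart -` box l u = box (to_cart l) (to_cart u)"
    proof (rule set_eqI)
      fix v
      have "v \<in> of_cart -` box l u \<longleftrightarrow> (\<forall>i. l \<bullet> Rep_basis_index i < v $ i \<and> v $ i < u \<bullet> Rep_basis_index i)"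
        unfolding vimage_eq mem_box ball_Basis_iff by (simp add: of_cart_inner Rep_basis_index Rep_basis_index_inverse)
      then show "v \<in> of_cart -` box l u \<longleftrightarrow> v \<in> box (to_cart l) (to_cart u)"
        by (simp add: mem_box_cart to_cart_def)
    qed
    then have "emeasure (distr lborel borel of_cart) (box l u) = emeasure lborel (box (to_cart l) (to_cart u))"
      using meas by (subst emeasure_distr) auto
    also have "\<dots> = (\<Prod>b\<in>Basis. (to_cart u - to_cart l) \<bullet> b)"
      using lu by (intro emeasure_lborel_box) (auto simp: Basis_vec_def inner_axis to_cart_def Rep_basis_index)
    also have "(\<Prod>b\<in>Basis. (to_cart u - to_cart l) \<bullet> b) = (\<Prod>i\<in>UNIV. (u - l) \<bullet> Rep_basis_index i)"
      by (simp add: Basis_vec_def UNION_singleton_eq_range prod.reindex inj_on_def axis_eq_axis inner_axis to_cart_def inner_diff_left)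
    also have "\<dots> = (\<Prod>b\<in>Basis. (u - l) \<bullet> b)" by (rule prod.reindex_bij_betw)
        (auto simp: bij_betw_def inj_on_def Rep_basis_index_inject Rep_basis_index image_def intro: Abs_basis_index_inverse[symmetric])
    finally show "emeasure (distr lborel borel of_cart) (box l u) = (\<Prod>b\<in>Basis. (u - l) \<bullet> b)" .
  qed simp
  have pre: "of_cart -` S = to_cart ` S" by (auto simp: image_iff) (metis to_cart_of_cart)
  have "compact (to_cart ` S)" by (rule compact_continuous_image[OF cont[OF linear_to_cart] assms])
  then have "emeasure lborel S = emeasure lborel (to_cart ` S)"
    using assms meas by (subst eq, subst emeasure_distr) (auto simp: pre borel_compact)
  then show ?thesis using assms \<open>compact (to_cart ` S)\<close> by (simp add: measure_def borel_compact)
qed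

text \<open>Change of variables in the only form used here, a lower bound of the image volume by a
  lower bound of the Jacobian, transported to an arbitrary Euclidean space.\<close>

lemma measure_image_ge:
  fixes f :: "'a::euclidean_space => 'a"
  assumes S: "compact S" and f: "\<And>x. x \<in> S ==> (f has_derivative f' x) (at x)" and inj: "inj_on f S"
    and d: "\<And>x. x \<in> S ==> d \<le> \<bar>det (matrix (to_cart \<circ> f' x \<circ> of_cart))\<bar>"
  shows "d * measure lebesgue S \<le> measure lebesgue (f ` S)"
proof -
  let ?S = "to_cart ` S" and ?F = "to_cart \<circ> f \<circ> of_cart"
  let ?F' = "\<lambda>v. to_cart \<circ> f' (of_cart v) \<circ> of_cart"
  note cont = linear_continuous_on[OF linear_conv_bounded_linear[THEN iffD1]]
  have comp: "compact ?S" by (rule compact_continuous_image[OF cont[OF linear_to_cart] S])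
  have compf: "compact (f ` S)"
    using f by (intro compact_continuous_image S continuous_at_imp_continuous_on) (auto intro: has_derivative_continuous)
  have im: "?F ` ?S = to_cart ` f ` S" by (auto simp: image_iff)
  have compF: "compact (?F ` ?S)" unfolding im by (rule compact_continuous_image[OF cont[OF linear_to_cart] compf])
  have der: "(?F has_derivative ?F' v) (at v within ?S)" if "v \<in> ?S" for v proof -
    have b: "bounded_linear (to_cart :: 'a => _)" "bounded_linear (of_cart :: _ => 'a)"
      using linear_to_cart linear_of_cart linear_conv_bounded_linear by blast+
    have "of_cart v \<in> S" using that by auto
    then have "((\<lambda>v. f (of_cart v)) has_derivative (\<lambda>w. f' (of_cart v) (of_cart w))) (at v within ?S)"
      by (rule has_derivative_compose[OF bounded_linear_imp_has_derivative[OF b(2)] f])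
    from bounded_linear.has_derivative[OF b(1) this] show ?thesis by (simp add: o_def)
  qed
  have injF: "inj_on ?F ?S" by (auto simp: inj_on_def) (metis inj inj_onD of_cart_to_cart)
  have Sl: "?S \<in> sets lebesgue" using comp by (simp add: lmeasurable_compact fmeasurableD)
  have int: "(\<lambda>v. \<bar>det (matrix (?F' v))\<bar>) integrable_on ?S"
    using measurable_differentiable_image_eq[OF Sl der injF] compF lmeasurable_compact by blast
  have "d * measure lebesgue ?S = integral ?S (\<lambda>v. d)"
    using comp by (simp add: lmeasure_integral lmeasurable_compact integral_mult_right[symmetric] del: integral_mult_right)
  also have "\<dots> \<le> integral ?S (\<lambda>v. \<bar>det (matrix (?F' v))\<bar>)"
    by (rule integral_le[OF _ int]) (use comp d in \<open>auto simp: lmeasurable_compact integrable_on_const\<close>)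
  also have "\<dots> = measure lebesgue (?F ` ?S)" by (rule measure_differentiable_image_eq[OF Sl der injF int, symmetric])
  finally show ?thesis unfolding im using measure_to_cart_image[OF S] measure_to_cart_image[OF compf] by simp
qed

text \<open>The diagonal term in the Leibniz expansion of det (1 + h A). What matters is that C
  depends only on L and on the number of factors.\<close>

lemma prod_one_plus_bound:
  fixes L :: real
  assumes "finite I" "L \<ge> 0"
  shows "\<exists>C\<ge>0. \<forall>a h. (\<forall>i\<in>I. \<bar>a i\<bar> \<le> L) \<longrightarrow> 0 \<le> h \<longrightarrow> h \<le> 1 \<longrightarrow>
    \<bar>(\<Prod>i\<in>I. 1 + h * a i) - 1 - h * (\<Sum>i\<in>I. a i)\<bar> \<le> C * h\<^sup>2" using assms(1)
proof induction
  case empty then show ?case by (intro exI[of _ 0]) simp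
next
  case (insert x F)
  then obtain C where C: "C \<ge> 0" "\<And>a h. [|\<forall>i\<in>F. \<bar>a i\<bar> \<le> L; 0 \<le> h; h \<le> 1|] ==>
    \<bar>(\<Prod>i\<in>F. 1 + h * a i) - 1 - h * (\<Sum>i\<in>F. a i)\<bar> \<le> C * h\<^sup>2" by blast
  \<comment> \<open>The three terms of the constant bound the old remainder r, the new quadratic
    term h^2 * a x * s, and h * a x * r, where h is at most 1.\<close>
  show ?case
  proof (intro exI[of _ "C + L * (card F * L) + L * C"] conjI allI impI)
    show "0 \<le> C + L * (card F * L) + L * C" using C \<open>L \<ge> 0\<close> by simp
    fix a :: "'a => real" and h :: real
    assume a: "\<forall>i\<in>insert x F. \<bar>a i\<bar> \<le> L" and h: "0 \<le> h" "h \<le> 1"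
    define s where "s = (\<Sum>i\<in>F. a i)"
    define r where "r = (\<Prod>i\<in>F. 1 + h * a i) - 1 - h * s"
    have r: "\<bar>r\<bar> \<le> C * h\<^sup>2" unfolding r_def s_def by (rule C(2)) (use a h in auto)
    have "\<bar>s\<bar> \<le> (\<Sum>i\<in>F. L)" unfolding s_def by (rule order_trans[OF sum_abs sum_mono]) (use a in auto)
    then have s: "\<bar>s\<bar> \<le> card F * L" by simp
    have "(\<Prod>i\<in>insert x F. 1 + h * a i) = (1 + h * a x) * (r + 1 + h * s)" using insert by (simp add: r_def)
    moreover have "(\<Sum>i\<in>insert x F. a i) = a x + s" using insert by (simp add: s_def)
    ultimately have "(\<Prod>i\<in>insert x F. 1 + h * a i) - 1 - h * (\<Sum>i\<in>insert x F. a i)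
      = r + h\<^sup>2 * (a x * s) + h * (a x * r)" by (simp add: algebra_simps power2_eq_square)
    also have "\<bar>\<dots>\<bar> \<le> \<bar>r\<bar> + \<bar>h\<^sup>2 * (a x * s)\<bar> + \<bar>h * (a x * r)\<bar>" by linarith
    also have "\<dots> \<le> C * h\<^sup>2 + h\<^sup>2 * (L * (card F * L)) + 1 * (L * (C * h\<^sup>2))"
    proof (intro add_mono r)
      show "\<bar>h\<^sup>2 * (a x * s)\<bar> \<le> h\<^sup>2 * (L * (card F * L))"
        using a s \<open>L \<ge> 0\<close> by (simp add: abs_mult mult_left_mono mult_mono)
      show "\<bar>h * (a x * r)\<bar> \<le> 1 * (L * (C * h\<^sup>2))"
        unfolding abs_mult using a r h \<open>L \<ge> 0\<close> C by (intro mult_mono) auto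
    qed
    finally show "\<bar>(\<Prod>i\<in>insert x F. 1 + h * a i) - 1 - h * (\<Sum>i\<in>insert x F. a i)\<bar>
      \<le> (C + L * (card F * L) + L * C) * h\<^sup>2" by (simp add: algebra_simps)
  qed
qed

text \<open>In the Leibniz expansion the identity contributes 1 + h tr A + O(h^2), and the trace
  vanishes. Every other permutation moves at least two indices, so its term contains two
  off-diagonal factors of size at most h * L.\<close>

lemma det_near_one:
  fixes L :: real
  assumes L: "L \<ge> 0"
  shows "\<exists>C\<ge>0. \<forall>(A :: real^'n^'n) h. (\<forall>i j. \<bar>A $ i $ j\<bar> \<le> L) \<longrightarrow> (\<Sum>i\<in>UNIV. A $ i $ i) = 0 \<longrightarrow>
    0 \<le> h \<longrightarrow> h \<le> 1 \<longrightarrow> \<bar>det (mat 1 + h *\<^sub>R A) - 1\<bar> \<le> C * h\<^sup>2"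
proof -
  let ?U = "UNIV :: 'n set" and ?B = "1 + L"
  obtain C where C: "C \<ge> 0" "\<And>a h. [|\<forall>i\<in>?U. \<bar>a i\<bar> \<le> L; 0 \<le> h; h \<le> 1|] ==>
    \<bar>(\<Prod>i\<in>?U. 1 + h * a i) - 1 - h * (\<Sum>i\<in>?U. a i)\<bar> \<le> C * h\<^sup>2"
    using prod_one_plus_bound[of ?U L] L by auto
  let ?P = "{p. p permutes ?U}"
  define C' where "C' = C + card ?P * (L\<^sup>2 * ?B ^ CARD('n))"
  show ?thesis
  proof (intro exI[of _ C'] conjI allI impI)
    show "0 \<le> C'" using C L by (simp add: C'_def)
    fix A :: "real^'n^'n" and h :: real
    assume A: "\<forall>i j. \<bar>A $ i $ j\<bar> \<le> L" "(\<Sum>i\<in>UNIV. A $ i $ i) = 0" and h: "0 \<le> h" "h \<le> 1"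
    define m where "m i j = (mat 1 + h *\<^sub>R A) $ i $ j" for i j
    have m: "m i j = (if i = j then 1 else 0) + h * A $ i $ j" for i j by (simp add: m_def mat_def)
    have hA: "\<bar>h * A $ i $ j\<bar> \<le> h * L" for i j using A h by (simp add: abs_mult mult_left_mono)
    have hL: "h * L \<le> L" using h L by (simp add: mult_left_le_one_le)
    have mB: "\<bar>m i j\<bar> \<le> ?B" for i j using hA[of i j] hL by (auto simp: m)
    define t where "t p = of_int (sign p) * (\<Prod>i\<in>?U. m i (p i))" for p :: "'n => 'n"
    have finP: "finite ?P" by simp
    have "det (mat 1 + h *\<^sub>R A) = sum t ?P" by (simp add: det_def t_def m_def)
    also have "\<dots> = t id + sum t (?P - {id})" by (rule sum.remove[OF finP]) (simp add: permutes_id)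
    finally have det: "det (mat 1 + h *\<^sub>R A) = t id + sum t (?P - {id})" .
    have "t id = (\<Prod>i\<in>?U. 1 + h * A $ i $ i)" by (simp add: t_def m)
    then have 1: "\<bar>t id - 1\<bar> \<le> C * h\<^sup>2" using C(2)[of "\<lambda>i. A $ i $ i" h] A h by simp
    have tp: "norm (t p) \<le> h\<^sup>2 * (L\<^sup>2 * ?B ^ CARD('n))" if p: "p \<in> ?P - {id}" for p proof -
      \<comment> \<open>If i is moved then so is p i; these are the two off-diagonal
        factors.\<close>
      obtain i where i: "p i \<noteq> i" using p by (auto simp: fun_eq_iff)
      define j where "j = p i"
      have inj: "inj p" using p permutes_inj by auto
      have j: "p j \<noteq> j" "j \<noteq> i" using i inj by (auto simp: j_def inj_eq)
      have "norm (t p) = (\<Prod>k\<in>?U. \<bar>m k (p k)\<bar>)" by (simp add: t_def abs_mult abs_prod sign_def)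
      also have "\<dots> = \<bar>m i (p i)\<bar> * (\<bar>m j (p j)\<bar> * (\<Prod>k\<in>?U - {i} - {j}. \<bar>m k (p k)\<bar>))"
        using j by (simp add: prod.remove[of ?U i] prod.remove[of "?U - {i}" j])
      also have "\<dots> \<le> (h * L) * ((h * L) * ?B ^ CARD('n))"
      proof (intro mult_mono)
        show "\<bar>m i (p i)\<bar> \<le> h * L" using i hA[of i "p i"] by (simp add: m)
        show "\<bar>m j (p j)\<bar> \<le> h * L" using j hA[of j "p j"] by (simp add: m)
        have "(\<Prod>k\<in>?U - {i} - {j}. \<bar>m k (p k)\<bar>) \<le> (\<Prod>k\<in>?U - {i} - {j}. ?B)"
          by (rule prod_mono) (use mB in auto)
        also have "\<dots> \<le> ?B ^ CARD('n)" using L by (simp only: prod_constant) (intro power_increasing card_mono, auto)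
        finally show "(\<Prod>k\<in>?U - {i} - {j}. \<bar>m k (p k)\<bar>) \<le> ?B ^ CARD('n)" .
      qed (use h L in \<open>auto intro!: mult_nonneg_nonneg prod_nonneg\<close>)
      finally show ?thesis by (simp add: power2_eq_square algebra_simps)
    qed
    have "norm (sum t (?P - {id})) \<le> (\<Sum>p\<in>?P - {id}. h\<^sup>2 * (L\<^sup>2 * ?B ^ CARD('n)))" by (rule sum_norm_le) (rule tp)
    also have "\<dots> \<le> (\<Sum>p\<in>?P. h\<^sup>2 * (L\<^sup>2 * ?B ^ CARD('n)))" by (rule sum_mono2[OF finP]) (use L in auto)
    finally have "\<bar>sum t (?P - {id})\<bar> \<le> card ?P * (h\<^sup>2 * (L\<^sup>2 * ?B ^ CARD('n)))" by simp
    then show "\<bar>det (mat 1 + h *\<^sub>R A) - 1\<bar> \<le> C' * h\<^sup>2" using 1 unfolding det C'_def by (simp add: algebra_simps)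
  qed
qed

text \<open>The constant depends on L alone, not on the map, the step size or the set, so the
  estimate can be iterated over arbitrarily many Euler steps with one and the same C.\<close>

lemma measure_image_near_identity:
  fixes L :: real
  assumes L: "L \<ge> 0"
  shows "\<exists>C\<ge>0. \<forall>(f :: 'a::euclidean_space => 'a) B h S. compact S \<longrightarrow> inj_on f S \<longrightarrow> 0 \<le> h \<longrightarrow> h \<le> 1 \<longrightarrow>
    (\<forall>x\<in>S. (f has_derivative (\<lambda>v. v + h *\<^sub>R B x v)) (at x) \<and> linear (B x) \<and>
       (\<forall>v. norm (B x v) \<le> L * norm v) \<and> (\<Sum>b\<in>Basis. B x b \<bullet> b) = 0) \<longrightarrow>
    (1 - C * h\<^sup>2) * measure lebesgue S \<le> measure lebesgue (f ` S)"
proof -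
  obtain C where C: "C \<ge> 0" "\<And>(A :: real^'a basis_index^'a basis_index) h.
    [|\<forall>i j. \<bar>A $ i $ j\<bar> \<le> L; (\<Sum>i\<in>UNIV. A $ i $ i) = 0; 0 \<le> h; h \<le> 1|] ==> \<bar>det (mat 1 + h *\<^sub>R A) - 1\<bar> \<le> C * h\<^sup>2"
    using det_near_one[OF L] by blast
  show ?thesis
  proof (intro exI[of _ C] conjI allI impI C(1))
    fix f :: "'a => 'a" and B h S
    assume S: "compact S" "inj_on f S" and h: "0 \<le> h" "h \<le> 1"
      and f: "\<forall>x\<in>S. (f has_derivative (\<lambda>v. v + h *\<^sub>R B x v)) (at x) \<and> linear (B x) \<and>
       (\<forall>v. norm (B x v) \<le> L * norm v) \<and> (\<Sum>b\<in>Basis. B x b \<bullet> b) = 0"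
    show "(1 - C * h\<^sup>2) * measure lebesgue S \<le> measure lebesgue (f ` S)"
    proof (rule measure_image_ge[OF S(1) _ S(2), where f' = "\<lambda>x v. v + h *\<^sub>R B x v"])
      fix x assume x: "x \<in> S"
      then show "(f has_derivative (\<lambda>v. v + h *\<^sub>R B x v)) (at x)" using f by blast
      define A :: "real^'a basis_index^'a basis_index" where
        "A = (\<chi> i j. B x (Rep_basis_index j) \<bullet> Rep_basis_index i)"
      have eq: "matrix (to_cart \<circ> (\<lambda>v. v + h *\<^sub>R B x v) \<circ> of_cart) = mat 1 + h *\<^sub>R A"
        by (auto simp: vec_eq_iff matrix_def mat_def of_cart_axis to_cart_def A_def inner_add_left
          inner_Basis Rep_basis_index Rep_basis_index_inject)
      have "\<bar>A $ i $ j\<bar> \<le> L" for i j proof -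
        have "\<bar>A $ i $ j\<bar> \<le> norm (B x (Rep_basis_index j)) * norm (Rep_basis_index i)"
          unfolding A_def by (simp add: Cauchy_Schwarz_ineq2)
        also have "\<dots> \<le> L" using f x by (auto simp: Rep_basis_index dest: bspec[of S _ x])
          (metis Rep_basis_index mult.right_neutral norm_Basis)
        finally show ?thesis .
      qed
      moreover have "(\<Sum>i\<in>UNIV. A $ i $ i) = 0" using sum_basis_index[of "\<lambda>b. B x b \<bullet> b"] f x by (simp add: A_def)
      ultimately have "\<bar>det (mat 1 + h *\<^sub>R A) - 1\<bar> \<le> C * h\<^sup>2" using C(2) h by blast
      then show "1 - C * h\<^sup>2 \<le> \<bar>det (matrix (to_cart \<circ> (\<lambda>v. v + h *\<^sub>R B x v) \<circ> of_cart))\<bar>"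
        unfolding eq by linarith
    qed
  qed
qed

subsection \<open>Points attracted by a null set under a volume preserving flow\<close>

context lipschitz_field
begin

definition euler_step :: "real => 'a => 'a" where
  "euler_step h x = x + h *\<^sub>R Y x"

text \<open>Discrete Gronwall: local errors L * M * h^2, each amplified by 1 + h * L per later step,
  sum up to a geometric series.\<close>

lemma euler_error:
  assumes h: "h \<ge> 0"
  shows "norm ((euler_step h ^^ i) a - flow (i * h) a) \<le> h * M * ((1 + h * L) ^ i - 1)"
proof (induction i)
  case 0 then show ?case by simp
next
  case (Suc i)
  define p q where "p = (euler_step h ^^ i) a" and "q = flow (i * h) a"
  have "flow (Suc i * h) a = flow (h + i * h) a" by (simp add: algebra_simps)
  also have "\<dots> = flow h q" unfolding q_def by (rule flow_add)
  finally have "(euler_step h ^^ Suc i) a - flow (Suc i * h) a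
    = (p - q) + h *\<^sub>R (Y p - Y q) - (flow h q - q - h *\<^sub>R Y q)" by (simp add: p_def euler_step_def algebra_simps)
  also have "norm \<dots> \<le> norm (p - q) + norm (h *\<^sub>R (Y p - Y q)) + norm (flow h q - q - h *\<^sub>R Y q)"
    by (meson add_mono norm_triangle_ineq norm_triangle_ineq4 order_refl order_trans)
  also have "\<dots> \<le> norm (p - q) + h * (L * norm (p - q)) + L * M * h\<^sup>2"
    using h lip[of p q] by (intro add_mono flow_step) (auto simp: mult_left_mono)
  also have "\<dots> = (1 + h * L) * norm (p - q) + L * M * h\<^sup>2" by (simp add: algebra_simps)
  also have "\<dots> \<le> (1 + h * L) * (h * M * ((1 + h * L) ^ i - 1)) + L * M * h\<^sup>2"
    using Suc h L_pos unfolding p_def q_def by (intro add_right_mono mult_left_mono) auto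
  also have "\<dots> = h * M * ((1 + h * L) ^ Suc i - 1)" by (simp add: algebra_simps power2_eq_square)
  finally show ?case .
qed

lemma inj_euler_step:
  assumes "0 \<le> h" "h * L < 1" shows "inj (euler_step h)"
proof (rule injI)
  fix x y assume "euler_step h x = euler_step h y"
  then have "x - y = h *\<^sub>R (Y y - Y x)" by (simp add: euler_step_def algebra_simps)
  then have "norm (x - y) \<le> h * (L * norm (x - y))" using assms(1) lip[of y x] by (simp add: mult_left_mono norm_minus_commute)
  then have "(1 - h * L) * norm (x - y) \<le> 0" by (simp add: algebra_simps)
  then show "x = y" using assms(2) by (simp add: mult_le_0_iff)
qed

lemma continuous_on_field: "continuous_on S Y"
  by (rule lipschitz_on_continuous_on[of L]) (use lip L_pos in \<open>auto simp: lipschitz_on_def dist_norm\<close>)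

text \<open>Trace zero makes each step lose at most the fraction C * h^2 of the volume. The iterates
  have to stay in U because only there the field is differentiable.\<close>

lemma measure_euler_image:
  assumes U: "\<And>x. x \<in> U ==> (Y has_derivative Y' x) (at x) \<and> (\<forall>v. norm (Y' x v) \<le> L * norm v) \<and> (\<Sum>b\<in>Basis. Y' x b \<bullet> b) = 0"
  shows "\<exists>C\<ge>0. \<forall>h D N. compact D \<longrightarrow> 0 \<le> h \<longrightarrow> h \<le> 1 \<longrightarrow> h * L < 1 \<longrightarrow> C * h\<^sup>2 \<le> 1 \<longrightarrow>
    (\<forall>a\<in>D. \<forall>i<N. (euler_step h ^^ i) a \<in> U) \<longrightarrow>
    (1 - C * h\<^sup>2) ^ N * measure lebesgue D \<le> measure lebesgue ((euler_step h ^^ N) ` D)"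
proof -
  obtain C where C: "C \<ge> 0" "\<And>(f :: 'a => 'a) B h S. [|compact S; inj_on f S; 0 \<le> h; h \<le> 1;
    \<forall>x\<in>S. (f has_derivative (\<lambda>v. v + h *\<^sub>R B x v)) (at x) \<and> linear (B x) \<and>
       (\<forall>v. norm (B x v) \<le> L * norm v) \<and> (\<Sum>b\<in>Basis. B x b \<bullet> b) = 0|] ==>
    (1 - C * h\<^sup>2) * measure lebesgue S \<le> measure lebesgue (f ` S)"
    using measure_image_near_identity[of L, where 'a = 'a] L_pos by (auto simp: less_imp_le)
  show ?thesis
  proof (intro exI[of _ C] conjI allI impI C(1))
    fix h :: real and D :: "'a set" and N :: nat
    assume D: "compact D" and h: "0 \<le> h" "h \<le> 1" "h * L < 1" "C * h\<^sup>2 \<le> 1"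
      and stay: "\<forall>a\<in>D. \<forall>i<N. (euler_step h ^^ i) a \<in> U"
    have cont: "continuous_on S (euler_step h)" for S
      unfolding euler_step_def by (intro continuous_intros continuous_on_field)
    have comp: "compact ((euler_step h ^^ i) ` D)" for i
    proof (induction i)
      case (Suc i)
      have "(euler_step h ^^ Suc i) ` D = euler_step h ` ((euler_step h ^^ i) ` D)" by auto
      then show ?case using compact_continuous_image[OF cont Suc] by simp
    qed (simp add: D)
    have "(1 - C * h\<^sup>2) ^ i * measure lebesgue D \<le> measure lebesgue ((euler_step h ^^ i) ` D)" if "i \<le> N" for i using that
    proof (induction i)
      case (Suc i)
      let ?S = "(euler_step h ^^ i) ` D"
      have "(1 - C * h\<^sup>2) ^ Suc i * measure lebesgue D \<le> (1 - C * h\<^sup>2) * measure lebesgue ?S"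
        using Suc h by (simp add: mult.assoc mult_left_mono)
      also have "\<dots> \<le> measure lebesgue (euler_step h ` ?S)"
      proof (rule C(2)[OF comp inj_on_subset[OF inj_euler_step[OF h(1,3)]] h(1,2), where B = Y'])
        show "\<forall>x\<in>?S. (euler_step h has_derivative (\<lambda>v. v + h *\<^sub>R Y' x v)) (at x) \<and> linear (Y' x) \<and>
          (\<forall>v. norm (Y' x v) \<le> L * norm v) \<and> (\<Sum>b\<in>Basis. Y' x b \<bullet> b) = 0"
        proof
          fix x assume "x \<in> ?S"
          then have x: "x \<in> U" using stay Suc(2) by auto
          have "(Y has_derivative Y' x) (at x)" using U[OF x] by blast
          then have "(euler_step h has_derivative (\<lambda>v. v + h *\<^sub>R Y' x v)) (at x)"
            unfolding euler_step_def[abs_def] by (auto intro!: derivative_eq_intros)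
          then show "(euler_step h has_derivative (\<lambda>v. v + h *\<^sub>R Y' x v)) (at x) \<and> linear (Y' x) \<and>
            (\<forall>v. norm (Y' x v) \<le> L * norm v) \<and> (\<Sum>b\<in>Basis. Y' x b \<bullet> b) = 0"
            using U[OF x] has_derivative_linear by blast
        qed
      qed simp
      also have "euler_step h ` ?S = (euler_step h ^^ Suc i) ` D" by auto
      finally show ?case .
    qed simp
    then show "(1 - C * h\<^sup>2) ^ N * measure lebesgue D \<le> measure lebesgue ((euler_step h ^^ N) ` D)" by blast
  qed
qed

text \<open>Fix e > 0. Points which stay in K up to time m and are then close to Z are carried by N
  Euler steps of size h = m / N into a neighbourhood of Z of measure at most e, losing at most the
  fraction C * m * h of their volume. Letting N grow bounds their measure by e, uniformly in
  m.\<close>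

theorem negligible_attracted:
  assumes U: "open U" "\<And>x. x \<in> U ==> (Y has_derivative Y' x) (at x) \<and> (\<forall>v. norm (Y' x v) \<le> L * norm v) \<and> (\<Sum>b\<in>Basis. Y' x b \<bullet> b) = 0"
    and K: "compact K" "K \<subseteq> U" and Z: "compact Z" "negligible Z"
  shows "negligible {a. (\<forall>s\<ge>0. flow s a \<in> K) \<and> (\<exists>l\<in>Z. ((\<lambda>s. flow s a) \<longlongrightarrow> l) at_top)}"
    (is "negligible ?A")
proof (cases "Z = {}")
  case True then show ?thesis by simp
next
  case False
  show ?thesis unfolding negligible_outer_le
  proof (intro allI impI)
    fix e :: real assume e: "e > 0"
    obtain W where W: "open W" "Z \<subseteq> W" "W \<in> lmeasurable" "measure lebesgue W \<le> e" proof -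
      obtain T where T: "open T" "Z \<subseteq> T" "T - Z \<in> lmeasurable" "emeasure lebesgue (T - Z) < ennreal e"
        using sets_lebesgue_outer_open[OF negligible_imp_sets[OF Z(2)] e] by auto
      have "T = (T - Z) \<union> Z" using T(2) by auto
      then have meas: "T \<in> lmeasurable" using fmeasurable.Un[OF T(3) negligible_imp_measurable[OF Z(2)]] by simp
      have "measure lebesgue T = measure lebesgue (T - Z)"
        by (rule measure_negligible_symdiff[OF T(3)]) (use Z in \<open>auto intro: negligible_subset\<close>)
      moreover have "measure lebesgue (T - Z) < e" using T(4) T(3) e by (simp add: emeasure_eq_measure2 ennreal_less_iff)
      ultimately show ?thesis using that[of T] T meas by auto
    qed
    obtain d where d: "d > 0" "(\<Union>x\<in>Z. cball x d) \<subseteq> W"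
      using compact_subset_open_imp_cball_epsilon_subset[OF Z(1) W(1,2)] by blast
    obtain dK where dK: "dK > 0" "(\<Union>x\<in>K. cball x dK) \<subseteq> U"
      using compact_subset_open_imp_cball_epsilon_subset[OF K(1) U(1) K(2)] by blast
    \<comment> \<open>Half of the distance d to the complement of W is spent on the tube G, the
      other half on the Euler error.\<close>
    define G where "G = {x. infdist x Z \<le> d / 2}"
    have G: "closed G" unfolding G_def by (intro closed_Collect_le continuous_intros)
    have GW: "y \<in> W" if "x \<in> G" "dist x y \<le> d / 2" for x y proof -
      obtain z where z: "z \<in> Z" "infdist x Z = dist x z" using infdist_attains_inf[OF compact_imp_closed[OF Z(1)] False] by metis
      have "dist z y \<le> dist x z + dist x y" by (metis dist_commute dist_triangle)
      also have "\<dots> \<le> d" using z that by (simp add: G_def)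
      finally have "y \<in> (\<Union>x\<in>Z. cball x d)" using z(1) by auto
      then show "y \<in> W" using d(2) by blast
    qed
    \<comment> \<open>Staying in K during the whole time keeps nearby Euler iterates inside U and
      makes D m compact, so that its images are measurable.\<close>
    define D where "D m = {a. (\<forall>s\<in>{0..m}. flow s a \<in> K) \<and> flow m a \<in> G}" for m :: real
    have compD: "compact (D m)" if "m \<ge> 0" for m proof -
      have "D m = K \<inter> ((\<Inter>s\<in>{0..m}. flow s -` K) \<inter> flow m -` G)"
        using that by (auto simp: D_def dest: bspec[of _ _ 0])
      moreover have "closed ((\<Inter>s\<in>{0..m}. flow s -` K) \<inter> flow m -` G)"
        by (intro closed_Int closed_INT ballI closed_vimage compact_imp_closed[OF K(1)] G continuous_on_flow)
      ultimately show ?thesis using compact_Int_closed[OF K(1)] by simp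
    qed
    obtain C where C: "C \<ge> 0" "\<And>h D N. [|compact D; 0 \<le> h; h \<le> 1; h * L < 1; C * h\<^sup>2 \<le> 1;
        \<forall>a\<in>D. \<forall>i<N. (euler_step h ^^ i) a \<in> U|] ==>
      (1 - C * h\<^sup>2) ^ N * measure lebesgue D \<le> measure lebesgue ((euler_step h ^^ N) ` D)"
      using measure_euler_image[OF U(2), of U] by blast
    have measD: "measure lebesgue (D m) \<le> e" if m: "m \<ge> 0" for m proof -
      define \<mu> where "\<mu> = measure lebesgue (D m)"
      have lim: "(\<lambda>N. m / real N) \<longlonglongrightarrow> 0" by (rule lim_const_over_n)
      have "(\<lambda>N. m / real N * M * (exp (L * m) - 1)) \<longlonglongrightarrow> 0 * M * (exp (L * m) - 1)"
        by (intro tendsto_intros lim)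
      then have ev1: "\<forall>\<^sub>F N in sequentially. m / real N * M * (exp (L * m) - 1) < min (d / 2) dK"
        by (rule order_tendstoD(2)) (use d dK in auto)
      have ev2: "\<forall>\<^sub>F N in sequentially. m / real N < 1" by (rule order_tendstoD(2)[OF lim]) simp
      have "(\<lambda>N. m / real N * L) \<longlonglongrightarrow> 0 * L" by (intro tendsto_intros lim)
      then have ev3: "\<forall>\<^sub>F N in sequentially. m / real N * L < 1" by (rule order_tendstoD(2)) simp
      have "(\<lambda>N. C * (m / real N)\<^sup>2) \<longlonglongrightarrow> C * 0\<^sup>2" by (intro tendsto_intros lim)
      then have ev4: "\<forall>\<^sub>F N in sequentially. C * (m / real N)\<^sup>2 < 1" by (rule order_tendstoD(2)) simp
      have "\<forall>\<^sub>F N in sequentially. (1 - C * m * (m / real N)) * \<mu> \<le> e"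
        using ev1 ev2 ev3 ev4 eventually_gt_at_top[of "0::nat"]
      proof eventually_elim
        case (elim N)
        define h where "h = m / real N"
        have h: "0 \<le> h" "h \<le> 1" "h * L < 1" "C * h\<^sup>2 \<le> 1" using elim m by (auto simp: h_def)
        have close: "norm ((euler_step h ^^ i) a - flow (i * h) a) \<le> min (d / 2) dK" if "i \<le> N" for i a proof -
          have "(1 + h * L) ^ i \<le> exp (h * L) ^ i" using h L_pos by (intro power_mono) (auto intro: exp_ge_add_one_self)
          also have "\<dots> = exp (h * i * L)" by (simp add: exp_of_nat_mult[symmetric] algebra_simps)
          also have "\<dots> \<le> exp (L * m)" proof -
            have "h * i \<le> h * N" using that h by (intro mult_left_mono) auto
            also have "\<dots> = m" using elim by (simp add: h_def)
            finally show ?thesis using L_pos by (simp add: mult.commute)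
          qed
          finally have "h * M * ((1 + h * L) ^ i - 1) \<le> h * M * (exp (L * m) - 1)" using h M_nonneg by (intro mult_left_mono) auto
          then show ?thesis using euler_error[OF h(1), of i a] elim(1) unfolding h_def by linarith
        qed
        have ih: "i * h \<in> {0..m}" if "i \<le> N" for i proof -
          have "i * h \<le> N * h" using that h by (intro mult_right_mono) auto
          moreover have "N * h = m" using elim by (simp add: h_def)
          moreover have "0 \<le> i * h" using h by simp
          ultimately show ?thesis by simp
        qed
        have "(1 - C * h\<^sup>2) ^ N * \<mu> \<le> measure lebesgue ((euler_step h ^^ N) ` D m)"
          unfolding \<mu>_def
        proof (rule C(2)[OF compD[OF m] h], intro ballI allI impI)
          fix a i assume a: "a \<in> D m" and i: "i < N"
          have "flow (i * h) a \<in> K" using a ih[of i] i by (auto simp: D_def)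
          moreover have "dist (flow (i * h) a) ((euler_step h ^^ i) a) \<le> dK"
            using close[of i a] i by (simp add: dist_norm norm_minus_commute)
          ultimately have "(euler_step h ^^ i) a \<in> (\<Union>x\<in>K. cball x dK)" by auto
          then show "(euler_step h ^^ i) a \<in> U" using dK(2) by blast
        qed
        also have "\<dots> \<le> measure lebesgue W"
        proof (rule measure_mono_fmeasurable[OF _ _ W(3)])
          show "(euler_step h ^^ N) ` D m \<subseteq> W"
          proof clarify
            fix a assume a: "a \<in> D m"
            have "flow (N * h) a \<in> G" using a elim by (auto simp: D_def h_def)
            moreover have "dist (flow (N * h) a) ((euler_step h ^^ N) a) \<le> d / 2"
              using close[of N a] by (simp add: dist_norm norm_minus_commute)
            ultimately show "(euler_step h ^^ N) a \<in> W" by (rule GW)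
          qed
          have cont: "continuous_on S (euler_step h)" for S
            unfolding euler_step_def by (intro continuous_intros continuous_on_field)
          have "continuous_on S (euler_step h ^^ i)" for S i
          proof (induction i)
            case (Suc i)
            then show ?case by (simp only: funpow.simps) (intro continuous_on_compose cont)
          qed (simp add: continuous_on_id id_def)
          then show "(euler_step h ^^ N) ` D m \<in> sets lebesgue"
            using compact_continuous_image[OF _ compD[OF m]] lmeasurable_compact by blast
        qed
        also have "\<dots> \<le> e" by (rule W)
        finally have le: "(1 - C * h\<^sup>2) ^ N * \<mu> \<le> e" .
        \<comment> \<open>Bernoulli: the loss over all N steps is at most N * C * h^2 = C * m * h,
          which vanishes as N grows because N * h = m is fixed.\<close>
        have "1 + real N * (- (C * h\<^sup>2)) \<le> (1 + - (C * h\<^sup>2)) ^ N" by (rule Bernoulli_inequality) (use h in auto)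
        moreover have "real N * h = m" using elim by (simp add: h_def)
        then have "real N * (C * h\<^sup>2) = C * m * h" by (simp add: power2_eq_square algebra_simps)
        ultimately have "1 - C * m * h \<le> (1 - C * h\<^sup>2) ^ N" by simp
        then have "(1 - C * m * h) * \<mu> \<le> (1 - C * h\<^sup>2) ^ N * \<mu>" by (rule mult_right_mono) (simp add: \<mu>_def)
        then show "(1 - C * m * (m / real N)) * \<mu> \<le> e" using le unfolding h_def by linarith
      qed
      moreover have "(\<lambda>N. (1 - C * m * (m / real N)) * \<mu>) \<longlonglongrightarrow> (1 - C * m * 0) * \<mu>"
        by (intro tendsto_intros lim)
      ultimately have "(1 - C * m * 0) * \<mu> \<le> e" by (intro tendsto_upperbound[of _ _ sequentially]) auto
      then show ?thesis by (simp add: \<mu>_def)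
    qed
    \<comment> \<open>The sets D m are not nested. Their tail intersections increase with n, obey
      the same bound e, and exhaust the attracted points.\<close>
    define T where "T n = (\<Inter>m\<in>{n..}. D (real m))" for n :: nat
    have compT: "compact (T n)" for n
      unfolding T_def by (rule compact_Inter) (auto simp: compD)
    have Tn: "T n \<in> lmeasurable" "measure lebesgue (T n) \<le> e" "T n \<subseteq> T (Suc n)" for n proof -
      show Tm: "T n \<in> lmeasurable" by (rule lmeasurable_compact[OF compT])
      have "measure lebesgue (T n) \<le> measure lebesgue (D (real n))"
        by (rule measure_mono_fmeasurable) (use Tm lmeasurable_compact[OF compD] in \<open>auto simp: T_def fmeasurableD\<close>)
      also have "\<dots> \<le> e" by (rule measD) simp
      finally show "measure lebesgue (T n) \<le> e" .
      show "T n \<subseteq> T (Suc n)" by (auto simp: T_def)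
    qed
    have lim: "(\<lambda>n. measure lebesgue (T n)) \<longlonglongrightarrow> measure lebesgue (\<Union>n. T n)" and meas: "(\<Union>n. T n) \<in> lmeasurable"
      using measure_nested_Union[of T, OF Tn] measurable_nested_Union[of T, OF Tn] by auto
    have "?A \<subseteq> (\<Union>n. T n)"
    proof clarify
      fix a l assume a: "\<forall>s\<ge>0. flow s a \<in> K" "l \<in> Z" "((\<lambda>s. flow s a) \<longlongrightarrow> l) at_top"
      have "\<forall>\<^sub>F s in at_top. dist (flow s a) l < d / 2" using a(3) d(1) by (intro tendstoD) auto
      then obtain S where S: "\<And>s. s \<ge> S ==> dist (flow s a) l < d / 2"
        unfolding eventually_at_top_linorder by blast
      obtain n :: nat where n: "real n \<ge> S" using real_arch_simple by blast
      have "a \<in> D (real m)" if "m \<ge> n" for m proof -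
        have "dist (flow m a) l < d / 2" using S n that by simp
        then have "infdist (flow m a) Z \<le> d / 2" using infdist_le[OF a(2), of "flow m a"] by simp
        then show ?thesis using a(1) by (simp add: D_def G_def)
      qed
      then show "a \<in> (\<Union>n. T n)" by (auto simp: T_def)
    qed
    moreover have "measure lebesgue (\<Union>n. T n) \<le> e" by (rule LIMSEQ_le_const2[OF lim]) (use Tn in auto)
    ultimately show "\<exists>T. ?A \<subseteq> T \<and> T \<in> lmeasurable \<and> measure lebesgue T \<le> e" using meas by blast
  qed
qed

end

subsection \<open>Flow boxes and reparametrization of leaves\<close>

lemma lipschitz_field_closest_point:
  fixes f :: "'a::euclidean_space => 'a"
  assumes S: "compact S" "convex S" "S \<noteq> {}"
    and f: "\<And>x y. [|x \<in> S; y \<in> S|] ==> norm (f x - f y) \<le> L * norm (x - y)" and L: "L > 0"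
    and M: "\<And>x. x \<in> S ==> norm (f x) \<le> M"
  shows "lipschitz_field (\<lambda>x. f (closest_point S x)) L M"
proof
  note cp = closest_point_in_set[OF compact_imp_closed[OF S(1)] S(3)]
  fix x y
  have "norm (f (closest_point S x) - f (closest_point S y)) \<le> L * norm (closest_point S x - closest_point S y)" by (intro f cp)
  also have "\<dots> \<le> L * norm (x - y)" using closest_point_lipschitz[OF S(2) compact_imp_closed[OF S(1)] S(3), of x y] L
    by (intro mult_left_mono) (auto simp: dist_norm)
  finally show "norm (f (closest_point S x) - f (closest_point S y)) \<le> L * norm (x - y)" .
  show "norm (f (closest_point S x)) \<le> M" by (intro M cp)
qed (rule L)

text \<open>Near a point where \<open>X\<close> does not vanish, leaves are parametrized by a linear coordinate.
  Unlike the time of \<open>X\<close>, this parameter is absolutely continuous along any absolutely continuous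
  curve in a leaf.\<close>

lemma flow_box:
  fixes X :: "'a::euclidean_space => 'a"
  assumes r0: "r0 > 0" and X0: "X y0 \<noteq> 0"
    and lip: "\<And>x y. [|x \<in> cball y0 r0; y \<in> cball y0 r0|] ==> norm (X x - X y) \<le> L * norm (x - y)"
  shows "\<exists>r e Y L' M' m. 0 < r \<and> r \<le> r0 \<and> m > 0 \<and> lipschitz_field Y L' M' \<and>
    (\<forall>x\<in>cball y0 r. X x \<bullet> e \<ge> m \<and> Y x = (1 / (X x \<bullet> e)) *\<^sub>R X x)"
proof -
  define n where "n = norm (X y0)"
  have n: "n > 0" using X0 by (simp add: n_def)
  define e where "e = (1 / n) *\<^sub>R X y0"
  have e: "norm e = 1" "X y0 \<bullet> e = n" using n by (auto simp: e_def n_def dot_square_norm power2_eq_square)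
  define L1 where "L1 = \<bar>L\<bar> + 1"
  have L1: "L1 > 0" by (simp add: L1_def add_nonneg_pos)
  \<comment> \<open>On this ball X differs from X y0 by at most n / 2, so its component along the
    unit vector e remains at least n / 2 and may be divided by.\<close>
  define r where "r = min r0 (n / (2 * L1))"
  have r: "0 < r" "r \<le> r0" "L1 * r \<le> n / 2" proof -
    show "0 < r" "r \<le> r0" using r0 n L1 by (auto simp: r_def)
    have "L1 * r \<le> L1 * (n / (2 * L1))" using L1 by (intro mult_left_mono) (auto simp: r_def)
    then show "L1 * r \<le> n / 2" using L1 by simp
  qed
  have lip1: "norm (X x - X y) \<le> L1 * norm (x - y)" if "x \<in> cball y0 r" "y \<in> cball y0 r" for x y proof -
    have "norm (X x - X y) \<le> L * norm (x - y)" using that r(2) by (intro lip) auto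
    also have "\<dots> \<le> L1 * norm (x - y)" by (intro mult_right_mono) (auto simp: L1_def)
    finally show ?thesis .
  qed
  have near: "norm (X x - X y0) \<le> n / 2" if "x \<in> cball y0 r" for x proof -
    have "norm (X x - X y0) \<le> L1 * norm (x - y0)" using that r by (intro lip1) auto
    also have "\<dots> \<le> L1 * r" using that L1 by (intro mult_left_mono) (auto simp: dist_norm norm_minus_commute)
    finally show ?thesis using r(3) by simp
  qed
  have pos: "X x \<bullet> e \<ge> n / 2" if "x \<in> cball y0 r" for x proof -
    have "\<bar>(X x - X y0) \<bullet> e\<bar> \<le> n / 2" using Cauchy_Schwarz_ineq2[of "X x - X y0" e] near[OF that] e(1) by simp
    then have "(X x - X y0) \<bullet> e \<ge> - (n / 2)" by linarith
    then show ?thesis using e(2) by (simp add: inner_diff_left)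
  qed
  have bd: "norm (X x) \<le> 2 * n" if "x \<in> cball y0 r" for x
    using near[OF that] norm_triangle_sub[of "X x" "X y0"] n unfolding n_def by linarith
  define f where "f x = (1 / (X x \<bullet> e)) *\<^sub>R X x" for x
  \<comment> \<open>From the splitting of f x - f y below: 2 / n bounds 1 / p, 4 / n^2 bounds the
    change of the reciprocal, and 2 * n bounds X.\<close>
  define L' where "L' = 2 / n * L1 + (4 / n\<^sup>2 * L1) * (2 * n)"
  have L': "L' > 0" using n L1 by (auto simp: L'_def intro!: add_pos_pos mult_pos_pos divide_pos_pos)
  have flip: "norm (f x - f y) \<le> L' * norm (x - y)" if xy: "x \<in> cball y0 r" "y \<in> cball y0 r" for x y proof -
    define p q where "p = X x \<bullet> e" and "q = X y \<bullet> e"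
    have pq: "p \<ge> n / 2" "q \<ge> n / 2" using pos xy by (auto simp: p_def q_def)
    then have pq0: "p > 0" "q > 0" using n by auto
    have "\<bar>p - q\<bar> \<le> norm (X x - X y)"
      using Cauchy_Schwarz_ineq2[of "X x - X y" e] e(1) by (simp add: p_def q_def inner_diff_left)
    also have "\<dots> \<le> L1 * norm (x - y)" by (rule lip1[OF xy])
    finally have dpq: "\<bar>p - q\<bar> \<le> L1 * norm (x - y)" .
    have inv: "\<bar>1 / p - 1 / q\<bar> \<le> 4 / n\<^sup>2 * (L1 * norm (x - y))" proof -
      have "\<bar>1 / p - 1 / q\<bar> = \<bar>p - q\<bar> * (1 / (p * q))" using pq0 by (simp add: diff_frac_eq abs_mult abs_minus_commute)
      also have "\<dots> \<le> (L1 * norm (x - y)) * (4 / n\<^sup>2)"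
      proof (rule mult_mono[OF dpq])
        have "n / 2 * (n / 2) \<le> p * q" using pq n by (intro mult_mono) auto
        then have "1 / (p * q) \<le> 1 / (n / 2 * (n / 2))" using n by (intro divide_left_mono) (auto intro!: mult_pos_pos pq0)
        then show "1 / (p * q) \<le> 4 / n\<^sup>2" by (simp add: power2_eq_square)
      qed (use pq0 L1 in auto)
      finally show ?thesis by (simp add: mult.commute)
    qed
    have "f x - f y = (1 / p) *\<^sub>R (X x - X y) + (1 / p - 1 / q) *\<^sub>R X y"
      by (simp add: f_def p_def[symmetric] q_def[symmetric] algebra_simps)
    also have "norm \<dots> \<le> \<bar>1 / p\<bar> * norm (X x - X y) + \<bar>1 / p - 1 / q\<bar> * norm (X y)"
      by (rule order_trans[OF norm_triangle_ineq]) simp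
    also have "\<dots> \<le> (2 / n) * (L1 * norm (x - y)) + (4 / n\<^sup>2 * (L1 * norm (x - y))) * (2 * n)"
    proof (intro add_mono mult_mono lip1[OF xy] inv bd[OF xy(2)])
      show "\<bar>1 / p\<bar> \<le> 2 / n" using pq n by (simp add: field_simps)
    qed (use n L1 in auto)
    also have "\<dots> = L' * norm (x - y)" by (simp add: L'_def algebra_simps)
    finally show ?thesis .
  qed
  have bdf: "norm (f x) \<le> 4" if "x \<in> cball y0 r" for x proof -
    have "norm (f x) = norm (X x) / (X x \<bullet> e)" using pos[OF that] n by (simp add: f_def)
    also have "\<dots> \<le> (2 * n) / (n / 2)" using bd[OF that] pos[OF that] n by (intro frac_le) auto
    finally show ?thesis using n by simp
  qed
  have field: "lipschitz_field (\<lambda>x. f (closest_point (cball y0 r) x)) L' 4"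
    by (rule lipschitz_field_closest_point[OF _ _ _ flip L' bdf]) (use r in auto)
  show ?thesis
    by (intro exI[of _ r] exI[of _ e] exI[of _ "\<lambda>x. f (closest_point (cball y0 r) x)"] exI[of _ L'] exI[of _ "4::real"] exI[of _ "n / 2"])
      (use r n field pos in \<open>auto simp: closest_point_self f_def\<close>)
qed

text \<open>The rescaled field Y has component 1 along e, hence the height c \<bullet> e is itself
  the time of Y along the curve. It is absolutely continuous with c, whatever the speed of c
  relative to X.\<close>

lemma flow_box_curve:
  fixes X :: "'a::euclidean_space => 'a"
  assumes Y: "lipschitz_field Y L' M'" and m: "m > 0"
    and box: "\<And>x. x \<in> S ==> X x \<bullet> e \<ge> m \<and> Y x = (1 / (X x \<bullet> e)) *\<^sub>R X x"
    and c: "abs_continuous_on a b c" "c ` {a..b} \<subseteq> S" and N: "negligible N"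
    and deriv: "\<And>t. t \<in> {a..b} - N ==> \<exists>u. (c has_vector_derivative u *\<^sub>R X (c t)) (at t within {a..b})"
    and t: "t \<in> {a..b}" "t' \<in> {a..b}"
  shows "c t' = lipschitz_field.flow Y ((c t' - c t) \<bullet> e) (c t)"
proof -
  interpret lipschitz_field Y L' M' by (rule Y)
  have main: "c t' = flow ((c t' - c t) \<bullet> e) (c t)" if tt: "t \<in> {a..b}" "t' \<in> {a..b}" "t \<le> t'" for t t' proof -
    have sub: "{t..t'} \<subseteq> {a..b}" using tt by auto
    have "c t' = flow (c t' \<bullet> e - c t \<bullet> e) (c t)"
    proof (rule flow_reparametrize[OF tt(3) _ _ N, where s = "\<lambda>t. c t \<bullet> e"])
      show ac: "abs_continuous_on t t' c" using abs_continuous_on_subinterval[OF c(1)] tt by auto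
      show "abs_continuous_on t t' (\<lambda>t. c t \<bullet> e)"
      proof (rule abs_continuous_on_dominated[OF ac ac, where L = "norm e"])
        fix u v
        have "dist (c u \<bullet> e) (c v \<bullet> e) \<le> norm e * dist (c u) (c v)"
          using Cauchy_Schwarz_ineq2[of "c u - c v" e] by (simp add: dist_norm inner_diff_left mult.commute)
        also have "\<dots> \<le> norm e * (dist (c u) (c v) + dist (c u) (c v))" by (intro mult_left_mono) auto
        finally show "dist (c u \<bullet> e) (c v \<bullet> e) \<le> norm e * (dist (c u) (c v) + dist (c u) (c v))" .
      qed
      fix \<tau> assume \<tau>: "\<tau> \<in> {t..t'} - N"
      then obtain u where "(c has_vector_derivative u *\<^sub>R X (c \<tau>)) (at \<tau> within {a..b})" using deriv sub by blast
      then have u: "(c has_vector_derivative u *\<^sub>R X (c \<tau>)) (at \<tau> within {t..t'})"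
        by (rule has_vector_derivative_within_subset[OF _ sub])
      have cS: "c \<tau> \<in> S" using c(2) sub \<tau> by auto
      have Xe: "X (c \<tau>) \<bullet> e > 0" using box[OF cS] m by linarith
      show "\<exists>u. (c has_vector_derivative u *\<^sub>R Y (c \<tau>)) (at \<tau> within {t..t'}) \<and>
        ((\<lambda>t. c t \<bullet> e) has_vector_derivative u) (at \<tau> within {t..t'})"
      proof (intro exI[of _ "u * (X (c \<tau>) \<bullet> e)"] conjI)
        show "(c has_vector_derivative (u * (X (c \<tau>) \<bullet> e)) *\<^sub>R Y (c \<tau>)) (at \<tau> within {t..t'})"
          using u Xe box[OF cS] by simp
        show "((\<lambda>t. c t \<bullet> e) has_vector_derivative u * (X (c \<tau>) \<bullet> e)) (at \<tau> within {t..t'})"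
          using bounded_linear.has_vector_derivative[OF bounded_linear_inner_left u, of e] by simp
      qed
    qed
    then show ?thesis by (simp add: inner_diff_left)
  qed
  show ?thesis
  proof (cases "t \<le> t'")
    case True then show ?thesis using main t by blast
  next
    case False
    then have "c t = flow ((c t - c t') \<bullet> e) (c t')" using main t by simp
    then have "flow (- ((c t - c t') \<bullet> e)) (c t) = c t'" by (metis flow_minus)
    then show ?thesis by (simp add: inner_diff_left)
  qed
qed

text \<open>Recovers the time of X itself. Along the leaf it is a primitive F of 1 / (X \<bullet> e)
  as a function of the height; F is Lipschitz, so F composed with the height of c is absolutely
  continuous with derivative u. Integrability of u is thus a conclusion.\<close>

lemma flow_box_time:
  fixes X :: "'a::euclidean_space => 'a"
  assumes Y: "lipschitz_field Y L' M'" and m: "m > 0" and r: "r > 0"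
    and box: "\<And>x. x \<in> cball y0 r ==> X x \<bullet> e \<ge> m \<and> Y x = (1 / (X x \<bullet> e)) *\<^sub>R X x"
    and Xlip: "\<And>x y. [|x \<in> cball y0 r; y \<in> cball y0 r|] ==> norm (X x - X y) \<le> L1 * norm (x - y)"
    and c: "abs_continuous_on a b c" "c ` {a..b} \<subseteq> cball y0 r" and N: "negligible N" and ab: "a \<le> b"
    and deriv: "\<And>t. t \<in> {a..b} - N ==> (c has_vector_derivative u t *\<^sub>R X (c t)) (at t within {a..b})"
    and uN: "\<And>t. t \<in> N ==> u t = 0"
    and F: "lipschitz_field Y2 L2 M2" "\<And>x. x \<in> cball y0 r ==> Y2 x = X x"
  shows "u integrable_on {a..b}" "c b = lipschitz_field.flow Y2 (integral {a..b} u) (c a)"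
proof -
  interpret y: lipschitz_field Y L' M' by (rule Y)
  interpret z: lipschitz_field Y2 L2 M2 by (rule F)
  define pr where "pr = closest_point (cball y0 r)"
  have pr: "pr x \<in> cball y0 r" for x unfolding pr_def by (rule closest_point_in_set) (use r in auto)
  have contX: "continuous_on (cball y0 r) X"
  proof (rule continuous_on_eq)
    show "continuous_on (cball y0 r) Y2" by (rule z.continuous_on_field)
  qed (use F in auto)
  have contpr: "continuous_on UNIV pr"
    unfolding pr_def by (rule continuous_on_closest_point) (use r in auto)
  \<comment> \<open>The leaf through c a, parametrized by height instead of time.\<close>
  define y where "y \<rho> = y.flow (\<rho> - c a \<bullet> e) (c a)" for \<rho>
  have conty: "continuous_on UNIV y" proof -
    have "continuous_on UNIV (\<lambda>s. y.flow s (c a))"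
      by (intro continuous_at_imp_continuous_on ballI has_vector_derivative_continuous[OF y.flow_deriv])
    then show ?thesis unfolding y_def by (rule continuous_on_compose2) (auto intro!: continuous_intros)
  qed
  \<comment> \<open>Time of X per unit of height. The projection \<open>pr\<close> keeps the
    denominator above m even at heights where the leaf has left the ball.\<close>
  define w where "w \<rho> = 1 / (X (pr (y \<rho>)) \<bullet> e)" for \<rho>
  have Xpr: "X (pr x) \<bullet> e \<ge> m" for x using box[OF pr] by blast
  have contw: "continuous_on UNIV w"
    unfolding w_def
  proof (intro continuous_intros continuous_on_compose2[OF contX])
    show "continuous_on UNIV (\<lambda>x. pr (y x))" by (rule continuous_on_compose2[OF contpr conty]) auto
  qed (use pr Xpr m in \<open>auto simp: less_le_trans[THEN less_imp_neq, symmetric]\<close>)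
  have wb: "\<bar>w \<rho>\<bar> \<le> 1 / m" for \<rho> using Xpr[of "y \<rho>"] m by (simp add: w_def frac_le)
  obtain F where F: "\<And>t. (F has_vector_derivative w t) (at t)" using antiderivative_real_line[OF contw] by blast
  have Flip: "norm (F p - F q) \<le> 1 / m * norm (p - q)" for p q
  proof (rule differentiable_bound[of UNIV F "\<lambda>s h. h *\<^sub>R w s"])
    show "(F has_derivative (\<lambda>h. h *\<^sub>R w x)) (at x within UNIV)" for x using F[of x] by (simp add: has_vector_derivative_def)
    show "onorm (\<lambda>h. h *\<^sub>R w x) \<le> 1 / m" for x
    proof (rule onorm_le)
      show "norm (h *\<^sub>R w x) \<le> 1 / m * norm h" for h
        using mult_left_mono[OF wb[of x], of "\<bar>h\<bar>"] by (simp add: abs_mult mult.commute)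
    qed
  qed auto
  define S where "S t = F (c t \<bullet> e)" for t
  have acS: "abs_continuous_on a b S"
  proof (rule abs_continuous_on_dominated[OF c(1) c(1), where L = "1 / m * norm e"])
    fix u v
    have "dist (S u) (S v) \<le> 1 / m * norm (c u \<bullet> e - c v \<bullet> e)" unfolding S_def dist_norm by (rule Flip)
    also have "\<dots> \<le> 1 / m * (norm e * dist (c u) (c v))"
      using Cauchy_Schwarz_ineq2[of "c u - c v" e] m by (intro mult_left_mono) (auto simp: dist_norm inner_diff_left mult.commute)
    also have "\<dots> \<le> 1 / m * norm e * (dist (c u) (c v) + dist (c u) (c v))"
      unfolding mult.assoc using m by (intro mult_left_mono) auto
    finally show "dist (S u) (S v) \<le> 1 / m * norm e * (dist (c u) (c v) + dist (c u) (c v))" .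
  qed
  have cy: "y (c t \<bullet> e) = c t" if "t \<in> {a..b}" for t proof -
    have ex: "\<exists>u. (c has_vector_derivative u *\<^sub>R X (c t)) (at t within {a..b})" if "t \<in> {a..b} - N" for t
      using deriv[OF that] by blast
    have "c t = y.flow ((c t - c a) \<bullet> e) (c a)" by (rule flow_box_curve[OF Y m box c N ex]) (use that ab in auto)
    then show ?thesis by (simp add: y_def inner_diff_left)
  qed
  have S': "(S has_vector_derivative u t) (at t within {a..b})" if t: "t \<in> {a..b} - N" for t proof -
    have ce: "((\<lambda>t. c t \<bullet> e) has_vector_derivative u t * (X (c t) \<bullet> e)) (at t within {a..b})"
      using bounded_linear.has_vector_derivative[OF bounded_linear_inner_left deriv[OF t], of e] by simp
    have ct: "c t \<in> cball y0 r" using c(2) t by blast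
    then have "w (c t \<bullet> e) = 1 / (X (c t) \<bullet> e)" using cy[of t] t by (simp add: w_def pr_def closest_point_self)
    moreover have "X (c t) \<bullet> e > 0" using box[OF ct] m by linarith
    moreover have "((F \<circ> (\<lambda>t. c t \<bullet> e)) has_vector_derivative (u t * (X (c t) \<bullet> e)) *\<^sub>R w (c t \<bullet> e)) (at t within {a..b})"
      by (rule vector_diff_chain_within[OF ce]) (rule has_vector_derivative_at_within[OF F])
    ultimately show ?thesis by (simp add: S_def[abs_def] o_def)
  qed
  have "((\<lambda>t. if t \<in> N then 0 else u t) has_integral S b - S a) {a..b}" by (rule abs_continuous_on_has_integral[OF ab acS N S'])
  then have int: "(u has_integral S b - S a) {a..b}" by (rule has_integral_eq[rotated]) (use uN in auto)
  then show "u integrable_on {a..b}" by blast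
  have "c b = z.flow (S b - S a) (c a)"
  proof (rule z.flow_reparametrize[OF ab c(1) acS N])
    fix t assume t: "t \<in> {a..b} - N"
    have "c t \<in> cball y0 r" using c(2) t by blast
    then show "\<exists>u. (c has_vector_derivative u *\<^sub>R Y2 (c t)) (at t within {a..b}) \<and> (S has_vector_derivative u) (at t within {a..b})"
      using deriv[OF t] S'[OF t] \<open>\<And>x. x \<in> cball y0 r ==> Y2 x = X x\<close> by auto
  qed
  then show "c b = z.flow (integral {a..b} u) (c a)" using integral_unique[OF int] by simp
qed

text \<open>A curve leaving a zero of Y along a leaf needs infinite time of the flow: by Lipschitz
  dependence a bounded time could not separate c b from the fixed point c a. Near a the time keeps
  one sign, recorded by \<sigma>, and by continuity it takes all values, so the half orbit of c b is
  contained in the curve.\<close>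

lemma (in lipschitz_field) leaf_curve_limit:
  assumes ab: "a < b" and c: "abs_continuous_on a b c" and K: "c ` {a..b} \<subseteq> K"
    and Ya: "Y (c a) = 0" and Yt: "\<And>t. t \<in> {a<..b} ==> Y (c t) \<noteq> 0" and N: "negligible N"
    and deriv: "\<And>t. t \<in> {a..b} - N ==> \<exists>u. (c has_vector_derivative u *\<^sub>R Y (c t)) (at t within {a..b})"
  shows "\<exists>\<sigma>\<in>{1, -1}. (\<forall>s\<ge>0. flow (\<sigma> * s) (c b) \<in> K) \<and> ((\<lambda>s. flow (\<sigma> * s) (c b)) \<longlongrightarrow> c a) at_top"
proof -
  \<comment> \<open>The default 0 on N matters: \<open>flow_box_time\<close> concludes integrability
    of u itself and asks for this value.\<close>
  define u where "u t = (if t \<in> N then 0 else SOME u. (c has_vector_derivative u *\<^sub>R Y (c t)) (at t within {a..b}))" for t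
  have u: "(c has_vector_derivative u t *\<^sub>R Y (c t)) (at t within {a..b})" if "t \<in> {a..b} - N" for t
    using someI_ex[OF deriv[OF that]] that by (simp add: u_def)
  have contc: "continuous_on {a..b} c" by (rule abs_continuous_on_imp_continuous_on[OF c])
  have local: "\<exists>d>0. \<forall>t t'. t \<le> t' \<and> t \<in> {a<..b} \<and> t' \<in> {a<..b} \<and> \<bar>t - t0\<bar> < d \<and> \<bar>t' - t0\<bar> < d \<longrightarrow>
      u integrable_on {t..t'} \<and> c t' = flow (integral {t..t'} u) (c t)" if t0: "t0 \<in> {a<..b}" for t0 proof -
    obtain r e Y1 L' M' m where box: "0 < r" "m > 0" "lipschitz_field Y1 L' M'"
      "\<And>x. x \<in> cball (c t0) r ==> Y x \<bullet> e \<ge> m \<and> Y1 x = (1 / (Y x \<bullet> e)) *\<^sub>R Y x"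
      using flow_box[of 1 Y "c t0" L, OF zero_less_one Yt[OF t0] lip] by blast
    obtain d where d: "d > 0" "\<And>t. [|t \<in> {a..b}; dist t t0 < d|] ==> dist (c t) (c t0) < r"
      using contc t0 box(1) unfolding continuous_on_iff by (metis atLeastAtMost_iff greaterThanAtMost_iff less_imp_le)
    show ?thesis
    proof (intro exI[of _ d] conjI[OF d(1)] allI impI, elim conjE)
      fix t t' assume tt: "t \<le> t'" "t \<in> {a<..b}" "t' \<in> {a<..b}" "\<bar>t - t0\<bar> < d" "\<bar>t' - t0\<bar> < d"
      have sub: "{t..t'} \<subseteq> {a..b}" using tt by auto
      have im: "c ` {t..t'} \<subseteq> cball (c t0) r"
      proof clarify
        fix \<tau> assume \<tau>: "\<tau> \<in> {t..t'}"
        then have "dist \<tau> t0 < d" using tt by (auto simp: dist_real_def)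
        then show "c \<tau> \<in> cball (c t0) r" using d(2)[of \<tau>] \<tau> sub by (auto simp: dist_commute less_imp_le)
      qed
      have ac: "abs_continuous_on t t' c" using abs_continuous_on_subinterval[OF c] tt by auto
      have der: "(c has_vector_derivative u \<tau> *\<^sub>R Y (c \<tau>)) (at \<tau> within {t..t'})" if "\<tau> \<in> {t..t'} - N" for \<tau>
        using has_vector_derivative_within_subset[OF u sub] that sub by blast
      have uN: "u \<tau> = 0" if "\<tau> \<in> N" for \<tau> using that by (simp add: u_def)
      note * = flow_box_time[OF box(3) box(2) box(1) box(4) lip ac im N tt(1) der uN lipschitz_field_axioms refl]
      show "u integrable_on {t..t'} \<and> c t' = flow (integral {t..t'} u) (c t)" by (rule conjI[OF *])
    qed
  qed
  \<comment> \<open>Local integrability suffices on compact intervals that avoid a; up to a the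
    integral diverges.\<close>
  have int: "u integrable_on {t..t'}" if t: "t \<in> {a<..b}" "t' \<le> b" for t t' proof -
    have "u integrable_on cbox t t'"
    proof (rule integrable_on_little_subintervals, intro ballI)
      fix x assume x: "x \<in> cbox t t'"
      then obtain d where d: "d > 0" "\<And>p q. [|p \<le> q; p \<in> {a<..b}; q \<in> {a<..b}; \<bar>p - x\<bar> < d; \<bar>q - x\<bar> < d|] ==> u integrable_on {p..q}"
        using local[of x] t by auto
      show "\<exists>d>0. \<forall>p q. x \<in> cbox p q \<and> cbox p q \<subseteq> ball x d \<and> cbox p q \<subseteq> cbox t t' \<longrightarrow> u integrable_on cbox p q"
      proof (intro exI[of _ d] conjI d(1) allI impI, elim conjE)
        fix p q assume pq: "x \<in> cbox p q" "cbox p q \<subseteq> ball x d" "cbox p q \<subseteq> cbox t t'"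
        then have "p \<le> q" "p \<in> cbox p q" "q \<in> cbox p q" by auto
        then have "p \<in> ball x d" "q \<in> ball x d" "p \<in> cbox t t'" "q \<in> cbox t t'" using pq by blast+
        then show "u integrable_on cbox p q" using d(2)[of p q] \<open>p \<le> q\<close> t by (auto simp: dist_real_def abs_minus_commute)
      qed
    qed
    then show ?thesis by simp
  qed
  define s where "s t = integral {t..b} u" for t
  have sb: "s b = 0" by (simp add: s_def)
  have sdiff: "s t - s t' = integral {t..t'} u" if "t \<in> {a<..b}" "t \<le> t'" "t' \<le> b" for t t'
    using Henstock_Kurzweil_Integration.integral_combine[of t t' b u] int[of t b] that by (simp add: s_def)
  \<comment> \<open>The identity is known near each time by flow boxes. Read as an equivalence
    relation on times, it extends over the connected set {a<..b}.\<close>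
  have flow_eq: "c t' = flow (s t - s t') (c t)" if tt: "t \<in> {a<..b}" "t' \<in> {a<..b}" for t t'
  proof (rule connected_equivalence_relation[of "{a<..b}", OF _ tt])
    show "c x = flow (s y - s x) (c y)" if "c y = flow (s x - s y) (c x)" for x y proof -
      have "flow (- (s x - s y)) (c y) = c x" unfolding that by (rule flow_minus)
      then show ?thesis by simp
    qed
    show "c z = flow (s x - s z) (c x)" if "c y = flow (s x - s y) (c x)" "c z = flow (s y - s z) (c y)" for x y z
      using flow_add[of "s y - s z" "s x - s y" "c x"] that by simp
    fix t0 assume t0: "t0 \<in> {a<..b}"
    obtain d where d: "d > 0" "\<And>p q. [|p \<le> q; p \<in> {a<..b}; q \<in> {a<..b}; \<bar>p - t0\<bar> < d; \<bar>q - t0\<bar> < d|] ==> c q = flow (integral {p..q} u) (c p)"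
      using local[OF t0] by blast
    show "\<exists>T. openin (top_of_set {a<..b}) T \<and> t0 \<in> T \<and> (\<forall>x\<in>T. c x = flow (s t0 - s x) (c t0))"
    proof (intro exI[of _ "{a<..b} \<inter> ball t0 d"] conjI ballI)
      show "openin (top_of_set {a<..b}) ({a<..b} \<inter> ball t0 d)" by (rule openin_open_Int) simp
      fix x assume x: "x \<in> {a<..b} \<inter> ball t0 d"
      show "c x = flow (s t0 - s x) (c t0)"
      proof (cases "t0 \<le> x")
        case True
        then show ?thesis using d(2)[of t0 x] sdiff[of t0 x] x t0 d(1) by (simp add: dist_real_def abs_minus_commute)
      next
        case False
        then have "c t0 = flow (s x - s t0) (c x)"
          using d(2)[of x t0] sdiff[of x t0] x t0 d(1) by (simp add: dist_real_def abs_minus_commute)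
        then have "flow (- (s x - s t0)) (c t0) = c x" by (metis flow_minus)
        then show ?thesis by simp
      qed
    qed (use t0 d(1) in auto)
  qed simp
  have flow_b: "c t = flow (- s t) (c b)" if "t \<in> {a<..b}" for t using flow_eq[of b t] that ab sb by simp
  have conts: "continuous_on {t..b} s" if "t \<in> {a<..b}" for t
    unfolding s_def by (rule indefinite_integral_continuous_1') (use int that in auto)
  \<comment> \<open>Within time R the flow separates c t from the fixed point c a at most by the
    factor exp (L * |R|); \<eta> is chosen so that this falls short of the distance from c b to c
    a.\<close>
  have blow: "\<exists>d>0. \<forall>t\<in>{a<..b}. t < a + d \<longrightarrow> R < \<bar>s t\<bar>" for R proof -
    have ne: "norm (c b - c a) > 0" using Ya Yt[of b] ab by auto
    define \<eta> where "\<eta> = exp (- (L * \<bar>R\<bar>)) * norm (c b - c a)"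
    have "\<eta> > 0" using ne by (simp add: \<eta>_def)
    then obtain d where d: "d > 0" "\<And>t. [|t \<in> {a..b}; dist t a < d|] ==> dist (c t) (c a) < \<eta>"
      using contc ab unfolding continuous_on_iff by (metis atLeastAtMost_iff less_imp_le order_refl)
    show ?thesis
    proof (intro exI[of _ d] conjI d(1) ballI impI, rule ccontr)
      fix t assume t: "t \<in> {a<..b}" "t < a + d" "\<not> R < \<bar>s t\<bar>"
      have "c b = flow (s t) (c t)" using flow_eq[of t b] t ab sb by simp
      then have "norm (c b - c a) = norm (flow (s t) (c t) - flow (s t) (c a))" using flow_fixed[OF Ya] by simp
      also have "\<dots> \<le> exp (L * \<bar>s t\<bar>) * norm (c t - c a)" by (rule flow_lipschitz)
      also have "\<dots> \<le> exp (L * \<bar>R\<bar>) * norm (c t - c a)" using t L_pos by (intro mult_right_mono) auto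
      also have "\<dots> < exp (L * \<bar>R\<bar>) * \<eta>" using d(2)[of t] t by (intro mult_strict_left_mono) (auto simp: dist_norm)
      also have "\<dots> = norm (c b - c a)" by (simp add: \<eta>_def exp_minus)
      finally show False by simp
    qed
  qed
  obtain d0 where d0: "d0 > 0" "\<And>t. [|t \<in> {a<..b}; t < a + d0|] ==> 0 < \<bar>s t\<bar>" using blow[of 0] by blast
  define t0 where "t0 = min b (a + d0 / 2)"
  have t0: "t0 \<in> {a<..b}" "t0 < a + d0" using ab d0(1) by (auto simp: t0_def min_def)
  define \<sigma> where "\<sigma> = - sgn (s t0)"
  have \<sigma>: "\<sigma> \<in> {1, -1}" "\<sigma> * \<sigma> = 1" using d0(2)[OF t0] by (auto simp: \<sigma>_def sgn_if)
  define \<tau> where "\<tau> t = - (\<sigma> * s t)" for t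
  have contt: "continuous_on {t..b} \<tau>" if "t \<in> {a<..b}" for t
    unfolding \<tau>_def by (intro continuous_intros conts that)
  have ct: "c t = flow (\<sigma> * \<tau> t) (c b)" if "t \<in> {a<..b}" for t proof -
    have "\<sigma> * \<tau> t = - s t" using \<sigma>(2) unfolding \<tau>_def by (metis mult.assoc mult_1 mult_minus_right)
    then show ?thesis using flow_b[OF that] by simp
  qed
  have abs\<tau>: "\<bar>\<tau> t\<bar> = \<bar>s t\<bar>" for t using \<sigma>(1) by (auto simp: \<tau>_def)
  have pos: "\<tau> t > 0" if t: "t \<in> {a<..b}" "t \<le> t0" for t
  proof (rule ccontr)
    assume neg: "\<not> \<tau> t > 0"
    have "\<tau> t0 > 0" using d0(2)[OF t0] by (auto simp: \<tau>_def \<sigma>_def sgn_if)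
    then have "\<exists>x\<ge>t. x \<le> t0 \<and> \<tau> x = 0"
      using neg t t0 by (intro IVT') (auto intro: continuous_on_subset[OF contt[OF t(1)]])
    then obtain x where x: "t \<le> x" "x \<le> t0" "\<tau> x = 0" by blast
    then have "0 < \<bar>s x\<bar>" using d0(2)[of x] t t0 by auto
    then show False using abs\<tau>[of x] x by simp
  qed
  \<comment> \<open>\<tau> vanishes at b and exceeds every bound near a, so it takes all nonnegative
    values even if the curve moves back and forth.\<close>
  have onto: "\<exists>t\<in>{a<..b}. \<tau> t = \<rho>" if \<rho>: "\<rho> \<ge> 0" for \<rho> proof -
    obtain d where d: "d > 0" "\<And>t. [|t \<in> {a<..b}; t < a + d|] ==> \<rho> < \<bar>s t\<bar>" using blow[of \<rho>] by blast
    define t where "t = min t0 (a + d / 2)"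
    have t: "t \<in> {a<..b}" "t < a + d" "t \<le> t0" using t0 d(1) by (auto simp: t_def min_def)
    have "\<rho> < \<tau> t" using d(2)[OF t(1,2)] pos[OF t(1,3)] abs\<tau>[of t] by simp
    then have "\<exists>x\<ge>t. x \<le> b \<and> \<tau> x = \<rho>"
      using \<rho> t contt[OF t(1)] sb by (intro IVT2') (auto simp: \<tau>_def)
    then show ?thesis using t by force
  qed
  \<comment> \<open>Since \<tau> is bounded on {t1..b}, large times are attained only close to a,
    where the curve is close to c a.\<close>
  have lim: "((\<lambda>s. flow (\<sigma> * s) (c b)) \<longlongrightarrow> c a) at_top"
  proof (rule tendstoI)
    fix \<epsilon> :: real assume "\<epsilon> > 0"
    then obtain d where d: "d > 0" "\<And>t. [|t \<in> {a..b}; dist t a < d|] ==> dist (c t) (c a) < \<epsilon>"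
      using contc ab unfolding continuous_on_iff by (metis atLeastAtMost_iff less_imp_le order_refl)
    define t1 where "t1 = min b (a + d / 2)"
    have t1: "t1 \<in> {a<..b}" "t1 < a + d" using ab d(1) by (auto simp: t1_def min_def)
    obtain B where B: "\<forall>x\<in>\<tau> ` {t1..b}. \<bar>x\<bar> \<le> B"
      using compact_imp_bounded[OF compact_continuous_image[OF contt[OF t1(1)] compact_Icc]]
      unfolding bounded_iff real_norm_def by blast
    have "dist (flow (\<sigma> * \<rho>) (c b)) (c a) < \<epsilon>" if \<rho>: "\<rho> \<ge> max 0 (B + 1)" for \<rho> proof -
      obtain t where t: "t \<in> {a<..b}" "\<tau> t = \<rho>" using onto[of \<rho>] \<rho> by auto
      have "t < t1"
      proof (rule ccontr)
        assume "\<not> t < t1"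
        then have "\<tau> t \<in> \<tau> ` {t1..b}" using t by auto
        with B have "\<bar>\<tau> t\<bar> \<le> B" by blast
        then show False using t \<rho> by auto
      qed
      then show ?thesis using d(2)[of t] ct[OF t(1)] t t1 by (auto simp: dist_real_def)
    qed
    then show "\<forall>\<^sub>F s in at_top. dist (flow (\<sigma> * s) (c b)) (c a) < \<epsilon>"
      unfolding eventually_at_top_linorder by blast
  qed
  have mem: "flow (\<sigma> * \<rho>) (c b) \<in> K" if rho: "\<rho> \<ge> 0" for \<rho> proof -
    obtain t where t: "t \<in> {a<..b}" "\<tau> t = \<rho>" using onto[OF rho] by blast
    then have "c t \<in> K" using K by auto
    then show ?thesis using ct[OF t(1)] t(2) by simp
  qed
  show ?thesis by (rule bexI[OF _ \<sigma>(1)], intro conjI allI impI mem lim)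
qed

section \<open>Leaves that issue from the zeros of a divergence-free field\<close>

abbreviation leaf_endpoints :: "('a::euclidean_space => 'a) => 'a => real => 'a set" where
  "leaf_endpoints Z x0 r \<equiv> {c b | c a b. a < b \<and> abs_continuous_on a b c \<and> c ` {a..b} \<subseteq> cball x0 r \<and>
    Z (c a) = 0 \<and> (\<forall>t\<in>{a<..b}. Z (c t) \<noteq> 0) \<and>
    (\<exists>N. negligible N \<and> (\<forall>t\<in>{a..b} - N. \<exists>u. (c has_vector_derivative u *\<^sub>R Z (c t)) (at t within {a..b})))}"

text \<open>By \<open>leaf_curve_limit\<close> each end-point is attracted to a zero by the flow of
  Z or of -Z, and both are divergence free. The doubled radius provides a neighbourhood of cball x0
  r on which the cut-off field still equals Z and is differentiable.\<close>

theorem negligible_leaf_curves_from_zeros: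
  fixes Z :: "'a::euclidean_space => 'a"
  assumes r: "r > 0" and U: "open U" "cball x0 (2 * r) \<subseteq> U"
    and Z': "\<And>x. x \<in> U ==> (Z has_derivative Z' x) (at x)" "\<And>x. x \<in> U ==> (\<Sum>b\<in>Basis. Z' x b \<bullet> b) = 0"
    and bd: "\<And>x v. x \<in> cball x0 (2 * r) ==> norm (Z' x v) \<le> B * norm v"
    and null: "negligible {x \<in> U. Z x = 0}"
  shows "negligible (leaf_endpoints Z x0 r)"
    (is "negligible ?E")
proof -
  let ?S = "cball x0 (2 * r)"
  define L where "L = \<bar>B\<bar> + 1"
  have L: "L > 0" by (simp add: L_def add_nonneg_pos)
  have bdL: "norm (Z' x v) \<le> L * norm v" if "x \<in> ?S" for x v proof -
    have "B * norm v \<le> L * norm v" by (intro mult_right_mono) (auto simp: L_def)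
    then show ?thesis using bd[OF that, of v] by linarith
  qed
  have lip: "norm (Z x - Z y) \<le> L * norm (x - y)" if "x \<in> ?S" "y \<in> ?S" for x y
  proof (rule differentiable_bound[OF convex_cball _ _ that(1) that(2)])
    show "(Z has_derivative Z' x) (at x within ?S)" if "x \<in> ?S" for x
      using Z'(1)[OF subsetD[OF U(2) that]] by (rule has_derivative_at_withinI)
    show "onorm (Z' x) \<le> L" if "x \<in> ?S" for x by (rule onorm_le) (rule bdL[OF that])
  qed
  have contZ: "continuous_on ?S Z" by (intro continuous_at_imp_continuous_on ballI has_derivative_continuous[OF Z'(1)] subsetD[OF U(2)])
  obtain M where M: "\<And>x. x \<in> ?S ==> norm (Z x) \<le> M"
    using compact_imp_bounded[OF compact_continuous_image[OF contZ compact_cball]] unfolding bounded_iff by blast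
  define Y where "Y x = Z (closest_point ?S x)" for x
  have field: "lipschitz_field Y L M"
    unfolding Y_def by (rule lipschitz_field_closest_point[OF _ _ _ lip L M]) (use r in auto)
  interpret p: lipschitz_field Y L M by (rule field)
  interpret q: lipschitz_field "\<lambda>x. - Y x" L M using p.lip p.bdd p.L_pos by unfold_locales (auto simp: norm_minus_commute)
  have q_flow: "q.flow s a = p.flow (- s) a" for s a proof -
    have "((\<lambda>s. p.flow (- s) a) has_vector_derivative - Y (p.flow (- s) a)) (at s)" for s
      using has_vector_derivative_affine[of "\<lambda>s. p.flow s a" "Y (p.flow (- s) a)" "-1" s 0] p.flow_deriv[of a "- s"] by simp
    from q.flow_unique[of "\<lambda>s. p.flow (- s) a" s, OF this] show ?thesis by simp
  qed
  have Y_eq: "Y x = Z x" if "x \<in> ?S" for x using that by (simp add: Y_def closest_point_self)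
  let ?B = "ball x0 (2 * r)" and ?K = "cball x0 r"
  have sub: "?K \<subseteq> ?B" "?B \<subseteq> ?S" "?K \<subseteq> ?S" "?B \<subseteq> U" "?K \<subseteq> U" using r U(2) by (auto simp: subset_eq)
  have Yd: "(Y has_derivative Z' x) (at x) \<and> (\<forall>v. norm (Z' x v) \<le> L * norm v) \<and> (\<Sum>b\<in>Basis. Z' x b \<bullet> b) = 0" if x: "x \<in> ?B" for x
  proof (intro conjI allI)
    show "(Y has_derivative Z' x) (at x)" by (rule has_derivative_transform_within_open[OF Z'(1) open_ball x]) (use x U sub Y_eq in auto)
    show "norm (Z' x v) \<le> L * norm v" for v using x sub(2) by (intro bdL) blast
    show "(\<Sum>b\<in>Basis. Z' x b \<bullet> b) = 0" using x sub(4) by (intro Z'(2)) blast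
  qed
  have mYd: "((\<lambda>x. - Y x) has_derivative (\<lambda>v. - Z' x v)) (at x) \<and> (\<forall>v. norm (- Z' x v) \<le> L * norm v) \<and> (\<Sum>b\<in>Basis. - Z' x b \<bullet> b) = 0" if x: "x \<in> ?B" for x
    using Yd[OF x] by (auto intro: has_derivative_minus simp: sum_negf)
  define \<Sigma> where "\<Sigma> = {x \<in> ?K. Z x = 0}"
  have \<Sigma>: "compact \<Sigma>" "negligible \<Sigma>" proof -
    have "\<Sigma> = ?K \<inter> {x \<in> ?K. Z x \<in> {0}}" by (auto simp: \<Sigma>_def)
    moreover have "closed {x \<in> ?K. Z x \<in> {0}}" using continuous_closed_preimage[OF continuous_on_subset[OF contZ sub(3)], of "{0}"]
      by (simp add: vimage_def Int_def)
    ultimately show "compact \<Sigma>" using compact_Int_closed[OF compact_cball] by metis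
    show "negligible \<Sigma>" by (rule negligible_subset[OF null]) (use sub(5) in \<open>auto simp: \<Sigma>_def\<close>)
  qed
  let ?A1 = "{a. (\<forall>s\<ge>0. p.flow s a \<in> ?K) \<and> (\<exists>l\<in>\<Sigma>. ((\<lambda>s. p.flow s a) \<longlongrightarrow> l) at_top)}"
  let ?A2 = "{a. (\<forall>s\<ge>0. q.flow s a \<in> ?K) \<and> (\<exists>l\<in>\<Sigma>. ((\<lambda>s. q.flow s a) \<longlongrightarrow> l) at_top)}"
  have "negligible ?A1" by (rule p.negligible_attracted[OF open_ball Yd compact_cball sub(1) \<Sigma>])
  moreover have "negligible ?A2" by (rule q.negligible_attracted[OF open_ball mYd compact_cball sub(1) \<Sigma>])
  moreover have "?E \<subseteq> ?A1 \<union> ?A2"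
  proof clarify
    fix c a b N assume c: "a < b" "abs_continuous_on a b c" "c ` {a..b} \<subseteq> ?K" "Z (c a) = 0"
      "\<forall>t\<in>{a<..b}. Z (c t) \<noteq> 0" "negligible N"
      "\<forall>t\<in>{a..b} - N. \<exists>u. (c has_vector_derivative u *\<^sub>R Z (c t)) (at t within {a..b})"
      and n2: "\<not> ((\<forall>s\<ge>0. q.flow s (c b) \<in> ?K) \<and> (\<exists>l\<in>\<Sigma>. ((\<lambda>s. q.flow s (c b)) \<longlongrightarrow> l) at_top))"
    have cS: "c t \<in> ?K" "c t \<in> ?S" if "t \<in> {a..b}" for t using c(3) that sub by blast+
    have YZ: "Y (c t) = Z (c t)" if "t \<in> {a..b}" for t using cS that by (intro Y_eq)
    have "\<exists>\<sigma>\<in>{1, -1}. (\<forall>s\<ge>0. p.flow (\<sigma> * s) (c b) \<in> ?K) \<and> ((\<lambda>s. p.flow (\<sigma> * s) (c b)) \<longlongrightarrow> c a) at_top"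
      by (rule p.leaf_curve_limit[OF c(1,2,3) _ _ c(6)]) (use c YZ in auto)
    moreover have "c a \<in> \<Sigma>" using cS[of a] c by (simp add: \<Sigma>_def)
    ultimately show "(\<forall>s\<ge>0. p.flow s (c b) \<in> ?K) \<and> (\<exists>l\<in>\<Sigma>. ((\<lambda>s. p.flow s (c b)) \<longlongrightarrow> l) at_top)"
      using n2 by (auto simp: q_flow)
  qed
  ultimately show ?thesis by (meson negligible_Un negligible_subset)
qed

subsection \<open>Calculus of \<open>C\<^sup>k\<close> maps\<close>

lemma Ck_on_cong:
  assumes S: "open S" and eq: "\<And>x. x \<in> S ==> f x = g x" and f: "Ck_on k S f"
  shows "Ck_on k S g" using eq f
proof (induction k arbitrary: f g)
  case 0 then show ?case using continuous_on_cong by force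
next
  case (Suc k)
  have d: "(g has_derivative fderiv f x) (at x)" if "x \<in> S" for x
  proof (rule has_derivative_transform_within_open[OF _ S that])
    show "(f has_derivative fderiv f x) (at x)" using Suc.prems(2) that by (simp add: frechet_derivative_works[symmetric])
  qed (rule Suc.prems(1))
  then have eq': "fderiv f x = fderiv g x" if "x \<in> S" for x using frechet_derivative_at that by blast
  show ?case unfolding Ck_on.simps
  proof (intro conjI ballI allI)
    show "g differentiable at x" if "x \<in> S" for x using d that unfolding differentiable_def by blast
    show "Ck_on k S (\<lambda>x. fderiv g x v)" for v by (rule Suc.IH[of "\<lambda>x. fderiv f x v"]) (use eq' Suc in auto)
  qed
qed

lemma Ck_on_subset:
  assumes "Ck_on k S f" "T \<subseteq> S" shows "Ck_on k T f" using assms(1)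
  by (induction k arbitrary: f) (use assms(2) in \<open>auto intro: continuous_on_subset\<close>)

lemma Ck_on_continuous:
  assumes "Ck_on k S f" shows "continuous_on S f"
proof (cases k)
  case 0 then show ?thesis using assms by simp
next
  case (Suc j)
  then have "\<forall>x\<in>S. f differentiable at x" using assms by simp
  then show ?thesis by (meson continuous_at_imp_continuous_on differentiable_imp_continuous_within)
qed

lemma Ck_on_Suc_imp: "Ck_on (Suc k) S f ==> Ck_on k S f"
proof (induction k arbitrary: f)
  case 0
  have "continuous_on S f" by (rule Ck_on_continuous[OF 0])
  then show ?case by simp
qed auto

lemma Ck_on_SucI:
  assumes "open S" "\<And>x. x \<in> S ==> (f has_derivative f' x) (at x)" "\<And>v. Ck_on k S (\<lambda>x. f' x v)"
  shows "Ck_on (Suc k) S f"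
  unfolding Ck_on.simps
proof (intro conjI ballI allI)
  show "f differentiable at x" if "x \<in> S" for x using assms(2) that unfolding differentiable_def by blast
  show "Ck_on k S (\<lambda>x. fderiv f x v)" for v
    by (rule Ck_on_cong[OF assms(1) _ assms(3)[of v]]) (use frechet_derivative_at[OF assms(2)] in auto)
qed

lemma Ck_on_deriv:
  "Ck_on (Suc k) S f ==> x \<in> S ==> (f has_derivative fderiv f x) (at x)"
  by (simp add: frechet_derivative_works[symmetric])

lemma Ck_on_const: "open S ==> Ck_on k S (\<lambda>x. c)"
proof (induction k arbitrary: c)
  case (Suc k) then show ?case by (intro Ck_on_SucI[where f' = "\<lambda>x v. 0"]) auto
qed simp

lemma Ck_on_add:
  assumes "open S" "Ck_on k S f" "Ck_on k S g" shows "Ck_on k S (\<lambda>x. f x + g x)" using assms(2,3)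
proof (induction k arbitrary: f g)
  case 0 then show ?case by (auto intro: continuous_intros)
next
  case (Suc k)
  show ?case by (rule Ck_on_SucI[OF assms(1), where f' = "\<lambda>x v. fderiv f x v + fderiv g x v"])
      (use Suc in \<open>auto intro!: has_derivative_add simp: frechet_derivative_works[symmetric]\<close>)
qed

lemma Ck_on_sum:
  assumes "open S" "\<And>i. i \<in> I ==> Ck_on k S (f i)" shows "Ck_on k S (\<lambda>x. \<Sum>i\<in>I. f i x)"
  using assms(2) by (induction I rule: infinite_finite_induct) (auto intro: Ck_on_const Ck_on_add assms(1))

lemma Ck_on_bounded_linear:
  assumes "open S" "bounded_linear h" "Ck_on k S f" shows "Ck_on k S (\<lambda>x. h (f x))" using assms(3)
proof (induction k arbitrary: f)
  case 0 then show ?case using bounded_linear.continuous_on[OF assms(2)] by auto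
next
  case (Suc k)
  show ?case by (rule Ck_on_SucI[OF assms(1), where f' = "\<lambda>x v. h (fderiv f x v)"])
      (use Suc in \<open>auto intro!: bounded_linear.has_derivative[OF assms(2)] simp: frechet_derivative_works[symmetric]\<close>)
qed

lemma Ck_on_bounded_bilinear:
  assumes "open S" "bounded_bilinear h" "Ck_on k S f" "Ck_on k S g" shows "Ck_on k S (\<lambda>x. h (f x) (g x))" using assms(3,4)
proof (induction k arbitrary: f g)
  case 0 then show ?case using bounded_bilinear.continuous_on[OF assms(2)] by auto
next
  case (Suc k)
  show ?case
  proof (rule Ck_on_SucI[OF assms(1), where f' = "\<lambda>x v. h (f x) (fderiv g x v) + h (fderiv f x v) (g x)"])
    show "((\<lambda>x. h (f x) (g x)) has_derivative (\<lambda>v. h (f x) (fderiv g x v) + h (fderiv f x v) (g x))) (at x)"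
      if "x \<in> S" for x
      by (rule bounded_bilinear.FDERIV[OF assms(2)]) (rule Ck_on_deriv[OF Suc.prems(1) that] Ck_on_deriv[OF Suc.prems(2) that])+
    show "Ck_on k S (\<lambda>x. h (f x) (fderiv g x v) + h (fderiv f x v) (g x))" for v using Suc.prems
      by (intro Ck_on_add[OF assms(1)] Suc.IH Ck_on_Suc_imp[OF Suc.prems(1)] Ck_on_Suc_imp[OF Suc.prems(2)]) auto
  qed
qed

lemmas Ck_on_scaleR = Ck_on_bounded_bilinear[OF _ bounded_bilinear_scaleR]
  and Ck_on_inner = Ck_on_bounded_bilinear[OF _ bounded_bilinear_inner]
  and Ck_on_mult = Ck_on_bounded_bilinear[OF _ bounded_bilinear_mult[where 'a = real]]

lemma Ck_on_minus:
  assumes "open S" "Ck_on k S f" shows "Ck_on k S (\<lambda>x. - f x)"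
  using Ck_on_bounded_linear[OF assms(1) bounded_linear_minus[OF bounded_linear_ident] assms(2)] .

lemma Ck_on_diff:
  assumes "open S" "Ck_on k S f" "Ck_on k S g" shows "Ck_on k S (\<lambda>x. f x - g x)"
  using Ck_on_add[OF assms(1,2) Ck_on_minus[OF assms(1,3)]] by simp

lemma Ck_on_id: "open S ==> Ck_on k S (\<lambda>x. x)"
proof (cases k)
  case (Suc j)
  then show "open S ==> ?thesis" by (auto intro!: Ck_on_SucI[where f' = "\<lambda>x v. v"] Ck_on_const)
qed auto

lemma Ck_on_prod:
  assumes "open S" "finite I" "\<And>i. i \<in> I ==> Ck_on k S (f i)" shows "Ck_on k S (\<lambda>x. \<Prod>i\<in>I. f i x :: real)"
  using assms(2,3) by (induction I rule: finite_induct) (auto intro: Ck_on_const Ck_on_mult assms(1))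

lemma Ck_on_inverse:
  fixes f :: "'a::euclidean_space => real"
  assumes "open S" "Ck_on k S f" "\<And>x. x \<in> S ==> f x \<noteq> 0" shows "Ck_on k S (\<lambda>x. inverse (f x))"
  using assms(2)
proof (induction k)
  case 0 then show ?case using assms(3) by (auto intro!: continuous_intros)
next
  case (Suc k)
  show ?case
  proof (rule Ck_on_SucI[OF assms(1), where f' = "\<lambda>x v. - (inverse (f x) * fderiv f x v * inverse (f x))"])
    show "((\<lambda>x. inverse (f x)) has_derivative (\<lambda>v. - (inverse (f x) * fderiv f x v * inverse (f x)))) (at x)"
      if "x \<in> S" for x by (intro Deriv.has_derivative_inverse assms(3) that Ck_on_deriv[OF Suc.prems])
    show "Ck_on k S (\<lambda>x. - (inverse (f x) * fderiv f x v * inverse (f x)))" for v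
      using Suc.prems by (intro Ck_on_minus[OF assms(1)] Ck_on_mult[OF assms(1)] Suc.IH Ck_on_Suc_imp[OF Suc.prems]) auto
  qed
qed

lemma Ck_on_componentwise:
  assumes "open S" shows "Ck_on k S f \<longleftrightarrow> (\<forall>b\<in>Basis. Ck_on k S (\<lambda>x. f x \<bullet> b))"
proof
  assume "Ck_on k S f" then show "\<forall>b\<in>Basis. Ck_on k S (\<lambda>x. f x \<bullet> b)"
    using Ck_on_inner[OF assms _ Ck_on_const[OF assms]] by blast
next
  assume *: "\<forall>b\<in>Basis. Ck_on k S (\<lambda>x. f x \<bullet> b)"
  have "Ck_on k S (\<lambda>x. \<Sum>b\<in>Basis. (f x \<bullet> b) *\<^sub>R b)"
    by (intro Ck_on_sum Ck_on_scaleR assms Ck_on_const) (use * in auto)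
  then show "Ck_on k S f" by (simp add: euclidean_representation)
qed

lemma Ck_on_Pair:
  assumes "open S" "Ck_on k S f" "Ck_on k S g" shows "Ck_on k S (\<lambda>x. (f x, g x))"
proof -
  have "Ck_on k S (\<lambda>x. (f x, 0) + (0, g x))"
    by (intro Ck_on_add assms Ck_on_bounded_linear[OF assms(1) _ assms(2), of "\<lambda>x. (x, 0)"]
      Ck_on_bounded_linear[OF assms(1) _ assms(3), of "\<lambda>x. (0, x)"] bounded_linear_Pair bounded_linear_ident bounded_linear_zero)
  then show ?thesis by simp
qed

text \<open>\<open>Ck_on\<close> recurses on derivatives in fixed directions, but the chain rule
  produces a moving one. Expanding it in the basis gives scalar functions times derivatives of g in
  fixed directions, to which the induction hypothesis applies.\<close>

lemma Ck_on_compose: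
  fixes f :: "'a::euclidean_space => 'b::euclidean_space" and g :: "'b => 'c::euclidean_space"
  assumes "open S" "f ` S \<subseteq> T" "Ck_on k S f" "Ck_on k T g"
  shows "Ck_on k S (\<lambda>x. g (f x))" using assms(3,4)
proof (induction k arbitrary: g)
  case 0 then show ?case using assms(2) continuous_on_compose2 by (metis Ck_on.simps(1))
next
  case (Suc k)
  have fx: "f x \<in> T" if "x \<in> S" for x using that assms(2) by auto
  show ?case
  proof (rule Ck_on_SucI[OF assms(1), where f' = "\<lambda>x v. \<Sum>b\<in>Basis. (fderiv f x v \<bullet> b) *\<^sub>R fderiv g (f x) b"])
    show "((\<lambda>x. g (f x)) has_derivative (\<lambda>v. \<Sum>b\<in>Basis. (fderiv f x v \<bullet> b) *\<^sub>R fderiv g (f x) b)) (at x)"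
      if "x \<in> S" for x proof -
      note g = Ck_on_deriv[OF Suc.prems(2) fx[OF that]]
      have "((\<lambda>x. g (f x)) has_derivative (\<lambda>v. fderiv g (f x) (fderiv f x v))) (at x)"
        by (rule has_derivative_compose[OF Ck_on_deriv[OF Suc.prems(1) that] g])
      moreover have "fderiv g (f x) w = (\<Sum>b\<in>Basis. (w \<bullet> b) *\<^sub>R fderiv g (f x) b)" for w proof -
        have "linear (fderiv g (f x))" using g has_derivative_linear by blast
        then have "fderiv g (f x) (\<Sum>b\<in>Basis. (w \<bullet> b) *\<^sub>R b) = (\<Sum>b\<in>Basis. (w \<bullet> b) *\<^sub>R fderiv g (f x) b)"
          by (simp add: linear_sum linear_scale)
        then show ?thesis by (simp add: euclidean_representation)
      qed
      ultimately show ?thesis by (metis (no_types, lifting) ext)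
    qed
    show "Ck_on k S (\<lambda>x. \<Sum>b\<in>Basis. (fderiv f x v \<bullet> b) *\<^sub>R fderiv g (f x) b)" for v using Suc.prems
      by (intro Ck_on_sum Ck_on_scaleR Ck_on_inner Ck_on_const assms(1) Suc.IH Ck_on_Suc_imp[OF Suc.prems(1)]) auto
  qed
qed

subsection \<open>Symmetry of second derivatives\<close>

lemma Ck_on_frechet_bound:
  fixes f :: "'a::euclidean_space => 'b::euclidean_space"
  assumes f: "Ck_on (Suc 0) S f" and K: "compact K" "K \<subseteq> S"
  shows "\<exists>B. \<forall>x\<in>K. \<forall>v. norm (fderiv f x v) \<le> B * norm v"
proof -
  have "\<exists>C. \<forall>x\<in>K. norm (fderiv f x b) \<le> C" for b proof -
    have "continuous_on K (\<lambda>x. fderiv f x b)" using f K(2) by (auto intro: continuous_on_subset)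
    from compact_imp_bounded[OF compact_continuous_image[OF this K(1)]]
    show ?thesis unfolding bounded_iff by blast
  qed
  then obtain C where C: "\<And>b x. x \<in> K ==> norm (fderiv f x b) \<le> C b" by metis
  show ?thesis
  proof (intro exI[of _ "\<Sum>b\<in>Basis. C b"] ballI allI)
    fix x and v :: 'a assume x: "x \<in> K"
    have lin: "linear (fderiv f x)" using Ck_on_deriv[OF f] x K(2) has_derivative_linear by blast
    have "fderiv f x v = fderiv f x (\<Sum>b\<in>Basis. (v \<bullet> b) *\<^sub>R b)" by (simp add: euclidean_representation)
    also have "\<dots> = (\<Sum>b\<in>Basis. (v \<bullet> b) *\<^sub>R fderiv f x b)" using lin by (simp add: linear_sum linear_scale)
    also have "norm \<dots> \<le> (\<Sum>b\<in>Basis. norm v * C b)"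
    proof (rule sum_norm_le)
      fix b :: 'a assume b: "b \<in> Basis"
      show "norm ((v \<bullet> b) *\<^sub>R fderiv f x b) \<le> norm v * C b"
        using Basis_le_norm[OF b, of v] C[OF x, of b] by (simp add: mult_mono)
    qed
    finally show "norm (fderiv f x v) \<le> (\<Sum>b\<in>Basis. C b) * norm v" by (simp add: sum_distrib_left mult.commute)
  qed
qed

text \<open>Both mixed derivatives are limits of the same second difference quotient, by two
  applications of the mean value theorem.\<close>

lemma second_difference_mean_value:
  fixes g :: "'a::euclidean_space => real"
  assumes S: "open S" and g: "Ck_on 2 S g" and h: "h > 0"
    and sub: "\<And>s t. [|0 \<le> s; s \<le> h; 0 \<le> t; t \<le> h|] ==> x + s *\<^sub>R u + t *\<^sub>R v \<in> S"
  shows "\<exists>s t. 0 < s \<and> s < h \<and> 0 < t \<and> t < h \<and>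
    g (x + h *\<^sub>R u + h *\<^sub>R v) - g (x + h *\<^sub>R u) - g (x + h *\<^sub>R v) + g x
      = h * (h * fderiv (\<lambda>y. fderiv g y u) (x + s *\<^sub>R u + t *\<^sub>R v) v)"
proof -
  let ?D = "\<lambda>y. fderiv g y"
  have g2: "Ck_on (Suc (Suc 0)) S g" using g by (simp only: numeral_2_eq_2)
  have dg: "(g has_derivative ?D y) (at y)" if "y \<in> S" for y using Ck_on_deriv[OF g2 that] .
  have dDg: "((\<lambda>y. ?D y u) has_derivative fderiv (\<lambda>y. ?D y u) y) (at y)" if "y \<in> S" for y
    using g2 that by (simp add: frechet_derivative_works[symmetric])
  define p where "p s = g (x + s *\<^sub>R u + h *\<^sub>R v) - g (x + s *\<^sub>R u)" for s
  have line: "((\<lambda>s. k (z + s *\<^sub>R w)) has_real_derivative k' w) (at s)"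
    if "(k has_derivative k') (at (z + s *\<^sub>R w))" for k :: "'a => real" and k' z w s proof -
    have "((\<lambda>s. z + s *\<^sub>R w) has_derivative (\<lambda>s. s *\<^sub>R w)) (at s)" by (auto intro!: derivative_eq_intros)
    from has_derivative_compose[OF this that]
    have "((\<lambda>s. k (z + s *\<^sub>R w)) has_derivative (\<lambda>s. k' (s *\<^sub>R w))) (at s)" .
    moreover have "linear k'" using that has_derivative_linear by blast
    ultimately show ?thesis by (simp add: has_field_derivative_def linear_scale mult_commute_abs)
  qed
  have "\<exists>s>0. s < h \<and> p h - p 0 = (h - 0) * (?D (x + s *\<^sub>R u + h *\<^sub>R v) u - ?D (x + s *\<^sub>R u) u)"
  proof (rule MVT2[OF h])
    fix s assume s: "0 \<le> s" "s \<le> h"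
    have "((\<lambda>s. g ((x + h *\<^sub>R v) + s *\<^sub>R u)) has_real_derivative ?D ((x + h *\<^sub>R v) + s *\<^sub>R u) u) (at s)"
      by (rule line, rule dg) (use sub[of s h] s h in \<open>simp add: algebra_simps\<close>)
    moreover have "((\<lambda>s. g (x + s *\<^sub>R u)) has_real_derivative ?D (x + s *\<^sub>R u) u) (at s)"
      by (rule line, rule dg) (use sub[of s 0] s h in simp)
    ultimately show "(p has_real_derivative ?D (x + s *\<^sub>R u + h *\<^sub>R v) u - ?D (x + s *\<^sub>R u) u) (at s)"
      unfolding p_def by (auto intro!: derivative_eq_intros simp: algebra_simps)
  qed
  then obtain s where s: "0 < s" "s < h" "p h - p 0 = h * (?D (x + s *\<^sub>R u + h *\<^sub>R v) u - ?D (x + s *\<^sub>R u) u)" by auto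
  have "\<exists>t>0. t < h \<and> ?D (x + s *\<^sub>R u + h *\<^sub>R v) u - ?D (x + s *\<^sub>R u + 0 *\<^sub>R v) u
     = (h - 0) * fderiv (\<lambda>y. ?D y u) (x + s *\<^sub>R u + t *\<^sub>R v) v"
  proof (rule MVT2[OF h])
    fix t assume t: "0 \<le> t" "t \<le> h"
    show "((\<lambda>t. ?D (x + s *\<^sub>R u + t *\<^sub>R v) u) has_real_derivative fderiv (\<lambda>y. ?D y u) (x + s *\<^sub>R u + t *\<^sub>R v) v) (at t)"
      by (rule line, rule dDg) (use sub[of s t] s t in simp)
  qed
  then obtain t where t: "0 < t" "t < h"
    "?D (x + s *\<^sub>R u + h *\<^sub>R v) u - ?D (x + s *\<^sub>R u) u = h * fderiv (\<lambda>y. ?D y u) (x + s *\<^sub>R u + t *\<^sub>R v) v"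
    by auto
  show ?thesis by (intro exI[of _ s] exI[of _ t] conjI s t) (use s(3) t(3) in \<open>simp add: p_def\<close>)
qed

lemma symmetric_second_derivative_real:
  fixes g :: "'a::euclidean_space => real"
  assumes S: "open S" and g: "Ck_on 2 S g" and x: "x \<in> S"
  shows "fderiv (\<lambda>y. fderiv g y u) x v
    = fderiv (\<lambda>y. fderiv g y v) x u"
proof -
  define E where "E u v y = fderiv (\<lambda>y. fderiv g y u) y v" for u v y
  have cont: "continuous_on S (E u v)" for u v
    unfolding E_def using g by (simp add: numeral_2_eq_2)
  have "\<bar>E u v x - E v u x\<bar> \<le> e" if "e > 0" for e proof -
    have "\<exists>d>0. \<forall>y\<in>S. dist y x < d \<longrightarrow> dist (E u v y) (E u v x) < e / 2" for u v
      using cont[of u v] x \<open>e > 0\<close> unfolding continuous_on_iff by (meson half_gt_zero)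
    then obtain d1 d2 where d: "d1 > 0" "d2 > 0"
      "\<And>y. [|y \<in> S; dist y x < d1|] ==> dist (E u v y) (E u v x) < e / 2"
      "\<And>y. [|y \<in> S; dist y x < d2|] ==> dist (E v u y) (E v u x) < e / 2" by meson
    obtain d3 where d3: "d3 > 0" "ball x d3 \<subseteq> S" using S x open_contains_ball by blast
    define d where "d = min d1 (min d2 d3)"
    have dpos: "d > 0" using d d3 by (simp add: d_def)
    \<comment> \<open>With this h all points x + s u + t v with s, t in {0..h} lie within d / 2 of
      x.\<close>
    define h where "h = d / (2 * (norm u + norm v + 1))"
    have np: "norm u + norm v + 1 > 0" by (simp add: add_nonneg_pos)
    have h: "h > 0" using dpos np by (simp add: h_def)
    have near: "dist (x + s *\<^sub>R u + t *\<^sub>R v) x < d" if "0 \<le> s" "s \<le> h" "0 \<le> t" "t \<le> h" for s t proof -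
      have "dist (x + s *\<^sub>R u + t *\<^sub>R v) x = norm (s *\<^sub>R u + t *\<^sub>R v)" by (simp add: dist_norm algebra_simps)
      also have "\<dots> \<le> s * norm u + t * norm v" using norm_triangle_ineq[of "s *\<^sub>R u" "t *\<^sub>R v"] that by simp
      also have "\<dots> \<le> h * norm u + h * norm v" using that by (intro add_mono mult_right_mono) auto
      also have "\<dots> \<le> h * (norm u + norm v + 1)" using h by (simp add: algebra_simps)
      also have "\<dots> = d / 2" using np unfolding h_def by (metis divide_divide_eq_left nonzero_eq_divide_eq less_irrefl)
      finally show ?thesis using dpos by simp
    qed
    have inS: "x + s *\<^sub>R u + t *\<^sub>R v \<in> S" "x + s *\<^sub>R v + t *\<^sub>R u \<in> S" if "0 \<le> s" "s \<le> h" "0 \<le> t" "t \<le> h" for s t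
      using near[OF that] near[of t s] that d3(2) by (auto simp: d_def dist_commute subset_iff add.commute add.left_commute)
    obtain s t where st: "0 < s" "s < h" "0 < t" "t < h"
      "g (x + h *\<^sub>R u + h *\<^sub>R v) - g (x + h *\<^sub>R u) - g (x + h *\<^sub>R v) + g x = h * (h * E u v (x + s *\<^sub>R u + t *\<^sub>R v))"
      using second_difference_mean_value[OF S g h inS(1)] unfolding E_def by blast
    obtain s' t' where st': "0 < s'" "s' < h" "0 < t'" "t' < h"
      "g (x + h *\<^sub>R v + h *\<^sub>R u) - g (x + h *\<^sub>R v) - g (x + h *\<^sub>R u) + g x = h * (h * E v u (x + s' *\<^sub>R v + t' *\<^sub>R u))"
      using second_difference_mean_value[OF S g h inS(2)] unfolding E_def by blast
    have "h * (h * E u v (x + s *\<^sub>R u + t *\<^sub>R v)) = h * (h * E v u (x + s' *\<^sub>R v + t' *\<^sub>R u))"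
      using st(5) st'(5) by (simp add: algebra_simps)
    then have eq: "E u v (x + s *\<^sub>R u + t *\<^sub>R v) = E v u (x + s' *\<^sub>R v + t' *\<^sub>R u)" using h by simp
    have "dist (E u v (x + s *\<^sub>R u + t *\<^sub>R v)) (E u v x) < e / 2"
      using near[of s t] inS(1)[of s t] st by (intro d(3)) (auto simp: d_def)
    moreover have "dist (E v u (x + s' *\<^sub>R v + t' *\<^sub>R u)) (E v u x) < e / 2"
    proof (rule d(4))
      show "x + s' *\<^sub>R v + t' *\<^sub>R u \<in> S" using inS(2)[of s' t'] st' by simp
      have eq: "x + s' *\<^sub>R v + t' *\<^sub>R u = x + t' *\<^sub>R u + s' *\<^sub>R v" by simp
      show "dist (x + s' *\<^sub>R v + t' *\<^sub>R u) x < d2" unfolding eq using near[of t' s'] st' by (simp add: d_def)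
    qed
    ultimately show ?thesis unfolding eq dist_real_def by linarith
  qed
  then have "\<bar>E u v x - E v u x\<bar> \<le> 0" by (rule field_le_epsilon[of _ 0, simplified])
  then show ?thesis by (simp add: E_def)
qed

lemma symmetric_second_derivative:
  fixes g :: "'a::euclidean_space => 'b::euclidean_space"
  assumes S: "open S" and g: "Ck_on 2 S g" and x: "x \<in> S"
  shows "fderiv (\<lambda>y. fderiv g y u) x v
    = fderiv (\<lambda>y. fderiv g y v) x u"
proof (rule euclidean_eqI)
  fix b :: 'b assume b: "b \<in> Basis"
  have g2: "Ck_on (Suc (Suc 0)) S g" using g by (simp only: numeral_2_eq_2)
  have comp: "fderiv (\<lambda>y. fderiv (\<lambda>y. g y \<bullet> b) y u) x v
    = fderiv (\<lambda>y. fderiv g y u) x v \<bullet> b" for u v proof -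
    have 1: "fderiv (\<lambda>y. g y \<bullet> b) y u = fderiv g y u \<bullet> b" if "y \<in> S" for y
      using frechet_derivative_at[OF bounded_linear.has_derivative[OF bounded_linear_inner_left
        Ck_on_deriv[OF g2 that], of b]] by (metis (no_types))
    have "((\<lambda>y. fderiv g y u \<bullet> b) has_derivative (\<lambda>v. fderiv (\<lambda>y. fderiv g y u) x v \<bullet> b)) (at x)"
      using g2 x by (intro bounded_linear.has_derivative[OF bounded_linear_inner_left]) (simp add: frechet_derivative_works[symmetric])
    then have "((\<lambda>y. fderiv (\<lambda>y. g y \<bullet> b) y u) has_derivative (\<lambda>v. fderiv (\<lambda>y. fderiv g y u) x v \<bullet> b)) (at x)"
      by (rule has_derivative_transform_within_open[OF _ S x]) (use 1 in auto)
    from frechet_derivative_at[OF this] show ?thesis by (metis (no_types))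
  qed
  have "Ck_on 2 S (\<lambda>y. g y \<bullet> b)" by (intro Ck_on_inner S g Ck_on_const)
  from symmetric_second_derivative_real[OF S this x, of u v]
  show "fderiv (\<lambda>y. fderiv g y u) x v \<bullet> b
    = fderiv (\<lambda>y. fderiv g y v) x u \<bullet> b" unfolding comp .
qed

subsection \<open>The Pfaffian vector of a skew form in odd dimension\<close>

text \<open>Up to the factor \<open>2\<^sup>k\<close>, \<open>pf_sum k \<nu> \<mu> v\<close> is the value of the form \<open>\<nu> \<and> \<mu>\<^sup>k\<close> on
  the vectors \<open>v 0, \<dots>, v (2 * k)\<close>.\<close>

abbreviation pf_pair :: "('v => 'v => real) => (nat => 'v) => (nat => nat) => nat => real" where
  "pf_pair \<mu> v \<pi> i \<equiv> \<mu> (v (\<pi> (2 * i + 1))) (v (\<pi> (2 * i + 2)))"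

definition pf_coeff :: "nat => ('v => 'v => real) => (nat => 'v) => (nat => nat) => real" where
  "pf_coeff k \<mu> v \<pi> = of_int (sign \<pi>) * (\<Prod>j<k. pf_pair \<mu> v \<pi> j)"

definition pf_sum :: "nat => ('v => real) => ('v => 'v => real) => (nat => 'v) => real" where
  "pf_sum k \<nu> \<mu> v = (\<Sum>\<pi> | \<pi> permutes {..2 * k}. pf_coeff k \<mu> v \<pi> * \<nu> (v (\<pi> 0)))"

text \<open>If v is a basis and vol a volume form, this is up to a constant the vector Z determined
  by \<nu> \<and> \<mu>^k = \<nu>(Z) vol for all \<nu>; compare
  \<open>linear_pf_vec\<close>.\<close>

definition pf_vec :: "nat => ('v::real_vector => 'v => real) => (nat => 'v) => 'v" where
  "pf_vec k \<mu> v = (\<Sum>\<pi> | \<pi> permutes {..2 * k}. pf_coeff k \<mu> v \<pi> *\<^sub>R v (\<pi> 0))"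

definition skew_form :: "('v::real_vector => 'v => real) => bool" where
  "skew_form \<mu> \<longleftrightarrow> (\<forall>u. linear (\<mu> u)) \<and> (\<forall>u v. \<mu> u v = - \<mu> v u)"

lemma skew_formD:
  assumes "skew_form \<mu>"
  shows "linear (\<mu> u)" "linear (\<lambda>u. \<mu> u v)" "\<mu> u v = - \<mu> v u" "\<mu> u u = 0"
proof -
  show l: "linear (\<mu> u)" and s: "\<mu> u v = - \<mu> v u" for u v using assms unfolding skew_form_def by blast+
  have "(\<lambda>u. \<mu> u v) = (\<lambda>u. - \<mu> v u)" using s by blast
  then show "linear (\<lambda>u. \<mu> u v)" using linear_compose_neg[OF l] by simp
  show "\<mu> u u = 0" using s[of u u] by simp
qed

lemma linear_pf_vec:
  assumes "linear \<nu>" shows "\<nu> (pf_vec k \<mu> v) = pf_sum k \<nu> \<mu> v"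
proof -
  have "\<nu> (pf_coeff k \<mu> v \<pi> *\<^sub>R v (\<pi> 0)) = pf_coeff k \<mu> v \<pi> * \<nu> (v (\<pi> 0))" for \<pi>
    by (simp only: linear_cmul[OF assms] real_scaleR_def)
  then show ?thesis by (simp only: pf_vec_def pf_sum_def linear_sum[OF assms])
qed

lemma sign_o:
  assumes "\<pi> permutes {..n::nat}" "\<rho> permutes {..n}"
  shows "sign (\<pi> \<circ> \<rho>) = sign \<pi> * sign \<rho>" by (rule sign_compose) (use assms permutation_permutes in blast)+

lemma transpose_permutes: "[|a \<le> n; b \<le> n|] ==> Transposition.transpose a b permutes {..n::nat}"
  by (rule permutes_swap_id) auto

lemma sum_perms_right:
  assumes "\<rho> permutes {..n::nat}"
  shows "(\<Sum>\<pi> | \<pi> permutes {..n}. f (\<pi> \<circ> \<rho>)) = (\<Sum>\<pi> | \<pi> permutes {..n}. f \<pi> :: real)"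
  by (rule sum.reindex_bij_witness[of _ "\<lambda>\<pi>. \<pi> \<circ> inv \<rho>" "\<lambda>\<pi>. \<pi> \<circ> \<rho>"])
    (use assms in \<open>auto simp: comp_assoc permutes_inv_o intro: permutes_compose permutes_inv\<close>)

lemma sum_perms_left:
  assumes "\<rho> permutes {..n::nat}"
  shows "(\<Sum>\<pi> | \<pi> permutes {..n}. f (\<rho> \<circ> \<pi>)) = (\<Sum>\<pi> | \<pi> permutes {..n}. f \<pi> :: real)"
  by (rule sum.reindex_bij_witness[of _ "\<lambda>\<pi>. inv \<rho> \<circ> \<pi>" "\<lambda>\<pi>. \<rho> \<circ> \<pi>"])
    (use assms in \<open>auto simp: comp_assoc[symmetric] permutes_inv_o intro: permutes_compose permutes_inv\<close>)

lemma sum_perms_right_on: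
  assumes "\<rho> permutes {..n::nat}" "\<rho> p = q"
  shows "(\<Sum>\<pi> | \<pi> permutes {..n} \<and> \<pi> q = l. f (\<pi> \<circ> \<rho>)) = (\<Sum>\<pi> | \<pi> permutes {..n} \<and> \<pi> p = l. f \<pi> :: real)"
proof (rule sum.reindex_bij_witness[of _ "\<lambda>\<pi>. \<pi> \<circ> inv \<rho>" "\<lambda>\<pi>. \<pi> \<circ> \<rho>"])
  have i: "inv \<rho> q = p" using assms by (metis permutes_inverses(2))
  show "b \<circ> inv \<rho> \<in> {\<pi>. \<pi> permutes {..n} \<and> \<pi> q = l}" if "b \<in> {\<pi>. \<pi> permutes {..n} \<and> \<pi> p = l}" for b
    using that assms i by (auto intro: permutes_compose permutes_inv)
qed (use assms in \<open>auto simp: comp_assoc permutes_inv_o intro: permutes_compose permutes_inv\<close>)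

lemma sum_perms_by_preimage:
  assumes "l \<le> n"
  shows "(\<Sum>\<pi> | \<pi> permutes {..n::nat}. f \<pi>) = (\<Sum>q\<le>n. \<Sum>\<pi> | \<pi> permutes {..n} \<and> \<pi> q = l. f \<pi> :: real)"
proof -
  have fin: "finite {\<pi>. \<pi> permutes {..n}}" by (rule finite_permutations) simp
  have "(\<Sum>q\<le>n. \<Sum>\<pi> | \<pi> permutes {..n} \<and> \<pi> q = l. f \<pi>) = (\<Sum>q\<le>n. sum f {\<pi> \<in> {\<pi>. \<pi> permutes {..n}}. inv \<pi> l = q})"
  proof (intro sum.cong refl arg_cong2[where f = sum])
    fix q show "{\<pi>. \<pi> permutes {..n} \<and> \<pi> q = l} = {\<pi> \<in> {\<pi>. \<pi> permutes {..n}}. inv \<pi> l = q}"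
      by (auto simp: permutes_inverses)
  qed
  also have "\<dots> = (\<Sum>\<pi> | \<pi> permutes {..n}. f \<pi>)"
    by (rule sum.group[OF fin]) (use assms permutes_inv permutes_in_image in \<open>fastforce+\<close>)
  finally show ?thesis by simp
qed

lemma pf_sum_cong:
  assumes "\<And>i. i \<le> 2 * k ==> v i = w i" shows "pf_sum k \<nu> \<mu> v = pf_sum k \<nu> \<mu> w"
  unfolding pf_sum_def
proof (rule sum.cong[OF refl])
  fix \<pi> assume "\<pi> \<in> {\<pi>. \<pi> permutes {..2 * k}}"
  then have \<pi>: "\<pi> i \<le> 2 * k" if "i \<le> 2 * k" for i using permutes_in_image[of \<pi> "{..2 * k}" i] that by simp
  have "pf_coeff k \<mu> v \<pi> = pf_coeff k \<mu> w \<pi>"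
    unfolding pf_coeff_def by (intro arg_cong2[where f = "(*)"] prod.cong refl) (use \<pi> assms in auto)
  then show "pf_coeff k \<mu> v \<pi> * \<nu> (v (\<pi> 0)) = pf_coeff k \<mu> w \<pi> * \<nu> (w (\<pi> 0))" using \<pi> assms by simp
qed

lemma pf_sum_compose:
  assumes "\<rho> permutes {..2 * k}" shows "pf_sum k \<nu> \<mu> (v \<circ> \<rho>) = of_int (sign \<rho>) * pf_sum k \<nu> \<mu> v"
proof -
  let ?f = "\<lambda>\<pi>. pf_coeff k \<mu> v \<pi> * \<nu> (v (\<pi> 0))"
  have "pf_coeff k \<mu> (v \<circ> \<rho>) \<pi> * \<nu> ((v \<circ> \<rho>) (\<pi> 0)) = of_int (sign \<rho>) * ?f (\<rho> \<circ> \<pi>)"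
    if "\<pi> permutes {..2 * k}" for \<pi> using sign_o[OF assms that] by (simp add: pf_coeff_def sign_def)
  then have "pf_sum k \<nu> \<mu> (v \<circ> \<rho>) = of_int (sign \<rho>) * (\<Sum>\<pi> | \<pi> permutes {..2 * k}. ?f (\<rho> \<circ> \<pi>))"
    unfolding pf_sum_def sum_distrib_left by (intro sum.cong refl) blast
  then show ?thesis using sum_perms_left[OF assms, of ?f] by (simp add: pf_sum_def)
qed

lemma pf_sum_repeated:
  assumes "i \<le> 2 * k" "j \<le> 2 * k" "i \<noteq> j" "v i = v j" shows "pf_sum k \<nu> \<mu> v = 0"
proof -
  have "v \<circ> Transposition.transpose i j = v" using assms(4) by (auto simp: Transposition.transpose_def fun_eq_iff)
  then show ?thesis using pf_sum_compose[OF transpose_permutes[OF assms(1,2)], of \<nu> \<mu> v] sign_swap_id[of i j] assms(3) by simp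
qed

text \<open>Position 0 of a permutation feeds \<nu>, positions 2 * j + 1 and 2 * j + 2 feed the j-th
  factor \<mu>.\<close>

lemma slot_cases:
  assumes "q \<le> 2 * k" obtains "q = 0" | j where "j < k" "q = 2 * j + 1" | j where "j < k" "q = 2 * j + (2::nat)"
proof (cases "q = 0")
  case False
  then have "q - 1 < 2 * k" using assms by simp
  then have d: "(q - 1) div 2 < k" by simp
  show ?thesis
  proof (cases "even (q - 1)")
    case True then have "q = 2 * ((q - 1) div 2) + 1" using False by simp
    then show ?thesis using that(2) d by blast
  next
    case odd: False
    then have "q = 2 * ((q - 1) div 2) + 2" using False by presburger
    then show ?thesis using that(3) d by blast
  qed
qed (rule that(1))

text \<open>Each permutation places the i-th vector in exactly one position, so each summand is
  linear in it by one of the three cases of \<open>slot_cases\<close>.\<close>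

lemma linear_pf_sum_slot:
  assumes \<nu>: "linear \<nu>" and \<mu>: "skew_form \<mu>" and i: "i \<le> 2 * k"
  shows "linear (\<lambda>x. pf_sum k \<nu> \<mu> (v(i := x)))"
  unfolding pf_sum_def
proof (rule linear_compose_sum, rule ballI)
  fix \<pi> assume "\<pi> \<in> {\<pi>. \<pi> permutes {..2 * k}}"
  then have \<pi>: "\<pi> permutes {..2 * k}" by simp
  define q where "q = inv \<pi> i"
  have \<pi>q: "\<pi> q = i" unfolding q_def using permutes_inverses(1)[OF \<pi>] .
  have inj: "\<pi> p = i \<longleftrightarrow> p = q" for p using permutes_inj[OF \<pi>] \<pi>q by (auto simp: inj_eq)
  have "q \<le> 2 * k" using permutes_in_image[OF \<pi>, of q] \<pi>q i by simp
  have lin: "linear (\<lambda>x. a * f x * b)" if "linear f" for f :: "'a => real" and a b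
    using that by (intro linearI) (simp_all add: linear_add linear_scale algebra_simps)
  show "linear (\<lambda>x. pf_coeff k \<mu> (v(i := x)) \<pi> * \<nu> ((v(i := x)) (\<pi> 0)))" using \<open>q \<le> 2 * k\<close>
  proof (cases rule: slot_cases)
    case 1
    have "pf_coeff k \<mu> (v(i := x)) \<pi> * \<nu> ((v(i := x)) (\<pi> 0)) = pf_coeff k \<mu> v \<pi> * \<nu> x * 1" for x
      by (simp add: pf_coeff_def inj 1)
    then show ?thesis using lin[OF \<nu>] by presburger
  next
    case (2 j)
    have "pf_coeff k \<mu> (v(i := x)) \<pi> * \<nu> ((v(i := x)) (\<pi> 0)) =
      of_int (sign \<pi>) * \<mu> x (v (\<pi> (2 * j + 2))) * ((\<Prod>l\<in>{..<k} - {j}. pf_pair \<mu> v \<pi> l) * \<nu> (v (\<pi> 0)))" for x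
    proof -
      have "(\<Prod>l\<in>{..<k} - {j}. \<mu> ((v(i := x)) (\<pi> (2 * l + 1))) ((v(i := x)) (\<pi> (2 * l + 2))))
        = (\<Prod>l\<in>{..<k} - {j}. pf_pair \<mu> v \<pi> l)"
      proof (rule prod.cong[OF refl])
        fix l assume "l \<in> {..<k} - {j}"
        then have "2 * l + 1 \<noteq> q" "2 * l + 2 \<noteq> q" using 2 by (auto, presburger?)
        then have "\<pi> (2 * l + 1) \<noteq> i" "\<pi> (2 * l + 2) \<noteq> i" unfolding inj .
        then show "\<mu> ((v(i := x)) (\<pi> (2 * l + 1))) ((v(i := x)) (\<pi> (2 * l + 2))) = pf_pair \<mu> v \<pi> l" by simp
      qed
      then show ?thesis unfolding pf_coeff_def using inj 2 \<pi>q by (subst prod.remove[of _ j]) (auto simp: algebra_simps)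
    qed
    then show ?thesis using lin[OF skew_formD(2)[OF \<mu>]] by presburger
  next
    case (3 j)
    have "pf_coeff k \<mu> (v(i := x)) \<pi> * \<nu> ((v(i := x)) (\<pi> 0)) =
      of_int (sign \<pi>) * \<mu> (v (\<pi> (2 * j + 1))) x * ((\<Prod>l\<in>{..<k} - {j}. pf_pair \<mu> v \<pi> l) * \<nu> (v (\<pi> 0)))" for x
    proof -
      have "(\<Prod>l\<in>{..<k} - {j}. \<mu> ((v(i := x)) (\<pi> (2 * l + 1))) ((v(i := x)) (\<pi> (2 * l + 2))))
        = (\<Prod>l\<in>{..<k} - {j}. pf_pair \<mu> v \<pi> l)"
      proof (rule prod.cong[OF refl])
        fix l assume "l \<in> {..<k} - {j}"
        then have "2 * l + 1 \<noteq> q" "2 * l + 2 \<noteq> q" using 3 by (auto, presburger?)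
        then have "\<pi> (2 * l + 1) \<noteq> i" "\<pi> (2 * l + 2) \<noteq> i" unfolding inj .
        then show "\<mu> ((v(i := x)) (\<pi> (2 * l + 1))) ((v(i := x)) (\<pi> (2 * l + 2))) = pf_pair \<mu> v \<pi> l" by simp
      qed
      then show ?thesis unfolding pf_coeff_def using inj 3 \<pi>q by (subst prod.remove[of _ j]) (auto simp: algebra_simps)
    qed
    then show ?thesis using lin[OF skew_formD(1)[OF \<mu>]] by presburger
  qed
qed

text \<open>An alternating multilinear form vanishes as soon as it does on one tuple, of its own
  length, that spans: expanding slot by slot reduces v to members of b, where a repetition gives 0
  and a rearrangement gives a sign times 0.\<close>

lemma pf_sum_zero_of_spanning:
  assumes \<nu>: "linear \<nu>" and \<mu>: "skew_form \<mu>" and span: "span (b ` {..2 * k}) = UNIV" and 0: "pf_sum k \<nu> \<mu> b = 0"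
  shows "pf_sum k \<nu> \<mu> v = 0"
proof -
  \<comment> \<open>Only the slots below m are unrestricted; the induction releases them one at a
    time.\<close>
  have "pf_sum k \<nu> \<mu> v = 0" if "m \<le> 2 * k + 1" "\<And>i. [|m \<le> i; i \<le> 2 * k|] ==> v i \<in> b ` {..2 * k}" for m v
    using that
  proof (induction m arbitrary: v)
    case 0
    then have "\<forall>i. \<exists>j. i \<le> 2 * k \<longrightarrow> j \<le> 2 * k \<and> v i = b j" by blast
    then obtain f where f: "\<And>i. i \<le> 2 * k ==> f i \<le> 2 * k \<and> v i = b (f i)" by metis
    show ?case
    proof (cases "inj_on f {..2 * k}")
      case True
      define \<rho> where "\<rho> i = (if i \<le> 2 * k then f i else i)" for i
      have "\<rho> permutes {..2 * k}"
      proof (rule bij_imp_permutes)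
        have "inj_on \<rho> {..2 * k}" using True by (simp add: inj_on_def \<rho>_def)
        moreover have "\<rho> ` {..2 * k} \<subseteq> {..2 * k}" using f by (auto simp: \<rho>_def)
        ultimately show "bij_betw \<rho> {..2 * k} {..2 * k}"
          unfolding bij_betw_def using endo_inj_surj[of "{..2 * k}" \<rho>] by blast
      qed (simp add: \<rho>_def)
      from pf_sum_compose[OF this, of \<nu> \<mu> b] \<open>pf_sum k \<nu> \<mu> b = 0\<close>
      have "pf_sum k \<nu> \<mu> (b \<circ> \<rho>) = 0" by simp
      moreover have "pf_sum k \<nu> \<mu> v = pf_sum k \<nu> \<mu> (b \<circ> \<rho>)"
        by (rule pf_sum_cong) (use f in \<open>simp add: \<rho>_def\<close>)
      ultimately show ?thesis by simp
    next
      case False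
      then obtain i j where "i \<le> 2 * k" "j \<le> 2 * k" "i \<noteq> j" "f i = f j" by (auto simp: inj_on_def)
      then show ?thesis using f by (intro pf_sum_repeated[of i k j]) auto
    qed
  next
    case (Suc m)
    have m: "m \<le> 2 * k" using Suc.prems by simp
    have "pf_sum k \<nu> \<mu> (v(m := v m)) = 0"
    proof (rule linear_eq_0_on_span[OF linear_pf_sum_slot[OF \<nu> \<mu> m], of "b ` {..2 * k}"])
      show "pf_sum k \<nu> \<mu> (v(m := x)) = 0" if "x \<in> b ` {..2 * k}" for x by (rule Suc.IH) (use Suc.prems that m in auto)
    qed (use span in simp)
    then show ?case by simp
  qed
  from this[of "2 * k + 1" v] show ?thesis by simp
qed

text \<open>Slot 0 is the only one outside \<mu>, and it can hold only one of the two kernel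
  vectors; the other annihilates a factor.\<close>

lemma pf_sum_two_kernel_vectors:
  assumes ker: "\<And>w. \<mu> (v i) w = 0" "\<And>w. \<mu> w (v i) = 0" "\<And>w. \<mu> (v j) w = 0" "\<And>w. \<mu> w (v j) = 0"
    and ij: "i \<le> 2 * k" "j \<le> 2 * k" "i \<noteq> j"
  shows "pf_sum k \<nu> \<mu> v = 0"
  unfolding pf_sum_def
proof (rule sum.neutral, clarify)
  fix \<pi> assume \<pi>: "\<pi> permutes {..2 * k}"
  obtain l q where l: "l \<in> {i, j}" "\<pi> q = l" "q \<noteq> 0" "q \<le> 2 * k" proof -
    have p: "\<pi> (inv \<pi> l) = l" "inv \<pi> l \<le> 2 * k" if "l \<le> 2 * k" for l
      using permutes_inverses(1)[OF \<pi>] permutes_in_image[OF permutes_inv[OF \<pi>], of l] that by auto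
    show ?thesis
    proof (cases "inv \<pi> i = 0")
      case True
      then have "inv \<pi> j \<noteq> 0" using p(1)[OF ij(1)] p(1)[OF ij(2)] ij(3) by metis
      then show ?thesis using that[of j "inv \<pi> j"] p ij by blast
    next
      case False then show ?thesis using that[of i "inv \<pi> i"] p ij by blast
    qed
  qed
  have k: "\<mu> (v l) w = 0" "\<mu> w (v l) = 0" for w using ker l(1) by auto
  have "\<exists>m<k. pf_pair \<mu> v \<pi> m = 0" using l(4)
  proof (cases rule: slot_cases)
    case (2 m) then show ?thesis using k l(2) by (intro exI[of _ m]) simp
  next
    case (3 m) then show ?thesis using k l(2) by (intro exI[of _ m]) simp
  qed (use l in simp)
  then have "pf_coeff k \<mu> v \<pi> = 0" by (auto simp: pf_coeff_def)
  then show "pf_coeff k \<mu> v \<pi> * \<nu> (v (\<pi> 0)) = 0" by simp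
qed

lemma sum_negated_by_perm:
  assumes "\<rho> permutes {..n::nat}" "\<rho> q = q" "\<And>\<pi>. [|\<pi> permutes {..n}; \<pi> q = l|] ==> f (\<pi> \<circ> \<rho>) = - f \<pi>"
  shows "(\<Sum>\<pi> | \<pi> permutes {..n} \<and> \<pi> q = l. f \<pi> :: real) = 0"
proof -
  have "(\<Sum>\<pi> | \<pi> permutes {..n} \<and> \<pi> q = l. f (\<pi> \<circ> \<rho>)) = - (\<Sum>\<pi> | \<pi> permutes {..n} \<and> \<pi> q = l. f \<pi>)"
    using assms(3) by (simp add: sum_negf[symmetric])
  then show ?thesis using sum_perms_right_on[OF assms(1,2)] by simp
qed

text \<open>This puts \<open>pf_vec\<close> into the kernel of \<mu>. Group the permutations by the
  position of v l: in slot 0 the term contains \<mu> (v l) (v l) = 0, and elsewhere exchanging slot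
  0 with the partner of v l exchanges the roles of two factors and reverses the sign.\<close>

lemma pf_sum_contracted:
  assumes \<mu>: "skew_form \<mu>" and l: "l \<le> 2 * k"
  shows "pf_sum k (\<mu> (v l)) \<mu> v = 0"
  unfolding pf_sum_def sum_perms_by_preimage[OF l]
proof (rule sum.neutral, clarify)
  note sk = skew_formD[OF \<mu>]
  fix q assume q: "q \<le> 2 * k"
  let ?f = "\<lambda>\<pi>. pf_coeff k \<mu> v \<pi> * \<mu> (v l) (v (\<pi> 0))"
  show "(\<Sum>\<pi> | \<pi> permutes {..2 * k} \<and> \<pi> q = l. ?f \<pi>) = 0" using q
  proof (cases rule: slot_cases)
    case 1 then show ?thesis using sk(4) by (intro sum.neutral) auto
  next
    case (2 j)
    let ?\<rho> = "Transposition.transpose 0 (2 * j + 2)"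
    have \<rho>: "?\<rho> permutes {..2 * k}" using 2 by (intro transpose_permutes) auto
    show ?thesis
    proof (rule sum_negated_by_perm[OF \<rho>])
      fix \<pi> assume \<pi>: "\<pi> permutes {..2 * k}" "\<pi> q = l"
      have "(\<Prod>i\<in>{..<k} - {j}. pf_pair \<mu> v (\<pi> \<circ> ?\<rho>) i)
        = (\<Prod>i\<in>{..<k} - {j}. pf_pair \<mu> v \<pi> i)" by (rule prod.cong[OF refl]) (auto simp: Transposition.transpose_def)
      then show "?f (\<pi> \<circ> ?\<rho>) = - ?f \<pi>"
        unfolding pf_coeff_def sign_o[OF \<pi>(1) \<rho>] using 2 \<pi>(2)
        by (simp add: prod.remove[of "{..<k}" j] sign_swap_id Transposition.transpose_def)
    qed (use 2 in \<open>simp add: Transposition.transpose_def\<close>)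
  next
    case (3 j)
    let ?\<rho> = "Transposition.transpose 0 (2 * j + 1)"
    have \<rho>: "?\<rho> permutes {..2 * k}" using 3 by (intro transpose_permutes) auto
    show ?thesis
    proof (rule sum_negated_by_perm[OF \<rho>])
      fix \<pi> assume \<pi>: "\<pi> permutes {..2 * k}" "\<pi> q = l"
      have "(\<Prod>i\<in>{..<k} - {j}. pf_pair \<mu> v (\<pi> \<circ> ?\<rho>) i)
        = (\<Prod>i\<in>{..<k} - {j}. pf_pair \<mu> v \<pi> i)" by (rule prod.cong[OF refl]) (auto simp: Transposition.transpose_def)
      then show "?f (\<pi> \<circ> ?\<rho>) = - ?f \<pi>"
        unfolding pf_coeff_def sign_o[OF \<pi>(1) \<rho>] using 3 \<pi>(2) sk(3)[of "v l" "v (\<pi> 0)"] sk(3)[of "v l" "v (\<pi> (Suc (2 * j)))"]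
        by (simp add: prod.remove[of "{..<k}" j] sign_swap_id Transposition.transpose_def)
    qed (use 3 in \<open>simp add: Transposition.transpose_def\<close>)
  qed
qed

text \<open>The identity d(\<mu>^k) = 0 for closed \<mu>, where D a b c is the derivative of
  \<mu>(b, c) in direction a. Rotating the slots 0, 2j+1, 2j+2 changes no sign, so three copies of
  the j-th sum combine into cyclic sums of D.\<close>

lemma pf_divergence:
  fixes D :: "nat => nat => nat => real"
  assumes closed: "\<And>a b c. D a b c + D b c a + D c a b = 0"
  shows "(\<Sum>\<pi> | \<pi> permutes {..2 * k}. of_int (sign \<pi>) * (\<Sum>j<k. D (\<pi> 0) (\<pi> (2 * j + 1)) (\<pi> (2 * j + 2)) *
     (\<Prod>i\<in>{..<k} - {j}. m (\<pi> (2 * i + 1)) (\<pi> (2 * i + 2))))) = 0"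
proof -
  have "(\<Sum>\<pi> | \<pi> permutes {..2 * k}. of_int (sign \<pi>) * (D (\<pi> 0) (\<pi> (2 * j + 1)) (\<pi> (2 * j + 2)) *
     (\<Prod>i\<in>{..<k} - {j}. m (\<pi> (2 * i + 1)) (\<pi> (2 * i + 2))))) = 0" (is "sum ?f _ = 0") if j: "j < k" for j proof -
    \<comment> \<open>A 3-cycle written as two transpositions, which shows that it is even.\<close>
    define \<rho> where "\<rho> = Transposition.transpose 0 (2 * j + 1) \<circ> Transposition.transpose (2 * j + 1) (2 * j + 2)"
    have \<rho>: "\<rho> permutes {..2 * k}" unfolding \<rho>_def by (intro permutes_compose transpose_permutes) (use j in auto)
    have "sign \<rho> = sign (Transposition.transpose 0 (2 * j + 1)) * sign (Transposition.transpose (2 * j + 1) (2 * j + 2))"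
      unfolding \<rho>_def by (rule sign_o[of _ "2 * k"]) (use j in \<open>auto intro: transpose_permutes\<close>)
    then have sgn: "sign \<rho> = 1" by (simp add: sign_swap_id)
    have v: "\<rho> 0 = 2 * j + 1" "\<rho> (2 * j + 1) = 2 * j + 2" "\<rho> (2 * j + 2) = 0"
      by (auto simp: \<rho>_def Transposition.transpose_def)
    have o: "\<rho> (2 * i + 1) = 2 * i + 1" "\<rho> (2 * i + 2) = 2 * i + 2" if "i \<noteq> j" for i
      using that by (auto simp: \<rho>_def Transposition.transpose_def)
    let ?P = "{\<pi>. \<pi> permutes {..2 * k}}"
    let ?R = "\<lambda>\<pi>. \<Prod>i\<in>{..<k} - {j}. m (\<pi> (2 * i + 1)) (\<pi> (2 * i + 2))"
    have R: "?R (\<pi> \<circ> \<rho>) = ?R \<pi>" for \<pi> :: "nat => nat"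
    proof (rule prod.cong[OF refl])
      fix i assume "i \<in> {..<k} - {j}"
      then have "i \<noteq> j" by simp
      show "m ((\<pi> \<circ> \<rho>) (2 * i + 1)) ((\<pi> \<circ> \<rho>) (2 * i + 2)) = m (\<pi> (2 * i + 1)) (\<pi> (2 * i + 2))"
        unfolding o_apply o[OF \<open>i \<noteq> j\<close>] ..
    qed
    have s: "sign (\<pi> \<circ> \<rho>) = sign \<pi>" if "\<pi> permutes {..2 * k}" for \<pi> using sign_o[OF that \<rho>] sgn by simp
    have "sum ?f ?P + sum ?f ?P + sum ?f ?P = sum ?f ?P + (\<Sum>\<pi>\<in>?P. ?f (\<pi> \<circ> \<rho>)) + (\<Sum>\<pi>\<in>?P. ?f (\<pi> \<circ> \<rho> \<circ> \<rho>))"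
      using sum_perms_right[OF \<rho>, of ?f] sum_perms_right[OF \<rho>, of "\<lambda>\<pi>. ?f (\<pi> \<circ> \<rho>)"] by simp
    also have "\<dots> = (\<Sum>\<pi>\<in>?P. ?f \<pi> + ?f (\<pi> \<circ> \<rho>) + ?f (\<pi> \<circ> \<rho> \<circ> \<rho>))" by (simp only: sum.distrib)
    also have "\<dots> = (\<Sum>\<pi>\<in>?P. 0)"
    proof (rule sum.cong[OF refl])
      fix \<pi> assume "\<pi> \<in> ?P"
      then have \<pi>: "\<pi> permutes {..2 * k}" by simp
      have s2: "sign (\<pi> \<circ> \<rho> \<circ> \<rho>) = sign \<pi>" using s[OF permutes_compose[OF \<rho> \<pi>]] s[OF \<pi>] by simp
      let ?a = "\<pi> 0" and ?b = "\<pi> (2 * j + 1)" and ?c = "\<pi> (2 * j + 2)"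
      have f1: "?f (\<pi> \<circ> \<rho>) = of_int (sign \<pi>) * (D ?b ?c ?a * ?R \<pi>)"
        unfolding R s[OF \<pi>] unfolding o_apply v ..
      have f2: "?f (\<pi> \<circ> \<rho> \<circ> \<rho>) = of_int (sign \<pi>) * (D ?c ?a ?b * ?R \<pi>)"
        unfolding R s2 unfolding o_apply v ..
      show "?f \<pi> + ?f (\<pi> \<circ> \<rho>) + ?f (\<pi> \<circ> \<rho> \<circ> \<rho>) = 0"
        unfolding f1 f2 using arg_cong[OF closed[of ?a ?b ?c], of "\<lambda>x. of_int (sign \<pi>) * (x * ?R \<pi>)"]
        by (simp add: algebra_simps)
    qed
    finally show ?thesis by simp
  qed
  then have "(\<Sum>j<k. \<Sum>\<pi> | \<pi> permutes {..2 * k}. of_int (sign \<pi>) * (D (\<pi> 0) (\<pi> (2 * j + 1)) (\<pi> (2 * j + 2)) *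
     (\<Prod>i\<in>{..<k} - {j}. m (\<pi> (2 * i + 1)) (\<pi> (2 * i + 2))))) = 0" by simp
  then show ?thesis by (simp only: sum_distrib_left sum.swap[of _ "{\<pi>. \<pi> permutes {..2 * k}}" "{..<k}"])
qed

lemma pf_coeff_swap_pair:
  assumes \<mu>: "skew_form \<mu>" and \<pi>: "\<pi> permutes {..2 * k}" and j: "j < k"
  shows "pf_coeff k \<mu> v (\<pi> \<circ> Transposition.transpose (2 * j + 1) (2 * j + 2)) = pf_coeff k \<mu> v \<pi>"
proof -
  let ?\<rho> = "Transposition.transpose (2 * j + 1) (2 * j + 2)"
  have \<rho>: "?\<rho> permutes {..2 * k}" using j by (intro transpose_permutes) auto
  have "(\<Prod>i\<in>{..<k} - {j}. pf_pair \<mu> v (\<pi> \<circ> ?\<rho>) i)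
    = (\<Prod>i\<in>{..<k} - {j}. pf_pair \<mu> v \<pi> i)"
  proof (rule prod.cong[OF refl])
    fix i assume "i \<in> {..<k} - {j}"
    then have "2 * i + 1 \<noteq> 2 * j + 1" "2 * i + 1 \<noteq> 2 * j + 2" "2 * i + 2 \<noteq> 2 * j + 1" "2 * i + 2 \<noteq> 2 * j + 2"
      by (auto, presburger?)
    then show "pf_pair \<mu> v (\<pi> \<circ> ?\<rho>) i = pf_pair \<mu> v \<pi> i" by (simp add: Transposition.transpose_def)
  qed
  then show ?thesis
    unfolding pf_coeff_def sign_o[OF \<pi> \<rho>] using j skew_formD(3)[OF \<mu>, of "v (\<pi> (2 * j + 1))" "v (\<pi> (2 * j + 2))"]
    by (simp add: prod.remove[of "{..<k}" j] sign_swap_id Transposition.transpose_def)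
qed

text \<open>Exchanging two factors \<mu> permutes the product and costs two transpositions, hence no
  sign.\<close>

lemma pf_coeff_swap_blocks:
  assumes \<pi>: "\<pi> permutes {..2 * k}" and ij: "i < k" "j < k" "i \<noteq> j"
  shows "pf_coeff k \<mu> v (\<pi> \<circ> (Transposition.transpose (2 * i + 1) (2 * j + 1) \<circ> Transposition.transpose (2 * i + 2) (2 * j + 2)))
    = pf_coeff k \<mu> v \<pi>"
proof -
  let ?a = "Transposition.transpose (2 * i + 1) (2 * j + 1)" and ?b = "Transposition.transpose (2 * i + 2) (2 * j + 2)"
  have ab: "?a permutes {..2 * k}" "?b permutes {..2 * k}" using ij by (auto intro!: transpose_permutes)
  let ?\<rho> = "?a \<circ> ?b"
  have \<rho>: "?\<rho> permutes {..2 * k}" by (rule permutes_compose[OF ab(2,1)])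
  have "sign ?\<rho> = 1" using sign_o[OF ab] ij by (simp add: sign_swap_id)
  then have sgn: "sign (\<pi> \<circ> ?\<rho>) = sign \<pi>" using sign_o[OF \<pi> \<rho>] by simp
  let ?\<sigma> = "Transposition.transpose i j"
  have "?\<sigma> permutes {..<k}" using ij by (intro permutes_swap_id) auto
  then have perm: "prod (g \<circ> ?\<sigma>) {..<k} = prod g {..<k}" for g :: "nat => real" by (rule prod.permute[symmetric])
  have v: "?\<rho> (2 * l + 1) = 2 * ?\<sigma> l + 1" "?\<rho> (2 * l + 2) = 2 * ?\<sigma> l + 2" for l proof -
    have odd: "2 * l + 1 \<noteq> 2 * m + 2" "2 * m + 2 \<noteq> 2 * l + 1" for l m :: nat by presburger+
    show "?\<rho> (2 * l + 1) = 2 * ?\<sigma> l + 1" "?\<rho> (2 * l + 2) = 2 * ?\<sigma> l + 2"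
      unfolding o_apply Transposition.transpose_def using odd by auto
  qed
  have "(\<Prod>l<k. pf_pair \<mu> v (\<pi> \<circ> ?\<rho>) l)
    = prod ((\<lambda>l. pf_pair \<mu> v \<pi> l) \<circ> ?\<sigma>) {..<k}"
    unfolding o_apply[of \<pi> ?\<rho>] v by simp
  then show ?thesis unfolding pf_coeff_def sgn perm by simp
qed

text \<open>Each of the \<open>2 * k + 2\<close> slots other than the first can receive the last vector, and all of them
  contribute equally.\<close>

lemma pf_sum_symplectic_step:
  assumes \<mu>: "skew_form \<mu>" and 1: "\<mu> (v (2 * k + 1)) (v (2 * k + 2)) = 1"
    and 0: "\<And>i. i \<le> 2 * k ==> \<mu> (v i) (v (2 * k + 2)) = 0" and \<nu>: "\<nu> (v (2 * k + 2)) = 0"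
  shows "pf_sum (Suc k) \<nu> \<mu> v = (2 * k + 2) * pf_sum k \<nu> \<mu> v"
proof -
  let ?m = "2 * k + 2"
  have m: "2 * Suc k = ?m" by simp
  define t where "t \<pi> = pf_coeff (Suc k) \<mu> v \<pi> * \<nu> (v (\<pi> 0))" for \<pi>
  define G where "G q = (\<Sum>\<pi> | \<pi> permutes {..?m} \<and> \<pi> q = ?m. t \<pi>)" for q
  have sum: "pf_sum (Suc k) \<nu> \<mu> v = (\<Sum>q\<le>?m. G q)"
    unfolding pf_sum_def m t_def[symmetric] G_def by (rule sum_perms_by_preimage) simp
  have G0: "G 0 = 0" unfolding G_def t_def by (rule sum.neutral) (use \<nu> in auto)
  have move: "G q = G p" if \<rho>: "\<rho> permutes {..?m}" "\<rho> p = q" "\<rho> 0 = 0"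
    and inv: "\<And>\<pi>. \<pi> permutes {..?m} ==> pf_coeff (Suc k) \<mu> v (\<pi> \<circ> \<rho>) = pf_coeff (Suc k) \<mu> v \<pi>" for \<rho> p q
  proof -
    have "G p = (\<Sum>\<pi> | \<pi> permutes {..?m} \<and> \<pi> q = ?m. t (\<pi> \<circ> \<rho>))"
      unfolding G_def using sum_perms_right_on[OF \<rho>(1,2)] by simp
    also have "\<dots> = G q" unfolding G_def by (rule sum.cong[OF refl]) (use inv \<rho>(3) in \<open>auto simp: t_def\<close>)
    finally show ?thesis by simp
  qed
  have G2: "G (2 * j + 2) = G ?m" if j: "j \<le> k" for j
  proof (cases "j = k")
    case False
    let ?\<rho> = "Transposition.transpose (2 * j + 1) (2 * k + 1) \<circ> Transposition.transpose (2 * j + 2) (2 * k + 2)"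
    show ?thesis
    proof (rule move[of ?\<rho>])
      show "?\<rho> permutes {..?m}" using j by (intro permutes_compose transpose_permutes) auto
      show "?\<rho> ?m = 2 * j + 2" "?\<rho> 0 = 0" by (auto simp: Transposition.transpose_def, presburger+)
      show "pf_coeff (Suc k) \<mu> v (\<pi> \<circ> ?\<rho>) = pf_coeff (Suc k) \<mu> v \<pi>" if "\<pi> permutes {..?m}" for \<pi>
        by (rule pf_coeff_swap_blocks) (use that j False in auto)
    qed
  qed simp
  have G1: "G (2 * j + 1) = G ?m" if j: "j \<le> k" for j proof -
    let ?\<rho> = "Transposition.transpose (2 * j + 1) (2 * j + 2)"
    have "G (2 * j + 1) = G (2 * j + 2)"
    proof (rule move[of ?\<rho>])
      show "?\<rho> permutes {..?m}" using j by (intro transpose_permutes) auto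
      show "?\<rho> (2 * j + 2) = 2 * j + 1" "?\<rho> 0 = 0" by (auto simp: Transposition.transpose_def)
      show "pf_coeff (Suc k) \<mu> v (\<pi> \<circ> ?\<rho>) = pf_coeff (Suc k) \<mu> v \<pi>" if "\<pi> permutes {..?m}" for \<pi>
        by (rule pf_coeff_swap_pair[OF \<mu>]) (use that j in auto)
    qed
    then show ?thesis using G2[OF j] by simp
  qed
  have Gq: "G q = G ?m" if "q \<le> ?m" "q \<noteq> 0" for q proof -
    from that(1) have "q \<le> 2 * Suc k" by simp
    then show ?thesis
    proof (cases rule: slot_cases)
      case 1 then show ?thesis using that(2) by simp
    next
      case (2 j) then show ?thesis using G1[of j] by (simp only: less_Suc_eq_le)
    next
      case (3 j) then show ?thesis using G2[of j] by (simp only: less_Suc_eq_le)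
    qed
  qed
  have "(\<Sum>q\<le>?m. G q) = G 0 + (\<Sum>q\<in>{..?m} - {0}. G q)" by (rule sum.remove) auto
  also have "\<dots> = (\<Sum>q\<in>{..?m} - {0}. G ?m)"
    unfolding G0 add_0 by (intro sum.cong refl Gq) auto
  also have "\<dots> = (2 * k + 2) * G ?m" by simp
  finally have total: "pf_sum (Suc k) \<nu> \<mu> v = (2 * k + 2) * G ?m" using sum by simp
  have sub: "{\<pi>. \<pi> permutes {..2 * k}} \<subseteq> {\<pi>. \<pi> permutes {..?m} \<and> \<pi> ?m = ?m}"
  proof clarify
    fix \<pi> assume \<pi>: "\<pi> permutes {..2 * k}"
    have "\<pi> permutes {..?m}" by (rule permutes_subset[OF \<pi>]) auto
    moreover have "\<pi> ?m = ?m" by (rule permutes_not_in[OF \<pi>]) simp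
    ultimately show "\<pi> permutes {..?m} \<and> \<pi> ?m = ?m" by simp
  qed
  \<comment> \<open>With the last vector fixed in the last slot, its partner slot must hold v
    (2k+1): any other vector pairs to 0 with it. The surviving permutations are those of the first
    2k+1 positions.\<close>
  have "G ?m = (\<Sum>\<pi> | \<pi> permutes {..2 * k}. t \<pi>)"
    unfolding G_def
  proof (rule sum.mono_neutral_right[OF _ sub], goal_cases)
    case 1
    show ?case by (rule finite_subset[OF _ finite_permutations[of "{..?m}"]]) auto
  next
    case 2
    show ?case
    proof
    fix \<pi> assume "\<pi> \<in> {\<pi>. \<pi> permutes {..?m} \<and> \<pi> ?m = ?m} - {\<pi>. \<pi> permutes {..2 * k}}"
    then have \<pi>: "\<pi> permutes {..?m}" "\<pi> ?m = ?m" "\<not> \<pi> permutes {..2 * k}" by auto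
    have "\<pi> (2 * k + 1) \<noteq> 2 * k + 1"
    proof
      assume fx: "\<pi> (2 * k + 1) = 2 * k + 1"
      have "\<pi> permutes {..2 * k}"
      proof (rule permutes_superset[OF \<pi>(1)])
        fix x assume "x \<in> {..?m} - {..2 * k}"
        then have "x = 2 * k + 1 \<or> x = ?m" by auto
        then show "\<pi> x = x" using fx \<pi>(2) by auto
      qed
      then show False using \<pi>(3) by simp
    qed
    moreover have "\<pi> (2 * k + 1) \<le> ?m" using permutes_in_image[OF \<pi>(1), of "2 * k + 1"] by simp
    moreover have "\<pi> (2 * k + 1) \<noteq> ?m" using permutes_inj[OF \<pi>(1)] \<pi>(2) by (metis injD Suc_eq_plus1 add_2_eq_Suc' n_not_Suc_n)
    ultimately have "\<pi> (2 * k + 1) \<le> 2 * k" by linarith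
    then have "pf_pair \<mu> v \<pi> k = 0" using 0 \<pi>(2) by simp
    then show "t \<pi> = 0" by (simp add: t_def pf_coeff_def)
    qed
  qed
  also have "\<dots> = pf_sum k \<nu> \<mu> v"
    unfolding pf_sum_def
  proof (rule sum.cong[OF refl])
    fix \<pi> assume "\<pi> \<in> {\<pi>. \<pi> permutes {..2 * k}}"
    then have "\<pi> (2 * k + 1) = 2 * k + 1" "\<pi> (2 * k + 2) = 2 * k + 2" using permutes_not_in[of \<pi> "{..2 * k}"] by auto
    then show "t \<pi> = pf_coeff k \<mu> v \<pi> * \<nu> (v (\<pi> 0))" using 1 by (simp add: t_def pf_coeff_def)
  qed
  finally show ?thesis using total by simp
qed

text \<open>Each symplectic pair multiplies the value by a nonzero number, and without pairs the
  value is \<nu> (v 0).\<close>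

lemma pf_sum_symplectic:
  assumes \<mu>: "skew_form \<mu>" and 1: "\<And>j. j < k ==> \<mu> (v (2 * j + 1)) (v (2 * j + 2)) = 1"
    and 0: "\<And>i j. [|j < k; i \<le> 2 * j|] ==> \<mu> (v i) (v (2 * j + 2)) = 0"
    and \<nu>: "\<And>j. j < k ==> \<nu> (v (2 * j + 2)) = 0" "\<nu> (v 0) \<noteq> 0"
  shows "pf_sum k \<nu> \<mu> v \<noteq> 0" using 1 0 \<nu>(1)
proof (induction k)
  case 0
  have "\<pi> = id" if "\<pi> permutes {..0::nat}" for \<pi>
  proof
    fix x show "\<pi> x = id x" using permutes_not_in[OF that, of x] permutes_in_image[OF that, of x] by (cases "x = 0") auto
  qed
  then have "{\<pi>. \<pi> permutes {..0::nat}} = {id}" using permutes_id by blast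
  then show ?case using \<nu>(2) by (simp add: pf_sum_def pf_coeff_def)
next
  case (Suc k)
  have "pf_sum k \<nu> \<mu> v \<noteq> 0" by (rule Suc.IH) (use Suc.prems in auto)
  then show ?case by (subst pf_sum_symplectic_step[OF \<mu>]) (use Suc.prems in auto)
qed

section \<open>Symplectic families and the rank of a skew form\<close>

definition symplectic_family :: "('v::real_vector => 'v => real) => nat => (nat => 'v) => bool" where
  "symplectic_family \<mu> k v \<longleftrightarrow> (\<forall>i<k. \<forall>j<k.
     \<mu> (v (2 * i + 1)) (v (2 * j + 1)) = 0 \<and> \<mu> (v (2 * i + 2)) (v (2 * j + 2)) = 0 \<and>
     \<mu> (v (2 * i + 1)) (v (2 * j + 2)) = (if i = j then 1 else 0))"

definition symplectic_complement :: "('v::real_vector => 'v => real) => nat => (nat => 'v) => 'v set" where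
  "symplectic_complement \<mu> k v = {x. \<forall>i<k. \<mu> x (v (2 * i + 1)) = 0 \<and> \<mu> x (v (2 * i + 2)) = 0}"

text \<open>The symplectic analogue of a Gram-Schmidt step, along the span of the pairs. Position 0
  of v does not enter; it is reserved for a kernel vector, which matches the slots of
  \<open>pf_sum\<close>.\<close>

definition symplectic_projection :: "('v::real_vector => 'v => real) => nat => (nat => 'v) => 'v => 'v" where
  "symplectic_projection \<mu> k v x = x - (\<Sum>i<k. \<mu> x (v (2 * i + 2)) *\<^sub>R v (2 * i + 1) - \<mu> x (v (2 * i + 1)) *\<^sub>R v (2 * i + 2))"

context
  fixes \<mu> :: "'v::euclidean_space => 'v => real" and k :: nat and v :: "nat => 'v"
  assumes \<mu>: "skew_form \<mu>" and fam: "symplectic_family \<mu> k v"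
begin

lemma symplectic_family_gram:
  assumes "i < k" "j < k"
  shows "\<mu> (v (2 * i + 1)) (v (2 * j + 1)) = 0" "\<mu> (v (2 * i + 2)) (v (2 * j + 2)) = 0"
    "\<mu> (v (2 * i + 1)) (v (2 * j + 2)) = (if i = j then 1 else 0)"
    "\<mu> (v (2 * i + 2)) (v (2 * j + 1)) = (if i = j then - 1 else 0)"
  using fam assms skew_formD(3)[OF \<mu>, of "v (2 * i + 2)" "v (2 * j + 1)"] by (auto simp: symplectic_family_def)

lemma symplectic_pairing_sum:
  assumes "j < k"
  shows "\<mu> (\<Sum>i<k. a i *\<^sub>R v (2 * i + 1) + b i *\<^sub>R v (2 * i + 2)) (v (2 * j + 2)) = a j"
    and "\<mu> (\<Sum>i<k. a i *\<^sub>R v (2 * i + 1) + b i *\<^sub>R v (2 * i + 2)) (v (2 * j + 1)) = - b j"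
proof -
  note lin = skew_formD(2)[OF \<mu>]
  have "\<mu> (\<Sum>i<k. a i *\<^sub>R v (2 * i + 1) + b i *\<^sub>R v (2 * i + 2)) w
    = (\<Sum>i<k. a i * \<mu> (v (2 * i + 1)) w + b i * \<mu> (v (2 * i + 2)) w)" for w
    by (simp only: linear_sum[OF lin] linear_add[OF lin] linear_cmul[OF lin] real_scaleR_def)
  moreover have "(\<Sum>i<k. a i * \<mu> (v (2 * i + 1)) (v (2 * j + 2)) + b i * \<mu> (v (2 * i + 2)) (v (2 * j + 2))) = (\<Sum>i<k. if i = j then a i else 0)"
    by (rule sum.cong[OF refl]) (use symplectic_family_gram(2,3) assms in auto)
  moreover have "(\<Sum>i<k. a i * \<mu> (v (2 * i + 1)) (v (2 * j + 1)) + b i * \<mu> (v (2 * i + 2)) (v (2 * j + 1))) = (\<Sum>i<k. if i = j then - b i else 0)"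
    by (rule sum.cong[OF refl]) (use symplectic_family_gram(1,4) assms in auto)
  ultimately show "\<mu> (\<Sum>i<k. a i *\<^sub>R v (2 * i + 1) + b i *\<^sub>R v (2 * i + 2)) (v (2 * j + 2)) = a j"
    "\<mu> (\<Sum>i<k. a i *\<^sub>R v (2 * i + 1) + b i *\<^sub>R v (2 * i + 2)) (v (2 * j + 1)) = - b j" using assms by simp_all
qed

lemma symplectic_projection_in: "symplectic_projection \<mu> k v x \<in> symplectic_complement \<mu> k v"
proof -
  note lin = skew_formD(2)[OF \<mu>]
  let ?a = "\<lambda>i. \<mu> x (v (2 * i + 2))" and ?b = "\<lambda>i. - \<mu> x (v (2 * i + 1))"
  have "symplectic_projection \<mu> k v x = x - (\<Sum>i<k. ?a i *\<^sub>R v (2 * i + 1) + ?b i *\<^sub>R v (2 * i + 2))"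
    by (simp add: symplectic_projection_def)
  then have "\<mu> (symplectic_projection \<mu> k v x) w = \<mu> x w - \<mu> (\<Sum>i<k. ?a i *\<^sub>R v (2 * i + 1) + ?b i *\<^sub>R v (2 * i + 2)) w" for w
    by (simp only: linear_diff[OF lin])
  then show ?thesis using symplectic_pairing_sum[of _ ?a ?b] by (simp add: symplectic_complement_def)
qed

text \<open>Every y is a vector of the complement plus a combination of the pairs, and x is
  orthogonal to both parts.\<close>

lemma symplectic_complement_isotropic_imp_kernel:
  assumes iso: "\<And>x y. [|x \<in> symplectic_complement \<mu> k v; y \<in> symplectic_complement \<mu> k v|] ==> \<mu> x y = 0"
    and x: "x \<in> symplectic_complement \<mu> k v"
  shows "\<mu> x y = 0"
proof -
  note lin = skew_formD(1)[OF \<mu>, of x]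
  have eq: "y = symplectic_projection \<mu> k v y + (\<Sum>i<k. \<mu> y (v (2 * i + 2)) *\<^sub>R v (2 * i + 1) - \<mu> y (v (2 * i + 1)) *\<^sub>R v (2 * i + 2))"
    by (simp add: symplectic_projection_def)
  have "\<mu> x y = \<mu> x (symplectic_projection \<mu> k v y) + (\<Sum>i<k. \<mu> y (v (2 * i + 2)) * \<mu> x (v (2 * i + 1)) - \<mu> y (v (2 * i + 1)) * \<mu> x (v (2 * i + 2)))"
    by (subst eq) (simp only: linear_add[OF lin] linear_sum[OF lin] linear_diff[OF lin] linear_cmul[OF lin] real_scaleR_def)
  then show ?thesis using iso[OF x symplectic_projection_in] x by (simp add: symplectic_complement_def)
qed

end

lemma independent_family:
  fixes v :: "nat => 'v::euclidean_space"
  assumes I: "finite I" and zero: "\<And>c i. [|(\<Sum>i\<in>I. c i *\<^sub>R v i) = 0; i \<in> I|] ==> c i = 0"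
  shows "card I \<le> DIM('v)"
proof -
  have inj: "inj_on v I"
  proof (rule inj_onI, rule ccontr)
    fix a b assume ab: "a \<in> I" "b \<in> I" "v a = v b" "a \<noteq> b"
    define c where "c i = (if i = a then 1 else if i = b then - 1 else 0 :: real)" for i
    have "(\<Sum>i\<in>I. c i *\<^sub>R v i) = c a *\<^sub>R v a + (\<Sum>i\<in>I - {a}. c i *\<^sub>R v i)" by (rule sum.remove[OF I ab(1)])
    also have "(\<Sum>i\<in>I - {a}. c i *\<^sub>R v i) = c b *\<^sub>R v b + (\<Sum>i\<in>I - {a} - {b}. c i *\<^sub>R v i)"
      by (rule sum.remove) (use I ab in auto)
    also have "(\<Sum>i\<in>I - {a} - {b}. c i *\<^sub>R v i) = 0" by (rule sum.neutral) (auto simp: c_def)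
    finally have "(\<Sum>i\<in>I. c i *\<^sub>R v i) = 0" using ab by (simp add: c_def)
    from zero[OF this ab(1)] show False by (simp add: c_def)
  qed
  have "independent (v ` I)"
  proof (rule independent_if_scalars_zero)
    fix f x assume "(\<Sum>x\<in>v ` I. f x *\<^sub>R x) = 0" "x \<in> v ` I"
    then have "(\<Sum>i\<in>I. f (v i) *\<^sub>R v i) = 0" by (simp add: sum.reindex[OF inj])
    then show "f x = 0" using zero[of "\<lambda>i. f (v i)"] \<open>x \<in> v ` I\<close> by auto
  qed (use I in simp)
  from independent_bound[OF this] show ?thesis using card_image[OF inj] by simp
qed

lemma sum_slots:
  fixes f :: "nat => 'v::real_vector"
  shows "(\<Sum>i\<le>2 * k. f i) = f 0 + (\<Sum>i<k. f (2 * i + 1) + f (2 * i + 2))" by (induction k) (simp_all add: algebra_simps)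

text \<open>Pairing a linear relation with the partners reads off all coefficients of the pairs;
  then v 0 remains alone. So v consists of 2k+1 independent vectors, which bounds the length of
  symplectic families.\<close>

lemma symplectic_dim:
  fixes \<mu> :: "'v::euclidean_space => 'v => real"
  assumes \<mu>: "skew_form \<mu>" and fam: "symplectic_family \<mu> k v"
    and v0: "v 0 \<noteq> 0" "v 0 \<in> symplectic_complement \<mu> k v"
  shows "2 * k + 1 \<le> DIM('v)"
proof -
  have "card {..2 * k} \<le> DIM('v)"
  proof (rule independent_family[of _ v])
    fix c :: "nat => real" and i assume sum: "(\<Sum>i\<le>2 * k. c i *\<^sub>R v i) = 0" and i: "i \<in> {..2 * k}"
    let ?S = "\<Sum>i<k. c (2 * i + 1) *\<^sub>R v (2 * i + 1) + c (2 * i + 2) *\<^sub>R v (2 * i + 2)"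
    have eq: "c 0 *\<^sub>R v 0 + ?S = 0" using sum by (simp only: sum_slots)
    note lin = skew_formD(2)[OF \<mu>]
    have pair: "c 0 * \<mu> (v 0) w + \<mu> ?S w = 0" for w
      using arg_cong[OF eq, of "\<lambda>x. \<mu> x w"] by (simp only: linear_add[OF lin] linear_cmul[OF lin] linear_0[OF lin] real_scaleR_def)
    have c: "c (2 * j + 1) = 0" "c (2 * j + 2) = 0" if j: "j < k" for j proof -
      have "\<mu> (v 0) (v (2 * j + 1)) = 0" "\<mu> (v 0) (v (2 * j + 2)) = 0" using v0(2) j by (auto simp: symplectic_complement_def)
      then show "c (2 * j + 1) = 0" "c (2 * j + 2) = 0" using pair[of "v (2 * j + 2)"] pair[of "v (2 * j + 1)"]
          symplectic_pairing_sum[OF \<mu> fam j, of "\<lambda>i. c (2 * i + 1)" "\<lambda>i. c (2 * i + 2)"] by simp_all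
    qed
    have "?S = 0" by (rule sum.neutral) (use c in auto)
    then have "c 0 = 0" using eq v0 by simp
    from i have "i \<le> 2 * k" by simp
    then show "c i = 0" by (cases rule: slot_cases) (use \<open>c 0 = 0\<close> c in auto)
  qed simp
  then show ?thesis by simp
qed

lemma symplectic_family_extend:
  assumes \<mu>: "skew_form \<mu>" and fam: "symplectic_family \<mu> k v"
    and x: "x \<in> symplectic_complement \<mu> k v" and y: "y \<in> symplectic_complement \<mu> k v" and xy: "\<mu> x y = 1"
  shows "symplectic_family \<mu> (Suc k) (v(2 * k + 1 := x, 2 * k + 2 := y))"
proof -
  let ?w = "v(2 * k + 1 := x, 2 * k + 2 := y)"
  have w: "?w (2 * i + 1) = (if i = k then x else v (2 * i + 1))" "?w (2 * i + 2) = (if i = k then y else v (2 * i + 2))" for i by auto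
  have z: "\<mu> x (v (2 * i + 1)) = 0" "\<mu> x (v (2 * i + 2)) = 0" "\<mu> y (v (2 * i + 1)) = 0" "\<mu> y (v (2 * i + 2)) = 0" if "i < k" for i
    using x y that by (auto simp: symplectic_complement_def)
  have z': "\<mu> (v (2 * i + 1)) x = 0" "\<mu> (v (2 * i + 2)) x = 0" "\<mu> (v (2 * i + 1)) y = 0" "\<mu> (v (2 * i + 2)) y = 0" if "i < k" for i
    using z[OF that] skew_formD(3)[OF \<mu>] by (metis neg_0_equal_iff_equal)+
  show ?thesis unfolding symplectic_family_def w using fam z z' xy skew_formD(4)[OF \<mu>] by (auto simp: symplectic_family_def less_Suc_eq)
qed

text \<open>As long as the complement is not isotropic, two of its vectors, suitably normalized,
  form another pair. By \<open>symplectic_dim\<close> this cannot continue for DIM steps, because w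
  is kept in position 0.\<close>

lemma symplectic_family_exists:
  fixes \<mu> :: "'v::euclidean_space => 'v => real"
  assumes \<mu>: "skew_form \<mu>" and w: "w \<noteq> 0" "\<And>u. \<mu> w u = 0"
  shows "\<exists>k v. symplectic_family \<mu> k v \<and> v 0 = w \<and>
    (\<forall>x\<in>symplectic_complement \<mu> k v. \<forall>y\<in>symplectic_complement \<mu> k v. \<mu> x y = 0)"
proof (rule ccontr)
  assume no: "\<not> ?thesis"
  have "\<exists>v. symplectic_family \<mu> k v \<and> v 0 = w" for k
  proof (induction k)
    case 0 show ?case by (intro exI[of _ "\<lambda>_. w"]) (simp add: symplectic_family_def)
  next
    case (Suc k)
    then obtain v where v: "symplectic_family \<mu> k v" "v 0 = w" by blast
    with no obtain x y where xy: "x \<in> symplectic_complement \<mu> k v" "y \<in> symplectic_complement \<mu> k v" "\<mu> x y \<noteq> 0" by blast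
    define y' where "y' = (1 / \<mu> x y) *\<^sub>R y"
    have "\<mu> x y' = 1" using xy(3) by (simp add: y'_def linear_cmul[OF skew_formD(1)[OF \<mu>]])
    moreover have "y' \<in> symplectic_complement \<mu> k v"
      using xy(2) by (simp add: y'_def symplectic_complement_def linear_cmul[OF skew_formD(2)[OF \<mu>]])
    ultimately have "symplectic_family \<mu> (Suc k) (v(2 * k + 1 := x, 2 * k + 2 := y'))"
      by (intro symplectic_family_extend[OF \<mu> v(1) xy(1)])
    moreover have "(v(2 * k + 1 := x, 2 * k + 2 := y')) 0 = w" using v(2) by simp
    ultimately show ?case by blast
  qed
  then obtain v where v: "symplectic_family \<mu> DIM('v) v" "v 0 = w" by blast
  have "2 * DIM('v) + 1 \<le> DIM('v)"
    by (rule symplectic_dim[OF \<mu> v(1)]) (use v w in \<open>auto simp: symplectic_complement_def\<close>)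
  then show False by simp
qed

definition form_kernel :: "('v => 'v => real) => 'v set" where
  "form_kernel \<mu> = {w. \<forall>u. \<mu> w u = 0}"

lemma subspace_form_kernel: "skew_form \<mu> ==> subspace (form_kernel \<mu>)"
  unfolding form_kernel_def
  by (auto intro!: subspaceI simp: linear_0[OF skew_formD(2)] linear_add[OF skew_formD(2)] linear_cmul[OF skew_formD(2)])

text \<open>A maximal symplectic family with the kernel direction in position 0 has its complement
  inside the kernel, hence spans, which forces the dimension to be 2k+1. The coordinate along the
  kernel then serves as \<nu>. The parity statement is used again for the dimension of M.\<close>

lemma one_dim_kernel:
  fixes \<mu> :: "'v::euclidean_space => 'v => real"
  assumes \<mu>: "skew_form \<mu>" and dim: "dim (form_kernel \<mu>) = 1"
  shows "\<exists>k \<nu> v. DIM('v) = 2 * k + 1 \<and> linear \<nu> \<and> pf_sum k \<nu> \<mu> v \<noteq> 0"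
proof -
  obtain w where w: "w \<noteq> 0" "form_kernel \<mu> = span {w}" proof -
    obtain B where B: "B \<subseteq> form_kernel \<mu>" "independent B" "form_kernel \<mu> \<subseteq> span B" "card B = 1"
      using basis_exists[of "form_kernel \<mu>"] dim by metis
    then obtain w where "B = {w}" by (auto simp: card_1_singleton_iff)
    moreover have "span B \<subseteq> form_kernel \<mu>" using B(1) subspace_form_kernel[OF \<mu>] by (simp add: span_minimal)
    ultimately show ?thesis using that B by (metis dependent_single subset_antisym)
  qed
  have ker: "\<mu> w u = 0" for u using w(2) span_base[of w "{w}"] by (auto simp: form_kernel_def)
  obtain k v where v: "symplectic_family \<mu> k v" "v 0 = w"
    "\<And>x y. [|x \<in> symplectic_complement \<mu> k v; y \<in> symplectic_complement \<mu> k v|] ==> \<mu> x y = 0"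
    using symplectic_family_exists[OF \<mu> w(1) ker] by blast
  have sub: "symplectic_complement \<mu> k v \<subseteq> span {w}"
    using symplectic_complement_isotropic_imp_kernel[OF \<mu> v(1) v(3)] unfolding w(2)[symmetric] form_kernel_def by blast
  have wc: "w \<in> symplectic_complement \<mu> k v" using ker by (simp add: symplectic_complement_def)
  have le: "2 * k + 1 \<le> DIM('v)" by (rule symplectic_dim[OF \<mu> v(1)]) (use v(2) w(1) wc in auto)
  have "span (v ` {..2 * k}) = UNIV" proof -
    have "x \<in> span (v ` {..2 * k})" for x proof -
      have "symplectic_projection \<mu> k v x \<in> span {w}" using symplectic_projection_in[OF \<mu> v(1)] sub by blast
      also have "span {w} \<subseteq> span (v ` {..2 * k})" by (rule span_mono) (use v(2) in auto)
      finally have p: "symplectic_projection \<mu> k v x \<in> span (v ` {..2 * k})" .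
      have "x = symplectic_projection \<mu> k v x + (\<Sum>i<k. \<mu> x (v (2 * i + 2)) *\<^sub>R v (2 * i + 1) - \<mu> x (v (2 * i + 1)) *\<^sub>R v (2 * i + 2))"
        by (simp add: symplectic_projection_def)
      also have "\<dots> \<in> span (v ` {..2 * k})" by (intro span_add p span_sum span_diff span_scale span_base) auto
      finally show ?thesis .
    qed
    then show ?thesis by blast
  qed
  then have "DIM('v) \<le> card (v ` {..2 * k})" by (metis dim_UNIV dim_span dim_le_card' finite_atMost finite_imageI)
  also have "\<dots> \<le> 2 * k + 1" using card_image_le[of "{..2 * k}" v] by simp
  finally have dimk: "DIM('v) = 2 * k + 1" using le by simp
  \<comment> \<open>The projection takes values in the line of w, so this is the kernel coordinate
    up to a factor; it vanishes on all pairs.\<close>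
  define \<nu> where "\<nu> x = symplectic_projection \<mu> k v x \<bullet> w" for x
  have lin\<nu>: "linear \<nu>" by (rule linearI)
      (simp_all add: \<nu>_def symplectic_projection_def linear_add[OF skew_formD(2)[OF \<mu>]] linear_cmul[OF skew_formD(2)[OF \<mu>]]
        inner_diff_left inner_add_left inner_sum_left sum.distrib sum_subtractf sum_distrib_left scaleR_add_left algebra_simps)
  note gram = symplectic_family_gram[OF \<mu> v(1)]
  have "pf_sum k \<nu> \<mu> v \<noteq> 0"
  proof (rule pf_sum_symplectic[OF \<mu>])
    show "\<mu> (v (2 * j + 1)) (v (2 * j + 2)) = 1" if "j < k" for j using gram(3)[of j j] that by simp
    show "\<mu> (v i) (v (2 * j + 2)) = 0" if j: "j < k" and "i \<le> 2 * j" for i j using that(2)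
    proof (cases rule: slot_cases)
      case 1 then show ?thesis using v(2) ker by simp
    next
      case (2 l) then show ?thesis using gram(3)[of l j] j by simp
    next
      case (3 l) then show ?thesis using gram(2)[of l j] j by simp
    qed
    show "\<nu> (v (2 * j + 2)) = 0" if j: "j < k" for j proof -
      have "(\<Sum>i<k. \<mu> (v (2 * j + 2)) (v (2 * i + 2)) *\<^sub>R v (2 * i + 1) - \<mu> (v (2 * j + 2)) (v (2 * i + 1)) *\<^sub>R v (2 * i + 2))
        = (\<Sum>i<k. if i = j then v (2 * i + 2) else 0)" by (rule sum.cong[OF refl]) (use gram(2,4) j in auto)
      also have "\<dots> = v (2 * j + 2)" using j by simp
      finally show ?thesis by (simp add: \<nu>_def symplectic_projection_def)
    qed
    have "symplectic_projection \<mu> k v w = w" by (simp add: symplectic_projection_def ker)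
    then show "\<nu> (v 0) \<noteq> 0" using w(1) v(2) by (simp add: \<nu>_def)
  qed
  then show ?thesis using dimk lin\<nu> by blast
qed

text \<open>Two independent kernel vectors extend to a basis on which all \<open>pf_sum\<close>
  vanish, and a one-dimensional kernel provides a tuple on which one of them does not. So the zeros
  of \<open>pf_vec\<close> detect exactly where the kernel fails to be a line.\<close>

theorem pf_vec_kernel:
  fixes \<mu> :: "'v::euclidean_space => 'v => real"
  assumes \<mu>: "skew_form \<mu>" and e: "bij_betw e {..2 * k} (Basis :: 'v set)"
  shows "pf_vec k \<mu> e \<in> form_kernel \<mu>"
    and "pf_vec k \<mu> e \<noteq> 0 \<longleftrightarrow> dim (form_kernel \<mu>) = 1"
    and "dim (form_kernel \<mu>) = 1 ==> form_kernel \<mu> = span {pf_vec k \<mu> e}"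
proof -
  have dimV: "DIM('v) = 2 * k + 1" using bij_betw_same_card[OF e] by simp
  have eB: "e ` {..2 * k} = Basis" using e by (simp add: bij_betw_def)
  have "\<mu> u (pf_vec k \<mu> e) = 0" for u
  proof (rule linear_eq_0_on_span[OF skew_formD(2)[OF \<mu>], of "Basis :: 'v set"])
    fix b :: 'v assume "b \<in> Basis"
    then obtain l where "l \<le> 2 * k" "b = e l" using eB by auto
    then show "\<mu> b (pf_vec k \<mu> e) = 0"
      using pf_sum_contracted[OF \<mu>, of l k e] linear_pf_vec[OF skew_formD(1)[OF \<mu>], of "e l" k \<mu> e] by simp
  qed simp
  then show ker: "pf_vec k \<mu> e \<in> form_kernel \<mu>"
    unfolding form_kernel_def mem_Collect_eq by (subst skew_formD(3)[OF \<mu>]) simp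
  note sub = subspace_form_kernel[OF \<mu>]
  have two: "pf_vec k \<mu> e = 0" if d: "dim (form_kernel \<mu>) \<ge> 2" proof -
    obtain B where B: "B \<subseteq> form_kernel \<mu>" "independent B" "card B = dim (form_kernel \<mu>)"
      by (rule basis_exists[of "form_kernel \<mu>"]) (rule that)
    obtain C where C: "B \<subseteq> C" "independent C" "span C = UNIV"
    proof (rule maximal_independent_subset_extend[OF subset_UNIV B(2)])
      fix C assume "B \<subseteq> C" "C \<subseteq> UNIV" "independent C" "UNIV \<subseteq> span C"
      then show thesis by (intro that[of C]) auto
    qed
    have finC: "finite C" using C(2) independent_bound by blast
    have cardC: "card C = 2 * k + 1"  using dim_span_eq_card_independent[OF C(2)] C(3) dimV by simp
    have finB: "finite B" using finC C(1) finite_subset by blast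
    have "\<not> card B \<le> 1" using B(3) d by simp
    then obtain x y where xy: "x \<in> B" "y \<in> B" "x \<noteq> y" using finB card_le_Suc0_iff_eq[OF finB] by auto
    have "card {..2 * k} = card C" using cardC by simp
    then obtain b where b: "bij_betw b {..2 * k} C" using finite_same_card_bij[of "{..2 * k}" C] finC by blast
    obtain i j where ij: "i \<le> 2 * k" "j \<le> 2 * k" "b i = x" "b j = y" proof -
      have "x \<in> b ` {..2 * k}" "y \<in> b ` {..2 * k}" using xy C(1) b by (auto simp: bij_betw_def)
      then show ?thesis using that by auto
    qed
    have z: "\<mu> u w = 0" "\<mu> w u = 0" if "u \<in> B" for u w

    proof -
      show "\<mu> u w = 0" using B(1) that by (auto simp: form_kernel_def)
      then show "\<mu> w u = 0" using skew_formD(3)[OF \<mu>, of w u] by simp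
    qed
    have "pf_sum k \<nu> \<mu> b = 0" for \<nu> by (rule pf_sum_two_kernel_vectors[of _ _ i j]) (use ij xy z in auto)
    moreover have "span (b ` {..2 * k}) = UNIV" using b C(3) by (simp add: bij_betw_def)
    ultimately have "pf_sum k \<nu> \<mu> e = 0" if "linear \<nu>" for \<nu> using pf_sum_zero_of_spanning[OF that \<mu>] by blast
    then have "pf_vec k \<mu> e \<bullet> pf_vec k \<mu> e = 0"
      using linear_pf_vec[of "\<lambda>x. x \<bullet> pf_vec k \<mu> e"] bounded_linear_inner_left linear_conv_bounded_linear by metis
    then show ?thesis by simp
  qed
  have one: "pf_vec k \<mu> e \<noteq> 0" if d: "dim (form_kernel \<mu>) = 1"
  proof
    assume 0: "pf_vec k \<mu> e = 0"
    obtain k' \<nu> v where k': "DIM('v) = 2 * k' + 1" "linear \<nu>" "pf_sum k' \<nu> \<mu> v \<noteq> 0"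
      using one_dim_kernel[OF \<mu> d] by blast
    then have "pf_sum k \<nu> \<mu> v \<noteq> 0" using dimV by simp
    moreover have "pf_sum k \<nu> \<mu> e = 0" using 0 linear_pf_vec[OF k'(2)] linear_0[OF k'(2)] by metis
    ultimately show False using pf_sum_zero_of_spanning[OF k'(2) \<mu>, of e k v] eB by simp
  qed
  show iff: "pf_vec k \<mu> e \<noteq> 0 \<longleftrightarrow> dim (form_kernel \<mu>) = 1"
  proof
    assume nz: "pf_vec k \<mu> e \<noteq> 0"
    have "dim (form_kernel \<mu>) \<noteq> 0" using nz ker dim_eq_0[of "form_kernel \<mu>"] by blast
    moreover have "\<not> dim (form_kernel \<mu>) \<ge> 2" using two nz by blast
    ultimately show "dim (form_kernel \<mu>) = 1" by linarith
  qed (rule one)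
  show "form_kernel \<mu> = span {pf_vec k \<mu> e}" if d: "dim (form_kernel \<mu>) = 1"
  proof (rule subspace_dim_equal[symmetric])
    show "span {pf_vec k \<mu> e} \<subseteq> form_kernel \<mu>" using ker sub by (simp add: span_minimal)
    show "dim (form_kernel \<mu>) \<le> dim (span {pf_vec k \<mu> e})" using one[OF d] d by simp
  qed (use sub in auto)
qed

subsection \<open>The restricted symplectic form in local coordinates\<close>

text \<open>The exterior derivative of the one-form w \<mapsto> \<nu> y \<bullet> w.\<close>

definition ext_deriv :: "('e::euclidean_space => 'e) => 'e => 'e => 'e => real" where
  "ext_deriv \<nu> y v w = fderiv \<nu> y v \<bullet> w - fderiv \<nu> y w \<bullet> v"

text \<open>The form d(\<kappa> \<nu>) = d\<kappa> \<and> \<nu> + \<kappa> d\<nu> at the point x =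
  (y, \<kappa>).\<close>

definition lifted_form :: "('e::euclidean_space => 'e) => 'e \<times> real => 'e \<times> real => 'e \<times> real => real" where
  "lifted_form \<nu> x u w = snd u * (\<nu> (fst x) \<bullet> fst w) - snd w * (\<nu> (fst x) \<bullet> fst u) + snd x * ext_deriv \<nu> (fst x) (fst u) (fst w)"

abbreviation lifted_kernel :: "('e::euclidean_space => 'e) => 'e \<times> real => ('e \<times> real) set" where
  "lifted_kernel \<nu> x \<equiv> form_kernel (lifted_form \<nu> x)"

text \<open>The kernel of d\<nu> restricted to the hyperplane ker \<nu>. It does not change if \<nu>
  is multiplied by a nonvanishing function, so it belongs to the distribution.\<close>

definition char_space :: "('e::euclidean_space => 'e) => 'e => 'e set" where
  "char_space \<nu> y = {v. \<nu> y \<bullet> v = 0 \<and> (\<forall>w. \<nu> y \<bullet> w = 0 \<longrightarrow> ext_deriv \<nu> y v w = 0)}"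

lemma linear_ext_deriv:
  assumes "\<nu> differentiable at y" shows "linear (ext_deriv \<nu> y v)" "linear (\<lambda>v. ext_deriv \<nu> y v w)"
proof -
  have l: "linear (fderiv \<nu> y)" by (rule linear_frechet_derivative[OF assms])
  show "linear (ext_deriv \<nu> y v)" "linear (\<lambda>v. ext_deriv \<nu> y v w)"
    by (rule linearI; simp add: ext_deriv_def linear_add[OF l] linear_cmul[OF l] inner_add_left inner_add_right algebra_simps)+
qed

lemma skew_lifted_form:
  assumes "\<nu> differentiable at (fst x)" shows "skew_form (lifted_form \<nu> x)"
  unfolding skew_form_def
proof (intro conjI allI)
  note l = linear_ext_deriv(1)[OF assms]
  show "linear (lifted_form \<nu> x u)" for u
    by (rule linearI) (simp_all add: lifted_form_def linear_add[OF l] linear_cmul[OF l] inner_add_right algebra_simps)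
  show "lifted_form \<nu> x u v = - lifted_form \<nu> x v u" for u v by (simp add: lifted_form_def ext_deriv_def algebra_simps)
qed

text \<open>Testing a kernel vector (v, m) against (0, 1) puts v into ker \<nu>, against vectors of
  ker \<nu> into \<open>char_space\<close>, and against \<nu> y determines m. Hence the kernel
  projects isomorphically to the base, for every \<kappa> other than 0.\<close>

lemma form_kernel_lifted_form:
  assumes d: "\<nu> differentiable at y" and a: "\<nu> y \<noteq> 0" and l: "\<kappa> \<noteq> 0"
  shows "lifted_kernel \<nu> (y, \<kappa>) = (\<lambda>v. (v, - \<kappa> * ext_deriv \<nu> y v (\<nu> y) / (\<nu> y \<bullet> \<nu> y))) ` char_space \<nu> y"
proof (intro equalityI subsetI)
  let ?n = "\<nu> y \<bullet> \<nu> y"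
  have n: "?n \<noteq> 0" using a by simp
  note lin = linear_ext_deriv(1)[OF d]
  fix u assume u: "u \<in> lifted_kernel \<nu> (y, \<kappa>)"
  obtain v m where vm: "u = (v, m)" by (cases u)
  have k: "m * (\<nu> y \<bullet> w) - k * (\<nu> y \<bullet> v) + \<kappa> * ext_deriv \<nu> y v w = 0" for w k
    using u[unfolded form_kernel_def mem_Collect_eq, rule_format, of "(w, k)"] by (simp add: vm lifted_form_def)
  have av: "\<nu> y \<bullet> v = 0" using k[of 0 1] linear_0[OF lin] by simp
  have "ext_deriv \<nu> y v w = 0" if "\<nu> y \<bullet> w = 0" for w using k[of w 0] that l by simp
  then have "v \<in> char_space \<nu> y" using av by (simp add: char_space_def)
  moreover have "m = - \<kappa> * ext_deriv \<nu> y v (\<nu> y) / ?n" using k[of "\<nu> y" 0] n by (simp add: field_simps)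
  ultimately show "u \<in> (\<lambda>v. (v, - \<kappa> * ext_deriv \<nu> y v (\<nu> y) / ?n)) ` char_space \<nu> y" unfolding vm by blast
next
  let ?n = "\<nu> y \<bullet> \<nu> y"
  have n: "?n \<noteq> 0" using a by simp
  note lin = linear_ext_deriv(1)[OF d]
  fix u assume "u \<in> (\<lambda>v. (v, - \<kappa> * ext_deriv \<nu> y v (\<nu> y) / ?n)) ` char_space \<nu> y"
  then obtain v where v: "v \<in> char_space \<nu> y" "u = (v, - \<kappa> * ext_deriv \<nu> y v (\<nu> y) / ?n)" by blast
  have "lifted_form \<nu> (y, \<kappa>) u w = 0" for w proof -
    define t where "t = (\<nu> y \<bullet> fst w) / ?n"
    define z where "z = fst w - t *\<^sub>R \<nu> y"
    have "\<nu> y \<bullet> z = 0" using n by (simp add: z_def t_def inner_diff_right)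
    then have z0: "ext_deriv \<nu> y v z = 0" using v(1) by (simp add: char_space_def)
    have "fst w = z + t *\<^sub>R \<nu> y" by (simp add: z_def)
    then have e: "ext_deriv \<nu> y v (fst w) = t * ext_deriv \<nu> y v (\<nu> y)"
      using z0 by (simp add: linear_add[OF lin] linear_cmul[OF lin])
    have "\<nu> y \<bullet> v = 0" using v(1) by (simp add: char_space_def)
    then show ?thesis by (simp add: lifted_form_def v(2) e t_def)
  qed
  then show "u \<in> lifted_kernel \<nu> (y, \<kappa>)" by (simp add: form_kernel_def)
qed

text \<open>Dilating the fibres by \<mu> multiplies the form by \<mu>, so dilated curves remain
  tangent to the kernel. This symmetry later turns one lifted curve into an interval of
  them.\<close>

lemma form_kernel_lifted_form_scale:
  assumes "(v, m) \<in> lifted_kernel \<nu> (y, \<kappa>)"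
  shows "(v, \<mu> * m) \<in> lifted_kernel \<nu> (y, \<mu> * \<kappa>)"
proof -
  have "lifted_form \<nu> (y, \<mu> * \<kappa>) (v, \<mu> * m) (w, k) = \<mu> * lifted_form \<nu> (y, \<kappa>) (v, m) (w, k / \<mu>)" if "\<mu> \<noteq> 0" for w k
    using that by (simp add: lifted_form_def algebra_simps)
  moreover have "lifted_form \<nu> (y, 0) (v, 0) (w, k) = 0" for w k proof -
    have "lifted_form \<nu> (y, \<kappa>) (v, m) (0, 1) - lifted_form \<nu> (y, \<kappa>) (v, m) (0, 0) = 0"
      using assms by (simp add: form_kernel_def)
    then have "\<nu> y \<bullet> v = 0" by (simp add: lifted_form_def)
    then show ?thesis by (simp add: lifted_form_def)
  qed
  ultimately show ?thesis using assms by (cases "\<mu> = 0") (auto simp: form_kernel_def)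
qed

lemma dim_form_kernel_lifted_form:
  assumes d: "\<nu> differentiable at y" and a: "\<nu> y \<noteq> 0" and l: "\<kappa> \<noteq> 0"
  shows "dim (lifted_kernel \<nu> (y, \<kappa>)) = dim (char_space \<nu> y)"
  unfolding form_kernel_lifted_form[OF d a l]
proof (rule dim_image_eq)
  note lin = linear_ext_deriv(2)[OF d]
  show "linear (\<lambda>v. (v, - \<kappa> * ext_deriv \<nu> y v (\<nu> y) / (\<nu> y \<bullet> \<nu> y)))"
    by (rule linearI) (simp_all add: linear_add[OF lin] linear_cmul[OF lin] divide_inverse ring_distribs)
qed (auto intro: inj_onI)

definition pf_field :: "nat => (nat => 'e \<times> real) => ('e::euclidean_space => 'e) => 'e \<times> real => 'e \<times> real" where
  "pf_field k e \<nu> x = pf_vec k (lifted_form \<nu> x) e"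

context
  fixes B :: "'e::euclidean_space set" and \<nu> :: "'e => 'e"
  assumes B: "open B" and C2: "Ck_on 2 B \<nu>"
begin

lemma C2_Suc: "Ck_on (Suc (Suc 0)) B \<nu>" using C2 by (simp only: numeral_2_eq_2)

lemma form_differentiable: "y \<in> B ==> \<nu> differentiable at y" using C2_Suc by simp

lemma open_cylinder: "open (B \<times> (UNIV :: real set))" by (intro open_Times B open_UNIV)

definition lifted_deriv :: "'e \<times> real => 'e \<times> real => 'e \<times> real => 'e \<times> real => real" where
  "lifted_deriv x h u w = (let D = \<lambda>v. fderiv \<nu> (fst x) v;
      D2 = \<lambda>v w. fderiv (\<lambda>y. fderiv \<nu> y w) (fst x) v
    in snd u * (D (fst h) \<bullet> fst w) - snd w * (D (fst h) \<bullet> fst u)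
       + (snd h * (D (fst u) \<bullet> fst w - D (fst w) \<bullet> fst u)
       + snd x * (D2 (fst h) (fst u) \<bullet> fst w - D2 (fst h) (fst w) \<bullet> fst u)))"

lemma has_derivative_lifted_form:
  assumes x: "fst x \<in> B"
  shows "((\<lambda>x. lifted_form \<nu> x u w) has_derivative (\<lambda>h. lifted_deriv x h u w)) (at x)"
proof -
  have a: "((\<lambda>x. \<nu> (fst x)) has_derivative (\<lambda>h. fderiv \<nu> (fst x) (fst h))) (at x)"
    by (rule has_derivative_compose[OF has_derivative_fst[OF has_derivative_ident] Ck_on_deriv[OF C2_Suc x]])
  have d: "((\<lambda>x. fderiv \<nu> (fst x) v) has_derivative
      (\<lambda>h. fderiv (\<lambda>y. fderiv \<nu> y v) (fst x) (fst h))) (at x)" for v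
  proof (rule has_derivative_compose[OF has_derivative_fst[OF has_derivative_ident]])
    show "((\<lambda>y. fderiv \<nu> y v) has_derivative fderiv (\<lambda>y. fderiv \<nu> y v) (fst x)) (at (fst x))"
      using C2_Suc x by (simp add: frechet_derivative_works[symmetric])
  qed
  show ?thesis
    unfolding lifted_form_def ext_deriv_def
    by (rule derivative_eq_intros a d refl)+ (auto simp: lifted_deriv_def Let_def fun_eq_iff algebra_simps)
qed

text \<open>d(d(\<kappa> \<nu>)) = 0: the second derivatives cancel by their symmetry and the
  first-order terms cancel algebraically.\<close>

lemma lifted_deriv_closed:
  assumes x: "fst x \<in> B"
  shows "lifted_deriv x a b c + lifted_deriv x b c a + lifted_deriv x c a b = 0"
proof -
  have sym: "fderiv (\<lambda>y. fderiv \<nu> y w) (fst x) v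
    = fderiv (\<lambda>y. fderiv \<nu> y v) (fst x) w" for v w by (rule symmetric_second_derivative[OF B C2 x])
  show ?thesis
    unfolding lifted_deriv_def Let_def sym[of "fst a" "fst b"] sym[of "fst c" "fst a"] sym[of "fst b" "fst c"] by (simp add: algebra_simps)
qed

lemma Ck_on_lifted_form: "Ck_on (Suc 0) (B \<times> (UNIV :: real set)) (\<lambda>x. lifted_form \<nu> x u w)"
proof -
  note o = open_cylinder
  have f: "Ck_on (Suc 0) (B \<times> (UNIV :: real set)) (\<lambda>x. fst x)"
    using Ck_on_bounded_linear[OF o bounded_linear_fst Ck_on_id[OF o]] by simp
  have s: "Ck_on (Suc 0) (B \<times> (UNIV :: real set)) (\<lambda>x. snd x)"
    using Ck_on_bounded_linear[OF o bounded_linear_snd Ck_on_id[OF o]] by simp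
  have sub: "(\<lambda>x. fst x) ` (B \<times> (UNIV :: real set)) \<subseteq> B" by auto
  have a: "Ck_on (Suc 0) (B \<times> (UNIV :: real set)) (\<lambda>x. \<nu> (fst x))"
    by (rule Ck_on_compose[OF o sub f Ck_on_Suc_imp[OF C2_Suc]])
  have d: "Ck_on (Suc 0) (B \<times> (UNIV :: real set)) (\<lambda>x. fderiv \<nu> (fst x) v)" for v proof -
    have "Ck_on (Suc 0) B (\<lambda>y. fderiv \<nu> y v)" using C2_Suc unfolding Ck_on.simps(2)[of "Suc 0"] by blast
    from Ck_on_compose[OF o sub f this] show ?thesis .
  qed
  show ?thesis unfolding lifted_form_def ext_deriv_def
    by (intro Ck_on_add[OF o] Ck_on_diff[OF o] Ck_on_mult[OF o] Ck_on_inner[OF o] Ck_on_const[OF o] a d s)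
qed

lemma Ck_on_pf_field: "Ck_on (Suc 0) (B \<times> UNIV) (pf_field k e \<nu>)"
  unfolding pf_field_def[abs_def] pf_vec_def pf_coeff_def
  by (intro Ck_on_sum[OF open_cylinder] Ck_on_scaleR[OF open_cylinder] Ck_on_mult[OF open_cylinder]
    Ck_on_prod[OF open_cylinder] Ck_on_const[OF open_cylinder] Ck_on_lifted_form finite_lessThan)

text \<open>The trace over the basis selects, in the summand of \<pi>, the derivative in the
  direction e (\<pi> 0). The product rule then leaves exactly the sum of
  \<open>pf_divergence\<close>.\<close>

lemma divergence_pf_field:
  assumes e: "bij_betw e {..2 * k} (Basis :: ('e \<times> real) set)" and x: "fst x \<in> B"
  shows "(\<Sum>b\<in>Basis. fderiv (pf_field k e \<nu>) x b \<bullet> b) = 0"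
proof -
  let ?P = "{\<pi>. \<pi> permutes {..2 * k}}"
  let ?m = "\<lambda>i j. lifted_form \<nu> x (e i) (e j)"
  define c where "c \<pi> h = of_int (sign \<pi>) * (\<Sum>j<k. lifted_deriv x h (e (\<pi> (2 * j + 1))) (e (\<pi> (2 * j + 2))) *
      (\<Prod>i\<in>{..<k} - {j}. ?m (\<pi> (2 * i + 1)) (\<pi> (2 * i + 2))))" for \<pi> h
  have "((\<lambda>x. pf_coeff k (lifted_form \<nu> x) e \<pi>) has_derivative c \<pi>) (at x)" for \<pi>
    unfolding pf_coeff_def c_def by (intro has_derivative_mult_right has_derivative_prod has_derivative_lifted_form[OF x])
  then have "(pf_field k e \<nu> has_derivative (\<lambda>h. \<Sum>\<pi>\<in>?P. c \<pi> h *\<^sub>R e (\<pi> 0))) (at x)"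
    unfolding pf_field_def[abs_def] pf_vec_def by (intro has_derivative_sum has_derivative_scaleR_left)
  then have "(\<Sum>b\<in>Basis. fderiv (pf_field k e \<nu>) x b \<bullet> b) = (\<Sum>b\<in>Basis. (\<Sum>\<pi>\<in>?P. c \<pi> b *\<^sub>R e (\<pi> 0)) \<bullet> b)"
    by (simp only: frechet_derivative_at[symmetric])
  also have "\<dots> = (\<Sum>\<pi>\<in>?P. \<Sum>b\<in>Basis. c \<pi> b * (e (\<pi> 0) \<bullet> b))"
    by (simp only: inner_sum_left inner_scaleR_left) (rule sum.swap)
  also have "\<dots> = (\<Sum>\<pi>\<in>?P. c \<pi> (e (\<pi> 0)))"
  proof (rule sum.cong[OF refl])
    fix \<pi> assume "\<pi> \<in> ?P"
    then have "\<pi> 0 \<in> {..2 * k}" using permutes_in_image[of \<pi> "{..2 * k}" 0] by simp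
    then have b: "e (\<pi> 0) \<in> Basis" using e by (auto simp: bij_betw_def)
    have "(\<Sum>b\<in>Basis. c \<pi> b * (e (\<pi> 0) \<bullet> b)) = (\<Sum>b\<in>Basis. if b = e (\<pi> 0) then c \<pi> b else 0)"
      by (rule sum.cong[OF refl]) (use b in \<open>auto simp: inner_Basis\<close>)
    then show "(\<Sum>b\<in>Basis. c \<pi> b * (e (\<pi> 0) \<bullet> b)) = c \<pi> (e (\<pi> 0))" using b by simp
  qed
  also have "\<dots> = 0"
    unfolding c_def by (rule pf_divergence[where D = "\<lambda>a b c. lifted_deriv x (e a) (e b) (e c)" and m = ?m])
      (rule lifted_deriv_closed[OF x])
  finally show ?thesis .
qed

end

lemma exists_Basis_enumeration:
  assumes "DIM('v::euclidean_space) = 2 * k + 1" shows "\<exists>e. bij_betw e {..2 * k} (Basis :: 'v set)"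
  using assms by (intro finite_same_card_bij) auto

subsection \<open>Null sets and products\<close>

text \<open>Fubini: almost every slice of a null set is null, but a slice that contains a nonempty
  open set is not. A Borel null set above E is used since N and E need not be Borel.\<close>

lemma negligible_of_product_sections:
  fixes N :: "'a::euclidean_space set" and E :: "('a \<times> 'b::euclidean_space) set"
  assumes E: "negligible E" and N: "\<And>y. y \<in> N ==> \<exists>U. open U \<and> U \<noteq> {} \<and> {y} \<times> U \<subseteq> E"
  shows "negligible N"
proof -
  have "E \<in> null_sets lebesgue" using E by (simp add: negligible_iff_null_sets)
  then obtain E' where E': "E' \<in> null_sets lborel" "E \<subseteq> E'" by (auto simp: null_sets_completion_iff2)
  then have meas: "E' \<in> sets (lborel \<Otimes>\<^sub>M lborel)" and zero: "emeasure (lborel \<Otimes>\<^sub>M lborel) E' = 0"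
    unfolding lborel_prod by (auto simp: null_sets_def)
  have "(\<integral>\<^sup>+ y. emeasure lborel (Pair y -` E') \<partial>lborel) = 0"
    using lborel.emeasure_pair_measure_alt[OF meas] zero by simp
  moreover have m: "(\<lambda>y. emeasure lborel (Pair y -` E')) \<in> borel_measurable lborel"
    by (rule lborel.measurable_emeasure_Pair[OF meas])
  ultimately have ae: "AE y in lborel. emeasure lborel (Pair y -` E') = 0" by (simp add: nn_integral_0_iff_AE)
  have "emeasure lborel (Pair y -` E') \<noteq> 0" if "y \<in> N" for y proof -
    obtain U where U: "open U" "U \<noteq> {}" "{y} \<times> U \<subseteq> E" using N[OF \<open>y \<in> N\<close>] by blast
    have "\<not> negligible U" using U(1,2) open_not_negligible by blast
    then have "emeasure lborel U \<noteq> 0" using U(1) by (auto simp: negligible_iff_null_sets null_sets_def)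
    moreover have "emeasure lborel U \<le> emeasure lborel (Pair y -` E')"
      using U(3) E'(2) meas by (intro emeasure_mono) (auto intro: sets_Pair1)
    ultimately show ?thesis by auto
  qed
  then have "AE y in lborel. y \<notin> N" using ae by (auto elim!: eventually_mono)
  then obtain N' where "N' \<in> null_sets lborel" "N \<subseteq> N'" by (auto simp: AE_iff_null_sets[symmetric] eventually_ae_filter)
  then show ?thesis by (meson negligible_iff_null_sets negligible_subset null_sets_completionI)
qed

subsection \<open>Real analytic maps are smooth\<close>

text \<open>Power series are grouped by total degree, so that only finite sums over multi-indices occur.\<close>

definition degree_indices :: "nat => ('a::euclidean_space => nat) set" where
  "degree_indices n = {\<alpha> \<in> Basis \<rightarrow>\<^sub>E UNIV. (\<Sum>b\<in>Basis. \<alpha> b) = n}"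

definition monomial :: "('a::euclidean_space => nat) => 'a => real" where
  "monomial \<alpha> x = (\<Prod>b\<in>Basis. (x \<bullet> b) ^ \<alpha> b)"

definition homogeneous_part :: "(('a::euclidean_space => nat) => real) => nat => 'a => real" where
  "homogeneous_part c n x = (\<Sum>\<alpha>\<in>degree_indices n. c \<alpha> * monomial \<alpha> x)"

definition coeff_norm :: "(('a::euclidean_space => nat) => real) => nat => real" where
  "coeff_norm c n = (\<Sum>\<alpha>\<in>degree_indices n. \<bar>c \<alpha>\<bar>)"

definition deriv_coeff :: "(('a::euclidean_space => nat) => real) => 'a => ('a => nat) => real" where
  "deriv_coeff c b \<alpha> = real (\<alpha> b + 1) * c (\<alpha>(b := \<alpha> b + 1))"

text \<open>A ball of the maximum norm, so that all monomials of degree n have the same bound s^n on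
  it.\<close>

definition open_cube :: "real => 'a::euclidean_space set" where
  "open_cube \<rho> = {x. \<forall>b\<in>Basis. \<bar>x \<bullet> b\<bar> < \<rho>}"

text \<open>Bounds at every smaller radius instead of one at \<rho>: in this form the property
  passes to derivatives without shrinking the cube.\<close>

definition converges_on_cube :: "real => (('a::euclidean_space => nat) => real) => bool" where
  "converges_on_cube \<rho> c \<longleftrightarrow> (\<forall>s. 0 < s \<and> s < \<rho> \<longrightarrow> (\<exists>K. \<forall>n. coeff_norm c n * s ^ n \<le> K))"

lemma finite_degree_indices: "finite (degree_indices n :: ('a::euclidean_space => nat) set)"
proof (rule finite_subset)
  show "(degree_indices n :: ('a => nat) set) \<subseteq> Basis \<rightarrow>\<^sub>E {..n}"
  proof
    fix \<alpha> :: "'a => nat" assume \<alpha>: "\<alpha> \<in> degree_indices n"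
    have "\<alpha> b \<le> n" if "b \<in> Basis" for b
      using \<alpha> member_le_sum[of b Basis \<alpha>] that by (auto simp: degree_indices_def)
    then show "\<alpha> \<in> Basis \<rightarrow>\<^sub>E {..n}" using \<alpha> by (auto simp: degree_indices_def PiE_iff)
  qed
  show "finite ((Basis :: 'a set) \<rightarrow>\<^sub>E {..n})" by (rule finite_PiE) auto
qed

lemma open_open_cube: "open (open_cube \<rho> :: 'a::euclidean_space set)"
proof -
  have "(open_cube \<rho> :: 'a set) = (\<Inter>b\<in>Basis. {x. \<bar>x \<bullet> b\<bar> < \<rho>})" by (auto simp: open_cube_def)
  moreover have "open (\<Inter>b\<in>Basis. {x :: 'a. \<bar>x \<bullet> b\<bar> < \<rho>})"
    by (intro open_INT finite_Basis ballI open_Collect_less continuous_intros)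
  ultimately show ?thesis by simp
qed

lemma convex_open_cube: "convex (open_cube \<rho> :: 'a::euclidean_space set)"
proof -
  have "(open_cube \<rho> :: 'a set) = (\<Inter>b\<in>Basis. {x. x \<bullet> b < \<rho>} \<inter> {x. x \<bullet> b > - \<rho>})" by (fastforce simp: open_cube_def abs_less_iff)
  moreover have "convex (\<Inter>b\<in>Basis. {x :: 'a. x \<bullet> b < \<rho>} \<inter> {x. x \<bullet> b > - \<rho>})"
    by (intro convex_INT convex_Int) (auto simp: convex_halfspace_lt convex_halfspace_gt inner_commute)
  ultimately show ?thesis by simp
qed

lemma open_cube_shrink:
  assumes "x \<in> open_cube \<rho>" obtains s where "0 < s" "s < \<rho>" "x \<in> open_cube s"
proof -
  have fin: "finite ((\<lambda>b. \<bar>x \<bullet> b\<bar>) ` Basis)" "(\<lambda>b. \<bar>x \<bullet> b\<bar>) ` Basis \<noteq> {}" by auto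
  define m where "m = Max ((\<lambda>b. \<bar>x \<bullet> b\<bar>) ` Basis)"
  have m1: "m < \<rho>" unfolding m_def using assms fin by (auto simp: open_cube_def)
  have "m \<in> (\<lambda>b. \<bar>x \<bullet> b\<bar>) ` Basis" unfolding m_def by (rule Max_in[OF fin])
  with m1 have m: "m < \<rho>" "m \<ge> 0" by auto
  have "\<bar>x \<bullet> b\<bar> \<le> m" if "b \<in> Basis" for b unfolding m_def using fin that by (intro Max_ge) auto
  then have "x \<in> open_cube ((m + \<rho>) / 2)" using m by (fastforce simp: open_cube_def)
  then show ?thesis using that[of "(m + \<rho>) / 2"] m by auto
qed

lemma monomial_bound:
  assumes "x \<in> open_cube s" "\<alpha> \<in> degree_indices n" shows "\<bar>monomial \<alpha> x\<bar> \<le> s ^ n"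
proof -
  have "\<bar>monomial \<alpha> x\<bar> = (\<Prod>b\<in>Basis. \<bar>x \<bullet> b\<bar> ^ \<alpha> b)" by (simp add: monomial_def abs_prod power_abs)
  also have "\<dots> \<le> (\<Prod>b\<in>Basis. s ^ \<alpha> b)"
    by (intro prod_mono conjI power_mono zero_le_power) (use assms in \<open>auto simp: open_cube_def less_imp_le\<close>)
  also have "\<dots> = s ^ n" using assms(2) by (simp add: power_sum[symmetric] degree_indices_def)
  finally show ?thesis .
qed

lemma homogeneous_part_bound:
  assumes "x \<in> open_cube s" shows "\<bar>homogeneous_part c n x\<bar> \<le> coeff_norm c n * s ^ n"
  unfolding homogeneous_part_def coeff_norm_def sum_distrib_right
  by (rule order_trans[OF sum_abs], rule sum_mono) (simp add: abs_mult mult_left_mono monomial_bound[OF assms])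

lemma coeff_norm_nonneg: "coeff_norm c n \<ge> 0" by (simp add: coeff_norm_def sum_nonneg)

lemma degree_indices_raise:
  assumes b: "b \<in> Basis"
  shows "bij_betw (\<lambda>\<beta>. \<beta>(b := \<beta> b + 1)) (degree_indices n) {\<alpha> \<in> degree_indices (Suc n). \<alpha> b > 0}"
proof (rule bij_betwI[where g = "\<lambda>\<alpha>. \<alpha>(b := \<alpha> b - 1)"])
  have s: "(\<Sum>i\<in>Basis. \<alpha> i) = \<alpha> b + (\<Sum>i\<in>Basis - {b}. \<alpha> i)" for \<alpha> :: "'a => nat"
    using b by (simp add: sum.remove)
  have t: "(\<Sum>i\<in>Basis - {b}. (\<alpha>(b := m)) i) = (\<Sum>i\<in>Basis - {b}. \<alpha> i)" for \<alpha> :: "'a => nat" and m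
    by (rule sum.cong) auto
  have u: "(\<Sum>i\<in>Basis. (\<alpha>(b := m)) i) = m + (\<Sum>i\<in>Basis - {b}. \<alpha> i)" for \<alpha> :: "'a => nat" and m
    by (simp only: s[of "\<alpha>(b := m)"] t fun_upd_same)
  show "(\<lambda>\<beta>. \<beta>(b := \<beta> b + 1)) \<in> degree_indices n \<rightarrow> {\<alpha> \<in> degree_indices (Suc n). \<alpha> b > 0}"
  proof
    fix \<beta> :: "'a => nat" assume \<beta>: "\<beta> \<in> degree_indices n"
    then have "(\<Sum>i\<in>Basis. (\<beta>(b := \<beta> b + 1)) i) = Suc n" using s[of \<beta>] unfolding u by (simp add: degree_indices_def)
    moreover have "\<beta>(b := \<beta> b + 1) \<in> Basis \<rightarrow>\<^sub>E UNIV" using \<beta> b by (auto simp: degree_indices_def PiE_iff extensional_def)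
    ultimately show "\<beta>(b := \<beta> b + 1) \<in> {\<alpha> \<in> degree_indices (Suc n). \<alpha> b > 0}" unfolding degree_indices_def by simp
  qed
  show "(\<lambda>\<alpha>. \<alpha>(b := \<alpha> b - 1)) \<in> {\<alpha> \<in> degree_indices (Suc n). \<alpha> b > 0} \<rightarrow> degree_indices n"
  proof
    fix \<beta> :: "'a => nat" assume \<beta>: "\<beta> \<in> {\<alpha> \<in> degree_indices (Suc n). \<alpha> b > 0}"
    then have "(\<Sum>i\<in>Basis. (\<beta>(b := \<beta> b - 1)) i) = n" using s[of \<beta>] unfolding u by (simp add: degree_indices_def)
    moreover have "\<beta>(b := \<beta> b - 1) \<in> Basis \<rightarrow>\<^sub>E UNIV" using \<beta> b by (auto simp: degree_indices_def PiE_iff extensional_def)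
    ultimately show "\<beta>(b := \<beta> b - 1) \<in> degree_indices n" unfolding degree_indices_def by simp
  qed
qed auto

lemma has_derivative_monomial:
  "(monomial \<alpha> has_derivative (\<lambda>h. \<Sum>b\<in>Basis. (h \<bullet> b) * (real (\<alpha> b) * monomial (\<alpha>(b := \<alpha> b - 1)) x))) (at x within S)"
proof -
  have d: "(monomial \<alpha> has_derivative (\<lambda>h. \<Sum>b\<in>Basis. (of_nat (\<alpha> b) * (h \<bullet> b) * (x \<bullet> b) ^ (\<alpha> b - 1)) * (\<Prod>j\<in>Basis - {b}. (x \<bullet> j) ^ \<alpha> j))) (at x within S)"
    unfolding monomial_def[abs_def]
    by (intro has_derivative_prod has_derivative_power bounded_linear_imp_has_derivative bounded_linear_inner_left)
  have eq: "(of_nat (\<alpha> b) * (h \<bullet> b) * (x \<bullet> b) ^ (\<alpha> b - 1)) * (\<Prod>j\<in>Basis - {b}. (x \<bullet> j) ^ \<alpha> j)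
    = (h \<bullet> b) * (real (\<alpha> b) * monomial (\<alpha>(b := \<alpha> b - 1)) x)" if b: "b \<in> Basis" for b h proof -
    have "monomial (\<alpha>(b := \<alpha> b - 1)) x = (x \<bullet> b) ^ (\<alpha> b - 1) * (\<Prod>j\<in>Basis - {b}. (x \<bullet> j) ^ \<alpha> j)"
      unfolding monomial_def using b by (subst prod.remove[of _ b]) auto
    then show ?thesis by simp
  qed
  show ?thesis by (rule has_derivative_eq_rhs[OF d]) (rule ext, rule sum.cong[OF refl], rule eq)
qed

lemma has_derivative_homogeneous_part:
  "(homogeneous_part c (Suc n) has_derivative (\<lambda>h. \<Sum>b\<in>Basis. (h \<bullet> b) * homogeneous_part (deriv_coeff c b) n x)) (at x within S)"
proof -
  have "(homogeneous_part c (Suc n) has_derivative (\<lambda>h. \<Sum>\<alpha>\<in>degree_indices (Suc n). c \<alpha> * (\<Sum>b\<in>Basis. (h \<bullet> b) * (real (\<alpha> b) * monomial (\<alpha>(b := \<alpha> b - 1)) x)))) (at x within S)"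
    unfolding homogeneous_part_def[abs_def] by (intro has_derivative_sum has_derivative_mult_right has_derivative_monomial)
  moreover have "(\<Sum>\<alpha>\<in>degree_indices (Suc n). c \<alpha> * (\<Sum>b\<in>Basis. (h \<bullet> b) * (real (\<alpha> b) * monomial (\<alpha>(b := \<alpha> b - 1)) x)))
     = (\<Sum>b\<in>Basis. (h \<bullet> b) * homogeneous_part (deriv_coeff c b) n x)" for h proof -
    have "(\<Sum>\<alpha>\<in>degree_indices (Suc n). c \<alpha> * (\<Sum>b\<in>Basis. (h \<bullet> b) * (real (\<alpha> b) * monomial (\<alpha>(b := \<alpha> b - 1)) x)))
      = (\<Sum>b\<in>Basis. \<Sum>\<alpha>\<in>degree_indices (Suc n). (h \<bullet> b) * (c \<alpha> * (real (\<alpha> b) * monomial (\<alpha>(b := \<alpha> b - 1)) x)))"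
      unfolding sum_distrib_left by (subst sum.swap) (simp add: mult.left_commute)
    also have "\<dots> = (\<Sum>b\<in>Basis. (h \<bullet> b) * homogeneous_part (deriv_coeff c b) n x)"
    proof (rule sum.cong[OF refl])
      fix b :: 'a assume b: "b \<in> Basis"
      let ?g = "\<lambda>\<alpha>. c \<alpha> * (real (\<alpha> b) * monomial (\<alpha>(b := \<alpha> b - 1)) x)"
      have "(\<Sum>\<alpha>\<in>degree_indices (Suc n). ?g \<alpha>) = (\<Sum>\<alpha>\<in>{\<alpha> \<in> degree_indices (Suc n). \<alpha> b > 0}. ?g \<alpha>)"
        by (rule sum.mono_neutral_right[OF finite_degree_indices]) auto
      also have "\<dots> = (\<Sum>\<beta>\<in>degree_indices n. ?g (\<beta>(b := \<beta> b + 1)))"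
        by (rule sum.reindex_bij_betw[OF degree_indices_raise[OF b], symmetric])
      also have "\<dots> = homogeneous_part (deriv_coeff c b) n x"
        unfolding homogeneous_part_def deriv_coeff_def by (rule sum.cong) auto
      finally show "(\<Sum>\<alpha>\<in>degree_indices (Suc n). (h \<bullet> b) * ?g \<alpha>) = (h \<bullet> b) * homogeneous_part (deriv_coeff c b) n x"
        by (simp only: sum_distrib_left[symmetric])
    qed
    finally show ?thesis .
  qed
  ultimately show ?thesis by simp
qed

lemma coeff_norm_deriv:
  assumes b: "b \<in> Basis" shows "coeff_norm (deriv_coeff c b) n \<le> real (Suc n) * coeff_norm c (Suc n)"
proof -
  have "coeff_norm (deriv_coeff c b) n \<le> (\<Sum>\<beta>\<in>degree_indices n. real (Suc n) * \<bar>c (\<beta>(b := \<beta> b + 1))\<bar>)"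
    unfolding coeff_norm_def
  proof (rule sum_mono)
    fix \<beta> :: "'a => nat" assume "\<beta> \<in> degree_indices n"
    then have "\<beta> b \<le> n" using member_le_sum[of b Basis \<beta>] b by (auto simp: degree_indices_def)
    then show "\<bar>deriv_coeff c b \<beta>\<bar> \<le> real (Suc n) * \<bar>c (\<beta>(b := \<beta> b + 1))\<bar>"
      unfolding deriv_coeff_def abs_mult by (intro mult_right_mono) auto
  qed
  also have "\<dots> = real (Suc n) * (\<Sum>\<alpha>\<in>{\<alpha> \<in> degree_indices (Suc n). \<alpha> b > 0}. \<bar>c \<alpha>\<bar>)"
    using sum.reindex_bij_betw[OF degree_indices_raise[OF b, of n], of "\<lambda>\<alpha>. \<bar>c \<alpha>\<bar>"] by (simp add: sum_distrib_left[symmetric])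
  also have "\<dots> \<le> real (Suc n) * coeff_norm c (Suc n)"
    unfolding coeff_norm_def by (intro mult_left_mono sum_mono2 finite_degree_indices) auto
  finally show ?thesis .
qed

lemma coeff_norm_geometric:
  assumes c: "converges_on_cube \<rho> c" and s: "0 < s" "s < \<rho>"
  obtains K q where "0 < q" "q < 1" "\<And>n. coeff_norm c n * s ^ n \<le> K * q ^ n" "K \<ge> 0"
proof -
  \<comment> \<open>Boundedness at the intermediate radius t gives geometric decay with ratio s / t
    at radius s.\<close>
  define t where "t = (s + \<rho>) / 2"
  have t: "0 < t" "t < \<rho>" "s < t" using s by (auto simp: t_def)
  obtain K where K: "\<And>n. coeff_norm c n * t ^ n \<le> K" using c t unfolding converges_on_cube_def by blast
  have "coeff_norm c n * s ^ n \<le> K * (s / t) ^ n" for n proof -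
    have "coeff_norm c n * s ^ n = (coeff_norm c n * t ^ n) * (s / t) ^ n" using t by (simp add: power_divide)
    also have "\<dots> \<le> K * (s / t) ^ n" using s t by (intro mult_right_mono K) auto
    finally show ?thesis .
  qed
  moreover have "K \<ge> 0" using order_trans[OF mult_nonneg_nonneg[OF coeff_norm_nonneg[of c 0]] K[of 0]] by simp
  ultimately show ?thesis using that[of "s / t" K] s t by auto
qed

text \<open>Differentiation multiplies the coefficients of degree n + 1 by at most n + 1, and the
  geometric decay absorbs this factor.\<close>

lemma converges_on_cube_deriv:
  assumes c: "converges_on_cube \<rho> c" and b: "b \<in> Basis" shows "converges_on_cube \<rho> (deriv_coeff c b)"
  unfolding converges_on_cube_def
proof (intro allI impI, elim conjE)
  fix s assume s: "0 < s" "s < \<rho>"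
  obtain K q where q: "0 < q" "q < 1" "\<And>n. coeff_norm c n * s ^ n \<le> K * q ^ n" "K \<ge> 0"
    by (rule coeff_norm_geometric[OF c s]) (rule that)
  have "(\<lambda>n. real n * q ^ n) \<longlonglongrightarrow> 0" by (rule powser_times_n_limit_0) (use q in simp)
  then have "Bseq (\<lambda>n. real n * q ^ n)" by (intro convergent_imp_Bseq convergentI)
  then obtain B where B: "\<And>n. norm (real n * q ^ n) \<le> B" unfolding Bseq_def by blast
  have "coeff_norm (deriv_coeff c b) n * s ^ n \<le> K * B / s" for n proof -
    have "coeff_norm (deriv_coeff c b) n * s ^ n \<le> real (Suc n) * coeff_norm c (Suc n) * s ^ n"
      using s by (intro mult_right_mono coeff_norm_deriv[OF b]) auto
    also have "\<dots> = real (Suc n) * (coeff_norm c (Suc n) * s ^ Suc n) / s" using s by simp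
    also have "\<dots> \<le> real (Suc n) * (K * q ^ Suc n) / s" using s q(3)[of "Suc n"] by (intro divide_right_mono mult_left_mono) auto
    also have "\<dots> = K * (real (Suc n) * q ^ Suc n) / s" by simp
    also have "\<dots> \<le> K * B / s" using B[of "Suc n"] s q(4) by (intro divide_right_mono mult_left_mono) auto
    finally show ?thesis .
  qed
  then show "\<exists>K. \<forall>n. coeff_norm (deriv_coeff c b) n * s ^ n \<le> K" by blast
qed

definition power_series :: "(('a::euclidean_space => nat) => real) => 'a => real" where
  "power_series c x = (\<Sum>n. homogeneous_part c n x)"

lemma summable_homogeneous_part:
  assumes "converges_on_cube \<rho> c" "x \<in> open_cube \<rho>" shows "summable (\<lambda>n. homogeneous_part c n x)"
proof -
  obtain s where s: "0 < s" "s < \<rho>" "x \<in> open_cube s" by (rule open_cube_shrink[OF assms(2)]) (rule that)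
  obtain K q where q: "0 < q" "q < 1" "\<And>n. coeff_norm c n * s ^ n \<le> K * q ^ n" "K \<ge> 0"
    by (rule coeff_norm_geometric[OF assms(1) s(1,2)]) (rule that)
  show ?thesis
  proof (rule summable_comparison_test'[of "\<lambda>n. K * q ^ n" 0])
    show "summable (\<lambda>n. K * q ^ n)" using q by (intro summable_mult summable_geometric) auto
    show "norm (homogeneous_part c n x) \<le> K * q ^ n" for n using homogeneous_part_bound[OF s(3), of c n] q(3)[of n] by simp
  qed
qed

lemma has_derivative_power_series:
  assumes c: "converges_on_cube \<rho> c" and x: "x \<in> open_cube \<rho>"
  shows "(power_series c has_derivative (\<lambda>h. \<Sum>b\<in>Basis. (h \<bullet> b) * power_series (deriv_coeff c b) x)) (at x)"
proof -
  obtain s where s: "0 < s" "s < \<rho>" "x \<in> open_cube s" by (rule open_cube_shrink[OF x]) (rule that)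
  have sub: "y \<in> open_cube \<rho>" if "y \<in> open_cube s" for y using that s by (auto simp: open_cube_def)
  \<comment> \<open>The derivative of the part of degree m + 1 has degree m, and that of degree 0
    vanishes; this shift is why partial sums up to Suc n are compared with n terms below.\<close>
  define f' where "f' n y h = (case n of 0 => 0 | Suc m => \<Sum>b\<in>Basis. (h \<bullet> b) * homogeneous_part (deriv_coeff c b) m y)" for n y and h :: 'a
  define g' where "g' y h = (\<Sum>b\<in>Basis. (h \<bullet> b) * power_series (deriv_coeff c b) y)" for y and h :: 'a
  have "\<exists>K q. 0 < q \<and> q < 1 \<and> K \<ge> 0 \<and> (\<forall>n. coeff_norm (deriv_coeff c b) n * s ^ n \<le> K * q ^ n)" if "b \<in> Basis" for b
    using coeff_norm_geometric[OF converges_on_cube_deriv[OF c that] s(1,2)] by metis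
  then obtain K q where q: "\<And>b. b \<in> Basis ==> 0 < q b \<and> q b < 1 \<and> K b \<ge> 0"
    "\<And>b n. b \<in> Basis ==> coeff_norm (deriv_coeff c b) n * s ^ n \<le> K b * q b ^ n" by metis
  have "\<exists>g. \<forall>y\<in>open_cube s. (\<lambda>n. homogeneous_part c n y) sums g y \<and> (g has_derivative g' y) (at y within open_cube s)"
  proof (rule has_derivative_series[where f = "homogeneous_part c" and f' = f' and g' = g', OF convex_open_cube _ _ s(3) summable_sums[OF summable_homogeneous_part[OF c x]]])
    show "(homogeneous_part c n has_derivative f' n y) (at y within open_cube s)" for n y
    proof (cases n)
      case 0
      have "degree_indices 0 = {\<lambda>b\<in>Basis::'a set. 0::nat}"
        by (auto simp: degree_indices_def PiE_iff extensional_def restrict_def fun_eq_iff)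
      then have "homogeneous_part c 0 = (\<lambda>y. c (\<lambda>b\<in>Basis. 0))" by (auto simp: homogeneous_part_def monomial_def)
      then show ?thesis by (simp add: 0 f'_def[abs_def])
    next
      case (Suc m) then show ?thesis using has_derivative_homogeneous_part[of c m y] by (simp add: f'_def[abs_def])
    qed
    fix e :: real assume e: "e > 0"
    define T where "T n = (\<Sum>b\<in>Basis. K b * q b ^ n / (1 - q b))" for n
    have q1: "norm (q b) < 1" "1 - q b \<noteq> 0" if "b \<in> Basis" for b using q(1)[OF that] by auto
    have "T \<longlonglongrightarrow> (\<Sum>b\<in>(Basis::'a set). K b * 0 / (1 - q b))"
      unfolding T_def by (intro tendsto_intros LIMSEQ_power_zero) (use q1 in auto)
    then have ev: "\<forall>\<^sub>F n in sequentially. T n < e" by (rule order_tendstoD(2)) (use e in simp)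
    have bound: "norm (sum (\<lambda>i. f' i y h) {..<Suc n} - g' y h) \<le> T n * norm h" if y: "y \<in> open_cube s" for n y h
    proof -
      have "sum (\<lambda>i. f' i y h) {..<Suc n} = (\<Sum>m<n. f' (Suc m) y h)" by (subst sum.lessThan_Suc_shift) (simp add: f'_def)
      also have "\<dots> = (\<Sum>b\<in>Basis. (h \<bullet> b) * (\<Sum>m<n. homogeneous_part (deriv_coeff c b) m y))"
        by (simp add: f'_def sum_distrib_left sum.swap[of _ "{..<n}"])
      finally have "sum (\<lambda>i. f' i y h) {..<Suc n} - g' y h
        = (\<Sum>b\<in>Basis. (h \<bullet> b) * ((\<Sum>m<n. homogeneous_part (deriv_coeff c b) m y) - power_series (deriv_coeff c b) y))"
        by (simp add: g'_def sum_subtractf right_diff_distrib)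
      also have "norm \<dots> \<le> (\<Sum>b\<in>Basis. norm h * (K b * q b ^ n / (1 - q b)))"
      proof (rule sum_norm_le)
        fix b :: 'a assume b: "b \<in> Basis"
        let ?p = "\<lambda>m. homogeneous_part (deriv_coeff c b) m y"
        have sm: "summable ?p" by (rule summable_homogeneous_part[OF converges_on_cube_deriv[OF c b] sub[OF y]])
        have pb: "norm (?p m) \<le> K b * q b ^ m" for m using homogeneous_part_bound[OF y, of "deriv_coeff c b" m] q(2)[OF b, of m] by simp
        have "power_series (deriv_coeff c b) y - (\<Sum>m<n. ?p m) = (\<Sum>m. ?p (m + n))"
          unfolding power_series_def using suminf_minus_initial_segment[OF sm, of n] by simp
        also have "norm \<dots> \<le> (\<Sum>m. K b * q b ^ n * q b ^ m)"
        proof (rule norm_suminf_le)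
          show "norm (?p (m + n)) \<le> K b * q b ^ n * q b ^ m" for m using pb[of "m + n"] by (simp add: power_add mult_ac)
          show "summable (\<lambda>m. K b * q b ^ n * q b ^ m)" using q(1)[OF b] by (intro summable_mult summable_geometric) auto
        qed
        also have "\<dots> = K b * q b ^ n / (1 - q b)"
          using q(1)[OF b] by (subst suminf_mult) (auto simp: suminf_geometric summable_geometric)
        finally have "\<bar>(\<Sum>m<n. ?p m) - power_series (deriv_coeff c b) y\<bar> \<le> K b * q b ^ n / (1 - q b)" by (simp add: abs_minus_commute)
        then show "norm ((h \<bullet> b) * ((\<Sum>m<n. ?p m) - power_series (deriv_coeff c b) y)) \<le> norm h * (K b * q b ^ n / (1 - q b))"
          using Basis_le_norm[OF b, of h] by (simp only: real_norm_def abs_mult) (intro mult_mono, auto)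
      qed
      also have "\<dots> = T n * norm h" unfolding T_def sum_distrib_right by (rule sum.cong[OF refl], rule mult.commute)
      finally show ?thesis .
    qed
    have "\<forall>\<^sub>F n in sequentially. T n < e \<longrightarrow> (\<forall>y\<in>open_cube s. \<forall>h. norm (sum (\<lambda>i. f' i y h) {..<Suc n} - g' y h) \<le> e * norm h)"
      by (intro always_eventually allI impI ballI, rule order_trans[OF bound], assumption, rule mult_right_mono) auto
    with ev have "\<forall>\<^sub>F n in sequentially. \<forall>y\<in>open_cube s. \<forall>h. norm (sum (\<lambda>i. f' i y h) {..<Suc n} - g' y h) \<le> e * norm h"
      by eventually_elim blast
    then show "\<forall>\<^sub>F n in sequentially. \<forall>y\<in>open_cube s. \<forall>h. norm (sum (\<lambda>i. f' i y h) {..<n} - g' y h) \<le> e * norm h"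
      by (subst (asm) eventually_sequentially_Suc)
  qed
  then obtain g where g: "\<And>y. y \<in> open_cube s ==> (\<lambda>n. homogeneous_part c n y) sums g y"
    "(g has_derivative g' x) (at x within open_cube s)" using s(3) by blast
  have "(g has_derivative g' x) (at x)" using g(2) at_within_open[OF s(3) open_open_cube] by simp
  then have "(power_series c has_derivative g' x) (at x)" by (rule has_derivative_transform_within_open[OF _ open_open_cube s(3)])
      (use g(1) in \<open>auto simp: power_series_def sums_unique\<close>)
  then show ?thesis by (simp add: g'_def[abs_def])
qed

lemma Ck_on_power_series:
  assumes "converges_on_cube \<rho> c" shows "Ck_on k (open_cube \<rho>) (power_series c)" using assms
proof (induction k arbitrary: c)
  case 0
  then show ?case by (auto intro!: continuous_at_imp_continuous_on has_derivative_continuous[OF has_derivative_power_series])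
next
  case (Suc k)
  show ?case
  proof (rule Ck_on_SucI[OF open_open_cube has_derivative_power_series[OF Suc.prems]])
    show "Ck_on k (open_cube \<rho>) (\<lambda>x. \<Sum>b\<in>Basis. (v \<bullet> b) * power_series (deriv_coeff c b) x)" for v
      by (intro Ck_on_sum Ck_on_mult Ck_on_const open_open_cube Suc.IH converges_on_cube_deriv[OF Suc.prems])
  qed
qed

text \<open>At the corner p of the cube every monomial of degree n equals \<rho>^n, so absolute
  summability there bounds all coefficients at once. The divisor 2 * DIM places the cube inside the
  ball of radius r.\<close>

lemma power_series_of_has_sum:
  fixes f :: "'a::euclidean_space => real"
  assumes r: "r > 0" and f: "\<And>x. x \<in> ball 0 r ==> ((\<lambda>\<alpha>. monomial \<alpha> x * c \<alpha>) has_sum f x) (Basis \<rightarrow>\<^sub>E UNIV)"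
  shows "\<exists>\<rho>>0. converges_on_cube \<rho> c \<and> (\<forall>x\<in>open_cube \<rho>. f x = power_series c x)"
proof -
  let ?I = "(Basis :: 'a set) \<rightarrow>\<^sub>E (UNIV :: nat set)"
  define \<rho> where "\<rho> = r / (2 * real DIM('a))"
  have \<rho>: "\<rho> > 0" using r by (simp add: \<rho>_def)
  have in_ball: "x \<in> ball 0 r" if "\<And>b. b \<in> Basis ==> \<bar>x \<bullet> b\<bar> \<le> \<rho>" for x :: 'a
  proof -
    have "norm x \<le> (\<Sum>b\<in>Basis. \<bar>x \<bullet> b\<bar>)" by (rule norm_le_l1)
    also have "\<dots> \<le> (\<Sum>b\<in>(Basis::'a set). \<rho>)" by (rule sum_mono) (rule that)
    also have "\<dots> = r / 2" by (simp add: \<rho>_def)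
    finally show ?thesis using r by simp
  qed
  define p :: 'a where "p = (\<Sum>b\<in>Basis. \<rho> *\<^sub>R b)"
  have pb: "p \<bullet> b = \<rho>" if "b \<in> Basis" for b using that by (simp add: p_def inner_sum_left inner_Basis if_distrib cong: if_cong)
  have "p \<in> ball 0 r" by (rule in_ball) (use pb \<rho> in auto)
  from has_sum_imp_summable[OF f[OF this]]
  have "(\<lambda>\<alpha>. monomial \<alpha> p * c \<alpha>) summable_on ?I" .
  from summable_on_iff_abs_summable_on_real[THEN iffD1, OF this]
  have abs: "(\<lambda>\<alpha>. norm (monomial \<alpha> p * c \<alpha>)) summable_on ?I" .
  have J: "homogeneous_part c n x = (\<Sum>\<alpha>\<in>degree_indices n. monomial \<alpha> x * c \<alpha>)" for n x
    by (simp add: homogeneous_part_def mult.commute)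
  have conv: "converges_on_cube \<rho> c"
    unfolding converges_on_cube_def
  proof (intro allI impI, elim conjE)
    fix s assume s: "0 < s" "s < \<rho>"
    have "coeff_norm c n * s ^ n \<le> infsum (\<lambda>\<alpha>. norm (monomial \<alpha> p * c \<alpha>)) ?I" for n proof -
      have mp: "monomial \<alpha> p = \<rho> ^ n" if "\<alpha> \<in> degree_indices n" for \<alpha>
        using that by (simp add: monomial_def pb power_sum[symmetric] degree_indices_def cong: prod.cong)
      have "coeff_norm c n * s ^ n \<le> coeff_norm c n * \<rho> ^ n" using s coeff_norm_nonneg by (intro mult_left_mono power_mono) auto
      also have "\<dots> = (\<Sum>\<alpha>\<in>degree_indices n. norm (monomial \<alpha> p * c \<alpha>))"
        unfolding coeff_norm_def sum_distrib_right by (rule sum.cong) (use mp \<rho> in \<open>auto simp: abs_mult\<close>)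
      also have "\<dots> \<le> infsum (\<lambda>\<alpha>. norm (monomial \<alpha> p * c \<alpha>)) ?I"
        by (rule finite_sum_le_infsum[OF abs finite_degree_indices]) (auto simp: degree_indices_def)
      finally show ?thesis .
    qed
    then show "\<exists>K. \<forall>n. coeff_norm c n * s ^ n \<le> K" by blast
  qed
  moreover have "f x = power_series c x" if x: "x \<in> open_cube \<rho>" for x proof -
    have "x \<in> ball 0 r" using x by (intro in_ball) (auto simp: open_cube_def less_imp_le)
    from f[OF this] have lim: "(sum (\<lambda>\<alpha>. monomial \<alpha> x * c \<alpha>) \<longlongrightarrow> f x) (finite_subsets_at_top ?I)"
      by (simp add: has_sum_def)
    define D where "D N = (\<Union>n<N. degree_indices n :: ('a => nat) set)" for N
    \<comment> \<open>The index sets of degree below N are cofinal among the finite ones, so summing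
      degree by degree gives the unordered sum.\<close>
    have "filterlim D (finite_subsets_at_top ?I) sequentially"
      unfolding filterlim_finite_subsets_at_top
    proof (intro allI impI, elim conjE)
      fix X assume X: "finite X" "X \<subseteq> ?I"
      define N0 where "N0 = Suc (Max (insert 0 ((\<lambda>\<alpha>. \<Sum>b\<in>Basis. \<alpha> b) ` X)))"
      have "(\<Sum>b\<in>Basis. \<alpha> b) < N0" if "\<alpha> \<in> X" for \<alpha>
        unfolding N0_def less_Suc_eq_le using X that by (intro Max_ge) auto
      then have "X \<subseteq> D N" if "N \<ge> N0" for N using X that by (force simp: D_def degree_indices_def)
      moreover have "finite (D N)" "D N \<subseteq> ?I" for N by (auto simp: D_def finite_degree_indices) (auto simp: degree_indices_def)
      ultimately show "\<forall>\<^sub>F N in sequentially. finite (D N) \<and> X \<subseteq> D N \<and> D N \<subseteq> ?I"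
        unfolding eventually_sequentially by blast
    qed
    from filterlim_compose[OF lim this]
    have "(\<lambda>N. sum (\<lambda>\<alpha>. monomial \<alpha> x * c \<alpha>) (D N)) \<longlonglongrightarrow> f x" .
    moreover have "sum (\<lambda>\<alpha>. monomial \<alpha> x * c \<alpha>) (D N) = (\<Sum>n<N. homogeneous_part c n x)" for N
      unfolding D_def J by (rule sum.UNION_disjoint) (auto simp: finite_degree_indices, auto simp: degree_indices_def)
    ultimately have "(\<lambda>n. homogeneous_part c n x) sums f x" by (simp add: sums_def)
    then show ?thesis by (simp add: power_series_def sums_unique)
  qed
  ultimately show ?thesis using \<rho> by blast
qed

lemma Ck_on_local:
  assumes S: "open S" and loc: "\<And>x. x \<in> S ==> \<exists>T. open T \<and> x \<in> T \<and> Ck_on k T f"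
  shows "Ck_on k S f" using loc
proof (induction k arbitrary: f)
  case 0
  show ?case unfolding Ck_on.simps
  proof (rule continuous_at_imp_continuous_on, rule ballI)
    fix x assume "x \<in> S"
    then obtain T where "open T" "x \<in> T" "continuous_on T f" using 0 by auto
    then show "isCont f x" by (simp add: continuous_on_eq_continuous_at)
  qed
next
  case (Suc k) show ?case unfolding Ck_on.simps
  proof (intro conjI ballI allI)
    show "f differentiable at x" if "x \<in> S" for x using Suc.prems[OF that] by auto
    show "Ck_on k S (\<lambda>x. fderiv f x v)" for v
    proof (rule Suc.IH)
      fix x assume "x \<in> S"
      from Suc.prems[OF this] show "\<exists>T. open T \<and> x \<in> T \<and> Ck_on k T (\<lambda>x. fderiv f x v)" by auto
    qed
  qed
qed

text \<open>From here on smooth and analytic data are treated alike, through their derivatives of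
  finite order.\<close>

theorem real_analytic_on_imp_Ck_on:
  fixes f :: "'a::euclidean_space => 'b::euclidean_space"
  assumes S: "open S" and f: "real_analytic_on S f"
  shows "Ck_on k S f"
proof -
  have "Ck_on k S (\<lambda>x. f x \<bullet> b)" for b
  proof (rule Ck_on_local[OF S])
    fix x0 assume "x0 \<in> S"
    then obtain r coef where r: "r > 0" and sum: "\<And>x. x \<in> ball x0 r ==>
        ((\<lambda>\<alpha>. (\<Prod>b\<in>Basis. ((x - x0) \<bullet> b) ^ \<alpha> b) *\<^sub>R coef \<alpha>) has_sum f x) (Basis \<rightarrow>\<^sub>E (UNIV :: nat set))"
      using f unfolding real_analytic_on_def by blast
    define c where "c \<alpha> = coef \<alpha> \<bullet> b" for \<alpha>
    have "((\<lambda>\<alpha>. monomial \<alpha> x * c \<alpha>) has_sum (\<lambda>x. f (x0 + x) \<bullet> b) x) (Basis \<rightarrow>\<^sub>E UNIV)" if "x \<in> ball 0 r" for x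
      using has_sum_bounded_linear[OF bounded_linear_inner_left[of b] sum[of "x0 + x"]] that
      by (simp add: monomial_def c_def dist_norm o_def)
    from power_series_of_has_sum[OF r this]
    obtain \<rho> where \<rho>: "\<rho> > 0" "converges_on_cube \<rho> c" "\<And>x. x \<in> open_cube \<rho> ==> f (x0 + x) \<bullet> b = power_series c x" by blast
    let ?T = "(\<lambda>x. x - x0) -` open_cube \<rho>"
    have T: "open ?T" by (rule open_vimage[OF open_open_cube]) (intro continuous_intros)
    have "Ck_on k ?T (\<lambda>x. power_series c (x - x0))" by (rule Ck_on_compose[OF T _ _ Ck_on_power_series[OF \<rho>(2)]])
        (auto intro!: Ck_on_diff[OF T] Ck_on_id[OF T] Ck_on_const[OF T])
    then have "Ck_on k ?T (\<lambda>x. f x \<bullet> b)" by (rule Ck_on_cong[OF T, rotated]) (use \<rho>(3)[of "_ - x0"] in auto)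
    moreover have "x0 \<in> ?T" using \<rho>(1) by (simp add: open_cube_def)
    ultimately show "\<exists>T. open T \<and> x0 \<in> T \<and> Ck_on k T (\<lambda>x. f x \<bullet> b)" using T by blast
  qed
  then show ?thesis using Ck_on_componentwise[OF S] by blast
qed

lemma class_on_imp_Ck_on: "class_on C S f ==> open S ==> Ck_on k S f"
  by (cases C) (auto simp: C_infinity_on_def real_analytic_on_imp_Ck_on)

lemma negligible_Times_UNIV:
  fixes N :: "'a::euclidean_space set"
  assumes "negligible N" shows "negligible (N \<times> (UNIV :: 'b::euclidean_space set))"
proof -
  obtain N' where N': "N' \<in> null_sets lborel" "N \<subseteq> N'"
    using assms by (auto simp: negligible_iff_null_sets null_sets_completion_iff2)
  then have "N' \<times> UNIV \<in> null_sets (lborel \<Otimes>\<^sub>M (lborel :: 'b measure))"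
    by (auto simp: null_sets_def lborel.emeasure_pair_measure_Times)
  then have "N' \<times> (UNIV :: 'b set) \<in> null_sets lborel" by (simp add: lborel_prod)
  then have "negligible (N' \<times> (UNIV :: 'b set))" by (simp add: negligible_iff_null_sets null_sets_completionI)
  then show ?thesis by (rule negligible_subset) (use N'(2) in auto)
qed

section \<open>Characteristic leaves in a coordinate box\<close>

abbreviation contains_exits :: "('e::euclidean_space => 'e) => 'e set => 'e set => bool" where
  "contains_exits \<nu> B N \<equiv> \<forall>c a b M. a < b \<and> abs_continuous_on a b c \<and> c ` {a..b} \<subseteq> B \<times> (-{0}) \<and> negligible M \<and>
    dim (char_space \<nu> (fst (c a))) \<noteq> 1 \<and> (\<forall>t\<in>{a<..b}. dim (char_space \<nu> (fst (c t))) = 1) \<and>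
    (\<forall>t\<in>{a..b} - M. \<exists>\<xi>\<in>lifted_kernel \<nu> (c t). (c has_vector_derivative \<xi>) (at t within {a..b})) \<longrightarrow>
    (\<exists>t1\<in>{a<..b}. \<forall>t\<in>{a<..t1}. fst (c t) \<in> N)"

abbreviation transports_leaves :: "('e::euclidean_space => 'e) => 'e set => 'e => (real => 'e => 'e) => bool" where
  "transports_leaves \<nu> K e \<psi> \<equiv> \<forall>c a b N. abs_continuous_on a b c \<and> c ` {a..b} \<subseteq> K \<and> negligible N \<and>
      (\<forall>t\<in>{a..b} - N. \<exists>v\<in>char_space \<nu> (c t). (c has_vector_derivative v) (at t within {a..b})) \<longrightarrow>
      (\<forall>t\<in>{a..b}. \<forall>t'\<in>{a..b}. c t' = \<psi> ((c t' - c t) \<bullet> e) (c t))"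

text \<open>The base component of Z at \<kappa> = 1. It serves for flow boxes on M; the volume
  argument is carried out upstairs with Z.\<close>

definition char_field :: "nat => (nat => 'e \<times> real) => ('e::euclidean_space => 'e) => 'e => 'e" where
  "char_field k e \<nu> y = fst (pf_field k e \<nu> (y, 1))"

context
  fixes B :: "'e::euclidean_space set" and \<nu> :: "'e => 'e"
  assumes B: "open B" and C2: "Ck_on 2 B \<nu>" and nz: "0 \<notin> \<nu> ` B"
begin

lemma nonvanishing: "y \<in> B ==> \<nu> y \<noteq> 0" using nz by auto

lemma pf_field_dichotomy:
  assumes e: "bij_betw e {..2 * k} (Basis :: ('e \<times> real) set)" and x: "fst x \<in> B" "snd x \<noteq> 0"
  shows "dim (char_space \<nu> (fst x)) = 1 \<longleftrightarrow> pf_field k e \<nu> x \<noteq> 0"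
    and "dim (char_space \<nu> (fst x)) = 1 ==> lifted_kernel \<nu> x = span {pf_field k e \<nu> x}"
proof -
  note d = form_differentiable[OF B C2 x(1)]
  have dim: "dim (lifted_kernel \<nu> x) = dim (char_space \<nu> (fst x))"
    using dim_form_kernel_lifted_form[OF d nonvanishing[OF x(1)] x(2)] by simp
  note pf = pf_vec_kernel[OF skew_lifted_form[OF d] e]
  show "dim (char_space \<nu> (fst x)) = 1 \<longleftrightarrow> pf_field k e \<nu> x \<noteq> 0" using pf(2) unfolding pf_field_def dim by blast
  show "lifted_kernel \<nu> x = span {pf_field k e \<nu> x}" if "dim (char_space \<nu> (fst x)) = 1"
    using pf(3) that unfolding pf_field_def dim by blast
qed

lemma char_field_span:
  assumes e: "bij_betw e {..2 * k} (Basis :: ('e \<times> real) set)" and y: "y \<in> B"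
    and dim: "dim (char_space \<nu> y) = 1"
  shows "char_space \<nu> y = span {char_field k e \<nu> y}" "char_field k e \<nu> y \<noteq> 0"
proof -
  note d = form_differentiable[OF B C2 y]
  have "char_space \<nu> y = fst ` lifted_kernel \<nu> (y, 1)"
    using form_kernel_lifted_form[OF d nonvanishing[OF y], of 1] by (simp add: image_image)
  also have "\<dots> = fst ` span {pf_field k e \<nu> (y, 1)}" using pf_field_dichotomy(2)[OF e, of "(y, 1)"] y dim by simp
  also have "\<dots> = span {char_field k e \<nu> y}"
    using span_linear_image[OF linear_fst, of "{pf_field k e \<nu> (y, 1)}"] by (simp add: char_field_def)
  finally show *: "char_space \<nu> y = span {char_field k e \<nu> y}" .
  show "char_field k e \<nu> y \<noteq> 0"
  proof
    assume "char_field k e \<nu> y = 0"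
    then have "char_space \<nu> y = {0}" using * by simp
    then show False using dim by simp
  qed
qed

lemma char_field_nonzero:
  assumes e: "bij_betw e {..2 * k} (Basis :: ('e \<times> real) set)" and y: "y \<in> B"
  shows "dim (char_space \<nu> y) = 1 \<longleftrightarrow> char_field k e \<nu> y \<noteq> 0"
proof
  assume "char_field k e \<nu> y \<noteq> 0"
  then have "pf_field k e \<nu> (y, 1) \<noteq> 0" by (auto simp: char_field_def)
  then show "dim (char_space \<nu> y) = 1" using pf_field_dichotomy(1)[OF e, of "(y, 1)"] y by simp
qed (rule char_field_span(2)[OF e y])

lemma Ck_on_char_field: "Ck_on (Suc 0) B (char_field k e \<nu>)"
proof -
  have p: "Ck_on (Suc 0) B (\<lambda>y. (y, 1 :: real))" by (rule Ck_on_Pair[OF B Ck_on_id[OF B] Ck_on_const[OF B]])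
  have s: "(\<lambda>y. (y, 1 :: real)) ` B \<subseteq> B \<times> UNIV" by auto
  have "Ck_on (Suc 0) B (\<lambda>y. pf_field k e \<nu> (y, 1))" by (rule Ck_on_compose[OF B s p Ck_on_pf_field[OF B C2]])
  from Ck_on_bounded_linear[OF B bounded_linear_fst this] show ?thesis
    unfolding char_field_def[abs_def] .
qed

text \<open>\<psi> is the flow of the rescaled base field, with time measured by the height along e.
  It respects null sets and has null orbits, which is what the propagation along leaves relies
  on.\<close>

lemma exists_char_flow_box:
  assumes DIM: "DIM('e \<times> real) = 2 * k + 1" and y0: "y0 \<in> B" and dim: "dim (char_space \<nu> y0) = 1"
  shows "\<exists>r e \<psi>. r > 0 \<and> cball y0 r \<subseteq> B \<and> (\<forall>y\<in>cball y0 r. dim (char_space \<nu> y) = 1) \<and>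
    (\<forall>\<sigma> N. negligible N \<longrightarrow> negligible (\<psi> \<sigma> ` N)) \<and> (DIM('e) \<ge> 2 \<longrightarrow> (\<forall>a. negligible (range (\<lambda>\<sigma>::real. \<psi> \<sigma> a)))) \<and>
    transports_leaves \<nu> (cball y0 r) e \<psi>"
proof -
  obtain en where en: "bij_betw en {..2 * k} (Basis :: ('e \<times> real) set)" using exists_Basis_enumeration[OF DIM] by blast
  let ?X = "char_field k en \<nu>"
  obtain r0 where r0: "r0 > 0" "cball y0 r0 \<subseteq> B" using B y0 open_contains_cball by blast
  obtain K where K: "\<And>x v. x \<in> cball y0 r0 ==> norm (fderiv ?X x v) \<le> K * norm v"
    using Ck_on_frechet_bound[OF Ck_on_char_field compact_cball r0(2)] by blast
  have lip: "norm (?X x - ?X y) \<le> K * norm (x - y)" if "x \<in> cball y0 r0" "y \<in> cball y0 r0" for x y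
  proof (rule differentiable_bound[OF convex_cball _ _ that(1) that(2)])
    fix z assume z: "z \<in> cball y0 r0"
    then show "(?X has_derivative fderiv ?X z) (at z within cball y0 r0)"
      using r0(2) by (intro has_derivative_at_withinI[OF Ck_on_deriv[OF Ck_on_char_field]]) auto
    show "onorm (fderiv ?X z) \<le> K" by (rule onorm_le) (rule K[OF z])
  qed
  obtain r e Y L' M' m where fb: "0 < r" "r \<le> r0" "m > 0" "lipschitz_field Y L' M'"
    "\<And>x. x \<in> cball y0 r ==> ?X x \<bullet> e \<ge> m \<and> Y x = (1 / (?X x \<bullet> e)) *\<^sub>R ?X x"
    using flow_box[OF r0(1) char_field_span(2)[OF en y0 dim] lip] by blast
  have sub: "cball y0 r \<subseteq> B" using r0(2) fb(2) by auto
  have d1: "dim (char_space \<nu> y) = 1" if "y \<in> cball y0 r" for y proof -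
    have "?X y \<noteq> 0" using fb(3) fb(5)[OF that] by auto
    then show ?thesis using char_field_nonzero[OF en, of y] sub that by blast
  qed
  interpret lipschitz_field Y L' M' by (rule fb(4))
  have "c t' = flow ((c t' - c t) \<bullet> e) (c t)"
    if c: "abs_continuous_on a b c" "c ` {a..b} \<subseteq> cball y0 r" "negligible N"
      "\<And>t. t \<in> {a..b} - N ==> \<exists>v\<in>char_space \<nu> (c t). (c has_vector_derivative v) (at t within {a..b})"
      and t: "t \<in> {a..b}" "t' \<in> {a..b}" for c a b N t t'
  proof (rule flow_box_curve[OF fb(4,3) fb(5) c(1,2,3) _ t])
    fix s assume s: "s \<in> {a..b} - N"
    then obtain v where v: "v \<in> char_space \<nu> (c s)" "(c has_vector_derivative v) (at s within {a..b})" using c(4) by blast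
    have cs: "c s \<in> cball y0 r" using s c(2) by (metis DiffD1 image_subset_iff)
    then have "v \<in> span {?X (c s)}" using v(1) char_field_span(1)[OF en _ d1[OF cs]] sub by auto
    then obtain u where "v = u *\<^sub>R ?X (c s)" by (auto simp: span_singleton)
    then show "\<exists>u. (c has_vector_derivative u *\<^sub>R ?X (c s)) (at s within {a..b})" using v(2) by blast
  qed
  note curve = this
  show ?thesis by (rule exI[of _ r], rule exI[of _ e], rule exI[of _ flow])
      (intro conjI impI allI ballI fb(1) sub d1 negligible_flow_image negligible_orbit, assumption+, elim conjE, rule curve, auto)
qed

text \<open>Upstairs, a curve leaving a zero of Z ends in one of countably many null sets E d q.
  Dilating its fibre coordinate slightly gives further such curves, so a whole interval of the fibre
  over the projected point lies in E d q. By Fubini the projected points form a null set.\<close>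

theorem negligible_exit_leaves:
  assumes DIM: "DIM('e \<times> real) = 2 * k + 1" and null: "negligible {y \<in> B. dim (char_space \<nu> y) \<noteq> 1}"
  shows "\<exists>N. negligible N \<and> (contains_exits \<nu> B N)"
proof -
  obtain en where en: "bij_betw en {..2 * k} (Basis :: ('e \<times> real) set)" using exists_Basis_enumeration[OF DIM] by blast
  let ?Z = "pf_field k en \<nu>"
  define W where "W = B \<times> (- {0::real})"
  have W: "open W" unfolding W_def by (intro open_Times B open_Compl closed_singleton)
  have dich: "dim (char_space \<nu> (fst x)) = 1 \<longleftrightarrow> ?Z x \<noteq> 0" "dim (char_space \<nu> (fst x)) = 1 ==> lifted_kernel \<nu> x = span {?Z x}"
    if "x \<in> W" for x using pf_field_dichotomy[OF en, of x] that by (auto simp: W_def)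
  define E where "E d q = leaf_endpoints ?Z d q" for d q
  have E: "negligible (E d q)" if dq: "q > 0" "cball d (2 * q) \<subseteq> W" for d q proof -
    have Ck: "Ck_on (Suc 0) W ?Z" by (rule Ck_on_subset[OF Ck_on_pf_field[OF B C2]]) (auto simp: W_def)
    obtain K where K: "\<And>x v. x \<in> cball d (2 * q) ==> norm (fderiv ?Z x v) \<le> K * norm v"
      using Ck_on_frechet_bound[OF Ck compact_cball dq(2)] by blast
    have "{x \<in> W. ?Z x = 0} \<subseteq> {y \<in> B. dim (char_space \<nu> y) \<noteq> 1} \<times> UNIV"
      using dich(1) by (auto simp: W_def)
    then have nW: "negligible {x \<in> W. ?Z x = 0}" using negligible_Times_UNIV[OF null] negligible_subset by blast
    show ?thesis unfolding E_def
    proof (rule negligible_leaf_curves_from_zeros[OF dq(1) W dq(2) _ _ K nW])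
      fix x assume x: "x \<in> W"
      show "(?Z has_derivative fderiv ?Z x) (at x)" by (rule Ck_on_deriv[OF Ck x])
      show "(\<Sum>b\<in>Basis. fderiv ?Z x b \<bullet> b) = 0"
        by (rule divergence_pf_field[OF B C2 en]) (use x in \<open>auto simp: W_def\<close>)
    qed
  qed
  obtain D :: "('e \<times> real) set" where D: "countable D" "\<And>X. open X ==> X \<noteq> {} ==> \<exists>d\<in>D. d \<in> X"
    using countable_dense_setE by blast
  define I where "I = {(d, q). d \<in> D \<and> q \<in> \<rat> \<and> q > 0 \<and> cball d (2 * q) \<subseteq> W}"
  have cI: "countable I" by (rule countable_subset[of _ "D \<times> \<rat>"]) (auto simp: I_def D(1) countable_rat intro!: countable_SIGMA)
  define P where "P d q = {y. \<exists>U. open U \<and> U \<noteq> {} \<and> {y} \<times> U \<subseteq> E d q}" for d q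
  define N where "N = (\<Union>(d, q)\<in>I. P d q)"
  have Nnull: "negligible N" unfolding N_def
  proof (rule negligible_countable_Union[OF countable_image[OF cI]], clarify)
    fix d q assume "(d, q) \<in> I"
    then have "negligible (E d q)" using E by (auto simp: I_def)
    then show "negligible (P d q)" by (rule negligible_of_product_sections) (simp add: P_def)
  qed
  have "\<exists>t1\<in>{a<..b}. \<forall>t\<in>{a<..t1}. fst (c t) \<in> N"
    if ab: "a < b" and ac: "abs_continuous_on a b c" and cW: "c ` {a..b} \<subseteq> B \<times> (-{0})" and M: "negligible M"
      and a1: "dim (char_space \<nu> (fst (c a))) \<noteq> 1" and t1: "\<And>t. t \<in> {a<..b} ==> dim (char_space \<nu> (fst (c t))) = 1"
      and der: "\<And>t. t \<in> {a..b} - M ==> \<exists>\<xi>\<in>lifted_kernel \<nu> (c t). (c has_vector_derivative \<xi>) (at t within {a..b})"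
    for c a b M proof -
    have cW': "c t \<in> W" if "t \<in> {a..b}" for t using cW that by (auto simp: W_def)
    obtain R where R: "R > 0" "ball (c a) R \<subseteq> W" using W cW'[of a] ab openE by (metis atLeastAtMost_iff less_eq_real_def)
    \<comment> \<open>With q < R / 3 and d within q / 2 of c a, the ball of radius 2 * q around d
      stays inside the ball of radius R around c a.\<close>
    obtain q where q: "q \<in> \<rat>" "0 < q" "q < R / 3" using Rats_dense_in_real[of 0 "R / 3"] R(1) by auto
    have "\<exists>d\<in>D. d \<in> ball (c a) (q / 2)" by (rule D(2)) (use q(2) in auto)
    then obtain d where d: "d \<in> D" "dist (c a) d < q / 2" by auto
    have sub: "cball d (2 * q) \<subseteq> W"
    proof
      fix z assume "z \<in> cball d (2 * q)"
      then have "dist (c a) z < R" using dist_triangle[of "c a" z d] d(2) q(2,3) by auto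
      then show "z \<in> W" using R(2) by auto
    qed
    have I: "(d, q) \<in> I" using d(1) q sub by (simp add: I_def)
    have cont: "continuous_on {a..b} c" by (rule abs_continuous_on_imp_continuous_on[OF ac])
    then obtain \<delta> where \<delta>: "\<delta> > 0" "\<And>t. t \<in> {a..b} ==> dist t a < \<delta> ==> dist (c t) (c a) < q / 4"
      unfolding continuous_on_iff using ab q(2) by (metis atLeastAtMost_iff divide_pos_pos less_eq_real_def zero_less_numeral)
    define t1' where "t1' = min b (a + \<delta> / 2)"
    have t1': "t1' \<in> {a<..b}" using ab \<delta>(1) by (auto simp: t1'_def)
    have near: "dist d (c t) < 3 / 4 * q" if "t \<in> {a..t1'}" for t proof -
      have "t \<in> {a..b}" "dist t a < \<delta>" using that \<delta>(1) by (auto simp: t1'_def dist_real_def min_def split: if_splits)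
      then show ?thesis using \<delta>(2)[of t] d(2) dist_triangle[of d "c t" "c a"] by (simp add: dist_commute)
    qed
    have "fst (c t) \<in> N" if t: "t \<in> {a<..t1'}" for t proof -
      have tb: "t \<in> {a<..b}" "{a..t} \<subseteq> {a..b}" "{a..t} \<subseteq> {a..t1'}" using t t1' by auto
      define K where "K = norm d + q"
      have K: "K > 0" using q(2) by (simp add: K_def add_nonneg_pos)
      have bd: "\<bar>snd (c s)\<bar> \<le> K" if "s \<in> {a..t}" for s proof -
        have "norm (snd (c s)) \<le> norm (fst (c s), snd (c s))" by (rule norm_snd_le)
        then have "norm (snd (c s)) \<le> norm (c s)" by simp
        moreover have "norm (c s) \<le> norm d + dist d (c s)" by (metis dist_norm norm_triangle_sub norm_minus_commute)
        moreover have "dist d (c s) < 3 / 4 * q" using near tb(3) that by blast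
        ultimately show ?thesis using q(2) by (simp add: K_def)
      qed
      \<comment> \<open>K bounds the fibre coordinate, so a dilation within \<epsilon> of 1 moves
        the curve by at most q / 4, from within 3/4 q of d to within q. The 1/2 keeps \<mu>
        nonzero.\<close>
      define \<epsilon> where "\<epsilon> = min (1 / 2) (q / (4 * K))"
      have \<epsilon>: "\<epsilon> > 0" using q(2) K by (simp add: \<epsilon>_def)
      have scaled: "(fst (c t), \<mu> * snd (c t)) \<in> E d q" if \<mu>: "\<bar>\<mu> - 1\<bar> < \<epsilon>" for \<mu> proof -
        define g where "g s = (fst (c s), \<mu> * snd (c s))" for s
        have \<mu>0: "\<mu> \<noteq> 0" "\<bar>\<mu>\<bar> \<le> 2" "\<bar>\<mu> - 1\<bar> \<le> q / (4 * K)"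
          using \<mu> by (auto simp: \<epsilon>_def abs_less_iff min_def split: if_splits)
        have act: "abs_continuous_on a t c" by (rule abs_continuous_on_subinterval[OF ac]) (use tb in auto)
        have gac: "abs_continuous_on a t g"
        proof (rule abs_continuous_on_dominated[OF act act])
          have norm_le: "norm (fst p) \<le> norm p" "norm (snd p) \<le> norm p" for p :: "'e \<times> real"
            using norm_fst_le[of "fst p" "snd p"] norm_snd_le[of "snd p" "fst p"] by simp_all
          fix u v
          have "dist (g u) (g v) \<le> norm (fst (c u) - fst (c v)) + norm (\<mu> * snd (c u) - \<mu> * snd (c v))"
            unfolding g_def dist_norm diff_Pair by (rule norm_Pair_le)
          also have "norm (\<mu> * snd (c u) - \<mu> * snd (c v)) = \<bar>\<mu>\<bar> * norm (snd (c u) - snd (c v))"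
            by (simp add: right_diff_distrib[symmetric] abs_mult)
          also have "norm (fst (c u) - fst (c v)) + \<bar>\<mu>\<bar> * norm (snd (c u) - snd (c v)) \<le> dist (c u) (c v) + 2 * dist (c u) (c v)"
            using norm_le[of "c u - c v"] \<mu>0(2) by (intro add_mono mult_mono) (simp_all add: dist_norm)
          also have "\<dots> \<le> 2 * (dist (c u) (c v) + dist (c u) (c v))" by simp
          finally show "dist (g u) (g v) \<le> 2 * (dist (c u) (c v) + dist (c u) (c v))" .
        qed
        have gd: "g ` {a..t} \<subseteq> cball d q"
        proof (rule image_subsetI)
          fix s assume s: "s \<in> {a..t}"
          have "dist (c s) (g s) = \<bar>\<mu> - 1\<bar> * \<bar>snd (c s)\<bar>"
            by (cases "c s") (simp add: g_def dist_Pair_Pair dist_real_def abs_mult[symmetric] algebra_simps abs_minus_commute)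
          also have "\<dots> \<le> q / (4 * K) * K" using bd[OF s] \<mu>0(3) K by (intro mult_mono) auto
          also have "\<dots> = q / 4" using K by simp
          finally have "dist (c s) (g s) \<le> q / 4" .
          then show "g s \<in> cball d q" using near[of s] s tb(3) dist_triangle[of d "g s" "c s"] by auto
        qed
        have gW: "g s \<in> W" "dim (char_space \<nu> (fst (g s))) = dim (char_space \<nu> (fst (c s)))" if "s \<in> {a..t}" for s
          using cW'[of s] tb(2) that \<mu>0(1) by (auto simp: W_def g_def)
        have g0: "?Z (g a) = 0" using gW[of a] tb(1) dich(1)[of "g a"] a1 by auto
        have g1: "?Z (g s) \<noteq> 0" if "s \<in> {a<..t}" for s using gW[of s] that tb(1) dich(1)[of "g s"] t1[of s] by auto
        \<comment> \<open>The starting time is excluded together with M: Z vanishes there and does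
          not span the kernel.\<close>
        have "\<exists>u. (g has_vector_derivative u *\<^sub>R ?Z (g s)) (at s within {a..t})" if s: "s \<in> {a..t} - insert a M" for s
        proof -
          have s': "s \<in> {a..b} - M" "s \<in> {a<..t}" using s tb(2) by auto
          obtain \<xi> where \<xi>: "\<xi> \<in> lifted_kernel \<nu> (c s)" "(c has_vector_derivative \<xi>) (at s within {a..b})"
            using der[OF s'(1)] by blast
          have "(c has_vector_derivative \<xi>) (at s within {a..t})" using \<xi>(2) tb(2) has_vector_derivative_within_subset by blast
          then have gd: "(g has_vector_derivative (fst \<xi>, \<mu> * snd \<xi>)) (at s within {a..t})"
            unfolding g_def has_vector_derivative_def by (auto intro!: derivative_eq_intros has_derivative_Pair)
          have "(fst \<xi>, \<mu> * snd \<xi>) \<in> lifted_kernel \<nu> (g s)"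
            using form_kernel_lifted_form_scale[of "fst \<xi>" "snd \<xi>" \<nu> "fst (c s)" "snd (c s)" \<mu>] \<xi>(1) by (simp add: g_def)
          also have "lifted_kernel \<nu> (g s) = span {?Z (g s)}" using dich(2)[OF gW(1)] dich(1)[OF gW(1)] g1[OF s'(2)] s'(2) by auto
          finally obtain u where "(fst \<xi>, \<mu> * snd \<xi>) = u *\<^sub>R ?Z (g s)" by (auto simp: span_singleton)
          then show ?thesis using gd by metis
        qed
        note gderiv = this
        have "g t \<in> E d q" unfolding E_def by (rule CollectI, rule exI[of _ g], rule exI[of _ a], rule exI[of _ t])
            (intro conjI refl gac gd g0 ballI g1 exI[of _ "insert a M"], use tb(1) M gderiv in \<open>auto simp: negligible_insert\<close>)
        then show ?thesis by (simp add: g_def)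
      qed
      define \<kappa> where "\<kappa> = snd (c t)"
      have \<kappa>: "\<kappa> \<noteq> 0" using cW'[of t] tb(1) by (auto simp: W_def \<kappa>_def)
      \<comment> \<open>A fibre coordinate l near \<kappa> is reached by the dilation l /
        \<kappa>.\<close>
      have "{fst (c t)} \<times> ball \<kappa> (\<epsilon> * \<bar>\<kappa>\<bar>) \<subseteq> E d q"
      proof clarify
        fix l assume "l \<in> ball \<kappa> (\<epsilon> * \<bar>\<kappa>\<bar>)"
        then have "\<bar>l - \<kappa>\<bar> < \<epsilon> * \<bar>\<kappa>\<bar>" by (simp add: dist_real_def abs_minus_commute)
        then have "\<bar>l - \<kappa>\<bar> / \<bar>\<kappa>\<bar> < \<epsilon>" using \<kappa> by (simp add: field_simps)
        moreover have "\<bar>l / \<kappa> - 1\<bar> = \<bar>l - \<kappa>\<bar> / \<bar>\<kappa>\<bar>" using \<kappa> by (simp add: abs_divide[symmetric] diff_divide_distrib)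
        ultimately show "(fst (c t), l) \<in> E d q" using scaled[of "l / \<kappa>"] \<kappa> by (simp add: \<kappa>_def)
      qed
      then have "fst (c t) \<in> P d q" unfolding P_def
        using \<epsilon> \<kappa> by (intro CollectI exI[of _ "ball \<kappa> (\<epsilon> * \<bar>\<kappa>\<bar>)"] conjI open_ball) (auto simp: not_le)
      then show ?thesis using I by (auto simp: N_def)
    qed
    then show ?thesis using t1' by blast
  qed
  note key = this
  show ?thesis
  proof (intro exI[of _ N] conjI allI impI)
    show "negligible N" by (rule Nnull)
  qed (elim conjE, rule key, assumption+, blast+)
qed

end

section \<open>Manifolds\<close>

abbreviation chart_preimage :: "('m, 'e) chart => 'e set => 'm set" where
  "chart_preimage c B \<equiv> {x \<in> fst c. snd c x \<in> B}"

text \<open>Only the local axioms, in terms of \<open>Ck_on\<close>. The cotangent atlas is an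
  instance too, and separation and countability of its topology do not have to be
  established.\<close>

locale smooth_manifold =
  fixes A :: "('m, 'e::euclidean_space) atlas"
  assumes chart_inj: "c \<in> A ==> inj_on (snd c) (fst c)"
    and open_overlap: "c \<in> A ==> d \<in> A ==> open (snd c ` (fst c \<inter> fst d))"
    and transition_Ck: "c \<in> A ==> d \<in> A ==> Ck_on k (snd c ` (fst c \<inter> fst d)) (transition c d)"

lemma manifold_imp_smooth_manifold:
  assumes "manifold C A" shows "smooth_manifold A"
proof
  fix c d k assume cd: "c \<in> A" "d \<in> A"
  have o: "open (snd c ` (fst c \<inter> fst d))" and cl: "class_on C (snd c ` (fst c \<inter> fst d)) (transition c d)"
    using assms cd unfolding manifold_def by blast+
  show "Ck_on k (snd c ` (fst c \<inter> fst d)) (transition c d)" by (rule class_on_imp_Ck_on[OF cl o])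
  show "open (snd c ` (fst c \<inter> fst d))" by (rule o)
next
  fix c assume "c \<in> A" then show "inj_on (snd c) (fst c)" using assms unfolding manifold_def by blast
qed

context smooth_manifold
begin

lemma transition_apply: "c \<in> A ==> x \<in> fst c ==> transition c d (snd c x) = snd d x"
  by (simp add: transition_def chart_inj)

lemma mem_overlap: "c \<in> A ==> x \<in> fst c ==> snd c x \<in> snd c ` (fst c \<inter> U) \<longleftrightarrow> x \<in> U"
  using inj_on_image_mem_iff[OF chart_inj, of c x "fst c \<inter> U"] by auto

lemma open_chart: "c \<in> A ==> open (snd c ` fst c)" using open_overlap[of c c] by simp

definition tderiv :: "('m, 'e) chart => ('m, 'e) chart => 'm => 'e => 'e" where
  "tderiv c d x = fderiv (transition c d) (snd c x)"

lemma has_derivative_transition: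
  assumes "c \<in> A" "d \<in> A" "x \<in> fst c" "x \<in> fst d"
  shows "(transition c d has_derivative tderiv c d x) (at (snd c x))"
  unfolding tderiv_def by (rule Ck_on_deriv[OF transition_Ck[OF assms(1,2)]]) (use assms in auto)

lemma linear_tderiv: "c \<in> A ==> d \<in> A ==> x \<in> fst c ==> x \<in> fst d ==> linear (tderiv c d x)"
  by (rule has_derivative_linear[OF has_derivative_transition])

text \<open>One chain rule for paths on intervals, parametrizations and transition maps. Membership
  in the chart near z is an explicit condition because coordinate maps are arbitrary outside their
  domains.\<close>

lemma has_derivative_change_chart:
  fixes f :: "'k::euclidean_space => 'm"
  assumes c: "c \<in> A" "f z \<in> fst c" and d: "d \<in> A" "f z \<in> fst d" and z: "z \<in> S"
    and f': "((snd c \<circ> f) has_derivative f') (at z within S)" and ev: "\<forall>\<^sub>F w in at z within S. f w \<in> fst c"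
  shows "((snd d \<circ> f) has_derivative (\<lambda>h. tderiv c d (f z) (f' h))) (at z within S)"
proof -
  have "((\<lambda>w. transition c d ((snd c \<circ> f) w)) has_derivative (\<lambda>h. tderiv c d (f z) (f' h))) (at z within S)"
    by (rule has_derivative_compose[OF f']) (use has_derivative_transition[OF c(1) d(1) c(2) d(2)] in simp)
  moreover have "((snd c \<circ> f) \<longlongrightarrow> (snd c \<circ> f) z) (at z within S)"
    using has_derivative_continuous[OF f'] by (simp add: continuous_within)
  then have "\<forall>\<^sub>F w in at z within S. (snd c \<circ> f) w \<in> snd c ` (fst c \<inter> fst d)"
    by (rule topological_tendstoD[OF _ open_overlap[OF c(1) d(1)]]) (use c d in auto)
  then have "\<forall>\<^sub>F w in at z within S. transition c d ((snd c \<circ> f) w) = (snd d \<circ> f) w"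
    using ev by eventually_elim (simp add: transition_apply c(1))
  moreover have "transition c d ((snd c \<circ> f) z) = (snd d \<circ> f) z" by (simp add: transition_apply c)
  ultimately show ?thesis using z by (rule has_derivative_transform_eventually)
qed

lemma tderiv_self:
  assumes c: "c \<in> A" "x \<in> fst c" shows "tderiv c c x v = v"
proof -
  have "(transition c c has_derivative (\<lambda>v. v)) (at (snd c x))"
  proof (rule has_derivative_transform_within_open[OF has_derivative_ident open_chart[OF c(1)]])
    show "y = transition c c y" if "y \<in> snd c ` fst c" for y using that transition_apply[OF c(1)] by (metis imageE)
  qed (use c in auto)
  then have "(\<lambda>v. v) = tderiv c c x" by (rule has_derivative_unique[OF _ has_derivative_transition[OF c(1,1,2,2)]])
  then show ?thesis by metis
qed

lemma tderiv_cocycle: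
  assumes c: "c \<in> A" "x \<in> fst c" and d: "d \<in> A" "x \<in> fst d" and f: "f \<in> A" "x \<in> fst f"
  shows "tderiv d f x (tderiv c d x v) = tderiv c f x v"
proof -
  let ?g = "inv_into (fst c) (snd c)"
  have gx: "?g (snd c x) = x" using chart_inj[OF c(1)] c(2) by simp
  have ev: "\<forall>\<^sub>F w in at (snd c x). w \<in> snd c ` (fst c \<inter> fst d)"
    by (rule eventually_at_in_open'[OF open_overlap[OF c(1) d(1)]]) (use c d in auto)
  have "((snd f \<circ> ?g) has_derivative (\<lambda>h. tderiv d f (?g (snd c x)) (tderiv c d x h))) (at (snd c x))"
  proof (rule has_derivative_change_chart[OF d(1) _ f(1) _ UNIV_I])
    show "((snd d \<circ> ?g) has_derivative tderiv c d x) (at (snd c x))"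
      using has_derivative_transition[OF c(1) d(1) c(2) d(2)] unfolding transition_def .
    show "\<forall>\<^sub>F w in at (snd c x). ?g w \<in> fst d" using ev by eventually_elim (auto simp: chart_inj[OF c(1)])
  qed (use gx d f in auto)
  then have "(transition c f has_derivative (\<lambda>h. tderiv d f x (tderiv c d x h))) (at (snd c x))"
    unfolding transition_def gx .
  then have "(\<lambda>h. tderiv d f x (tderiv c d x h)) = tderiv c f x"
    by (rule has_derivative_unique[OF _ has_derivative_transition[OF c(1) f(1) c(2) f(2)]])
  then show ?thesis by metis
qed

lemma tderiv_inverse:
  assumes "c \<in> A" "x \<in> fst c" "d \<in> A" "x \<in> fst d" shows "tderiv d c x (tderiv c d x v) = v"
  using tderiv_cocycle[OF assms assms(1,2)] tderiv_self[OF assms(1,2)] by simp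

lemma inj_tderiv: "c \<in> A ==> x \<in> fst c ==> d \<in> A ==> x \<in> fst d ==> inj (tderiv c d x)"
  by (rule inj_on_inverseI[where g = "tderiv d c x"]) (rule tderiv_inverse)

definition tvec :: "('m, 'e) chart => 'm => 'e => ('m, 'e) chart => 'e" where
  "tvec c x v = (\<lambda>d. if d \<in> A \<and> x \<in> fst d then tderiv c d x v else 0)"

lemma tvec_component: "c \<in> A ==> x \<in> fst c ==> tvec c x v c = v" by (simp add: tvec_def tderiv_self)

lemma tangent_component:
  "u \<in> tangent_space A x ==> c \<in> A ==> x \<in> fst c ==> d \<in> A ==> x \<in> fst d ==> u d = tderiv c d x (u c)"
  unfolding tangent_space_def tderiv_def by blast

lemma tangent_space_iff:
  assumes c: "c \<in> A" "x \<in> fst c"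
  shows "u \<in> tangent_space A x \<longleftrightarrow> u = tvec c x (u c)"
proof
  assume u: "u \<in> tangent_space A x"
  show "u = tvec c x (u c)"
  proof
    fix d
    show "u d = tvec c x (u c) d"
    proof (cases "d \<in> A \<and> x \<in> fst d")
      case True
      then have "u d = tderiv c d x (u c)" using tangent_component[OF u c] by blast
      then show ?thesis using True unfolding tvec_def by presburger
    next
      case False
      then have "u d = 0" using u unfolding tangent_space_def by blast
      then show ?thesis using False unfolding tvec_def by presburger
    qed
  qed
next
  assume u: "u = tvec c x (u c)"
  have "tvec c x v \<in> tangent_space A x" for v
    unfolding tangent_space_def tderiv_def[symmetric] by (auto simp: tvec_def tderiv_cocycle c)
  then show "u \<in> tangent_space A x" using u by metis
qed

lemma tvec_tangent: "c \<in> A ==> x \<in> fst c ==> tvec c x v \<in> tangent_space A x"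
  using tangent_space_iff tvec_component by metis

lemma chart_at: "c \<in> A ==> x \<in> fst c ==> chart_at A x \<in> A \<and> x \<in> fst (chart_at A x)"
  unfolding chart_at_def by (rule someI[of "\<lambda>c. c \<in> A \<and> x \<in> fst c"]) simp

lemma subspace_dim_eq:
  assumes c: "c \<in> A" "x \<in> fst c" and W: "W \<subseteq> tangent_space A x"
  shows "subspace_dim A x W = dim ((\<lambda>u. u c) ` W)"
proof -
  define d where "d = chart_at A x"
  have d: "d \<in> A" "x \<in> fst d" using chart_at[OF c] by (auto simp: d_def)
  have "(\<lambda>u. u d) ` W = tderiv c d x ` (\<lambda>u. u c) ` W"
    unfolding image_image by (rule image_cong[OF refl]) (use W tangent_component c d in blast)
  then show ?thesis unfolding subspace_dim_def d_def[symmetric]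
    using dim_image_eq[OF linear_tderiv[OF c(1) d(1) c(2) d(2)] inj_on_subset[OF inj_tderiv[OF c d] subset_UNIV]] by metis
qed

lemma has_velocityI:
  assumes c: "c \<in> A" "g t \<in> fst c" and t: "t \<in> S" and v: "((snd c \<circ> g) has_vector_derivative v) (at t within S)"
    and ev: "\<forall>\<^sub>F s in at t within S. g s \<in> fst c"
  shows "has_velocity A g (tvec c (g t) v) t S"
  unfolding has_velocity_def
proof (intro conjI ballI impI tvec_tangent c)
  fix d assume d: "d \<in> A" "g t \<in> fst d"
  have "((snd d \<circ> g) has_derivative (\<lambda>h. tderiv c d (g t) (h *\<^sub>R v))) (at t within S)"
    by (rule has_derivative_change_chart[OF c d t v[unfolded has_vector_derivative_def] ev])
  then show "((snd d \<circ> g) has_vector_derivative tvec c (g t) v d) (at t within S)"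
    unfolding has_vector_derivative_def by (simp add: tvec_def d linear_cmul[OF linear_tderiv[OF c(1) d(1) c(2) d(2)]])
qed

lemma smooth_map_onI:
  assumes W: "open W" and c: "c \<in> A" "f ` W \<subseteq> fst c" and f: "\<And>k. Ck_on k W (snd c \<circ> f)"
  shows "smooth_map_on A W f"
  unfolding smooth_map_on_def
proof (intro conjI ballI W)
  show "f ` W \<subseteq> carrier A" using c by (auto simp: carrier_def)
  fix d assume d: "d \<in> A"
  have eq: "{y \<in> W. f y \<in> fst d} = W \<inter> (snd c \<circ> f) -` (snd c ` (fst c \<inter> fst d))" proof -
    have "f y \<in> fst d \<longleftrightarrow> snd c (f y) \<in> snd c ` (fst c \<inter> fst d)" if "y \<in> W" for y
      using mem_overlap[OF c(1), of "f y" "fst d"] c(2) that by blast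
    then show ?thesis by auto
  qed
  show o: "open {y \<in> W. f y \<in> fst d}" unfolding eq
    by (rule continuous_open_preimage[OF Ck_on_continuous[OF f] W open_overlap[OF c(1) d]])
  have "Ck_on k {y \<in> W. f y \<in> fst d} (snd d \<circ> f)" for k
  proof (rule Ck_on_cong[OF o])
    have "(snd c \<circ> f) ` {y \<in> W. f y \<in> fst d} \<subseteq> snd c ` (fst c \<inter> fst d)" using c(2) by auto
    from Ck_on_compose[OF o this Ck_on_subset[OF f] transition_Ck[OF c(1) d]]
    show "Ck_on k {y \<in> W. f y \<in> fst d} (\<lambda>y. transition c d ((snd c \<circ> f) y))" by simp
    show "transition c d ((snd c \<circ> f) y) = (snd d \<circ> f) y" if "y \<in> {y \<in> W. f y \<in> fst d}" for y
      using that c(2) transition_apply[OF c(1)] by (simp add: image_subset_iff)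
  qed
  then show "class_on Smooth {y \<in> W. f y \<in> fst d} (snd d \<circ> f)" by (simp add: C_infinity_on_def)
qed

lemma openin_iff: "openin (manifold_topology A) W \<longleftrightarrow> W \<subseteq> carrier A \<and> (\<forall>c\<in>A. open (snd c ` (W \<inter> fst c)))"
  by (rule openin_manifold_topology) (rule chart_inj)

lemma topspace_manifold_topology: "topspace (manifold_topology A) = carrier A"
proof -
  have "openin (manifold_topology A) (carrier A)"
    unfolding openin_iff
  proof (intro conjI ballI subset_refl)
    fix c assume c: "c \<in> A"
    then have "carrier A \<inter> fst c = fst c" by (auto simp: carrier_def)
    then show "open (snd c ` (carrier A \<inter> fst c))" using open_chart[OF c] by simp
  qed
  moreover have "W \<subseteq> carrier A" if "openin (manifold_topology A) W" for W using that openin_iff by blast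
  ultimately show ?thesis by (meson openin_subset openin_topspace subset_antisym)
qed

lemma openin_chart_preimage:
  assumes c: "c \<in> A" and B: "open B"
  shows "openin (manifold_topology A) (chart_preimage c B)"
  unfolding openin_iff
proof (intro conjI ballI)
  show "chart_preimage c B \<subseteq> carrier A" using c by (auto simp: carrier_def)
  fix d assume d: "d \<in> A"
  have "snd d ` (chart_preimage c B \<inter> fst d) = snd d ` (fst d \<inter> fst c) \<inter> transition d c -` B"
  proof (intro equalityI subsetI)
    fix y assume "y \<in> snd d ` (chart_preimage c B \<inter> fst d)"
    then show "y \<in> snd d ` (fst d \<inter> fst c) \<inter> transition d c -` B" using transition_apply[OF d, of _ c] by auto
  next
    fix y assume y: "y \<in> snd d ` (fst d \<inter> fst c) \<inter> transition d c -` B"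
    then obtain x where x: "x \<in> fst d" "x \<in> fst c" "y = snd d x" by blast
    then have "snd c x \<in> B" using y transition_apply[OF d x(1)] by simp
    then show "y \<in> snd d ` (chart_preimage c B \<inter> fst d)" using x by blast
  qed
  moreover have "open (snd d ` (fst d \<inter> fst c) \<inter> transition d c -` B)"
    by (rule continuous_open_preimage[OF Ck_on_continuous[OF transition_Ck[OF d c]] open_overlap[OF d c] B])
  ultimately show "open (snd d ` (chart_preimage c B \<inter> fst d))" by simp
qed

lemma open_chart_image: "openin (manifold_topology A) U ==> c \<in> A ==> open (snd c ` (fst c \<inter> U))"
  using openin_iff by (metis inf_commute)

lemma continuous_map_chart:
  assumes c: "c \<in> A" shows "continuous_map (subtopology (manifold_topology A) (fst c)) euclidean (snd c)"
  unfolding continuous_map_def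
proof (intro conjI allI impI)
  fix B :: "'e set" assume "openin euclidean B"
  then have B: "open B" by simp
  have "{x \<in> topspace (subtopology (manifold_topology A) (fst c)). snd c x \<in> B} = fst c \<inter> chart_preimage c B"
    using c by (auto simp: topspace_manifold_topology carrier_def)
  then show "openin (subtopology (manifold_topology A) (fst c)) {x \<in> topspace (subtopology (manifold_topology A) (fst c)). snd c x \<in> B}"
    using openin_chart_preimage[OF c B] by (auto simp: openin_subtopology_Int2)
qed simp

lemma continuous_map_into_chart:
  assumes c: "c \<in> A" "f ` W \<subseteq> fst c" and f: "continuous_on W (snd c \<circ> f)"
  shows "continuous_map (top_of_set W) (manifold_topology A) f"
  unfolding continuous_map_def
proof (intro conjI allI impI)
  show "f \<in> topspace (top_of_set W) \<rightarrow> topspace (manifold_topology A)"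
    using c by (auto simp: topspace_manifold_topology carrier_def)
  fix U assume U: "openin (manifold_topology A) U"
  have "{x \<in> topspace (top_of_set W). f x \<in> U} = W \<inter> (snd c \<circ> f) -` (snd c ` (fst c \<inter> U))" proof -
    have "f y \<in> U \<longleftrightarrow> snd c (f y) \<in> snd c ` (fst c \<inter> U)" if "y \<in> W" for y
      using mem_overlap[OF c(1), of "f y" U] c(2) that by blast
    then show ?thesis by auto
  qed
  then show "openin (top_of_set W) {x \<in> topspace (top_of_set W). f x \<in> U}"
    using continuous_openin_preimage_gen[OF f open_chart_image[OF U c(1)]] by simp
qed

text \<open>Transition maps are differentiable between spaces of equal dimension, so they carry null
  sets to null sets.\<close>

lemma measure_zero_chart:
  assumes c: "c \<in> A" and N: "negligible N" shows "measure_zero A (chart_preimage c N)"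
  unfolding measure_zero_def
proof
  fix d assume d: "d \<in> A"
  let ?S = "snd c ` (fst c \<inter> fst d) \<inter> N"
  have "negligible (transition c d ` ?S)"
  proof (rule negligible_differentiable_image_negligible[OF order_refl])
    show "negligible ?S" using N negligible_subset by blast
    show "transition c d differentiable_on ?S"
      using transition_Ck[OF c d, of "Suc 0"] by (auto simp: differentiable_on_def intro: differentiable_at_withinI)
  qed
  moreover have "snd d ` (chart_preimage c N \<inter> fst d) \<subseteq> transition c d ` ?S"
  proof clarify
    fix x assume "x \<in> fst c" "x \<in> fst d" "snd c x \<in> N"
    then show "snd d x \<in> transition c d ` ?S" using transition_apply[OF c, of x d] by (intro image_eqI[of _ _ "snd c x"]) auto
  qed
  ultimately show "snd d ` (chart_preimage c N \<inter> fst d) \<in> null_sets lebesgue"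
    using negligible_subset negligible_iff_null_sets by blast
qed

subsection \<open>The cotangent bundle\<close>

definition covec :: "('m, 'e) chart => 'm => 'e => ('m, 'e) chart => 'e" where
  "covec c x q = (\<lambda>d. if d \<in> A \<and> x \<in> fst d then adjoint (tderiv d c x) q else 0)"

lemma cotangent_component:
  assumes "p \<in> cotangent_space A x" "c \<in> A" "x \<in> fst c" "d \<in> A" "x \<in> fst d"
  shows "p d = adjoint (tderiv d c x) (p c)"
proof -
  note lin = linear_tderiv[OF assms(4,2,5,3)]
  have "w \<bullet> p d = w \<bullet> adjoint (tderiv d c x) (p c)" for w using assms unfolding cotangent_space_def tderiv_def[symmetric]
    by (simp add: adjoint_works[OF lin] inner_commute)
  then show ?thesis using vector_eq_rdot by (metis inner_commute)
qed

lemma cotangent_space_iff: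
  assumes c: "c \<in> A" "x \<in> fst c"
  shows "p \<in> cotangent_space A x \<longleftrightarrow> p = covec c x (p c)"
proof
  assume p: "p \<in> cotangent_space A x"
  show "p = covec c x (p c)"
  proof
    fix d
    show "p d = covec c x (p c) d"
    proof (cases "d \<in> A \<and> x \<in> fst d")
      case True
      then have "p d = adjoint (tderiv d c x) (p c)" using cotangent_component[OF p c] by blast
      then show ?thesis using True unfolding covec_def by presburger
    next
      case False
      then have "p d = 0" using p unfolding cotangent_space_def by blast
      then show ?thesis using False unfolding covec_def by presburger
    qed
  qed
next
  assume p: "p = covec c x (p c)"
  have "covec c x q \<in> cotangent_space A x" for q
    unfolding cotangent_space_def tderiv_def[symmetric] by (auto simp: covec_def adjoint_clauses linear_tderiv tderiv_cocycle c)
  then show "p \<in> cotangent_space A x" using p by metis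
qed

lemma covec_component: "c \<in> A ==> x \<in> fst c ==> covec c x q c = q"
proof -
  assume c: "c \<in> A" "x \<in> fst c"
  have "w \<bullet> covec c x q c = w \<bullet> q" for w by (simp add: covec_def c adjoint_works[OF linear_tderiv] tderiv_self)
  then show ?thesis using vector_eq_rdot by (metis inner_commute)
qed

lemma covec_cotangent: "c \<in> A ==> x \<in> fst c ==> covec c x q \<in> cotangent_space A x"
  using cotangent_space_iff covec_component by metis

lemma covec_0: "c \<in> A ==> x \<in> fst c ==> covec c x 0 = (\<lambda>d. 0)"
proof
  fix d assume c: "c \<in> A" "x \<in> fst c"
  show "covec c x 0 d = 0" using linear_0[OF adjoint_linear[OF linear_tderiv[OF _ c(1) _ c(2)]]] by (simp add: covec_def)
qed

lemma mem_cotangent_chart: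
  "a \<in> fst (cotangent_chart A c) \<longleftrightarrow> fst a \<in> fst c \<and> snd a \<in> cotangent_space A (fst a)"
  "snd (cotangent_chart A c) a = (snd c (fst a), snd a c)" by (auto simp: cotangent_chart_def split: prod.splits)

lemma cotangent_overlap:
  assumes c: "c \<in> A" and d: "d \<in> A"
  shows "snd (cotangent_chart A c) ` (fst (cotangent_chart A c) \<inter> fst (cotangent_chart A d)) = (snd c ` (fst c \<inter> fst d)) \<times> UNIV"
proof (intro equalityI subsetI)
  fix z assume "z \<in> (snd c ` (fst c \<inter> fst d)) \<times> (UNIV :: 'e set)"
  then obtain x q where x: "x \<in> fst c" "x \<in> fst d" "z = (snd c x, q)" by auto
  then have "z = snd (cotangent_chart A c) (x, covec c x q)" by (simp add: mem_cotangent_chart covec_component c)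
  moreover have "(x, covec c x q) \<in> fst (cotangent_chart A c) \<inter> fst (cotangent_chart A d)"
    using x covec_cotangent[OF c x(1)] by (simp add: mem_cotangent_chart)
  ultimately show "z \<in> snd (cotangent_chart A c) ` (fst (cotangent_chart A c) \<inter> fst (cotangent_chart A d))" by blast
qed (auto simp: mem_cotangent_chart)

lemma inj_on_cotangent_chart:
  assumes c: "c \<in> A" shows "inj_on (snd (cotangent_chart A c)) (fst (cotangent_chart A c))"
proof (rule inj_onI)
  fix a b assume ab: "a \<in> fst (cotangent_chart A c)" "b \<in> fst (cotangent_chart A c)"
    and eq: "snd (cotangent_chart A c) a = snd (cotangent_chart A c) b"
  have f: "fst a = fst b" using ab eq chart_inj[OF c] by (auto simp: mem_cotangent_chart dest: inj_onD)
  have "snd a = covec c (fst a) (snd a c)" "snd b = covec c (fst b) (snd b c)"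
    using cotangent_space_iff[OF c] ab unfolding mem_cotangent_chart by blast+
  then show "a = b" using f eq by (metis mem_cotangent_chart(2) prod.inject prod_eqI)
qed

lemma transition_cotangent:
  assumes c: "c \<in> A" and d: "d \<in> A" and x: "x \<in> fst c" "x \<in> fst d"
  shows "transition (cotangent_chart A c) (cotangent_chart A d) (snd c x, q) = (snd d x, adjoint (tderiv d c x) q)"
proof -
  have a: "(x, covec c x q) \<in> fst (cotangent_chart A c)" by (simp add: mem_cotangent_chart x covec_cotangent c)
  have "snd (cotangent_chart A c) (x, covec c x q) = (snd c x, q)" by (simp add: mem_cotangent_chart covec_component c x)
  then have "inv_into (fst (cotangent_chart A c)) (snd (cotangent_chart A c)) (snd c x, q) = (x, covec c x q)"
    using inv_into_f_f[OF inj_on_cotangent_chart[OF c] a] by simp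
  then show ?thesis by (simp add: transition_def mem_cotangent_chart covec_def d x)
qed

lemma smooth_manifold_cotangent: "smooth_manifold (cotangent_atlas A)"
proof
  fix C assume "C \<in> cotangent_atlas A"
  then show "inj_on (snd C) (fst C)" using inj_on_cotangent_chart by (auto simp: cotangent_atlas_def)
next
  fix C D assume "C \<in> cotangent_atlas A" "D \<in> cotangent_atlas A"
  then obtain c d where cd: "c \<in> A" "d \<in> A" and C: "C = cotangent_chart A c" "D = cotangent_chart A d"
    by (auto simp: cotangent_atlas_def)
  let ?U = "snd c ` (fst c \<inter> fst d)" and ?V = "snd d ` (fst d \<inter> fst c)"
  have eq: "snd C ` (fst C \<inter> fst D) = ?U \<times> UNIV" unfolding C by (rule cotangent_overlap[OF cd])
  have o: "open (?U \<times> (UNIV :: 'e set))" by (intro open_Times open_overlap cd open_UNIV)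
  show "open (snd C ` (fst C \<inter> fst D))" unfolding eq by (rule o)
  fix k
  \<comment> \<open>The transition of covectors with the adjoint written out in the basis: only
    derivatives of the inverse transition in fixed directions occur, and these are known to be
    smooth.\<close>
  define f where "f z = (transition c d (fst z), \<Sum>b\<in>Basis. (snd z \<bullet> fderiv (transition d c) (transition c d (fst z)) b) *\<^sub>R b)" for z :: "'e \<times> 'e"
  have fst: "Ck_on k (?U \<times> (UNIV :: 'e set)) (\<lambda>z. fst z)" for k
    by (rule Ck_on_bounded_linear[OF o bounded_linear_fst Ck_on_id[OF o]])
  have snd: "Ck_on k (?U \<times> (UNIV :: 'e set)) (\<lambda>z. snd z)" for k
    by (rule Ck_on_bounded_linear[OF o bounded_linear_snd Ck_on_id[OF o]])
  have t: "Ck_on k (?U \<times> (UNIV :: 'e set)) (\<lambda>z. transition c d (fst z))" for k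
    by (rule Ck_on_compose[OF o _ fst transition_Ck[OF cd]]) auto
  have "(\<lambda>z. transition c d (fst z)) ` (?U \<times> (UNIV :: 'e set)) \<subseteq> ?V" using transition_apply[OF cd(1), of _ d] by auto
  note D = Ck_on_compose[OF o this t]
  have "Ck_on k ?V (\<lambda>y. fderiv (transition d c) y b)" for b using transition_Ck[OF cd(2,1), of "Suc k"] by simp
  from D[OF this] have "Ck_on k (?U \<times> UNIV) f"
    unfolding f_def[abs_def] by (intro Ck_on_Pair[OF o] Ck_on_sum[OF o] Ck_on_scaleR[OF o] Ck_on_inner[OF o] Ck_on_const[OF o] t snd)
  moreover have "f z = transition C D z" if z: "z \<in> ?U \<times> UNIV" for z proof -
    obtain x q where x: "x \<in> fst c" "x \<in> fst d" "z = (snd c x, q)" using z by auto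
    have "adjoint (tderiv d c x) q = (\<Sum>b\<in>Basis. (adjoint (tderiv d c x) q \<bullet> b) *\<^sub>R b)" by (rule euclidean_representation[symmetric])
    also have "\<dots> = (\<Sum>b\<in>Basis. (q \<bullet> tderiv d c x b) *\<^sub>R b)" by (simp add: adjoint_clauses linear_tderiv cd x)
    finally show ?thesis unfolding C x(3) transition_cotangent[OF cd x(1,2)] by (simp add: f_def transition_apply[OF cd(1) x(1)] tderiv_def)
  qed
  ultimately show "Ck_on k (snd C ` (fst C \<inter> fst D)) (transition C D)"
    unfolding eq using Ck_on_cong[OF o] by blast
qed

text \<open>The terms with second derivatives of the transition map cancel by their symmetry.\<close>

lemma canonical_form_eq:
  assumes c: "c \<in> A" "a \<in> fst (cotangent_chart A c)"
    and xi: "\<xi> \<in> tangent_space (cotangent_atlas A) a" and eta: "\<eta> \<in> tangent_space (cotangent_atlas A) a"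
  shows "canonical_form A a \<xi> \<eta> = snd (\<xi> (cotangent_chart A c)) \<bullet> fst (\<eta> (cotangent_chart A c))
    - snd (\<eta> (cotangent_chart A c)) \<bullet> fst (\<xi> (cotangent_chart A c))"
proof -
  interpret cot: smooth_manifold "cotangent_atlas A" by (rule smooth_manifold_cotangent)
  define x p where "x = fst a" and "p = snd a"
  have xc: "x \<in> fst c" "p \<in> cotangent_space A x" using c(2) by (auto simp: mem_cotangent_chart x_def p_def)
  define d where "d = chart_at A x"
  have d: "d \<in> A" "x \<in> fst d" using chart_at[OF c(1) xc(1)] by (auto simp: d_def)
  let ?C = "cotangent_chart A c" and ?D = "cotangent_chart A d"
  have CD: "?C \<in> cotangent_atlas A" "?D \<in> cotangent_atlas A" "a \<in> fst ?D" using c d xc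
    by (auto simp: cotangent_atlas_def mem_cotangent_chart x_def p_def)
  define T where "T = transition ?C ?D"
  define z where "z = snd ?C a"
  have z: "z = (snd c x, p c)" by (simp add: z_def mem_cotangent_chart x_def p_def)
  have T': "(T has_derivative cot.tderiv ?C ?D a) (at z)"
    unfolding T_def z_def by (rule cot.has_derivative_transition[OF CD(1,2) c(2) CD(3)])
  let ?U = "snd c ` (fst c \<inter> fst d)"
  have oU: "open (?U \<times> (UNIV :: 'e set))" by (intro open_Times open_overlap c d open_UNIV)
  have zU: "z \<in> ?U \<times> UNIV" using z xc d by auto
  define t where "t = transition c d"
  define t' where "t' y = fderiv t y" for y
  define t'' where "t'' v w = fderiv (\<lambda>y. t' y w) (snd c x) v" for v w
  have Ck2: "Ck_on (Suc (Suc 0)) ?U t" unfolding t_def by (rule transition_Ck[OF c(1) d(1)])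
  have xU: "snd c x \<in> ?U" using xc d by auto
  have dt': "((\<lambda>y. t' y w) has_derivative (\<lambda>v. t'' v w)) (at (snd c x))" for w proof -
    have "Ck_on (Suc 0) ?U (\<lambda>y. t' y w)" using Ck2 unfolding t'_def Ck_on.simps(2)[of "Suc 0"] by blast
    then show ?thesis unfolding t''_def using xU by (rule Ck_on_deriv)
  qed
  have sym: "t'' v w = t'' w v" for v w
    unfolding t''_def t'_def using symmetric_second_derivative[OF open_overlap[OF c(1) d(1)] _ xU, of t] Ck2 by (simp only: numeral_2_eq_2)
  \<comment> \<open>The new covector is characterized by its pairing with transformed vectors.
    Differentiating this identity, as in \<open>f2\<close>, avoids differentiating an inverse or an
    adjoint.\<close>
  have fstT: "fst (T w) = t (fst w)" and sndT: "snd (T w) \<bullet> t' (fst w) v = snd w \<bullet> v" if w: "w \<in> ?U \<times> UNIV" for w v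
  proof -
    obtain u q where u: "u \<in> fst c" "u \<in> fst d" "w = (snd c u, q)" using w by auto
    show "fst (T w) = t (fst w)" unfolding T_def u(3) transition_cotangent[OF c(1) d(1) u(1,2)]
      by (simp add: t_def transition_apply[OF c(1) u(1)])
    show "snd (T w) \<bullet> t' (fst w) v = snd w \<bullet> v" unfolding T_def u(3) transition_cotangent[OF c(1) d(1) u(1,2)]
      using tderiv_inverse[OF c(1) u(1) d(1) u(2)] by (simp add: t'_def t_def tderiv_def[symmetric] adjoint_clauses linear_tderiv c d u)
  qed
  have f1: "fst (cot.tderiv ?C ?D a h) = t' (snd c x) (fst h)" for h proof -
    have "((\<lambda>w. fst (T w)) has_derivative (\<lambda>h. fst (cot.tderiv ?C ?D a h))) (at z)" by (rule has_derivative_fst[OF T'])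
    then have 1: "((\<lambda>w. t (fst w)) has_derivative (\<lambda>h. fst (cot.tderiv ?C ?D a h))) (at z)"
      by (rule has_derivative_transform_within_open[OF _ oU zU]) (rule fstT)
    have 2: "((\<lambda>w. t (fst w)) has_derivative (\<lambda>h. t' (snd c x) (fst h))) (at z)"
      by (rule has_derivative_compose[OF has_derivative_fst[OF has_derivative_ident]])
        (use Ck_on_deriv[OF Ck2 xU] in \<open>simp add: t'_def z\<close>)
    show ?thesis using has_derivative_unique[OF 1 2] by metis
  qed
  have f2: "snd (cot.tderiv ?C ?D a h) \<bullet> t' (snd c x) v + snd (T z) \<bullet> t'' (fst h) v = snd h \<bullet> v" for h v
  proof -
    have d1: "((\<lambda>w. t' (fst w) v) has_derivative (\<lambda>h. t'' (fst h) v)) (at z)"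
      by (rule has_derivative_compose[OF has_derivative_fst[OF has_derivative_ident]]) (use dt' in \<open>simp add: z\<close>)
    have "((\<lambda>w. snd (T w) \<bullet> t' (fst w) v) has_derivative
        (\<lambda>h. snd (T z) \<bullet> t'' (fst h) v + snd (cot.tderiv ?C ?D a h) \<bullet> t' (fst z) v)) (at z)"
      by (rule has_derivative_inner[OF has_derivative_snd[OF T'] d1])
    then have 1: "((\<lambda>w. snd w \<bullet> v) has_derivative
        (\<lambda>h. snd (T z) \<bullet> t'' (fst h) v + snd (cot.tderiv ?C ?D a h) \<bullet> t' (fst z) v)) (at z)"
      by (rule has_derivative_transform_within_open[OF _ oU zU]) (rule sndT)
    have 2: "((\<lambda>w. snd w \<bullet> v) has_derivative (\<lambda>h. snd h \<bullet> v)) (at z)" by (auto intro!: derivative_eq_intros)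
    show ?thesis using fun_cong[OF has_derivative_unique[OF 1 2], of h] by (simp add: z add.commute)
  qed
  have comp: "\<zeta> ?D = cot.tderiv ?C ?D a (\<zeta> ?C)" if "\<zeta> \<in> tangent_space (cotangent_atlas A) a" for \<zeta>
    by (rule cot.tangent_component[OF that CD(1) c(2) CD(2,3)])
  show ?thesis
    unfolding canonical_form_def Let_def x_def[symmetric] d_def[symmetric] comp[OF xi] comp[OF eta] f1
    using f2[of "\<xi> ?C" "fst (\<eta> ?C)"] f2[of "\<eta> ?C" "fst (\<xi> ?C)"] sym[of "fst (\<xi> ?C)" "fst (\<eta> ?C)"] by simp
qed

end

subsection \<open>Distributions that are locally the kernel of a one-form\<close>

text \<open>A function on M because all covectors over x give the same dimension, by
  \<open>subspace_dim_annihilator\<close>; the choice of p is immaterial wherever \<Delta> has a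
  local form.\<close>

definition (in smooth_manifold) char_dim :: "('m => (('m, 'e) chart => 'e) set) => 'm => nat" where
  "char_dim \<Delta> x = (let a = (x, SOME p. (x, p) \<in> annihilator A \<Delta>) in subspace_dim (cotangent_atlas A) a (ker_omega A \<Delta> a))"

definition (in smooth_manifold) regular_point :: "('m => (('m, 'e) chart => 'e) set) => 'm => bool" where
  "regular_point \<Delta> x \<longleftrightarrow> (\<exists>U. openin (manifold_topology A) U \<and> x \<in> U \<and> (\<forall>y\<in>U. char_dim \<Delta> y = char_dim \<Delta> x))"

locale local_form = smooth_manifold A
  for A :: "('m, 'e::euclidean_space) atlas" +
  fixes \<Delta> :: "'m => (('m, 'e) chart => 'e) set" and c :: "('m, 'e) chart" and B :: "'e set" and \<nu> :: "'e => 'e"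
  assumes c: "c \<in> A" and B: "open B" and Bc: "B \<subseteq> snd c ` fst c"
    and smooth: "\<And>k. Ck_on k B \<nu>" and nonzero: "\<And>y. y \<in> B ==> \<nu> y \<noteq> 0"
    and Delta_eq: "\<And>x. x \<in> fst c ==> snd c x \<in> B ==> \<Delta> x = {v \<in> tangent_space A x. \<nu> (snd c x) \<bullet> v c = 0}"
begin

definition pt :: "'e => 'm" where "pt y = inv_into (fst c) (snd c) y"

lemma pt: "y \<in> B ==> pt y \<in> fst c" "y \<in> B ==> snd c (pt y) = y"
  using Bc by (auto simp: pt_def inv_into_into f_inv_into_f)

lemma pt_chart: "x \<in> fst c ==> pt (snd c x) = x" by (simp add: pt_def chart_inj c)

abbreviation "CB \<equiv> cotangent_atlas A"
abbreviation "ann \<equiv> annihilator A \<Delta>"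
abbreviation "C \<equiv> cotangent_chart A c"
abbreviation "W \<equiv> B \<times> (- {0::real})"

lemma CB: "smooth_manifold CB" by (rule smooth_manifold_cotangent)
lemma C: "C \<in> CB" using c by (simp add: cotangent_atlas_def)

definition lift :: "'e \<times> real => ('m, 'e) cotangent" where
  "lift z = (pt (fst z), covec c (pt (fst z)) (snd z *\<^sub>R \<nu> (fst z)))"

definition lift_coord :: "'e \<times> real => 'e \<times> 'e" where
  "lift_coord z = (fst z, snd z *\<^sub>R \<nu> (fst z))"

text \<open>A left inverse of \<open>lift_coord\<close> by orthogonal projection to the line of
  \<nu>. It is smooth on all covectors over B, so it can be composed with curves before anything is
  known about how they lie in the annihilator.\<close>

definition coord :: "'e \<times> 'e => 'e \<times> real" where
  "coord w = (fst w, snd w \<bullet> \<nu> (fst w) * inverse (\<nu> (fst w) \<bullet> \<nu> (fst w)))"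

definition lift_deriv :: "'e \<times> real => 'e \<times> real => 'e \<times> 'e" where
  "lift_deriv z h = (fst h, snd z *\<^sub>R fderiv \<nu> (fst z) (fst h) + snd h *\<^sub>R \<nu> (fst z))"

lemma coord_lift_coord: "fst z \<in> B ==> coord (lift_coord z) = z"
  using nonzero[of "fst z"] by (cases z) (simp add: coord_def lift_coord_def)

lemma lift_chart: "fst z \<in> B ==> lift z \<in> fst C" "fst z \<in> B ==> snd C (lift z) = lift_coord z"
  "fst z \<in> B ==> fst (lift z) = pt (fst z)"
  by (simp_all add: lift_def lift_coord_def mem_cotangent_chart pt covec_cotangent covec_component c)

lemma lift_in_annihilator:
  assumes z: "z \<in> W" shows "lift z \<in> ann"
proof -
  let ?x = "pt (fst z)"
  have zB: "fst z \<in> B" "snd z \<noteq> 0" using z by auto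
  have x: "?x \<in> fst c" "snd c ?x = fst z" using pt zB by auto
  define p where "p = covec c ?x (snd z *\<^sub>R \<nu> (fst z))"
  have p: "p \<in> cotangent_space A ?x" "p c = snd z *\<^sub>R \<nu> (fst z)"
    unfolding p_def by (rule covec_cotangent[OF c x(1)], rule covec_component[OF c x(1)])
  have "p \<noteq> (\<lambda>d. 0)"
  proof
    assume "p = (\<lambda>d. 0)" then have "p c = 0" by simp
    then show False using p(2) zB nonzero by simp
  qed
  moreover have "pairing A ?x p v = 0" if "v \<in> \<Delta> ?x" for v proof -
    have v: "v \<in> tangent_space A ?x" "\<nu> (fst z) \<bullet> v c = 0" using that Delta_eq[OF x(1)] x(2) zB(1) by auto
    show ?thesis using pairing_eq[OF p(1) v(1) c x(1)] p(2) v(2) by simp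
  qed
  moreover have "?x \<in> carrier A" using x(1) c by (auto simp: carrier_def)
  ultimately show ?thesis using p(1) by (simp add: annihilator_def lift_def p_def[symmetric])
qed

lemma annihilator_eq_lift:
  assumes a: "a \<in> ann" "fst a \<in> fst c" "snd c (fst a) \<in> B"
  shows "coord (snd C a) \<in> W" "lift (coord (snd C a)) = a"
proof -
  obtain x p where xp: "a = (x, p)" by (cases a)
  have p: "p \<in> cotangent_space A x" "p \<noteq> (\<lambda>c. 0)" "\<And>v. v \<in> \<Delta> x ==> pairing A x p v = 0"
    using a(1) by (auto simp: annihilator_def xp)
  have x: "x \<in> fst c" "snd c x \<in> B" using a by (auto simp: xp)
  let ?n = "\<nu> (snd c x)"
  have n: "?n \<noteq> 0" using nonzero x by blast
  have orth: "p c \<bullet> v = 0" if "?n \<bullet> v = 0" for v proof -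
    have t: "tvec c x v \<in> tangent_space A x" "tvec c x v c = v" using tvec_tangent tvec_component c x(1) by auto
    then have "tvec c x v \<in> \<Delta> x" using Delta_eq[OF x] that by simp
    then show ?thesis using p(3) pairing_eq[OF p(1) t(1) c x(1)] t(2) by simp
  qed
  define \<kappa> where "\<kappa> = p c \<bullet> ?n * inverse (?n \<bullet> ?n)"
  define w where "w = p c - \<kappa> *\<^sub>R ?n"
  have nw: "?n \<bullet> w = 0" using n by (simp add: w_def \<kappa>_def inner_diff_right inner_commute)
  \<comment> \<open>w lies in ker \<nu>, where p vanishes, so it is orthogonal to p c and to \<nu>,
    hence to itself.\<close>
  have "w \<bullet> w = p c \<bullet> w - \<kappa> * (?n \<bullet> w)" by (simp add: w_def inner_diff_left)
  then have "w = 0" using orth[OF nw] nw by simp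
  then have pc: "p c = \<kappa> *\<^sub>R ?n" by (simp add: w_def)
  have peq: "p = covec c x (p c)" using cotangent_space_iff[OF c x(1)] p(1) by blast
  have "\<kappa> \<noteq> 0"
  proof
    assume "\<kappa> = 0"
    then have "p = (\<lambda>d. 0)" using peq pc covec_0[OF c x(1)] by simp
    then show False using p(2) by simp
  qed
  moreover have co: "coord (snd C a) = (snd c x, \<kappa>)" by (simp add: xp mem_cotangent_chart coord_def \<kappa>_def)
  ultimately show "coord (snd C a) \<in> W" using x by simp
  show "lift (coord (snd C a)) = a" unfolding co using peq pc x(1) by (simp add: lift_def pt_chart xp)
qed

lemma Ck_on_fst_snd:
  fixes S :: "('e \<times> 'b::euclidean_space) set"
  assumes "open S" shows "Ck_on k S (\<lambda>z. fst z)" "Ck_on k S (\<lambda>z. snd z)"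
  by (rule Ck_on_bounded_linear[OF assms bounded_linear_fst Ck_on_id[OF assms]],
    rule Ck_on_bounded_linear[OF assms bounded_linear_snd Ck_on_id[OF assms]])

lemma Ck_on_form_fst: "Ck_on k (B \<times> (UNIV :: 'b::euclidean_space set)) (\<lambda>z. \<nu> (fst z))"
proof -
  have o: "open (B \<times> (UNIV :: 'b set))" by (intro open_Times B open_UNIV)
  show ?thesis by (rule Ck_on_compose[OF o _ Ck_on_fst_snd(1)[OF o] smooth]) auto
qed

lemma Ck_on_lift_coord: "Ck_on k (B \<times> UNIV) lift_coord"
proof -
  have o: "open (B \<times> (UNIV :: real set))" by (intro open_Times B open_UNIV)
  show ?thesis unfolding lift_coord_def[abs_def] by (intro Ck_on_Pair[OF o] Ck_on_scaleR[OF o] Ck_on_fst_snd[OF o] Ck_on_form_fst)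
qed

lemma Ck_on_coord: "Ck_on k (B \<times> UNIV) coord"
proof -
  have o: "open (B \<times> (UNIV :: 'e set))" by (intro open_Times B open_UNIV)
  have ne: "\<nu> (fst z) \<bullet> \<nu> (fst z) \<noteq> 0" if "z \<in> B \<times> (UNIV :: 'e set)" for z using that nonzero by auto
  show ?thesis unfolding coord_def[abs_def]
    by (intro Ck_on_Pair[OF o] Ck_on_mult[OF o] Ck_on_inverse[OF o] Ck_on_inner[OF o] Ck_on_fst_snd[OF o] Ck_on_form_fst ne)
qed

lemma has_derivative_lift_coord:
  assumes z: "fst z \<in> B" shows "(lift_coord has_derivative lift_deriv z) (at z)"
proof -
  have a: "((\<lambda>z. \<nu> (fst z)) has_derivative (\<lambda>h. fderiv \<nu> (fst z) (fst h))) (at z)"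
    by (rule has_derivative_compose[OF has_derivative_fst[OF has_derivative_ident] Ck_on_deriv[OF smooth z]])
  show ?thesis unfolding lift_coord_def[abs_def] lift_deriv_def[abs_def] by (rule derivative_eq_intros a refl)+
qed

lemma linear_lift_deriv: "fst z \<in> B ==> linear (lift_deriv z)"
  by (rule has_derivative_linear[OF has_derivative_lift_coord])

lemma inj_lift_deriv: "fst z \<in> B ==> inj (lift_deriv z)" by (rule injI) (auto simp: lift_deriv_def prod_eq_iff nonzero)

lemma open_W: "open W" by (intro open_Times B open_Compl closed_singleton)

lemma smooth_map_on_lift: "smooth_map_on CB W lift"
proof -
  interpret cot: smooth_manifold CB by (rule CB)
  show ?thesis
  proof (rule cot.smooth_map_onI[OF open_W C])
    show "lift ` W \<subseteq> fst C" using lift_chart(1) by auto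
    show "Ck_on k W (snd C \<circ> lift)" for k
    proof (rule Ck_on_cong[OF open_W])
      show "Ck_on k W lift_coord" by (rule Ck_on_subset[OF Ck_on_lift_coord]) auto
      show "lift_coord z = (snd C \<circ> lift) z" if "z \<in> W" for z using that lift_chart(2) by auto
    qed
  qed
qed

text \<open>A curve in the annihilator is fixed by \<open>lift_coord\<close> after
  \<open>coord\<close>, so its velocity is in the range of the derivative of
  \<open>lift_coord\<close>. Conversely, lifting the line z + t h realizes every vector of that
  range.\<close>

lemma tangent_space_sub_lift:
  assumes z: "z \<in> W"
  shows "(\<lambda>\<xi>. \<xi> C) ` tangent_space_sub CB ann (lift z) = range (lift_deriv z)"
proof (intro equalityI subsetI)
  interpret cot: smooth_manifold CB by (rule CB)
  have zB: "fst z \<in> B" using z by auto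
  {
    fix w assume "w \<in> (\<lambda>\<xi>. \<xi> C) ` tangent_space_sub CB ann (lift z)"
    then obtain \<xi> g e where w: "w = \<xi> C" and e: "e > 0" and g: "smooth_map_on CB {-e<..<e} g" "g ` {-e<..<e} \<subseteq> ann"
      "g 0 = lift z" "has_velocity CB g \<xi> 0 UNIV" unfolding tangent_space_sub_def by blast
    have g': "((snd C \<circ> g) has_vector_derivative w) (at 0)"
      using g(4) C lift_chart(1)[OF zB] unfolding has_velocity_def g(3) w by auto
    have g0: "(snd C \<circ> g) 0 = lift_coord z" by (simp add: g(3) lift_chart(2)[OF zB])
    have "open {t \<in> {-e<..<e}. g t \<in> fst C}" using g(1) C unfolding smooth_map_on_def by blast
    then have e1: "\<forall>\<^sub>F t in at 0. t \<in> {t \<in> {-e<..<e}. g t \<in> fst C}"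
      by (rule eventually_at_in_open') (use e g(3) lift_chart(1)[OF zB] in auto)
    have "((snd C \<circ> g) \<longlongrightarrow> (snd C \<circ> g) 0) (at 0)"
      using has_vector_derivative_continuous[OF g'] by (simp add: continuous_within)
    moreover have "open (B \<times> (UNIV :: 'e set))" by (intro open_Times B open_UNIV)
    moreover have "(snd C \<circ> g) 0 \<in> B \<times> UNIV" unfolding g0 using zB by (simp add: lift_coord_def)
    ultimately have e2: "\<forall>\<^sub>F t in at 0. (snd C \<circ> g) t \<in> B \<times> UNIV" by (rule topological_tendstoD)
    have e3: "\<forall>\<^sub>F t in at 0. (snd C \<circ> g) t = lift_coord (coord ((snd C \<circ> g) t))" using e1 e2
    proof eventually_elim
      case (elim t)
      then have t: "g t \<in> ann" "fst (g t) \<in> fst c" "snd c (fst (g t)) \<in> B" using g(2) by (auto simp: mem_cotangent_chart)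
      note l = annihilator_eq_lift[OF t]
      have "snd C (lift (coord (snd C (g t)))) = lift_coord (coord (snd C (g t)))" by (rule lift_chart(2)) (use l(1) in auto)
      then show ?case using l(2) by simp
    qed
    have c0: "coord ((snd C \<circ> g) 0) = z" unfolding g0 by (rule coord_lift_coord[OF zB])
    let ?D = "fderiv coord ((snd C \<circ> g) 0)"
    have dc: "(coord has_derivative ?D) (at ((snd C \<circ> g) 0))"
      by (rule Ck_on_deriv[OF Ck_on_coord]) (use g0 zB in \<open>simp add: lift_coord_def\<close>)
    have 1: "((\<lambda>t. coord ((snd C \<circ> g) t)) has_derivative (\<lambda>h. ?D (h *\<^sub>R w))) (at 0)"
      by (rule has_derivative_compose[OF g'[unfolded has_vector_derivative_def] dc])
    have "((\<lambda>t. lift_coord (coord ((snd C \<circ> g) t))) has_derivative (\<lambda>h. lift_deriv z (?D (h *\<^sub>R w)))) (at 0)"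
      by (rule has_derivative_compose[OF 1]) (unfold c0, rule has_derivative_lift_coord[OF zB])
    then have "((snd C \<circ> g) has_derivative (\<lambda>h. lift_deriv z (?D (h *\<^sub>R w)))) (at 0)"
      by (rule has_derivative_transform_eventually[OF _ _ _ UNIV_I])
        (use e3 in \<open>auto elim: eventually_mono simp: c0 g0 coord_lift_coord[OF zB] simp del: o_apply\<close>)
    then have "(\<lambda>h. lift_deriv z (?D (h *\<^sub>R w))) = (\<lambda>h. h *\<^sub>R w)"
      by (rule has_derivative_unique[OF _ g'[unfolded has_vector_derivative_def]])
    from fun_cong[OF this, of 1] have "w = lift_deriv z (?D w)" by simp
    then show "w \<in> range (lift_deriv z)" by (rule range_eqI)
  next
    fix w assume "w \<in> range (lift_deriv z)"
    then obtain h where w: "w = lift_deriv z h" by blast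
    define l where "l t = z + t *\<^sub>R h" for t :: real
    have lc: "continuous_on UNIV l" unfolding l_def by (intro continuous_intros)
    have "open (l -` W)" by (rule open_vimage[OF open_W lc])
    moreover have "0 \<in> l -` W" using z by (simp add: l_def)
    ultimately obtain e where e: "e > 0" "ball 0 e \<subseteq> l -` W" using openE by blast
    have lW: "l t \<in> W" if "t \<in> {-e<..<e}" for t proof -
      have "t \<in> ball 0 e" using that by (auto simp: dist_real_def)
      then show ?thesis using e(2) by blast
    qed
    let ?I = "{-e<..<e}"
    have eq: "lift_coord (l t) = (snd C \<circ> (lift \<circ> l)) t" "(lift \<circ> l) t \<in> fst C" if "t \<in> ?I" for t
      using lW[OF that] lift_chart by auto
    have oI: "open ?I" by simp
    have sm: "smooth_map_on CB ?I (lift \<circ> l)"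
    proof (rule cot.smooth_map_onI[OF oI C])
      show "(lift \<circ> l) ` ?I \<subseteq> fst C" using eq(2) by blast
      fix k
      have "Ck_on k ?I l" unfolding l_def
        by (intro Ck_on_add[OF oI] Ck_on_const[OF oI] Ck_on_bounded_linear[OF oI bounded_linear_scaleR_left Ck_on_id[OF oI]])
      moreover have "l ` ?I \<subseteq> B \<times> UNIV"
      proof (rule image_subsetI)
        fix t assume "t \<in> ?I" then show "l t \<in> B \<times> UNIV" using lW[of t] by auto
      qed
      ultimately have ck: "Ck_on k ?I (\<lambda>t. lift_coord (l t))" using Ck_on_compose[OF oI _ _ Ck_on_lift_coord] by blast
      show "Ck_on k ?I (snd C \<circ> (lift \<circ> l))" by (rule Ck_on_cong[OF oI _ ck]) (rule eq(1))
    qed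
    have ev: "\<forall>\<^sub>F t in at 0. t \<in> ?I" by (rule eventually_at_in_open'[OF oI]) (use e in auto)
    have "(l has_derivative (\<lambda>t. t *\<^sub>R h)) (at 0)" unfolding l_def by (auto intro!: derivative_eq_intros)
    then have "((\<lambda>t. lift_coord (l t)) has_derivative (\<lambda>t. lift_deriv z (t *\<^sub>R h))) (at 0)"
      by (rule has_derivative_compose) (use has_derivative_lift_coord[OF zB] in \<open>simp add: l_def\<close>)
    then have "((snd C \<circ> (lift \<circ> l)) has_derivative (\<lambda>t. lift_deriv z (t *\<^sub>R h))) (at 0)"
      by (rule has_derivative_transform_within_open[OF _ oI _ eq(1)]) (use e in auto)
    then have v: "((snd C \<circ> (lift \<circ> l)) has_vector_derivative w) (at 0)"
      unfolding has_vector_derivative_def w linear_cmul[OF linear_lift_deriv[OF zB]] .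
    have "(lift \<circ> l) 0 \<in> fst C" by (rule eq(2)) (use e in auto)
    moreover have "\<forall>\<^sub>F t in at 0. (lift \<circ> l) t \<in> fst C" using ev by eventually_elim (rule eq(2))
    ultimately have vel: "has_velocity CB (lift \<circ> l) (cot.tvec C ((lift \<circ> l) 0) w) 0 UNIV"
      using cot.has_velocityI[OF C _ UNIV_I v] by blast
    have l0: "(lift \<circ> l) 0 = lift z" by (simp add: l_def)
    have "(lift \<circ> l) ` ?I \<subseteq> ann"
    proof (rule image_subsetI)
      fix t assume "t \<in> ?I" then show "(lift \<circ> l) t \<in> ann" using lift_in_annihilator[OF lW] by simp
    qed
    then have "cot.tvec C (lift z) w \<in> tangent_space_sub CB ann (lift z)"
      unfolding tangent_space_sub_def using e(1) sm vel l0 by (intro CollectI exI[of _ "lift \<circ> l"] exI[of _ e] conjI) simp_all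
    moreover have "cot.tvec C (lift z) w C = w" by (rule cot.tvec_component[OF C lift_chart(1)[OF zB]])
    ultimately show "w \<in> (\<lambda>\<xi>. \<xi> C) ` tangent_space_sub CB ann (lift z)" by (metis (mono_tags, lifting) image_eqI)
  }
qed

lemma tangent_space_sub_subset: "tangent_space_sub CB ann a \<subseteq> tangent_space CB a"
  by (auto simp: tangent_space_sub_def has_velocity_def)

text \<open>The canonical form pulls back under \<open>lift\<close> to \<open>lifted_form\<close>,
  and all tangent vectors of the annihilator have the form \<open>lift_deriv z u\<close>; so the
  kernels correspond.\<close>

lemma ker_omega_lift:
  assumes z: "z \<in> W"
  shows "(\<lambda>\<xi>. \<xi> C) ` ker_omega A \<Delta> (lift z) = lift_deriv z ` lifted_kernel \<nu> z"
proof -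
  have zB: "fst z \<in> B" using z by auto
  let ?T = "tangent_space_sub CB ann (lift z)"
  have form: "canonical_form A (lift z) \<xi> \<eta> = lifted_form \<nu> z u v"
    if "\<xi> \<in> ?T" "\<eta> \<in> ?T" "\<xi> C = lift_deriv z u" "\<eta> C = lift_deriv z v" for \<xi> \<eta> u v proof -
    have "\<xi> \<in> tangent_space CB (lift z)" "\<eta> \<in> tangent_space CB (lift z)" using that(1,2) tangent_space_sub_subset by blast+
    from canonical_form_eq[OF c lift_chart(1)[OF zB] this] show ?thesis
      by (simp add: that(3,4) lift_deriv_def lifted_form_def ext_deriv_def inner_add_left algebra_simps)
  qed
  have T: "\<exists>u. \<xi> C = lift_deriv z u" if "\<xi> \<in> ?T" for \<xi> using tangent_space_sub_lift[OF z] that by blast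
  have T': "\<exists>\<xi>\<in>?T. \<xi> C = lift_deriv z u" for u proof -
    have "lift_deriv z u \<in> (\<lambda>\<xi>. \<xi> C) ` ?T" unfolding tangent_space_sub_lift[OF z] by blast
    then show ?thesis by force
  qed
  show ?thesis
  proof (intro equalityI subsetI)
    fix w assume "w \<in> (\<lambda>\<xi>. \<xi> C) ` ker_omega A \<Delta> (lift z)"
    then obtain \<xi> where \<xi>: "\<xi> \<in> ?T" "\<And>\<eta>. \<eta> \<in> ?T ==> canonical_form A (lift z) \<xi> \<eta> = 0" "w = \<xi> C"
      by (auto simp: ker_omega_def)
    obtain u where u: "\<xi> C = lift_deriv z u" using T[OF \<xi>(1)] by blast
    have "lifted_form \<nu> z u v = 0" for v proof -
      obtain \<eta> where "\<eta> \<in> ?T" "\<eta> C = lift_deriv z v" using T' by blast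
      then show ?thesis using form[OF \<xi>(1) _ u] \<xi>(2) by metis
    qed
    then show "w \<in> lift_deriv z ` lifted_kernel \<nu> z" using \<xi>(3) u by (auto simp: form_kernel_def)
  next
    fix w assume "w \<in> lift_deriv z ` lifted_kernel \<nu> z"
    then obtain u where u: "w = lift_deriv z u" "\<And>v. lifted_form \<nu> z u v = 0" by (auto simp: form_kernel_def)
    obtain \<xi> where \<xi>: "\<xi> \<in> ?T" "\<xi> C = lift_deriv z u" using T' by blast
    have "canonical_form A (lift z) \<xi> \<eta> = 0" if "\<eta> \<in> ?T" for \<eta>
      using T[OF that] form[OF \<xi>(1) that \<xi>(2)] u(2) by metis
    then have "\<xi> \<in> ker_omega A \<Delta> (lift z)" using \<xi>(1) by (simp add: ker_omega_def)
    then show "w \<in> (\<lambda>\<xi>. \<xi> C) ` ker_omega A \<Delta> (lift z)" using \<xi>(2) u(1) by (metis (mono_tags, lifting) image_eqI)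
  qed
qed

lemma subspace_dim_ker_omega:
  assumes z: "z \<in> W"
  shows "subspace_dim CB (lift z) (ker_omega A \<Delta> (lift z)) = dim (char_space \<nu> (fst z))"
proof -
  interpret cot: smooth_manifold CB by (rule CB)
  have zB: "fst z \<in> B" "snd z \<noteq> 0" using z by auto
  have "ker_omega A \<Delta> (lift z) \<subseteq> tangent_space CB (lift z)"
    unfolding ker_omega_def using tangent_space_sub_subset[of "lift z"] by blast
  then have "subspace_dim CB (lift z) (ker_omega A \<Delta> (lift z)) = dim (lift_deriv z ` lifted_kernel \<nu> z)"
    using cot.subspace_dim_eq[OF C lift_chart(1)[OF zB(1)]] ker_omega_lift[OF z] by simp
  also have "\<dots> = dim (lifted_kernel \<nu> z)"
    by (rule dim_image_eq[OF linear_lift_deriv[OF zB(1)] inj_on_subset[OF inj_lift_deriv[OF zB(1)] subset_UNIV]])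
  also have "\<dots> = dim (char_space \<nu> (fst z))"
    using dim_form_kernel_lifted_form[OF form_differentiable[OF B smooth zB(1)] nonzero[OF zB(1)] zB(2)] by simp
  finally show ?thesis .
qed

lemma subspace_dim_annihilator:
  assumes a: "a \<in> ann" "fst a \<in> fst c" "snd c (fst a) \<in> B"
  shows "subspace_dim CB a (ker_omega A \<Delta> a) = dim (char_space \<nu> (snd c (fst a)))"
  using subspace_dim_ker_omega[OF annihilator_eq_lift(1)[OF a]] annihilator_eq_lift(2)[OF a] by (simp add: coord_def mem_cotangent_chart)

lemma char_dim_eq:
  assumes x: "x \<in> fst c" "snd c x \<in> B" shows "char_dim \<Delta> x = dim (char_space \<nu> (snd c x))"
proof -
  have "lift (snd c x, 1) \<in> ann" by (rule lift_in_annihilator) (use x in auto)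
  then have "(x, snd (lift (snd c x, 1))) \<in> ann" by (simp add: lift_def pt_chart x)
  then have "(x, SOME p. (x, p) \<in> ann) \<in> ann" by (rule someI[of "\<lambda>p. (x, p) \<in> ann"])
  from subspace_dim_annihilator[OF this] show ?thesis using x by (simp add: char_dim_def)
qed

lemma openin_box: "openin (manifold_topology A) (chart_preimage c B)" by (rule openin_chart_preimage[OF c B])

text \<open>The kernel dimension is constant on fibres. A neighbourhood in the annihilator is cut at
  the fixed height snd z to obtain one in M, and a neighbourhood in M is pulled back to a
  cylinder.\<close>

lemma regular_set_lift:
  assumes z: "z \<in> W"
  shows "lift z \<in> regular_set A \<Delta> \<longleftrightarrow> regular_point \<Delta> (pt (fst z))"
proof
  interpret cot: smooth_manifold CB by (rule CB)
  have zB: "fst z \<in> B" "snd z \<noteq> 0" using z by auto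
  assume "lift z \<in> regular_set A \<Delta>"
  then obtain V k where V: "openin (subtopology (manifold_topology CB) ann) V" "lift z \<in> V"
    "\<And>b. b \<in> V ==> subspace_dim CB b (ker_omega A \<Delta> b) = k" unfolding regular_set_def by blast
  obtain T where T: "openin (manifold_topology CB) T" "V = T \<inter> ann" using V(1) by (auto simp: openin_subtopology)
  have "continuous_map (top_of_set W) (manifold_topology CB) lift"
  proof (rule cot.continuous_map_into_chart[OF C])
    show "lift ` W \<subseteq> fst C" using lift_chart(1) by auto
    have "continuous_on W lift_coord" by (rule Ck_on_continuous[OF Ck_on_subset[OF Ck_on_lift_coord[of 0]]]) auto
    then show "continuous_on W (snd C \<circ> lift)" by (rule continuous_on_eq) (use lift_chart(2) in auto)
  qed
  then have "openin (top_of_set W) {z \<in> W. lift z \<in> T}" using openin_continuous_map_preimage[OF _ T(1)] by fastforce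
  then have o: "open {z \<in> W. lift z \<in> T}" using open_W openin_open_trans by blast
  define V' where "V' = (\<lambda>y. (y, snd z)) -` {z \<in> W. lift z \<in> T}"
  have V': "open V'" unfolding V'_def by (rule open_vimage[OF o]) (intro continuous_intros)
  define U where "U = chart_preimage c V'"
  have U: "openin (manifold_topology A) U" unfolding U_def by (rule openin_chart_preimage[OF c V'])
  have k: "char_dim \<Delta> x = k" if x: "x \<in> U" for x proof -
    have x': "x \<in> fst c" "(snd c x, snd z) \<in> W" "lift (snd c x, snd z) \<in> T" using x by (auto simp: U_def V'_def)
    have "lift (snd c x, snd z) \<in> V" using T(2) x'(3) lift_in_annihilator[OF x'(2)] by blast
    then have "dim (char_space \<nu> (snd c x)) = k" using V(3) subspace_dim_ker_omega[OF x'(2)] by simp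
    then show ?thesis using char_dim_eq x' by simp
  qed
  have "pt (fst z) \<in> U" using z V(2) T(2) pt[OF zB(1)] by (auto simp: U_def V'_def)
  then show "regular_point \<Delta> (pt (fst z))" unfolding regular_point_def using U k by blast
next
  interpret cot: smooth_manifold CB by (rule CB)
  have zB: "fst z \<in> B" "snd z \<noteq> 0" using z by auto
  assume "regular_point \<Delta> (pt (fst z))"
  then obtain U where U: "openin (manifold_topology A) U" "pt (fst z) \<in> U"
    "\<And>x. x \<in> U ==> char_dim \<Delta> x = char_dim \<Delta> (pt (fst z))" unfolding regular_point_def by blast
  define V where "V = snd c ` (fst c \<inter> U) \<inter> B"
  have V: "open V" unfolding V_def by (intro open_Int B open_chart_image[OF U(1) c])
  define V' where "V' = {a \<in> fst C. snd C a \<in> V \<times> UNIV}"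
  have "openin (manifold_topology CB) V'" unfolding V'_def by (rule cot.openin_chart_preimage[OF C open_Times[OF V open_UNIV]])
  then have "openin (subtopology (manifold_topology CB) ann) (ann \<inter> V')" by (rule openin_subtopology_Int2)
  moreover have "lift z \<in> ann \<inter> V'"
    using lift_in_annihilator[OF z] lift_chart[OF zB(1)] zB U(2) pt[OF zB(1)] mem_overlap[OF c pt(1)[OF zB(1)], of U]
    by (auto simp: V'_def V_def lift_coord_def)
  moreover have "subspace_dim CB b (ker_omega A \<Delta> b) = char_dim \<Delta> (pt (fst z))" if b: "b \<in> ann \<inter> V'" for b
  proof -
    have b': "b \<in> ann" "fst b \<in> fst c" "snd c (fst b) \<in> B" "fst b \<in> U"
      using b mem_overlap[OF c, of "fst b" U] by (auto simp: V'_def V_def mem_cotangent_chart simp del: image_Int)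
    show ?thesis using subspace_dim_annihilator[OF b'(1-3)] char_dim_eq[OF b'(2,3)] U(3)[OF b'(4)] by simp
  qed
  ultimately show "lift z \<in> regular_set A \<Delta>" unfolding regular_set_def using lift_in_annihilator[OF z] by blast
qed

text \<open>The hypothesis on the singular set is stated through local parametrizations; this makes
  it available in the coordinates (y, \<kappa>).\<close>

lemma local_parametrization_lift: "local_parametrization CB ann W lift"
  unfolding local_parametrization_def
proof (intro conjI ballI impI)
  interpret cot: smooth_manifold CB by (rule CB)
  show "smooth_map_on CB W lift" by (rule smooth_map_on_lift)
  show sub: "lift ` W \<subseteq> ann" using lift_in_annihilator by blast
  have o: "open (B \<times> (UNIV :: 'e set))" by (intro open_Times B open_UNIV)
  have im: "lift ` W = ann \<inter> {a \<in> fst C. snd C a \<in> B \<times> UNIV}"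
  proof (intro equalityI subsetI)
    fix a assume "a \<in> ann \<inter> {a \<in> fst C. snd C a \<in> B \<times> UNIV}"
    then have "a \<in> ann" "fst a \<in> fst c" "snd c (fst a) \<in> B" by (auto simp: mem_cotangent_chart)
    then show "a \<in> lift ` W" using annihilator_eq_lift by (metis image_eqI)
  next
    fix a assume "a \<in> lift ` W"
    then obtain z where z: "z \<in> W" "a = lift z" by blast
    then show "a \<in> ann \<inter> {a \<in> fst C. snd C a \<in> B \<times> UNIV}"
      using lift_in_annihilator[OF z(1)] lift_chart[of z] by (auto simp: lift_coord_def)
  qed
  show "openin (subtopology (manifold_topology CB) ann) (lift ` W)"
    unfolding im by (rule openin_subtopology_Int2[OF cot.openin_chart_preimage[OF C o]])
  let ?X = "subtopology (manifold_topology CB) (lift ` W)"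
  have "homeomorphic_maps (top_of_set W) ?X lift (coord \<circ> snd C)"
    unfolding homeomorphic_maps_def
  proof (intro conjI ballI)
    have "continuous_map (top_of_set W) (manifold_topology CB) lift"
    proof (rule cot.continuous_map_into_chart[OF C])
      show "lift ` W \<subseteq> fst C" using lift_chart(1) by auto
      have "continuous_on W lift_coord" by (rule Ck_on_continuous[OF Ck_on_subset[OF Ck_on_lift_coord[of 0]]]) auto
      then show "continuous_on W (snd C \<circ> lift)" by (rule continuous_on_eq) (use lift_chart(2) in auto)
    qed
    then show "continuous_map (top_of_set W) ?X lift" by (rule continuous_map_into_subtopology) auto
    have "subtopology (manifold_topology CB) (lift ` W) = subtopology (subtopology (manifold_topology CB) (fst C)) (lift ` W)"
      unfolding subtopology_subtopology by (rule arg_cong[where f = "subtopology _"]) (use im in blast)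
    then have 1: "continuous_map ?X euclidean (snd C)" using continuous_map_from_subtopology[OF cot.continuous_map_chart[OF C]] by simp
    have inv: "coord (snd C (lift z)) = z" if "z \<in> W" for z using that lift_chart(2)[of z] coord_lift_coord[of z] by auto
    have 2: "continuous_map ?X (top_of_set (B \<times> UNIV)) (snd C)" by (rule continuous_map_into_subtopology[OF 1]) (use im in auto)
    have cc: "continuous_map (top_of_set (B \<times> UNIV)) euclidean coord" using Ck_on_continuous[OF Ck_on_coord[of 0]] by simp
    have inv': "coord (snd C a) \<in> W" "lift (coord (snd C a)) = a" if a: "a \<in> topspace ?X" for a proof -
      have "a \<in> lift ` W" using a unfolding topspace_subtopology by (rule IntD2)
      then obtain w where w: "w \<in> W" "a = lift w" by blast
      then show "coord (snd C a) \<in> W" "lift (coord (snd C a)) = a" using inv[OF w(1)] by simp_all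
    qed
    from continuous_map_compose[OF 2 cc] show "continuous_map ?X (top_of_set W) (coord \<circ> snd C)"
      by (rule continuous_map_into_subtopology) (rule Pi_I, use inv'(1) in simp)
    show "(coord \<circ> snd C) (lift z) = z" if "z \<in> topspace (top_of_set W)" for z using that inv by simp
    show "lift ((coord \<circ> snd C) a) = a" if "a \<in> topspace ?X" for a using inv'(2)[OF that] by simp
  qed
  then show "homeomorphic_map (top_of_set W) ?X lift" by (rule homeomorphic_maps_imp_map)
  fix D z assume D: "D \<in> CB" and z: "z \<in> W" "lift z \<in> fst D"
  have zB: "fst z \<in> B" using z by auto
  have "(snd C \<circ> lift has_derivative lift_deriv z) (at z)"
    by (rule has_derivative_transform_within_open[OF has_derivative_lift_coord[OF zB] open_W z(1)]) (use lift_chart(2) in auto)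
  moreover have "\<forall>\<^sub>F w in at z. lift w \<in> fst C"
    using eventually_at_in_open'[OF open_W z(1)] by eventually_elim (use lift_chart(1) in auto)
  ultimately have "(snd D \<circ> lift has_derivative (\<lambda>h. cot.tderiv C D (lift z) (lift_deriv z h))) (at z)"
    by (rule cot.has_derivative_change_chart[where f = lift and z = z, OF C lift_chart(1)[OF zB] D z(2) UNIV_I])
  then have "fderiv (snd D \<circ> lift) z = cot.tderiv C D (lift z) \<circ> lift_deriv z"
    by (simp add: frechet_derivative_at[symmetric] o_def)
  then show "inj (fderiv (snd D \<circ> lift) z)"
    using inj_compose[OF cot.inj_tderiv[OF C lift_chart(1)[OF zB] D z(2)] inj_lift_deriv[OF zB]] by simp
qed

text \<open>The singular set contains the whole punctured fibre over each non-regular point, so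
  Fubini brings its nullity down to M.\<close>

lemma negligible_not_regular:
  assumes "measure_zero_sub TYPE('e \<times> real) CB ann (singular_set A \<Delta>)"
  shows "negligible {y \<in> B. \<not> regular_point \<Delta> (pt y)}"
proof (rule negligible_of_product_sections)
  have "{z \<in> W. lift z \<in> singular_set A \<Delta>} \<in> null_sets lebesgue"
    using assms local_parametrization_lift unfolding measure_zero_sub_def by blast
  then show "negligible {z \<in> W. lift z \<in> singular_set A \<Delta>}" by (simp add: negligible_iff_null_sets)
  fix y assume y: "y \<in> {y \<in> B. \<not> regular_point \<Delta> (pt y)}"
  have "{y} \<times> (- {0}) \<subseteq> {z \<in> W. lift z \<in> singular_set A \<Delta>}"
    using y regular_set_lift lift_in_annihilator by (auto simp: singular_set_def)
  then show "\<exists>U. open U \<and> U \<noteq> {} \<and> {y} \<times> U \<subseteq> {z \<in> W. lift z \<in> singular_set A \<Delta>}"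
    by (intro exI[of _ "- {0}"]) (auto intro: exI[of _ 1])
qed

text \<open>The covectors along the curve are bounded, so it runs in a compact convex set, and there
  \<open>coord\<close> is Lipschitz by the bound on its derivative.\<close>

lemma abs_continuous_coord:
  assumes K: "compact K" "convex K" "K \<subseteq> B" and ac: "abs_continuous_on a b (snd C \<circ> \<psi>)"
    and psi: "\<And>t. t \<in> {a..b} ==> \<psi> t \<in> ann \<and> fst (\<psi> t) \<in> fst c \<and> snd c (fst (\<psi> t)) \<in> K"
  shows "abs_continuous_on a b (coord \<circ> (snd C \<circ> \<psi>))" "(coord \<circ> (snd C \<circ> \<psi>)) ` {a..b} \<subseteq> W"
proof -
  let ?f = "snd C \<circ> \<psi>"
  have "compact (?f ` {a..b})" by (rule compact_continuous_image[OF abs_continuous_on_imp_continuous_on[OF ac] compact_Icc])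
  then obtain R where R: "\<And>t. t \<in> {a..b} ==> norm (?f t) \<le> R"
    using compact_imp_bounded bounded_iff by (metis imageI)
  let ?K = "K \<times> cball (0::'e) R"
  have cK: "compact ?K" "convex ?K" by (auto intro: compact_Times convex_Times K)
  have KB: "?K \<subseteq> B \<times> UNIV" using K(3) by auto
  obtain M where M: "\<And>x v. x \<in> ?K ==> norm (fderiv coord x v) \<le> M * norm v"
    using Ck_on_frechet_bound[OF Ck_on_coord cK(1) KB] by blast
  have lip: "norm (coord x - coord y) \<le> M * norm (x - y)" if "x \<in> ?K" "y \<in> ?K" for x y
  proof (rule differentiable_bound[OF cK(2) _ _ that(1) that(2)])
    fix z assume z: "z \<in> ?K"
    then show "(coord has_derivative fderiv coord z) (at z within ?K)"
      using KB by (intro has_derivative_at_withinI[OF Ck_on_deriv[OF Ck_on_coord]]) auto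
    show "onorm (fderiv coord z) \<le> M" by (rule onorm_le) (rule M[OF z])
  qed
  have fK: "?f t \<in> ?K" if t: "t \<in> {a..b}" for t proof -
    have "norm (snd (fst (?f t), snd (?f t))) \<le> norm (fst (?f t), snd (?f t))" using norm_snd_le by (metis snd_conv)
    then have "norm (snd (?f t)) \<le> R" using R[OF t] by simp
    then show ?thesis using psi[OF t] by (simp add: mem_cotangent_chart)
  qed
  show "abs_continuous_on a b (coord \<circ> ?f)"
  proof (rule abs_continuous_on_dominated[OF ac ac])
    fix u v assume uv: "u \<in> {a..b}" "v \<in> {a..b}"
    have "dist ((coord \<circ> ?f) u) ((coord \<circ> ?f) v) \<le> M * dist (?f u) (?f v)"
      using lip[OF fK[OF uv(1)] fK[OF uv(2)]] by (simp add: dist_norm)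
    also have "\<dots> = (M / 2) * (dist (?f u) (?f v) + dist (?f u) (?f v))" by simp
    finally show "dist ((coord \<circ> ?f) u) ((coord \<circ> ?f) v) \<le> (M / 2) * (dist (?f u) (?f v) + dist (?f u) (?f v))" .
  qed
  show "(coord \<circ> ?f) ` {a..b} \<subseteq> W"
  proof (rule image_subsetI)
    fix t assume t: "t \<in> {a..b}"
    have "coord (snd C (\<psi> t)) \<in> W" by (rule annihilator_eq_lift(1)) (use psi[OF t] K(3) in auto)
    then show "(coord \<circ> ?f) t \<in> W" by simp
  qed
qed

lemma coord_has_derivative:
  assumes t: "\<psi> t \<in> ann" "fst (\<psi> t) \<in> fst c" "snd c (fst (\<psi> t)) \<in> B"
    and xi: "\<xi> \<in> ker_omega A \<Delta> (\<psi> t)" and v: "has_velocity CB \<psi> \<xi> t S"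
  shows "\<exists>u\<in>form_kernel (lifted_form \<nu> ((coord \<circ> (snd C \<circ> \<psi>)) t)).
    ((coord \<circ> (snd C \<circ> \<psi>)) has_vector_derivative u) (at t within S)"
proof -
  define z where "z = coord (snd C (\<psi> t))"
  have z: "z \<in> W" "lift z = \<psi> t" using annihilator_eq_lift[OF t] by (auto simp: z_def)
  have zB: "fst z \<in> B" using z by auto
  have "(\<lambda>\<xi>. \<xi> C) ` ker_omega A \<Delta> (\<psi> t) = lift_deriv z ` lifted_kernel \<nu> z"
    using ker_omega_lift[OF z(1)] unfolding z(2) .
  then have "\<xi> C \<in> lift_deriv z ` lifted_kernel \<nu> z" using imageI[OF xi, of "\<lambda>\<xi>. \<xi> C"] by simp
  then obtain u where u: "u \<in> lifted_kernel \<nu> z" "\<xi> C = lift_deriv z u" by blast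
  have lz: "snd C (\<psi> t) = lift_coord z" using lift_chart(2)[OF zB] z(2) by simp
  have "\<psi> t \<in> fst C" using lift_chart(1)[OF zB] z(2) by simp
  then have d: "((snd C \<circ> \<psi>) has_derivative (\<lambda>h. h *\<^sub>R lift_deriv z u)) (at t within S)"
    using v C u(2) by (auto simp: has_velocity_def has_vector_derivative_def)
  let ?D = "fderiv coord (lift_coord z)"
  have D: "(coord has_derivative ?D) (at (lift_coord z))"
    by (rule Ck_on_deriv[OF Ck_on_coord]) (use zB in \<open>simp add: lift_coord_def\<close>)
  have "((\<lambda>w. coord (lift_coord w)) has_derivative (\<lambda>h. ?D (lift_deriv z h))) (at z)"
    by (rule has_derivative_compose[OF has_derivative_lift_coord[OF zB] D])
  moreover have "((\<lambda>w. coord (lift_coord w)) has_derivative (\<lambda>h. h)) (at z)"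
    by (rule has_derivative_transform_within_open[OF has_derivative_ident open_W z(1)]) (use coord_lift_coord in auto)
  ultimately have "(\<lambda>h. ?D (lift_deriv z h)) = (\<lambda>h. h)" by (rule has_derivative_unique)
  then have Du: "?D (h *\<^sub>R lift_deriv z u) = h *\<^sub>R u" for h
    using fun_cong[of _ _ "h *\<^sub>R u"] linear_cmul[OF linear_lift_deriv[OF zB]] by metis
  have "((\<lambda>s. coord ((snd C \<circ> \<psi>) s)) has_derivative (\<lambda>h. ?D (h *\<^sub>R lift_deriv z u))) (at t within S)"
    by (rule has_derivative_compose[OF d]) (use D lz in simp)
  then have "((coord \<circ> (snd C \<circ> \<psi>)) has_vector_derivative u) (at t within S)"
    unfolding Du has_vector_derivative_def o_def .
  then show ?thesis using u(1) z_def by auto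
qed

end

text \<open>A smooth Gram-Schmidt process: project everything orthogonally to w m and induct on the
  remaining vectors. The vector u outside the span at y0 survives all projections and certifies that
  the normal is not zero there.\<close>

lemma exists_smooth_normal:
  fixes w :: "nat => 'e::euclidean_space => 'e" and u :: "'e => 'e"
  assumes "open S" "y0 \<in> S" "\<And>i k. i < m ==> Ck_on k S (w i)" "\<And>k. Ck_on k S u"
    and "\<And>a. (\<Sum>i<m. a i *\<^sub>R w i y0) = 0 ==> \<forall>i<m. a i = 0" and "\<And>a. u y0 \<noteq> (\<Sum>i<m. a i *\<^sub>R w i y0)"
  shows "\<exists>T \<nu>. open T \<and> y0 \<in> T \<and> T \<subseteq> S \<and> (\<forall>k. Ck_on k T \<nu>) \<and> (\<forall>y\<in>T. \<forall>i<m. \<nu> y \<bullet> w i y = 0) \<and> \<nu> y0 \<bullet> u y0 \<noteq> 0"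
  using assms
proof (induction m arbitrary: S w u)
  case 0
  have "u y0 \<noteq> 0" using "0.prems"(6)[of "\<lambda>_. 0"] by simp
  then show ?case using "0.prems"(1,2,4) by (intro exI[of _ S] exI[of _ u]) auto
next
  case (Suc m)
  note S = Suc.prems(1) and Ckw = Suc.prems(3) and indep = Suc.prems(5) and notin = Suc.prems(6)
  define S1 where "S1 = S \<inter> w m -` (- {0})"
  have S1: "open S1" unfolding S1_def by (rule continuous_open_preimage[OF Ck_on_continuous[OF Ckw[of m 0]] S]) auto
  have "w m y0 \<noteq> 0"
  proof
    assume "w m y0 = 0"
    then have "(\<Sum>i<Suc m. (if i = m then 1 else 0) *\<^sub>R w i y0) = 0" by simp
    from indep[OF this] show False by auto
  qed
  then have y0: "y0 \<in> S1" using Suc.prems(2) by (simp add: S1_def)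
  have nz: "w m y \<bullet> w m y \<noteq> 0" if "y \<in> S1" for y using that by (simp add: S1_def)
  define t where "t f y = (f y \<bullet> w m y) * inverse (w m y \<bullet> w m y)" for f y
  define P where "P f y = f y - t f y *\<^sub>R w m y" for f y
  have Cm: "Ck_on k S1 (w m)" for k by (rule Ck_on_subset[OF Ckw]) (auto simp: S1_def)
  have CkP: "Ck_on k T (P f)" if "Ck_on k T f" "open T" "T \<subseteq> S1" for k f T proof -
    note cm = Ck_on_subset[OF Cm that(3)]
    have "w m y \<bullet> w m y \<noteq> 0" if "y \<in> T" for y using nz \<open>T \<subseteq> S1\<close> that by blast
    then show ?thesis unfolding P_def[abs_def] t_def
      by (intro Ck_on_diff[OF that(2)] Ck_on_scaleR[OF that(2)] Ck_on_mult[OF that(2)] Ck_on_inner[OF that(2)] Ck_on_inverse[OF that(2)] that(1) cm)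
  qed
  \<comment> \<open>P is self-adjoint, so a normal to the projected vectors becomes a normal to the
    original ones after projection.\<close>
  have adj: "P f y \<bullet> g y = f y \<bullet> P g y" for f g y by (simp add: P_def t_def inner_diff_left inner_diff_right inner_commute)
  have sumP: "(\<Sum>i<m. a i *\<^sub>R P (w i) y) = (\<Sum>i<Suc m. (a(m := - (\<Sum>i<m. a i * t (w i) y))) i *\<^sub>R w i y)" for a y
    by (simp add: P_def scaleR_diff_right sum_subtractf scaleR_sum_left)
  have "\<exists>T \<nu>. open T \<and> y0 \<in> T \<and> T \<subseteq> S1 \<and> (\<forall>k. Ck_on k T \<nu>) \<and> (\<forall>y\<in>T. \<forall>i<m. \<nu> y \<bullet> P (w i) y = 0) \<and> \<nu> y0 \<bullet> P u y0 \<noteq> 0"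
  proof (rule Suc.IH[OF S1 y0])
    show "Ck_on k S1 (P (w i))" if "i < m" for i k
      by (rule CkP[OF Ck_on_subset[OF Ckw] S1 order_refl]) (use that in \<open>auto simp: S1_def\<close>)
    show "Ck_on k S1 (P u)" for k by (rule CkP[OF Ck_on_subset[OF Suc.prems(4)] S1 order_refl]) (auto simp: S1_def)
    fix a :: "nat => real"
    show "\<forall>i<m. a i = 0" if "(\<Sum>i<m. a i *\<^sub>R P (w i) y0) = 0"
    proof (intro allI impI)
      fix i assume "i < m"
      then show "a i = 0" using indep[OF that[unfolded sumP], rule_format, of i] by simp
    qed
    show "P u y0 \<noteq> (\<Sum>i<m. a i *\<^sub>R P (w i) y0)"
    proof
      assume eq: "P u y0 = (\<Sum>i<m. a i *\<^sub>R P (w i) y0)"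
      define b where "b = a(m := t u y0 - (\<Sum>i<m. a i * t (w i) y0))"
      have "u y0 = P u y0 + t u y0 *\<^sub>R w m y0" by (simp add: P_def)
      also have "\<dots> = (\<Sum>i<Suc m. b i *\<^sub>R w i y0)" unfolding eq sumP by (simp add: b_def algebra_simps)
      finally show False using notin by blast
    qed
  qed
  then obtain T \<nu> where T: "open T" "y0 \<in> T" "T \<subseteq> S1" "\<And>k. Ck_on k T \<nu>" "\<And>y i. y \<in> T ==> i < m ==> \<nu> y \<bullet> P (w i) y = 0"
    "\<nu> y0 \<bullet> P u y0 \<noteq> 0" by blast
  have "P \<nu> y \<bullet> w i y = 0" if "y \<in> T" "i < Suc m" for y i
  proof (cases "i = m")
    case True
    have "P (w m) y = 0" using nz[of y] T(3) that(1) by (auto simp: P_def t_def)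
    then show ?thesis using adj[of \<nu> y "w i"] True by simp
  next
    case False
    then show ?thesis using adj[of \<nu> y "w i"] T(5)[OF that(1), of i] that(2) by simp
  qed
  moreover have "P \<nu> y0 \<bullet> u y0 \<noteq> 0" using adj[of \<nu> y0 u] T(6) by simp
  moreover have "T \<subseteq> S" using T(3) by (auto simp: S1_def)
  ultimately show ?case using T(1,2) CkP[OF T(4) T(1,3)] by (intro exI[of _ T] exI[of _ "P \<nu>"]) blast
qed

section \<open>Countable covers and null sets on a manifold\<close>

lemma countable_subcover:
  assumes X: "second_countable X" and V: "\<And>s. P s ==> openin X (V s)"
    and U: "U \<subseteq> topspace X" "\<And>x. x \<in> U ==> \<exists>s. P s \<and> x \<in> V s"
  shows "\<exists>S. countable S \<and> S \<subseteq> Collect P \<and> U \<subseteq> (\<Union>s\<in>S. V s)"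
proof -
  let ?Y = "subtopology X U"
  let ?F = "(\<lambda>s. U \<inter> V s) ` Collect P"
  have "Lindelof_space ?Y" by (rule second_countable_imp_Lindelof_space[OF second_countable_subtopology[OF X]])
  moreover have "\<forall>S\<in>?F. openin ?Y S" using V by (auto intro: openin_subtopology_Int2)
  moreover have "topspace ?Y \<subseteq> \<Union>?F" using U by fastforce
  ultimately obtain \<V> where \<V>: "countable \<V>" "\<V> \<subseteq> ?F" "topspace ?Y \<subseteq> \<Union>\<V>"
    unfolding Lindelof_space_alt by meson
  then obtain S where S: "countable S" "S \<subseteq> Collect P" "\<V> = (\<lambda>s. U \<inter> V s) ` S"
    using countable_subset_image[of \<V> "\<lambda>s. U \<inter> V s" "Collect P"] by auto
  then show ?thesis using \<V>(3) U(1) by (intro exI[of _ S]) auto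
qed

lemma measure_zero_iff: "measure_zero A E \<longleftrightarrow> (\<forall>c\<in>A. negligible (snd c ` (E \<inter> fst c)))"
  by (simp add: measure_zero_def negligible_iff_null_sets)

lemma measure_zero_subset: "measure_zero A E ==> F \<subseteq> E ==> measure_zero A F"
  unfolding measure_zero_iff by (meson Int_mono image_mono negligible_subset order_refl)

lemma measure_zero_UN:
  assumes "countable I" "\<And>i. i \<in> I ==> measure_zero A (E i)" shows "measure_zero A (\<Union>i\<in>I. E i)"
  unfolding measure_zero_iff
proof
  fix c assume c: "c \<in> A"
  have "snd c ` ((\<Union>i\<in>I. E i) \<inter> fst c) = \<Union>((\<lambda>i. snd c ` (E i \<inter> fst c)) ` I)" by auto
  moreover have "negligible (\<Union>((\<lambda>i. snd c ` (E i \<inter> fst c)) ` I))"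
    by (rule negligible_countable_Union[OF countable_image[OF assms(1)]]) (use assms(2) c in \<open>auto simp: measure_zero_iff\<close>)
  ultimately show "negligible (snd c ` ((\<Union>i\<in>I. E i) \<inter> fst c))" by simp
qed

lemma measure_zero_Un: "measure_zero A E ==> measure_zero A F ==> measure_zero A (E \<union> F)"
  by (simp add: measure_zero_iff Int_Un_distrib2 image_Un negligible_Un)

lemma measure_zero_singleton: "measure_zero A {x}"
proof -
  have "negligible (snd c ` ({x} \<inter> fst c))" for c :: "('a, 'b) chart"
    by (rule negligible_subset[OF negligible_sing[of "snd c x"]]) auto
  then show ?thesis by (simp add: measure_zero_iff)
qed

text \<open>The frame spans a hyperplane in each tangent space because its rank is one less than the
  dimension. A smooth normal to the frame is the one-form, and the inclusion of the span in its
  kernel is an equality by counting dimensions.\<close>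

lemma (in smooth_manifold) exists_local_form:
  assumes man: "manifold R A" and dist: "distribution R A (DIM('e) - 1) \<Delta>" and x0: "x0 \<in> carrier A"
  shows "\<exists>c B \<nu>. local_form A \<Delta> c B \<nu> \<and> x0 \<in> fst c \<and> snd c x0 \<in> B"
proof -
  define m where "m = DIM('e) - 1"
  obtain c where c: "c \<in> A" "x0 \<in> fst c" using x0 by (auto simp: carrier_def)
  have "\<exists>U X. openin (manifold_topology A) U \<and> x0 \<in> U \<and> (\<forall>i<m. vector_field_on R A U (X i)) \<and>
      (\<forall>y\<in>U. \<Delta> y = {\<lambda>c. \<Sum>i<m. a i *\<^sub>R X i y c | a :: nat => real. True} \<and>
             (\<forall>a :: nat => real. (\<lambda>c. \<Sum>i<m. a i *\<^sub>R X i y c) = (\<lambda>c. 0) \<longrightarrow> (\<forall>i<m. a i = 0)))"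
    using dist x0 unfolding distribution_def m_def by (rule bspec)
  then obtain U X where U: "openin (manifold_topology A) U" "x0 \<in> U" and X': "\<forall>i<m. vector_field_on R A U (X i)"
    and frame: "\<forall>y\<in>U. \<Delta> y = {\<lambda>c. \<Sum>i<m. a i *\<^sub>R X i y c | a :: nat => real. True} \<and>
             (\<forall>a :: nat => real. (\<lambda>c. \<Sum>i<m. a i *\<^sub>R X i y c) = (\<lambda>c. 0) \<longrightarrow> (\<forall>i<m. a i = 0))"
    by (elim exE conjE) (rule that)
  have X: "vector_field_on R A U (X i)" if "i < m" for i using X' that by simp
  have Dl: "\<Delta> y = {\<lambda>c. \<Sum>i<m. a i *\<^sub>R X i y c | a :: nat => real. True}" if "y \<in> U" for y
    using bspec[OF frame that] by (rule conjunct1)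
  have ind: "\<forall>i<m. a i = 0" if "y \<in> U" "(\<lambda>c. \<Sum>i<m. a i *\<^sub>R X i y c) = (\<lambda>c. 0)" for y and a :: "nat => real"
  proof -
    have "\<forall>a :: nat => real. (\<lambda>c. \<Sum>i<m. a i *\<^sub>R X i y c) = (\<lambda>c. 0) \<longrightarrow> (\<forall>i<m. a i = 0)"
      using bspec[OF frame that(1)] by (rule conjunct2)
    then show ?thesis using that(2) by (elim allE[of _ a]) simp
  qed
  let ?S = "snd c ` (fst c \<inter> U)"
  have S: "open ?S" by (rule open_chart_image[OF U(1) c(1)])
  have y0: "snd c x0 \<in> ?S" using c U by auto
  define w where "w i = coord_expr c (X i)" for i
  have w: "w i (snd c x) = X i x c" if "x \<in> fst c" for i x using that by (simp add: w_def coord_expr_def chart_inj c)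
  have Ckw: "Ck_on k ?S (w i)" if "i < m" for i k
    unfolding w_def by (rule class_on_imp_Ck_on[OF _ S]) (use X[OF that] c in \<open>auto simp: vector_field_on_def Int_commute\<close>)
  have tan: "(\<lambda>d. \<Sum>i<m. a i *\<^sub>R X i x d) = tvec c x (\<Sum>i<m. a i *\<^sub>R w i (snd c x))" if x: "x \<in> fst c" "x \<in> U" for a x
  proof
    fix d
    have Xi: "X i x = tvec c x (w i (snd c x))" if "i < m" for i
      using X[OF that] x tangent_space_iff[OF c(1) x(1), of "X i x"] w[OF x(1)] by (simp add: vector_field_on_def)
    have "(\<Sum>i<m. a i *\<^sub>R X i x d) = (\<Sum>i<m. a i *\<^sub>R tvec c x (w i (snd c x)) d)" by (rule sum.cong) (use Xi in auto)
    also have "\<dots> = tvec c x (\<Sum>i<m. a i *\<^sub>R w i (snd c x)) d"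
      using linear_sum[OF linear_tderiv[OF c(1) _ x(1)], of d "\<lambda>i. a i *\<^sub>R w i (snd c x)" "{..<m}"]
      by (auto simp: tvec_def linear_cmul[OF linear_tderiv[OF c(1) _ x(1)]])
    finally show "(\<Sum>i<m. a i *\<^sub>R X i x d) = tvec c x (\<Sum>i<m. a i *\<^sub>R w i (snd c x)) d" .
  qed
  have t0: "tvec c x 0 = (\<lambda>d. 0)" if "x \<in> fst c" for x using linear_0[OF linear_tderiv[OF c(1) _ that]] by (auto simp: tvec_def)
  have indw: "\<forall>i<m. a i = 0" if "x \<in> fst c" "x \<in> U" "(\<Sum>i<m. a i *\<^sub>R w i (snd c x)) = 0" for a x
    by (rule ind[OF that(2)]) (use tan[OF that(1,2), of a] that(3) t0[OF that(1)] in simp)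
  have span: "(\<Sum>i<m. a i *\<^sub>R w i y) \<in> span ((\<lambda>i. w i y) ` {..<m})" for a y
    by (intro span_sum span_scale span_base) auto
  have "dim ((\<lambda>i. w i (snd c x0)) ` {..<m}) \<le> card ((\<lambda>i. w i (snd c x0)) ` {..<m})"
    by (rule dim_le_card[OF span_superset]) auto
  also have "\<dots> \<le> m" using card_image_le[of "{..<m}"] by simp
  also have "\<dots> < DIM('e)" by (simp add: m_def)
  finally have "span ((\<lambda>i. w i (snd c x0)) ` {..<m}) \<noteq> UNIV" by (metis dim_span dim_UNIV less_irrefl)
  then obtain e0 where e0: "e0 \<notin> span ((\<lambda>i. w i (snd c x0)) ` {..<m})" by blast
  have "\<exists>T \<nu>. open T \<and> snd c x0 \<in> T \<and> T \<subseteq> ?S \<and> (\<forall>k. Ck_on k T \<nu>) \<and> (\<forall>y\<in>T. \<forall>i<m. \<nu> y \<bullet> w i y = 0) \<and> \<nu> (snd c x0) \<bullet> e0 \<noteq> 0"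
    by (rule exists_smooth_normal[where u = "\<lambda>_. e0", OF S y0 Ckw Ck_on_const[OF S] indw[OF c(2) U(2)]])
      (use span e0 in \<open>auto\<close>)
  then obtain T \<nu> where T: "open T" "snd c x0 \<in> T" "T \<subseteq> ?S" "\<And>k. Ck_on k T \<nu>"
    "\<And>y i. y \<in> T ==> i < m ==> \<nu> y \<bullet> w i y = 0" "\<nu> (snd c x0) \<bullet> e0 \<noteq> 0" by blast
  \<comment> \<open>The normal is only known to be nonzero at the centre; B is the open part where
    it does not vanish.\<close>
  define B where "B = T \<inter> \<nu> -` (- {0})"
  have B: "open B" unfolding B_def by (rule continuous_open_preimage[OF Ck_on_continuous[OF T(4)[of 0]] T(1)]) auto
  have xB: "snd c x0 \<in> B" using T(2,6) by (auto simp: B_def)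
  have "local_form A \<Delta> c B \<nu>"
  proof (unfold_locales)
    show "c \<in> A" "open B" "B \<subseteq> snd c ` fst c" using c B T(3) by (auto simp: B_def)
    show "Ck_on k B \<nu>" for k by (rule Ck_on_subset[OF T(4)]) (auto simp: B_def)
    show "\<nu> y \<noteq> 0" if "y \<in> B" for y using that by (simp add: B_def)
    fix x assume x: "x \<in> fst c" "snd c x \<in> B"
    let ?y = "snd c x"
    have xU: "x \<in> U" using x T(3) mem_overlap[OF c(1) x(1), of U] by (auto simp: B_def simp del: image_Int)
    have yT: "?y \<in> T" "\<nu> ?y \<noteq> 0" using x by (auto simp: B_def)
    have inj: "inj_on (\<lambda>i. w i ?y) {..<m}"
    proof (rule inj_onI, rule ccontr)
      fix i j assume ij: "i \<in> {..<m}" "j \<in> {..<m}" "w i ?y = w j ?y" "i \<noteq> j"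
      have "(\<Sum>l<m. ((if l = i then 1 else 0) - (if l = j then 1 else 0)) *\<^sub>R w l ?y) = w i ?y - w j ?y"
        using ij(1,2) by (simp add: scaleR_left_diff_distrib sum_subtractf if_distrib[of "\<lambda>r. r *\<^sub>R _"] cong: if_cong)
      then have "\<forall>l<m. (if l = i then 1 else 0) - (if l = j then 1 else (0::real)) = 0"
        by (intro indw[OF x(1) xU]) (simp add: ij(3))
      then show False using ij(1,4) by auto
    qed
    have "independent ((\<lambda>i. w i ?y) ` {..<m})"
    proof (rule independent_if_scalars_zero)
      fix f v assume f: "(\<Sum>v\<in>(\<lambda>i. w i ?y) ` {..<m}. f v *\<^sub>R v) = 0" "v \<in> (\<lambda>i. w i ?y) ` {..<m}"
      have "(\<Sum>i<m. f (w i ?y) *\<^sub>R w i ?y) = 0" using f(1) by (simp add: sum.reindex[OF inj])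
      from indw[OF x(1) xU this] show "f v = 0" using f(2) by auto
    qed simp
    then have "dim (span ((\<lambda>i. w i ?y) ` {..<m})) = m" using inj by (simp add: dim_eq_card_independent card_image)
    moreover have "dim {v. \<nu> ?y \<bullet> v = 0} = m" using dim_hyperplane[OF yT(2)] by (simp add: m_def)
    moreover have "span ((\<lambda>i. w i ?y) ` {..<m}) \<subseteq> {v. \<nu> ?y \<bullet> v = 0}"
      by (rule span_minimal[OF _ subspace_hyperplane]) (use T(5)[OF yT(1)] in auto)
    ultimately have sp: "span ((\<lambda>i. w i ?y) ` {..<m}) = {v. \<nu> ?y \<bullet> v = 0}"
      by (intro subspace_dim_equal subspace_span subspace_hyperplane) auto
    show "\<Delta> x = {v \<in> tangent_space A x. \<nu> ?y \<bullet> v c = 0}"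
    proof (intro equalityI subsetI)
      fix v assume "v \<in> \<Delta> x"
      then obtain a :: "nat => real" where "v = (\<lambda>c. \<Sum>i<m. a i *\<^sub>R X i x c)" using Dl[OF xU] by blast
      then have v: "v = tvec c x (\<Sum>i<m. a i *\<^sub>R w i ?y)" using tan[OF x(1) xU] by simp
      then have "v c = (\<Sum>i<m. a i *\<^sub>R w i ?y)" using tvec_component[OF c(1) x(1)] by simp
      then have "\<nu> ?y \<bullet> v c = 0" using span[of a ?y] sp by simp
      then show "v \<in> {v \<in> tangent_space A x. \<nu> ?y \<bullet> v c = 0}" using tvec_tangent[OF c(1) x(1)] v by simp
    next
      fix v assume v: "v \<in> {v \<in> tangent_space A x. \<nu> ?y \<bullet> v c = 0}"
      then have "v c \<in> span ((\<lambda>i. w i ?y) ` {..<m})" using sp by simp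
      then obtain f where "v c = (\<Sum>z\<in>(\<lambda>i. w i ?y) ` {..<m}. f z *\<^sub>R z)" by (auto simp: span_finite)
      then have vc: "v c = (\<Sum>i<m. f (w i ?y) *\<^sub>R w i ?y)" by (simp add: sum.reindex[OF inj])
      have "v = tvec c x (v c)" using v tangent_space_iff[OF c(1) x(1)] by blast
      then have "v = (\<lambda>d. \<Sum>i<m. f (w i ?y) *\<^sub>R X i x d)" using tan[OF x(1) xU, of "\<lambda>i. f (w i ?y)"] vc by simp
      then show "v \<in> \<Delta> x" unfolding Dl[OF xU] by (intro CollectI exI[of _ "\<lambda>i. f (w i ?y)"] conjI TrueI)
    qed
  qed
  then show ?thesis using c(2) xB by blast
qed

section \<open>Propagation of a set along a leafwise curve\<close>

abbreviation open_along :: "(real => 'a) => 'a set => bool" where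
  "open_along g U \<equiv> \<forall>t\<in>{0..1}. g t \<in> U \<longrightarrow> (\<exists>d>0. \<forall>s\<in>{0..1}. \<bar>s - t\<bar> < d \<longrightarrow> g s \<in> U)"

text \<open>The function h plays the part of the height in a flow box and R \<sigma> x y that of the
  motion from x to y by height \<sigma>. Kept abstract, they reduce the propagation to an argument
  about one real variable.\<close>

abbreviation leafwise :: "(real => 'a) => 'a set => ('a => real) => (real => 'a => 'a => bool) => bool" where
  "leafwise g U h R \<equiv> \<forall>a b. 0 \<le> a \<and> b \<le> 1 \<and> g ` {a..b} \<subseteq> U \<longrightarrow> continuous_on {a..b} (h \<circ> g) \<and>
    (\<forall>s\<in>{a..b}. \<forall>s'\<in>{a..b}. R (h (g s') - h (g s)) (g s) (g s'))"

abbreviation leaf_chart :: "(real => 'a) => 'a set => 'a => 'a set => ('a => real) => (real => 'a => 'a => bool) => bool" where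
  "leaf_chart g N x0 U h R \<equiv> open_along g U \<and>
    (leafwise g U h R) \<and>
    (\<forall>\<sigma>. \<forall>x\<in>U. \<forall>y\<in>U. \<forall>y'\<in>U. R \<sigma> x y \<and> R \<sigma> x y' \<longrightarrow> y = y') \<and>
    (\<forall>q\<in>\<rat>. \<forall>x\<in>N \<inter> U. \<forall>y\<in>U. R q x y \<longrightarrow> y \<in> N) \<and>
    (x0 \<in> U \<longrightarrow> (\<forall>(\<sigma>::real). \<forall>y\<in>U. R \<sigma> x0 y \<longrightarrow> y \<in> N))"

text \<open>The heights visited just before a stretch where the curve rests fill an interval, so every later
  point is reached from an earlier one by a rational motion along the leaf.\<close>

lemma leaf_curve_propagation:
  fixes g :: "real => 'm"
  assumes loc: "\<And>t. t \<in> {\<tau><..1} ==> \<exists>U h R. g t \<in> U \<and>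
      leaf_chart g N x0 U h R"
    and closed: "\<And>p. closed {t \<in> {0..1}. g t = p}"
    and start: "0 \<le> \<tau>" "t1 \<in> {\<tau><..1}" "\<And>t. t \<in> {\<tau><..t1} ==> g t \<in> N"
    and init: "g \<tau> = x0 \<or> (\<forall>t\<in>{\<tau><..1}. g t \<noteq> g \<tau>)"
  shows "g 1 \<in> N"
proof -
  define T where "T = {t \<in> {\<tau><..1}. \<forall>s\<in>{\<tau><..t}. g s \<in> N}"
  define t2 where "t2 = Sup T"
  have t1T: "t1 \<in> T" using start by (auto simp: T_def)
  have bdd: "bdd_above T" by (rule bdd_aboveI[of _ 1]) (auto simp: T_def)
  have Tne: "T \<noteq> {}" using t1T by blast
  have T1: "t \<le> 1" if "t \<in> T" for t using that by (simp add: T_def)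
  have t2: "t1 \<le> t2" "t2 \<le> 1"
    unfolding t2_def by (rule cSup_upper[OF t1T bdd], rule cSup_least[OF Tne T1])
  have t2\<tau>: "t2 \<in> {\<tau><..1}" using t2 start(2) by auto
  have before: "g s \<in> N" if s: "s \<in> {\<tau><..<t2}" for s proof -
    obtain t where "t \<in> T" "s < t" using s less_cSup_iff[OF Tne bdd, of s] unfolding t2_def greaterThanLessThan_iff by blast
    then show ?thesis using s by (auto simp: T_def)
  qed
  obtain U h R where U: "g t2 \<in> U"
    and nbhd': "open_along g U"
    and leaf': "leafwise g U h R"
    and func': "\<forall>\<sigma>. \<forall>x\<in>U. \<forall>y\<in>U. \<forall>y'\<in>U. R \<sigma> x y \<and> R \<sigma> x y' \<longrightarrow> y = y'"
    and rat': "\<forall>q\<in>\<rat>. \<forall>x\<in>N \<inter> U. \<forall>y\<in>U. R q x y \<longrightarrow> y \<in> N"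
    and orbit': "x0 \<in> U \<longrightarrow> (\<forall>(\<sigma>::real). \<forall>y\<in>U. R \<sigma> x0 y \<longrightarrow> y \<in> N)"
    using loc[OF t2\<tau>] by (elim exE conjE) (rule that)
  have nbhd: "\<exists>d>0. \<forall>s\<in>{0..1}. \<bar>s - t\<bar> < d \<longrightarrow> g s \<in> U" if "t \<in> {0..1}" "g t \<in> U" for t
    using nbhd' that by blast
  have leaf: "continuous_on {a..b} (h \<circ> g)" "\<And>s s'. s \<in> {a..b} ==> s' \<in> {a..b} ==> R (h (g s') - h (g s)) (g s) (g s')"
    if "0 \<le> a" "b \<le> 1" "g ` {a..b} \<subseteq> U" for a b using leaf' that by blast+
  have func: "y = y'" if "x \<in> U" "y \<in> U" "y' \<in> U" "R \<sigma> x y" "R \<sigma> x y'" for \<sigma> x y y'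
    using func' that by blast
  have rat: "y \<in> N" if "q \<in> \<rat>" "x \<in> N" "x \<in> U" "y \<in> U" "R q x y" for q x y using rat' that by blast
  have orbit: "y \<in> N" if "x0 \<in> U" "y \<in> U" "R \<sigma> x0 y" for \<sigma> y using orbit' that by blast
  define p where "p = g t2"
  \<comment> \<open>The curve may be at rest when it reaches t2; r0 is the beginning of this rest,
    and strict motion is to be found just before r0.\<close>
  define Q where "Q = {r \<in> {\<tau>..t2}. \<forall>s\<in>{r..t2}. g s = p}"
  define r0 where "r0 = Inf Q"
  have Q2: "t2 \<in> Q" using t2\<tau> by (auto simp: Q_def p_def)
  have bddQ: "bdd_below Q" by (rule bdd_belowI[of _ \<tau>]) (auto simp: Q_def)
  have Qne: "Q \<noteq> {}" using Q2 by blast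
  have Q\<tau>: "\<tau> \<le> r" if "r \<in> Q" for r using that by (simp add: Q_def)
  have r0: "\<tau> \<le> r0" "r0 \<le> t2"
    using cInf_greatest[of Q \<tau>, OF Qne Q\<tau>] cInf_lower[OF Q2 bddQ] unfolding r0_def by blast+
  have const': "g s = p" if s: "s \<in> {r0<..t2}" for s proof -
    obtain r where "r \<in> Q" "r < s" using s cInf_less_iff[OF Qne bddQ, of s] unfolding r0_def greaterThanAtMost_iff by blast
    then show ?thesis using s by (auto simp: Q_def)
  qed
  have const: "g s = p" if s: "s \<in> {r0..t2}" for s
  proof (cases "r0 < t2")
    case True
    have "{r0<..<t2} \<subseteq> {t \<in> {0..1}. g t = p}" using const' r0 t2 start(1) by auto
    then have "closure {r0<..<t2} \<subseteq> {t \<in> {0..1}. g t = p}" by (rule closure_minimal[OF _ closed])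
    then show ?thesis using s True by auto
  next
    case False
    then have "s = t2" using s by auto
    then show ?thesis by (simp add: p_def)
  qed
  obtain d where d: "d > 0" "\<And>s. s \<in> {0..1} ==> \<bar>s - t2\<bar> < d ==> g s \<in> U" using nbhd[OF _ U] t2\<tau> start(1) by auto
  define b where "b = min 1 (t2 + d / 2)"
  have b: "b \<le> 1" "t2 \<le> b" "b = 1 \<or> t2 < b" using t2 d(1) by (auto simp: b_def)
  have right: "g s \<in> U" if "s \<in> {r0..b}" for s
  proof (cases "s \<le> t2")
    case True then show ?thesis using const[of s] that U by (simp add: p_def)
  next
    case False then show ?thesis using d that r0 start(1) by (auto simp: b_def min_def split: if_splits)
  qed
  have extend: "g s \<in> N" if s: "s \<in> {t2..b}" for s
  proof (cases "r0 = \<tau>")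
    case True
    \<comment> \<open>A rest that has lasted since \<tau> is compatible with \<open>init\<close>
      only if the curve started at x0, and all motions from x0 lead into N.\<close>
    have "g \<tau> = g t2" using const[of r0] r0 True by (simp add: p_def)
    then have gx: "g \<tau> = x0" using init t2\<tau> by auto
    have im: "g ` {\<tau>..b} \<subseteq> U" using right True by blast
    have "R (h (g s) - h (g \<tau>)) (g \<tau>) (g s)" by (rule leaf(2)[OF start(1) b(1) im]) (use s t2\<tau> b in auto)
    moreover have "g s \<in> U" by (rule right) (use s r0 in auto)
    moreover have "g \<tau> \<in> U" by (rule right) (use True s t2\<tau> in auto)
    ultimately show ?thesis using orbit unfolding gx by blast
  next
    case False
    then have r0': "\<tau> < r0" using r0 by simp
    have r01: "r0 \<in> {0..1}" "g r0 \<in> U" using r0 t2 start(1) right[of r0] b by auto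
    obtain d' where d': "d' > 0" "\<And>s. s \<in> {0..1} ==> \<bar>s - r0\<bar> < d' ==> g s \<in> U" using nbhd[OF r01] by blast
    \<comment> \<open>Slightly before r0, but after \<tau> and still within the same U, so that the
      comparison of heights applies on {a..b}.\<close>
    define a where "a = max ((\<tau> + r0) / 2) (r0 - d' / 2)"
    have a: "\<tau> < a" "a < r0" "0 \<le> a" using r0' d'(1) start(1) by (auto simp: a_def max_def)
    have im: "g ` {a..b} \<subseteq> U"
    proof (rule image_subsetI)
      fix u assume u: "u \<in> {a..b}"
      show "g u \<in> U"
      proof (cases "u < r0")
        case True
        have "u \<in> {0..1}" using u True r01(1) a by auto
        moreover have "\<bar>u - r0\<bar> < d'" using u True d'(1) by (auto simp: a_def)
        ultimately show ?thesis by (rule d'(2))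
      qed (use right u in auto)
    qed
    have "a \<notin> Q" using a(2) cInf_lower[OF _ bddQ, of a] by (auto simp: r0_def)
    then obtain s1 where s1: "s1 \<in> {a..t2}" "g s1 \<noteq> p" using a r0 by (auto simp: Q_def)
    have s1r: "s1 < r0" using s1 const[of s1] by force
    have ab: "s1 \<in> {a..b}" "r0 \<in> {a..b}" "s \<in> {a..b}" using s1 s1r a b r0 s by auto
    note lf = leaf(2)[OF a(3) b(1) im]
    have "h (g s1) \<noteq> h (g r0)"
    proof
      assume eq: "h (g s1) = h (g r0)"
      have "R 0 (g s1) (g r0)" "R 0 (g s1) (g s1)" using lf[OF ab(1,2)] lf[OF ab(1,1)] eq by simp_all
      then have "g r0 = g s1" using func im ab by blast
      then show False using s1(2) const[of r0] r0 by simp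
    qed
    define u v where "u = min (h (g s1)) (h (g r0))" and "v = max (h (g s1)) (h (g r0))"
    have uv: "u < v" using \<open>h (g s1) \<noteq> h (g r0)\<close> by (auto simp: u_def v_def)
    \<comment> \<open>A rational q such that the height h (g s) - q lies strictly between those at
      s1 and r0. The curve takes it at some s2 between them; s2 differs from r0, so g s2 already
      lies in N.\<close>
    obtain q where q: "q \<in> \<rat>" "h (g s) - v < q" "q < h (g s) - u" using Rats_dense_in_real[of "h (g s) - v" "h (g s) - u"] uv by auto
    define y where "y = h (g s) - q"
    have y: "u < y" "y < v" using q by (auto simp: y_def)
    have seg: "closed_segment s1 r0 = {s1..r0}" using s1r by (simp add: closed_segment_eq_real_ivl)
    have "y \<in> closed_segment ((h \<circ> g) s1) ((h \<circ> g) r0)" using y by (auto simp: closed_segment_eq_real_ivl u_def v_def)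
    moreover have "continuous_on (closed_segment s1 r0) (h \<circ> g)"
      unfolding seg by (rule continuous_on_subset[OF leaf(1)[OF a(3) b(1) im]]) (use ab in auto)
    ultimately obtain s2 where s2: "s2 \<in> closed_segment s1 r0" "(h \<circ> g) s2 = y" using IVT'_closed_segment_real by blast
    have s2': "s2 \<in> {s1..r0}" using s2(1) unfolding seg .
    have "s2 \<noteq> r0" using s2(2) y by (auto simp: u_def v_def)
    then have s2N: "g s2 \<in> N" using before[of s2] s2' a s1 r0 by auto
    have s2ab: "s2 \<in> {a..b}" using s2' ab by auto
    have "R q (g s2) (g s)" using lf[OF s2ab ab(3)] s2(2) by (simp add: y_def)
    then show ?thesis using rat[OF q(1) s2N] im s2ab ab(3) by blast
  qed
  have all: "g s \<in> N" if s: "s \<in> {\<tau><..b}" for s using before[of s] extend[of s] s by (cases "s < t2") auto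
  have "b \<in> T" using all b t2\<tau> by (auto simp: T_def)
  then have "b \<le> t2" using cSup_upper[OF _ bdd] by (simp add: t2_def)
  then have "b = 1" using b by auto
  then show ?thesis using all[of 1] t2\<tau> b by auto
qed

section \<open>Singular paths\<close>

lemma continuous_path_nbhd:
  assumes g: "continuous_map (top_of_set {0..1::real}) X g" and U: "openin X U" and t: "t \<in> {0..1}" "g t \<in> U"
  shows "\<exists>d>0. \<forall>s\<in>{0..1}. \<bar>s - t\<bar> < d \<longrightarrow> g s \<in> U"
proof -
  have "openin (top_of_set {0..1}) {s \<in> {0..1}. g s \<in> U}" using openin_continuous_map_preimage[OF g U] by simp
  then obtain d where d: "d > 0" "ball t d \<inter> {0..1} \<subseteq> {s \<in> {0..1}. g s \<in> U}"
    using t unfolding openin_contains_ball by blast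
  show ?thesis
  proof (intro exI[of _ d] conjI ballI impI d(1))
    fix s :: real assume "s \<in> {0..1}" "\<bar>s - t\<bar> < d"
    then have "s \<in> ball t d \<inter> {0..1}" by (simp add: dist_real_def abs_minus_commute)
    then show "g s \<in> U" using d(2) by blast
  qed
qed

context smooth_manifold
begin

lemma singular_path_continuous:
  "singular_path A \<Delta> g ==> continuous_map (top_of_set {0..1}) (manifold_topology A) g"
  by (simp add: singular_path_def horizontal_path_def ac_path_def)

lemma singular_path_chart_continuous:
  assumes g: "singular_path A \<Delta> g" and c: "c \<in> A" and ab: "0 \<le> a" "b \<le> 1" "g ` {a..b} \<subseteq> fst c"
  shows "continuous_on {a..b} (snd c \<circ> g)"
proof (cases "a \<le> b")
  case True
  have "ac_path A g" using g by (simp add: singular_path_def horizontal_path_def)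
  then have "abs_continuous_on a b (snd c \<circ> g)" using c ab True unfolding ac_path_def by blast
  then show ?thesis by (rule abs_continuous_on_imp_continuous_on)
qed simp

lemma singular_path_lift:
  assumes "singular_path A \<Delta> g"
  shows "\<exists>\<psi> M. negligible M \<and> ac_path (cotangent_atlas A) \<psi> \<and>
    (\<forall>t\<in>{0..1}. \<psi> t \<in> annihilator A \<Delta> \<and> fst (\<psi> t) = g t) \<and>
    (\<forall>t\<in>{0..1} - M. \<exists>\<xi>\<in>ker_omega A \<Delta> (\<psi> t). has_velocity (cotangent_atlas A) \<psi> \<xi> t {0..1})"
proof -
  obtain \<psi> where psi: "ac_path (cotangent_atlas A) \<psi>" "\<forall>t\<in>{0..1}. \<psi> t \<in> annihilator A \<Delta> \<and> fst (\<psi> t) = g t"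
    and ae: "AE t in lebesgue_on {0..1}. \<exists>\<xi>\<in>ker_omega A \<Delta> (\<psi> t). has_velocity (cotangent_atlas A) \<psi> \<xi> t {0..1}"
    using assms unfolding singular_path_def by blast
  have "AE t in lebesgue. t \<in> {0..1} \<longrightarrow> (\<exists>\<xi>\<in>ker_omega A \<Delta> (\<psi> t). has_velocity (cotangent_atlas A) \<psi> \<xi> t {0..1})"
    using ae by (subst (asm) AE_restrict_space_iff) auto
  then obtain M where M: "M \<in> null_sets lebesgue"
    "{t \<in> space lebesgue. \<not> (t \<in> {0..1} \<longrightarrow> (\<exists>\<xi>\<in>ker_omega A \<Delta> (\<psi> t). has_velocity (cotangent_atlas A) \<psi> \<xi> t {0..1}))} \<subseteq> M"
    unfolding eventually_ae_filter by blast
  have 1: "negligible M" using M(1) by (simp add: negligible_iff_null_sets)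
  have 2: "\<exists>\<xi>\<in>ker_omega A \<Delta> (\<psi> t). has_velocity (cotangent_atlas A) \<psi> \<xi> t {0..1}" if "t \<in> {0..1} - M" for t
    using M(2) that by auto
  show ?thesis by (intro exI[of _ \<psi>] exI[of _ M] conjI ballI 1 psi 2)
qed

text \<open>Rank zero is included: there singular paths rest, and the identity with e = 0 serves as
  motion. So both ranks share the propagation argument.\<close>

definition flow_chart :: "('m => (('m, 'e) chart => 'e) set) => ('m, 'e) chart => 'e set => 'e => (real => 'e => 'e) => bool" where
  "flow_chart \<Delta> c B e \<phi> \<longleftrightarrow> c \<in> A \<and> open B \<and> (\<forall>\<sigma> N. negligible N \<longrightarrow> negligible (\<phi> \<sigma> ` N)) \<and>
    (\<forall>y. negligible (range (\<lambda>\<sigma>. \<phi> \<sigma> y))) \<and>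
    (\<forall>g a b. singular_path A \<Delta> g \<and> 0 \<le> a \<and> b \<le> 1 \<and> g ` {a..b} \<subseteq> chart_preimage c B \<longrightarrow>
      (\<forall>t\<in>{a..b}. \<forall>t'\<in>{a..b}. snd c (g t') = \<phi> ((snd c (g t') - snd c (g t)) \<bullet> e) (snd c (g t))))"

definition exit_set :: "('m => (('m, 'e) chart => 'e) set) => 'm set => 'm set => bool" where
  "exit_set \<Delta> V E \<longleftrightarrow> measure_zero A E \<and> (\<forall>g \<tau>. singular_path A \<Delta> g \<and> 0 \<le> \<tau> \<and> \<tau> < 1 \<and> g \<tau> \<in> V \<and>
     \<not> regular_point \<Delta> (g \<tau>) \<and> (\<forall>t\<in>{\<tau><..1}. regular_point \<Delta> (g t)) \<longrightarrow>
     (\<exists>t1\<in>{\<tau><..1}. \<forall>t\<in>{\<tau><..t1}. g t \<in> E))"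

end

context local_form
begin

lemma zero_notin: "0 \<notin> \<nu> ` B" using nonzero by auto

abbreviation runs_in :: "(real => 'm) => real => real => 'e set => bool" where
  "runs_in g a b K \<equiv> 0 \<le> a \<and> a \<le> b \<and> b \<le> 1 \<and> compact K \<and> convex K \<and> K \<subseteq> B \<and> (\<forall>t\<in>{a..b}. g t \<in> fst c \<and> snd c (g t) \<in> K)"

abbreviation kernel_curve :: "(real => 'm) => (real => 'e \<times> real) => real set => real => real => bool" where
  "kernel_curve g f M a b \<equiv> abs_continuous_on a b f \<and> f ` {a..b} \<subseteq> W \<and> (\<forall>t\<in>{a..b}. fst (f t) = snd c (g t)) \<and>
    (\<forall>t\<in>{a..b} - M. \<exists>u\<in>lifted_kernel \<nu> (f t). (f has_vector_derivative u) (at t within {a..b}))"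

abbreviation char_curve :: "(real => 'm) => real set => real => real => bool" where
  "char_curve g M a b \<equiv> abs_continuous_on a b (snd c \<circ> g) \<and>
    (\<forall>t\<in>{a..b} - M. \<exists>v\<in>char_space \<nu> (snd c (g t)). ((snd c \<circ> g) has_vector_derivative v) (at t within {a..b}))"

text \<open>One lift and one exceptional null set serve all intervals on which the path stays in the
  box; compactness and convexity of K give the Lipschitz bound for \<open>coord\<close>.\<close>

lemma singular_path_coord:
  assumes g: "singular_path A \<Delta> g"
  shows "\<exists>f M. negligible M \<and> (\<forall>a b K. runs_in g a b K \<longrightarrow> kernel_curve g f M a b)"
proof -
  obtain \<psi> M where M: "negligible M" and psi: "ac_path CB \<psi>"
    "\<forall>t\<in>{0..1}. \<psi> t \<in> ann \<and> fst (\<psi> t) = g t"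
    "\<forall>t\<in>{0..1} - M. \<exists>\<xi>\<in>ker_omega A \<Delta> (\<psi> t). has_velocity CB \<psi> \<xi> t {0..1}"
    using singular_path_lift[OF g] by (elim exE conjE) (rule that)
  define f where "f = coord \<circ> (snd C \<circ> \<psi>)"
  show ?thesis
  proof (rule exI[of _ f], rule exI[of _ M], rule conjI[OF M], intro allI impI, elim conjE, intro conjI ballI)
    fix a b K assume ab: "0 \<le> a" "a \<le> b" "b \<le> 1" and K: "compact K" "convex K" "K \<subseteq> B"
      and gK: "\<forall>t\<in>{a..b}. g t \<in> fst c \<and> snd c (g t) \<in> K"
    have sub: "{a..b} \<subseteq> {0..1}" using ab by auto
    have p: "\<psi> t \<in> ann \<and> fst (\<psi> t) \<in> fst c \<and> snd c (fst (\<psi> t)) \<in> K" if "t \<in> {a..b}" for t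
      using bspec[OF psi(2), of t] gK sub that by auto
    have "\<psi> ` {a..b} \<subseteq> fst C"
    proof (rule image_subsetI)
      fix t assume "t \<in> {a..b}"
      then show "\<psi> t \<in> fst C" using p[of t] by (auto simp: mem_cotangent_chart annihilator_def)
    qed
    then have ac: "abs_continuous_on a b (snd C \<circ> \<psi>)" using psi(1) C ab unfolding ac_path_def by blast
    show "abs_continuous_on a b f" "f ` {a..b} \<subseteq> W"
      unfolding f_def by (rule abs_continuous_coord[OF K ac p], assumption)+
    show "fst (f t) = snd c (g t)" if "t \<in> {a..b}" for t
      using bspec[OF psi(2), of t] sub that by (auto simp: f_def coord_def mem_cotangent_chart)
    fix t assume t: "t \<in> {a..b} - M"
    then have t': "t \<in> {a..b}" "t \<in> {0..1} - M" using sub by auto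
    obtain \<xi> where \<xi>: "\<xi> \<in> ker_omega A \<Delta> (\<psi> t)" "has_velocity CB \<psi> \<xi> t {0..1}" using bspec[OF psi(3) t'(2)] by blast
    have "snd c (fst (\<psi> t)) \<in> B" using p[OF t'(1)] K(3) by blast
    with p[OF t'(1)] obtain u where u: "u \<in> lifted_kernel \<nu> (f t)" "(f has_vector_derivative u) (at t within {0..1})"
      using coord_has_derivative[OF _ _ _ \<xi>] unfolding f_def by blast
    show "\<exists>u\<in>lifted_kernel \<nu> (f t). (f has_vector_derivative u) (at t within {a..b})"
      using u has_vector_derivative_within_subset[OF u(2) sub] by blast
  qed
qed

lemma singular_path_base:
  assumes g: "singular_path A \<Delta> g"
  shows "\<exists>M. negligible M \<and> (\<forall>a b K. runs_in g a b K \<longrightarrow> char_curve g M a b)"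
proof -
  obtain f M where M: "negligible M" and f: "\<forall>a b K. runs_in g a b K \<longrightarrow> kernel_curve g f M a b"
    using singular_path_coord[OF g] by (elim exE conjE) (rule that)
  show ?thesis
  proof (rule exI[of _ M], rule conjI[OF M], intro allI impI conjI)
    fix a b K assume cond: "runs_in g a b K"
    note F = f[rule_format, OF cond]
    show "abs_continuous_on a b (snd c \<circ> g)" proof -
      have gK: "g ` {a..b} \<subseteq> fst c" using cond by blast
      have "ac_path A g" using g by (simp add: singular_path_def horizontal_path_def)
      then show ?thesis using c cond gK unfolding ac_path_def by blast
    qed
    show "\<forall>t\<in>{a..b} - M. \<exists>v\<in>char_space \<nu> (snd c (g t)). ((snd c \<circ> g) has_vector_derivative v) (at t within {a..b})"
    proof
    fix t assume t: "t \<in> {a..b} - M"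
    obtain u where u: "u \<in> lifted_kernel \<nu> (f t)" "(f has_vector_derivative u) (at t within {a..b})" using F t by blast
    have ft: "f t \<in> W" "fst (f t) = snd c (g t)" using F t by blast+
    have "u \<in> lifted_kernel \<nu> (fst (f t), snd (f t))" using u(1) by simp
    then have "fst u \<in> char_space \<nu> (fst (f t))"
      using form_kernel_lifted_form[of \<nu> "fst (f t)" "snd (f t)"] form_differentiable[OF B smooth] nonzero ft(1)
      by (auto simp: mem_Times_iff)
    moreover have "((\<lambda>t. fst (f t)) has_vector_derivative fst u) (at t within {a..b})"
      by (rule bounded_linear.has_vector_derivative[OF bounded_linear_fst u(2)])
    then have "((snd c \<circ> g) has_vector_derivative fst u) (at t within {a..b})"
      by (rule has_vector_derivative_transform[rotated 2]) (use F t in auto)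
    ultimately show "\<exists>v\<in>char_space \<nu> (snd c (g t)). ((snd c \<circ> g) has_vector_derivative v) (at t within {a..b})"
      using ft(2) by auto
    qed
  qed
qed

lemma char_dim_regular_point:
  assumes x: "x \<in> fst c" "snd c x \<in> B" and r: "\<And>a. a \<in> regular_set A \<Delta> ==> char_rank A \<Delta> a = r"
    and reg: "regular_point \<Delta> x"
  shows "char_dim \<Delta> x = r"
proof -
  have z: "(snd c x, 1) \<in> W" using x by simp
  have a: "lift (snd c x, 1) \<in> regular_set A \<Delta>" using regular_set_lift[OF z] reg by (simp add: pt_chart x)
  from r[OF a] have "dim (char_space \<nu> (snd c x)) = r"
    using subspace_dim_ker_omega[OF z] a by (simp add: char_rank_def char_distribution_def)
  then show ?thesis using char_dim_eq[OF x] by simp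
qed

text \<open>Rank one means that Z, or equivalently its base component, is nonzero, which is an open
  condition. In contrapositive form: Z vanishes over every non-regular point, so an exit starts at a
  zero of Z.\<close>

lemma regular_pointI:
  assumes DIM: "DIM('e \<times> real) = 2 * k + 1" and x: "x \<in> fst c" "snd c x \<in> B" and dim: "char_dim \<Delta> x = 1"
  shows "regular_point \<Delta> x"
proof -
  obtain en where en: "bij_betw en {..2 * k} (Basis :: ('e \<times> real) set)" using exists_Basis_enumeration[OF DIM] by blast
  let ?X = "char_field k en \<nu>"
  note nz = char_field_nonzero[OF B smooth zero_notin en]
  define V where "V = B \<inter> ?X -` (- {0})"
  have V: "open V" unfolding V_def
    by (rule continuous_open_preimage[OF Ck_on_continuous[OF Ck_on_char_field[OF B smooth zero_notin]] B]) auto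
  define U where "U = chart_preimage c V"
  have "char_dim \<Delta> y = 1" if "y \<in> U" for y using that char_dim_eq[of y] nz[of "snd c y"] by (auto simp: U_def V_def)
  moreover have "x \<in> U" using x dim char_dim_eq[OF x] nz[of "snd c x"] by (auto simp: U_def V_def)
  ultimately show ?thesis unfolding regular_point_def using openin_chart_preimage[OF c V] dim by (intro exI[of _ U]) (auto simp: U_def)
qed

lemma measure_zero_not_regular:
  assumes "measure_zero_sub TYPE('e \<times> real) CB ann (singular_set A \<Delta>)"
  shows "measure_zero A {x \<in> fst c. snd c x \<in> B \<and> \<not> regular_point \<Delta> x}"
  by (rule measure_zero_subset[OF measure_zero_chart[OF c negligible_not_regular[OF assms]]]) (auto simp: pt_chart)

lemma odd_dimension:
  assumes y: "y \<in> B" "dim (char_space \<nu> y) = 1" shows "\<exists>k. DIM('e \<times> real) = 2 * k + 1"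
proof -
  note d = form_differentiable[OF B smooth y(1)]
  have "skew_form (lifted_form \<nu> (y, 1))" using skew_lifted_form[of \<nu> "(y, 1)"] d by simp
  moreover have "dim (lifted_kernel \<nu> (y, 1)) = 1" using dim_form_kernel_lifted_form[OF d nonzero[OF y(1)], of 1] y(2) by simp
  ultimately show ?thesis using one_dim_kernel by blast
qed

lemma path_stays_in_cball:
  assumes g: "singular_path A \<Delta> g" and \<tau>: "0 \<le> \<tau>" "\<tau> < 1" and x: "g \<tau> \<in> fst c" "snd c (g \<tau>) \<in> B"
  obtains b r where "\<tau> < b" "b \<le> 1" "cball (snd c (g \<tau>)) r \<subseteq> B" "r > 0"
    "\<And>t. t \<in> {\<tau>..b} ==> g t \<in> fst c \<and> snd c (g t) \<in> cball (snd c (g \<tau>)) r"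
proof -
  let ?y = "snd c (g \<tau>)"
  obtain r where r: "r > 0" "cball ?y r \<subseteq> B" using B x(2) open_contains_cball by blast
  obtain d where d: "d > 0" "\<And>s. s \<in> {0..1} ==> \<bar>s - \<tau>\<bar> < d ==> g s \<in> {x \<in> fst c. snd c x \<in> ball ?y r}"
    using continuous_path_nbhd[OF singular_path_continuous[OF g] openin_chart_preimage[OF c open_ball], of \<tau> ?y r] \<tau> x r(1)
    by auto
  define b where "b = min 1 (\<tau> + d / 2)"
  have b: "\<tau> < b" "b \<le> 1" using \<tau> d(1) by (auto simp: b_def)
  have "g t \<in> fst c \<and> snd c (g t) \<in> cball ?y r" if t: "t \<in> {\<tau>..b}" for t proof -
    have "t \<in> {0..1}" "\<bar>t - \<tau>\<bar> < d" using t b \<tau> d(1) by (auto simp: b_def)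
    from d(2)[OF this] show ?thesis by (auto simp: less_imp_le)
  qed
  then show ?thesis using that[OF b r(2,1)] by blast
qed

text \<open>A trivial kernel forces zero velocity. The initial time may be singular; it only adds
  one point to the null set of exceptional times.\<close>

lemma stationary_path:
  assumes g: "singular_path A \<Delta> g" and ab: "0 \<le> a" "a \<le> b" "b \<le> 1" and K: "compact K" "convex K" "K \<subseteq> B"
    and gK: "\<And>t. t \<in> {a..b} ==> g t \<in> fst c \<and> snd c (g t) \<in> K" and d0: "\<And>t. t \<in> {a<..b} ==> char_dim \<Delta> (g t) = 0"
    and t: "t \<in> {a..b}"
  shows "snd c (g t) = snd c (g a)"
proof -
  obtain M where M: "negligible M" and f: "\<forall>a b K. runs_in g a b K \<longrightarrow> char_curve g M a b"
    using singular_path_base[OF g] by (elim exE conjE) (rule that)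
  have t': "a \<le> t" "t \<le> 1" "{a..t} \<subseteq> {a..b}" using t ab by auto
  have "runs_in g a t K" using ab(1) t' K gK by blast
  note F = f[rule_format, OF this]
  have "(snd c \<circ> g) t = (snd c \<circ> g) a"
  proof (rule abs_continuous_on_deriv_zero[OF t'(1)])
    show "abs_continuous_on a t (snd c \<circ> g)" using F by blast
    show "negligible (insert a M)" using M by (simp add: negligible_insert)
    fix s assume s: "s \<in> {a..t} - insert a M"
    then obtain v where v: "v \<in> char_space \<nu> (snd c (g s))" "((snd c \<circ> g) has_vector_derivative v) (at s within {a..t})"
      using F by blast
    have sab: "s \<in> {a..b}" "s \<in> {a<..b}" using s t'(3) by auto
    have gs: "g s \<in> fst c" "snd c (g s) \<in> B" using gK[OF sab(1)] K(3) by auto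
    have "dim (char_space \<nu> (snd c (g s))) = 0" using char_dim_eq[OF gs] d0[OF sab(2)] by simp
    then have "v = 0" using v(1) by (auto simp: dim_eq_0)
    then show "((snd c \<circ> g) has_vector_derivative 0) (at s within {a..t})" using v(2) by simp
  qed
  then show ?thesis by simp
qed

lemma exists_flow_chart:
  assumes r: "r \<in> {0, 1}" "\<And>a. a \<in> regular_set A \<Delta> ==> char_rank A \<Delta> a = r" and DIM: "DIM('e) \<ge> 2"
    and x: "x \<in> fst c" "snd c x \<in> B" and reg: "regular_point \<Delta> x"
  shows "\<exists>B' e \<phi>. flow_chart \<Delta> c B' e \<phi> \<and> snd c x \<in> B'"
proof (cases "r = 0")
  case True
  obtain U where U: "openin (manifold_topology A) U" "x \<in> U" "\<And>y. y \<in> U ==> char_dim \<Delta> y = char_dim \<Delta> x"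
    using reg unfolding regular_point_def by blast
  have d0: "char_dim \<Delta> y = 0" if "y \<in> U" for y using U(3)[OF that] char_dim_regular_point[OF x r(2) reg] True by simp
  have "open (snd c ` (fst c \<inter> U) \<inter> B)" by (intro open_Int B open_chart_image[OF U(1) c])
  moreover have "snd c x \<in> snd c ` (fst c \<inter> U) \<inter> B" using x U(2) by auto
  ultimately obtain s where s: "s > 0" "cball (snd c x) s \<subseteq> snd c ` (fst c \<inter> U) \<inter> B"
    using open_contains_cball by metis
  have "flow_chart \<Delta> c (ball (snd c x) s) 0 (\<lambda>\<sigma> y. y)"
    unfolding flow_chart_def
  proof (intro conjI allI impI ballI)
    fix g a b t t' assume h: "singular_path A \<Delta> g \<and> 0 \<le> a \<and> b \<le> 1 \<and> g ` {a..b} \<subseteq> {z \<in> fst c. snd c z \<in> ball (snd c x) s}"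
      and t: "t \<in> {a..b}" "t' \<in> {a..b}"
    have gK: "g t \<in> fst c \<and> snd c (g t) \<in> cball (snd c x) s" if "t \<in> {a..b}" for t
      using h that by (force simp: less_imp_le)
    have gU: "char_dim \<Delta> (g t) = 0" if "t \<in> {a<..b}" for t
    proof (rule d0)
      have "g t \<in> fst c" "snd c (g t) \<in> snd c ` (fst c \<inter> U)" using gK[of t] s(2) that by auto
      then show "g t \<in> U" using mem_overlap[OF c] by blast
    qed
    have ab: "a \<le> b" using t by auto
    have KB: "cball (snd c x) s \<subseteq> B" using s(2) by blast
    have "snd c (g u) = snd c (g a)" if "u \<in> {a..b}" for u
      by (rule stationary_path[OF _ _ ab _ compact_cball convex_cball KB gK gU that]) (use h in auto)
    from trans[OF this[OF t(2)] sym[OF this[OF t(1)]]] show "snd c (g t') = (\<lambda>\<sigma> y. y) ((snd c (g t') - snd c (g t)) \<bullet> 0) (snd c (g t))" .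
  qed (use c in auto)
  moreover have "snd c x \<in> ball (snd c x) s" using s(1) by simp
  ultimately show ?thesis by (intro exI conjI)
next
  case False
  then have r1: "r = 1" using r(1) by simp
  have dim: "dim (char_space \<nu> (snd c x)) = 1" using char_dim_regular_point[OF x r(2) reg] char_dim_eq[OF x] r1 by simp
  obtain k where k: "DIM('e \<times> real) = 2 * k + 1" using odd_dimension[OF x(2) dim] by blast
  have "\<exists>s e \<psi>. s > 0 \<and> cball (snd c x) s \<subseteq> B \<and> (\<forall>\<sigma> N. negligible N \<longrightarrow> negligible (\<psi> \<sigma> ` N)) \<and>
      (\<forall>a. negligible (range (\<lambda>\<sigma>::real. \<psi> \<sigma> a))) \<and>
      (transports_leaves \<nu> (cball (snd c x) s) e \<psi>)"
    using exists_char_flow_box[OF B smooth zero_notin k x(2) dim] DIM by (elim exE conjE) (intro exI conjI, assumption+, simp, assumption)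
  then obtain s e \<psi> where s: "s > 0" "cball (snd c x) s \<subseteq> B" and \<psi>: "\<forall>\<sigma> N. negligible N \<longrightarrow> negligible (\<psi> \<sigma> ` N)"
      "\<forall>a. negligible (range (\<lambda>\<sigma>::real. \<psi> \<sigma> a))"
    and curve: "transports_leaves \<nu> (cball (snd c x) s) e \<psi>" by (elim exE conjE) (rule that)
  have "flow_chart \<Delta> c (ball (snd c x) s) e \<psi>"
    unfolding flow_chart_def
  proof (intro conjI c open_ball \<psi>, intro allI impI ballI)
    fix g a b t t' assume h: "singular_path A \<Delta> g \<and> 0 \<le> a \<and> b \<le> 1 \<and> g ` {a..b} \<subseteq> {z \<in> fst c. snd c z \<in> ball (snd c x) s}"
      and t: "t \<in> {a..b}" "t' \<in> {a..b}"
    have gK: "g t \<in> fst c \<and> snd c (g t) \<in> cball (snd c x) s" if "t \<in> {a..b}" for t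
      using h that by (force simp: less_imp_le)
    have g: "singular_path A \<Delta> g" using h by blast
    have ab: "0 \<le> a" "a \<le> b" "b \<le> 1" using h t by auto
    obtain M where M: "negligible M" and f: "\<forall>a b K. runs_in g a b K \<longrightarrow> char_curve g M a b"
      using singular_path_base[OF g] by (elim exE conjE) (rule that)
    have "runs_in g a b (cball (snd c x) s)" by (intro conjI ab compact_cball convex_cball s(2) ballI) (use gK in blast)+
    note F = f[rule_format, OF this]
    have "(snd c \<circ> g) ` {a..b} \<subseteq> cball (snd c x) s" using gK by (auto simp del: mem_cball)
    then have "\<forall>t\<in>{a..b}. \<forall>t'\<in>{a..b}. (snd c \<circ> g) t' = \<psi> (((snd c \<circ> g) t' - (snd c \<circ> g) t) \<bullet> e) ((snd c \<circ> g) t)"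
      using curve[rule_format, of a b "snd c \<circ> g" M] F M by simp
    then show "snd c (g t') = \<psi> ((snd c (g t') - snd c (g t)) \<bullet> e) (snd c (g t))" using t by simp
  qed
  moreover have "snd c x \<in> ball (snd c x) s" using s(1) by simp
  ultimately show ?thesis by (intro exI conjI)
qed

text \<open>In rank zero there are no exits: after \<tau> the path would rest at the non-regular
  point g \<tau>. In rank one the lifted path is a curve as in \<open>contains_exits\<close>, since
  \<open>regular_pointI\<close> excludes kernel dimension one at g \<tau>.\<close>

lemma exists_exit_set:
  assumes r: "r \<in> {0, 1}" "\<And>a. a \<in> regular_set A \<Delta> ==> char_rank A \<Delta> a = r"
    and null: "measure_zero_sub TYPE('e \<times> real) CB ann (singular_set A \<Delta>)"
    and odd: "r = 1 ==> \<exists>k. DIM('e \<times> real) = 2 * k + 1" and boxes: "\<And>x. x \<in> carrier A ==> \<exists>c B \<nu>. local_form A \<Delta> c B \<nu> \<and> x \<in> fst c \<and> snd c x \<in> B"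
  shows "\<exists>E. exit_set \<Delta> (chart_preimage c B) E"
proof -
  have reg_dim: "char_dim \<Delta> x = r" if xr: "regular_point \<Delta> x" "x \<in> carrier A" for x proof -
    obtain c B \<nu> where b: "local_form A \<Delta> c B \<nu>" "x \<in> fst c" "snd c x \<in> B" using boxes[OF xr(2)] by blast
    show ?thesis by (rule local_form.char_dim_regular_point[OF b r(2) xr(1)])
  qed
  have carr: "g t \<in> carrier A" if gt: "singular_path A \<Delta> g" "t \<in> {0..1}" for g t
    using singular_path_continuous[OF gt(1)] gt(2) by (auto simp: continuous_map_def topspace_manifold_topology)
  show ?thesis
  proof (cases "r = 0")
    case True
    have "exit_set \<Delta> (chart_preimage c B) {}"
      unfolding exit_set_def
    proof (intro conjI allI impI)
      show "measure_zero A {}" by (simp add: measure_zero_iff)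
      fix g \<tau> assume h: "singular_path A \<Delta> g \<and> 0 \<le> \<tau> \<and> \<tau> < 1 \<and> g \<tau> \<in> chart_preimage c B \<and>
        \<not> regular_point \<Delta> (g \<tau>) \<and> (\<forall>t\<in>{\<tau><..1}. regular_point \<Delta> (g t))"
      then have g: "singular_path A \<Delta> g" and \<tau>: "0 \<le> \<tau>" "\<tau> < 1" "g \<tau> \<in> fst c" "snd c (g \<tau>) \<in> B" by auto
      obtain b s where b: "\<tau> < b" "b \<le> 1" "cball (snd c (g \<tau>)) s \<subseteq> B" "s > 0"
        "\<And>t. t \<in> {\<tau>..b} ==> g t \<in> fst c \<and> snd c (g t) \<in> cball (snd c (g \<tau>)) s"
        using path_stays_in_cball[OF g \<tau>] by blast
      have "snd c (g b) = snd c (g \<tau>)"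
      proof (rule stationary_path[OF g \<tau>(1) less_imp_le[OF b(1)] b(2) compact_cball convex_cball b(3,5)])
        show "char_dim \<Delta> (g t) = 0" if "t \<in> {\<tau><..b}" for t
          using reg_dim[of "g t"] carr[OF g, of t] h that \<tau> b(2) True by auto
      qed (use b(1) in auto)
      then have "g b = g \<tau>" using pt_chart b(5)[of b] b(1) \<tau>(3) by (metis atLeastAtMost_iff less_imp_le order_refl)
      moreover have "regular_point \<Delta> (g b)" using h b(1,2) by (simp add: greaterThanAtMost_iff)
      ultimately have False using h by simp
      then show "\<exists>t1\<in>{\<tau><..1}. \<forall>t\<in>{\<tau><..t1}. g t \<in> {}" by blast
    qed
    then show ?thesis by blast
  next
    case False
    then have r1: "r = 1" using r(1) by simp
    then obtain k where k: "DIM('e \<times> real) = 2 * k + 1" using odd by blast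
    have "negligible {y \<in> B. dim (char_space \<nu> y) \<noteq> 1}"
    proof (rule negligible_subset[OF negligible_not_regular[OF null]], clarify)
      fix y assume y: "y \<in> B" "dim (char_space \<nu> y) \<noteq> 1" "regular_point \<Delta> (pt y)"
      have "char_dim \<Delta> (pt y) = 1" using char_dim_regular_point[OF _ _ r(2) y(3)] pt[OF y(1)] y(1) r1 by simp
      then show False using char_dim_eq[of "pt y"] pt[OF y(1)] y(1,2) by simp
    qed
    from negligible_exit_leaves[OF B smooth zero_notin k this]
    obtain N where N: "negligible N" and exit: "contains_exits \<nu> B N" by (elim exE conjE) (rule that)
    have "exit_set \<Delta> (chart_preimage c B) (chart_preimage c N)"
      unfolding exit_set_def
    proof (intro conjI allI impI)
      show "measure_zero A (chart_preimage c N)" by (rule measure_zero_chart[OF c N])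
      fix g \<tau> assume h: "singular_path A \<Delta> g \<and> 0 \<le> \<tau> \<and> \<tau> < 1 \<and> g \<tau> \<in> chart_preimage c B \<and>
        \<not> regular_point \<Delta> (g \<tau>) \<and> (\<forall>t\<in>{\<tau><..1}. regular_point \<Delta> (g t))"
      then have g: "singular_path A \<Delta> g" and \<tau>: "0 \<le> \<tau>" "\<tau> < 1" "g \<tau> \<in> fst c" "snd c (g \<tau>) \<in> B" by auto
      obtain b s where b: "\<tau> < b" "b \<le> 1" "cball (snd c (g \<tau>)) s \<subseteq> B" "s > 0"
        "\<And>t. t \<in> {\<tau>..b} ==> g t \<in> fst c \<and> snd c (g t) \<in> cball (snd c (g \<tau>)) s"
        using path_stays_in_cball[OF g \<tau>] by blast
      obtain f M where M: "negligible M" and f: "\<forall>a b K. runs_in g a b K \<longrightarrow> kernel_curve g f M a b"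
        using singular_path_coord[OF g] by (elim exE conjE) (rule that)
      let ?K = "cball (snd c (g \<tau>)) s"
      have "runs_in g \<tau> b ?K"
        by (intro conjI \<tau>(1) less_imp_le[OF b(1)] b(2) compact_cball convex_cball b(3) ballI) (use b(5) in blast)+
      note F = f[rule_format, OF this]
      have ft: "fst (f t) = snd c (g t)" if "t \<in> {\<tau>..b}" for t using F that by blast
      have "dim (char_space \<nu> (fst (f \<tau>))) \<noteq> 1"
        using regular_pointI[OF k \<tau>(3,4)] char_dim_eq[OF \<tau>(3,4)] h ft[of \<tau>] b(1) by auto
      moreover have "dim (char_space \<nu> (fst (f t))) = 1" if t: "t \<in> {\<tau><..b}" for t proof -
        have t': "t \<in> {\<tau>..b}" "t \<in> {0..1}" "regular_point \<Delta> (g t)" using t \<tau>(1) b(2) h by auto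
        have "g t \<in> fst c" "snd c (g t) \<in> B" using b(5)[OF t'(1)] b(3) by auto
        then show ?thesis using char_dim_eq reg_dim[OF t'(3) carr[OF g t'(2)]] r1 ft[OF t'(1)] by simp
      qed
      ultimately obtain t1 where t1: "t1 \<in> {\<tau><..b}" "\<forall>t\<in>{\<tau><..t1}. fst (f t) \<in> N"
        using exit[rule_format, of \<tau> b f M] F M b(1) by blast
      have "g t \<in> chart_preimage c N" if "t \<in> {\<tau><..t1}" for t proof -
        have "t \<in> {\<tau>..b}" using t1(1) that by auto
        moreover have "fst (f t) \<in> N" using t1(2) that by blast
        ultimately show ?thesis using ft b(5) by force
      qed
      then show "\<exists>t1\<in>{\<tau><..1}. \<forall>t\<in>{\<tau><..t1}. g t \<in> chart_preimage c N"
        using t1(1) b(2) by (intro bexI[of _ t1]) auto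
    qed
    then show ?thesis by blast
  qed
qed

end

section \<open>End-points of singular paths\<close>

context smooth_manifold
begin

text \<open>Countably many charts and rational motions generate countably many finite compositions,
  each of which keeps null sets null.\<close>

lemma measure_zero_closure:
  fixes ch :: "'s => ('m, 'e) chart" and \<phi> :: "'s => real => 'e => 'e"
  assumes J: "countable J" "\<And>j. j \<in> J ==> ch j \<in> A" "\<And>j \<sigma> N. j \<in> J ==> negligible N ==> negligible (\<phi> j \<sigma> ` N)"
    and E: "measure_zero A E"
  shows "\<exists>N. E \<subseteq> N \<and> measure_zero A N \<and>
    (\<forall>j\<in>J. \<forall>q\<in>\<rat>. \<forall>x\<in>N \<inter> fst (ch j). \<forall>y\<in>fst (ch j). snd (ch j) y = \<phi> j q (snd (ch j) x) \<longrightarrow> y \<in> N)"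
proof -
  define F where "F N = N \<union> (\<Union>j\<in>J. \<Union>q\<in>\<rat>. {y \<in> fst (ch j). snd (ch j) y \<in> \<phi> j q ` snd (ch j) ` (N \<inter> fst (ch j))})" for N
  have F: "measure_zero A (F N)" if N: "measure_zero A N" for N
    unfolding F_def
  proof (intro measure_zero_Un N measure_zero_UN J(1) countable_rat)
    fix j and q :: real assume j: "j \<in> J"
    have "negligible (snd (ch j) ` (N \<inter> fst (ch j)))" using N J(2)[OF j] by (simp add: measure_zero_iff)
    then show "measure_zero A {y \<in> fst (ch j). snd (ch j) y \<in> \<phi> j q ` snd (ch j) ` (N \<inter> fst (ch j))}"
      by (intro measure_zero_chart J(2)[OF j] J(3)[OF j])
  qed
  have Fn: "measure_zero A ((F ^^ n) E)" for n by (induction n) (use E F in auto)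
  show ?thesis
  proof (intro exI[of _ "\<Union>n. (F ^^ n) E"] conjI ballI impI)
    show "E \<subseteq> (\<Union>n. (F ^^ n) E)" by (rule order_trans[OF _ UN_upper[of 0]]) auto
    show "measure_zero A (\<Union>n. (F ^^ n) E)" by (rule measure_zero_UN) (use Fn in auto)
    fix j q x y assume h: "j \<in> J" "q \<in> \<rat>" "x \<in> (\<Union>n. (F ^^ n) E) \<inter> fst (ch j)" "y \<in> fst (ch j)" "snd (ch j) y = \<phi> j q (snd (ch j) x)"
    then obtain n where n: "x \<in> (F ^^ n) E" by blast
    have "y \<in> {y \<in> fst (ch j). snd (ch j) y \<in> \<phi> j q ` snd (ch j) ` ((F ^^ n) E \<inter> fst (ch j))}"
      using h(3,4,5) n by blast
    then have "y \<in> (F ^^ Suc n) E" using h(1,2) unfolding F_def[of "(F ^^ n) E"] funpow.simps(2) o_apply by blast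
    then show "y \<in> (\<Union>n. (F ^^ n) E)" by blast
  qed
qed

theorem singular_endpoints_measure_zero:
  assumes top: "Hausdorff_space (manifold_topology A)" "second_countable (manifold_topology A)"
    and boxes: "\<And>x. x \<in> carrier A ==> \<exists>c B \<nu>. local_form A \<Delta> c B \<nu> \<and> x \<in> fst c \<and> snd c x \<in> B"
    and DIM: "DIM('e) \<ge> 2" and r: "r \<in> {0, 1}" "\<And>a. a \<in> regular_set A \<Delta> ==> char_rank A \<Delta> a = r"
    and null: "measure_zero_sub TYPE('e \<times> real) (cotangent_atlas A) (annihilator A \<Delta>) (singular_set A \<Delta>)"
  shows "measure_zero A (Abn A \<Delta> x0)"
proof -
  let ?T = "manifold_topology A"
  define S where "S = {x \<in> carrier A. regular_point \<Delta> x}"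
  have carr: "g t \<in> carrier A" if gt: "singular_path A \<Delta> g" "t \<in> {0..1}" for g t
    using singular_path_continuous[OF gt(1)] gt(2) by (auto simp: continuous_map_def topspace_manifold_topology)
  let ?box = "\<lambda>(c, B, \<nu>). chart_preimage c B"
  have "\<exists>I. countable I \<and> I \<subseteq> {(c, B, \<nu>). local_form A \<Delta> c B \<nu>} \<and> carrier A \<subseteq> (\<Union>s\<in>I. ?box s)"
  proof (rule countable_subcover[OF top(2)])
    show "openin ?T (?box s)" if "case s of (c, B, \<nu>) => local_form A \<Delta> c B \<nu>" for s
      using that local_form.openin_box by (cases s) fastforce
    show "carrier A \<subseteq> topspace ?T" by (simp add: topspace_manifold_topology)
    fix x assume "x \<in> carrier A"
    then obtain c B \<nu> where "local_form A \<Delta> c B \<nu>" "x \<in> fst c" "snd c x \<in> B" using boxes by blast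
    then show "\<exists>s. (case s of (c, B, \<nu>) => local_form A \<Delta> c B \<nu>) \<and> x \<in> ?box s"
      by (intro exI[of _ "(c, B, \<nu>)"]) simp
  qed
  then obtain I where I: "countable I" "\<And>c B \<nu>. (c, B, \<nu>) \<in> I ==> local_form A \<Delta> c B \<nu>" "carrier A \<subseteq> (\<Union>s\<in>I. ?box s)" by auto
  have singular: "measure_zero A (carrier A - S)"
  proof (rule measure_zero_subset)
    show "measure_zero A (\<Union>(c, B, \<nu>)\<in>I. {x \<in> fst c. snd c x \<in> B \<and> \<not> regular_point \<Delta> x})"
    proof (rule measure_zero_UN[OF I(1)], clarify)
      fix c B \<nu> assume "(c, B, \<nu>) \<in> I"
      then show "measure_zero A {x \<in> fst c. snd c x \<in> B \<and> \<not> regular_point \<Delta> x}"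
        by (rule local_form.measure_zero_not_regular[OF I(2) null])
    qed
    show "carrier A - S \<subseteq> (\<Union>(c, B, \<nu>)\<in>I. {x \<in> fst c. snd c x \<in> B \<and> \<not> regular_point \<Delta> x})"
    proof
      fix x assume x: "x \<in> carrier A - S"
      then obtain s where s: "s \<in> I" "x \<in> ?box s" using I(3) by blast
      obtain c B \<nu> where "s = (c, B, \<nu>)" by (cases s)
      then show "x \<in> (\<Union>(c, B, \<nu>)\<in>I. {x \<in> fst c. snd c x \<in> B \<and> \<not> regular_point \<Delta> x})"
        using s x by (intro UN_I[OF s(1)]) (simp add: S_def)
    qed
  qed
  have Abn: "Abn A \<Delta> x0 \<subseteq> carrier A" using carr by (auto simp: Abn_def)
  show ?thesis
  proof (cases "S = {}")
    \<comment> \<open>With an empty regular set all end-points are singular points, and these form a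
      null set.\<close>
    case True then show ?thesis using singular Abn measure_zero_subset by auto
  next
    case False
    then obtain x1 where x1: "x1 \<in> carrier A" "regular_point \<Delta> x1" by (auto simp: S_def)
    have odd: "\<exists>k. DIM('e \<times> real) = 2 * k + 1" if "r = 1" proof -
      obtain c B \<nu> where b: "local_form A \<Delta> c B \<nu>" "x1 \<in> fst c" "snd c x1 \<in> B" using boxes[OF x1(1)] by blast
      have "dim (char_space \<nu> (snd c x1)) = 1"
        using local_form.char_dim_regular_point[OF b r(2) x1(2)] local_form.char_dim_eq[OF b] \<open>r = 1\<close> by simp
      then show ?thesis by (rule local_form.odd_dimension[OF b(1,3)])
    qed
    have openS: "openin ?T S"
      unfolding openin_subopen[of ?T S]
    proof
      fix x assume x: "x \<in> S"
      then obtain U where U: "openin ?T U" "x \<in> U" "\<And>y. y \<in> U ==> char_dim \<Delta> y = char_dim \<Delta> x"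
        unfolding S_def regular_point_def by blast
      have "regular_point \<Delta> y" if y: "y \<in> U" for y
        unfolding regular_point_def by (intro exI[of _ U] conjI ballI U(1) y) (rule trans[OF U(3) U(3)[OF y, symmetric]])
      moreover have "U \<subseteq> carrier A" using openin_subset[OF U(1)] by (simp add: topspace_manifold_topology)
      ultimately show "\<exists>U. openin ?T U \<and> x \<in> U \<and> U \<subseteq> S" using U(1,2) unfolding S_def by blast
    qed
    let ?dom = "\<lambda>(c, B, e, \<phi>). chart_preimage c B"
    have "\<exists>J. countable J \<and> J \<subseteq> {(c, B, e, \<phi>). flow_chart \<Delta> c B e \<phi>} \<and> S \<subseteq> (\<Union>s\<in>J. ?dom s)"
    proof (rule countable_subcover[OF top(2)])
      show "openin ?T (?dom s)" if "case s of (c, B, e, \<phi>) => flow_chart \<Delta> c B e \<phi>" for s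
        using that openin_chart_preimage by (cases s) (simp add: flow_chart_def)
      show "S \<subseteq> topspace ?T" using openin_subset[OF openS] .
      fix x assume "x \<in> S"
      then have x: "x \<in> carrier A" "regular_point \<Delta> x" by (auto simp: S_def)
      obtain c B \<nu> where b: "local_form A \<Delta> c B \<nu>" "x \<in> fst c" "snd c x \<in> B" using boxes[OF x(1)] by blast
      obtain B' e \<phi> where "flow_chart \<Delta> c B' e \<phi>" "snd c x \<in> B'"
        using local_form.exists_flow_chart[OF b(1) r DIM b(2,3) x(2)] by blast
      then show "\<exists>s. (case s of (c, B, e, \<phi>) => flow_chart \<Delta> c B e \<phi>) \<and> x \<in> ?dom s"
        using b(2) by (intro exI[of _ "(c, B', e, \<phi>)"]) simp
    qed
    then obtain J where J: "countable J" "\<And>c B e \<phi>. (c, B, e, \<phi>) \<in> J ==> flow_chart \<Delta> c B e \<phi>" "S \<subseteq> (\<Union>s\<in>J. ?dom s)" by auto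
    have "\<forall>s\<in>I. \<exists>E. exit_set \<Delta> (?box s) E"
    proof clarify
      fix c B \<nu> assume "(c, B, \<nu>) \<in> I"
      from local_form.exists_exit_set[OF I(2)[OF this] r null odd boxes]
      show "\<exists>E. exit_set \<Delta> (chart_preimage c B) E" by blast
    qed
    then obtain X where X: "\<And>s. s \<in> I ==> exit_set \<Delta> (?box s) (X s)" using bchoice[of I "\<lambda>s E. exit_set \<Delta> (?box s) E"] by blast
    let ?orbit = "\<lambda>(c, B, e, \<phi>). {x \<in> fst c. snd c x \<in> range (\<lambda>\<sigma>. \<phi> \<sigma> (snd c x0))}"
    \<comment> \<open>The sources of the exceptional set: singular points, for paths that end in
      one; x0 itself; the exits after a last singular time; and the orbit of x0 in each flow chart,
      for paths that never meet a singular point.\<close>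
    define E where "E = (carrier A - S) \<union> {x0} \<union> (\<Union>s\<in>I. X s) \<union> (\<Union>s\<in>J. ?orbit s)"
    have "measure_zero A E"
      unfolding E_def
    proof (intro measure_zero_Un singular measure_zero_singleton measure_zero_UN I(1) J(1))
      show "measure_zero A (X s)" if "s \<in> I" for s using X[OF that] by (simp add: exit_set_def)
      show "measure_zero A (?orbit s)" if sJ: "s \<in> J" for s proof -
        obtain c B e \<phi> where s: "s = (c, B, e, \<phi>)" by (cases s)
        then have "flow_chart \<Delta> c B e \<phi>" using J(2) sJ by blast
        then show ?thesis unfolding s flow_chart_def by (auto intro: measure_zero_chart)
      qed
    qed
    moreover have "measure_zero A E ==> \<exists>N. E \<subseteq> N \<and> measure_zero A N \<and>
      (\<forall>j\<in>J. \<forall>q\<in>\<rat>. \<forall>x\<in>N \<inter> fst (fst j). \<forall>y\<in>fst (fst j). snd (fst j) y = snd (snd (snd j)) q (snd (fst j) x) \<longrightarrow> y \<in> N)"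
      by (rule measure_zero_closure[where ch = fst and \<phi> = "\<lambda>j. snd (snd (snd j))", OF J(1)])
        (use J(2) in \<open>auto simp: flow_chart_def\<close>)
    ultimately obtain N where N: "E \<subseteq> N" "measure_zero A N"
      "\<And>j q x y. j \<in> J ==> q \<in> \<rat> ==> x \<in> N ==> x \<in> fst (fst j) ==> y \<in> fst (fst j) ==>
        snd (fst j) y = snd (snd (snd j)) q (snd (fst j) x) ==> y \<in> N" by blast
    have "g 1 \<in> N" if g: "singular_path A \<Delta> g" "g 0 = x0" for g proof -
      note cont = singular_path_continuous[OF g(1)]
      have loc: "\<exists>U h R. g t \<in> U \<and>
          leaf_chart g N x0 U h R" if t: "g t \<in> S" for t proof -
        obtain c B e \<phi> where j: "(c, B, e, \<phi>) \<in> J" and gU: "g t \<in> chart_preimage c B" using J(3) t by blast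
        have fc: "flow_chart \<Delta> c B e \<phi>" by (rule J(2)[OF j])
        have c: "c \<in> A" "open B" using fc by (auto simp: flow_chart_def)
        let ?U = "chart_preimage c B"
        have U: "openin ?T ?U" by (rule openin_chart_preimage[OF c])
        show ?thesis
        proof (rule exI[of _ ?U], rule exI[of _ "\<lambda>x. snd c x \<bullet> e"], rule exI[of _ "\<lambda>\<sigma> x y. snd c y = \<phi> \<sigma> (snd c x)"],
            intro conjI gU)
          show "\<forall>t\<in>{0..1}. g t \<in> ?U \<longrightarrow> (\<exists>d>0. \<forall>s\<in>{0..1}. \<bar>s - t\<bar> < d \<longrightarrow> g s \<in> ?U)"
            using continuous_path_nbhd[OF cont U] by blast
          show "\<forall>a b. 0 \<le> a \<and> b \<le> 1 \<and> g ` {a..b} \<subseteq> ?U \<longrightarrow> continuous_on {a..b} ((\<lambda>x. snd c x \<bullet> e) \<circ> g) \<and>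
             (\<forall>s\<in>{a..b}. \<forall>s'\<in>{a..b}. snd c (g s') = \<phi> (snd c (g s') \<bullet> e - snd c (g s) \<bullet> e) (snd c (g s)))"
          proof (intro allI impI conjI)
            fix a b assume ab: "0 \<le> a \<and> b \<le> 1 \<and> g ` {a..b} \<subseteq> ?U"
            have "continuous_on {a..b} (snd c \<circ> g)" by (rule singular_path_chart_continuous[OF g(1) c(1)]) (use ab in auto)
            then have "continuous_on {a..b} (\<lambda>t. (snd c \<circ> g) t \<bullet> e)" by (intro continuous_intros)
            then show "continuous_on {a..b} ((\<lambda>x. snd c x \<bullet> e) \<circ> g)" by (simp add: o_def)
            have "\<forall>s\<in>{a..b}. \<forall>s'\<in>{a..b}. snd c (g s') = \<phi> ((snd c (g s') - snd c (g s)) \<bullet> e) (snd c (g s))"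
              using fc g(1) ab unfolding flow_chart_def by blast
            then show "\<forall>s\<in>{a..b}. \<forall>s'\<in>{a..b}. snd c (g s') = \<phi> (snd c (g s') \<bullet> e - snd c (g s) \<bullet> e) (snd c (g s))"
              by (simp only: inner_diff_left)
          qed
          show "\<forall>\<sigma>. \<forall>x\<in>?U. \<forall>y\<in>?U. \<forall>y'\<in>?U. snd c y = \<phi> \<sigma> (snd c x) \<and> snd c y' = \<phi> \<sigma> (snd c x) \<longrightarrow> y = y'"
            by (intro allI ballI impI, rule inj_onD[OF chart_inj[OF c(1)]]) auto
          show "\<forall>q\<in>\<rat>. \<forall>x\<in>N \<inter> ?U. \<forall>y\<in>?U. snd c y = \<phi> q (snd c x) \<longrightarrow> y \<in> N"
            using N(3)[OF j] by auto
          show "x0 \<in> ?U \<longrightarrow> (\<forall>\<sigma>. \<forall>y\<in>?U. snd c y = \<phi> \<sigma> (snd c x0) \<longrightarrow> y \<in> N)"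
          proof (intro impI allI ballI)
            fix \<sigma> y assume y: "y \<in> ?U" "snd c y = \<phi> \<sigma> (snd c x0)"
            then have "y \<in> ?orbit (c, B, e, \<phi>)" by auto
            then have "y \<in> E" unfolding E_def using j by blast
            then show "y \<in> N" using N(1) by blast
          qed
        qed
      qed
      have closed: "closed {t \<in> {0..1}. g t \<in> K}" if "closedin ?T K" for K proof -
        have "closedin (top_of_set {0..1}) {t \<in> {0..1}. g t \<in> K}" using closedin_continuous_map_preimage[OF cont that] by simp
        then show ?thesis by (rule closedin_closed_trans) simp
      qed
      have point: "closed {t \<in> {0..1}. g t = p}" for p
      proof (cases "p \<in> topspace ?T")
        case True then show ?thesis using closed[OF closedin_Hausdorff_singleton[OF top(1)]] by simp
      next
        case False
        then have "{t \<in> {0..1}. g t = p} = {}" using carr[OF g(1)] by (auto simp: topspace_manifold_topology)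
        then show ?thesis by (simp only: closed_empty)
      qed
      define Z where "Z = {t \<in> {0..1}. g t \<in> carrier A - S}"
      have Z: "closed Z" unfolding Z_def
        by (rule closed) (use openin_closedin_eq openS in \<open>auto simp: topspace_manifold_topology[symmetric] intro: closedin_diff\<close>)
      show ?thesis
      proof (cases "Z = {}")
        case True
        then have gS: "g t \<in> S" if "t \<in> {0..1}" for t using carr[OF g(1) that] that by (auto simp: Z_def)
        have g0: "g 0 \<in> S" by (rule gS) simp
        obtain U h R where U: "g 0 \<in> U" and nb: "open_along g U"
          and leaf: "leafwise g U h R"
          and orbit: "x0 \<in> U \<longrightarrow> (\<forall>(\<sigma>::real). \<forall>y\<in>U. R \<sigma> x0 y \<longrightarrow> y \<in> N)"
          using loc[OF g0] by (elim exE conjE) (rule that)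
        obtain d where d: "d > 0" "\<And>s. s \<in> {0..1} ==> \<bar>s - 0\<bar> < d ==> g s \<in> U" using nb U by force
        define t1 where "t1 = min 1 (d / 2)"
        have t1: "t1 \<in> {0<..1}" using d(1) by (auto simp: t1_def)
        have im: "g ` {0..t1} \<subseteq> U"
        proof (rule image_subsetI)
          fix s assume "s \<in> {0..t1}" then show "g s \<in> U" using d(1) by (intro d(2)) (auto simp: t1_def)
        qed
        \<comment> \<open>Without singular times the first stretch of the path runs on the orbit of
          x0, which was put into E for this purpose.\<close>
        have start: "g t \<in> N" if t: "t \<in> {0<..t1}" for t proof -
          have "R (h (g t) - h (g 0)) (g 0) (g t)" using leaf[rule_format, of 0 t1, THEN conjunct2] im t t1 by auto
          moreover have "g t \<in> U" using im t by auto
          ultimately show ?thesis using orbit U unfolding g(2) by blast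
        qed
        show ?thesis
          by (rule leaf_curve_propagation[where \<tau> = 0 and ?t1.0 = t1 and ?x0.0 = x0 and N = N, OF loc point order_refl t1 start])
            (use gS g(2) in auto)
      next
        case False
        define \<tau> where "\<tau> = Sup Z"
        have bdd: "bdd_above Z" by (rule bdd_aboveI[of _ 1]) (auto simp: Z_def)
        have \<tau>Z: "\<tau> \<in> Z" unfolding \<tau>_def by (rule closed_contains_Sup[OF False bdd Z])
        then have \<tau>: "0 \<le> \<tau>" "\<tau> \<le> 1" "g \<tau> \<in> carrier A - S" by (auto simp: Z_def)
        have gS: "g t \<in> S" if t: "t \<in> {\<tau><..1}" for t
        proof (rule ccontr)
          assume "g t \<notin> S"
          then have "t \<in> Z" using carr[OF g(1), of t] t \<tau>(1) by (auto simp: Z_def)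
          then have "t \<le> \<tau>" unfolding \<tau>_def by (rule cSup_upper[OF _ bdd])
          then show False using t by simp
        qed
        show ?thesis
        proof (cases "\<tau> = 1")
          case True then show ?thesis using \<tau>(3) N(1) by (auto simp: E_def)
        next
          case False
          then have \<tau>1: "\<tau> < 1" using \<tau>(2) by simp
          obtain s where s: "s \<in> I" "g \<tau> \<in> ?box s" using I(3) \<tau>(3) by blast
          have nr: "\<not> regular_point \<Delta> (g \<tau>)" "\<forall>t\<in>{\<tau><..1}. regular_point \<Delta> (g t)" using \<tau>(3) gS by (auto simp: S_def)
          have "\<exists>t1\<in>{\<tau><..1}. \<forall>t\<in>{\<tau><..t1}. g t \<in> X s"
            using X[OF s(1)] g(1) \<tau>(1) \<tau>1 s(2) nr unfolding exit_set_def by blast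
          then obtain t1 where t1: "t1 \<in> {\<tau><..1}" "\<forall>t\<in>{\<tau><..t1}. g t \<in> X s" by blast
          have start: "g t \<in> N" if "t \<in> {\<tau><..t1}" for t using t1(2) that s(1) N(1) unfolding E_def by blast
          \<comment> \<open>Later points are regular and g \<tau> is not, so the path cannot rest at
            g \<tau>; this is the alternative to starting at x0 in
            \<open>leaf_curve_propagation\<close>.\<close>
          have ne: "\<forall>t\<in>{\<tau><..1}. g t \<noteq> g \<tau>" using gS \<tau>(3) by (metis DiffD2)
          show ?thesis by (rule leaf_curve_propagation[where \<tau> = \<tau> and ?t1.0 = t1 and ?x0.0 = x0 and N = N,
                  OF loc[OF gS] point \<tau>(1) t1(1) start disjI2[OF ne]])
        qed
      qed
    qed
    then have "Abn A \<Delta> x0 \<subseteq> N" by (auto simp: Abn_def)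
    then show ?thesis using N(2) measure_zero_subset by blast
  qed
qed

end

theorem theorem1p3:
  fixes C :: regularity
    and A :: "('m, 'e::euclidean_space) atlas"
    and \<Delta> :: "'m \<Rightarrow> (('m, 'e) chart \<Rightarrow> 'e) set"
    and n :: nat
  assumes "manifold C A" and "connected_space (manifold_topology A)"
    and "DIM('e) = n" and "n \<ge> 3"
    and "distribution C A (n - 1) \<Delta>" and "totally_nonholonomic C A \<Delta>"
    and H1: "\<exists>r\<in>{0, 1}. \<forall>a\<in>regular_set A \<Delta>. char_rank A \<Delta> a = r"
    and H2: "measure_zero_sub TYPE('e \<times> real) (cotangent_atlas A) (annihilator A \<Delta>)
               (singular_set A \<Delta>)"
  shows "sard_conjecture A \<Delta>"
proof -
  interpret smooth_manifold A by (rule manifold_imp_smooth_manifold[OF assms(1)])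
  obtain r :: nat where r: "r \<in> {0, 1}" "\<And>a. a \<in> regular_set A \<Delta> \<Longrightarrow> char_rank A \<Delta> a = r" using H1 by blast
  have top: "Hausdorff_space (manifold_topology A)" "second_countable (manifold_topology A)"
    using assms(1) by (simp_all add: manifold_def)
  have DIM: "DIM('e) \<ge> 2" using assms(3,4) by simp
  have dist: "distribution C A (DIM('e) - 1) \<Delta>" using assms(3,5) by simp
  show ?thesis
    unfolding sard_conjecture_def
    by (intro ballI singular_endpoints_measure_zero[OF top exists_local_form[OF assms(1) dist] DIM r H2])
qed

end
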